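(* Let $\chi:H\to\overline{\mathbf F}_p^\times$ be a character and $\gamma=\{\chi,\chi^s\}$. Let $\pi$ be a smooth $\overline{\mathbf F}_p$-representation of $G$ and suppose that one of the following holds: $\chi=\chi^s$, or $p=q$. Then $$\mathrm{Hom}_G(H_0(X,\mathcal V_\gamma),\pi)\cong\mathrm{Hom}_{\mathcal H}(M_\gamma,\pi^{I_1}).$$
   Context: All representations are on $\overline{\mathbf F}_p$-vector spaces. $F$ is a non-Archimedean local field with ring of integers $\mathfrak o_F$, maximal ideal $\mathfrak p_F$, fixed uniformiser $\varpi_F$ and residue field $\mathbf F_q$ of characteristic $p$. $G=\mathrm{GL}_2(F)$, $K=\mathrm{GL}_2(\mathfrak o_F)$, $\Gamma=\mathrm{GL}_2(\mathbf F_q)$; $B,H,U\subset\Gamma$ are the upper triangular, diagonal, and unipotent upper triangular matrices. $K_1$ is the kernel of reduction $K\to\Gamma$; $I$, $I_1$ are the preimages of $B$, $U$ in $K$. $\Pi=\begin{pmatrix}0&1\\ \varpi_F&0\end{pmatrix}$, $n_s=\begin{pmatrix}0&-1\\1&0\end{pmatrix}$, $s=\begin{pmatrix}0&1\\1&0\end{pmatrix}$, $\chi^s(h)=\chi(s^{-1}hs)$. Representations of $\Gamma$ are viewed as representations of $K$ via $K/K_1\cong\Gamma$. Hecke algebra: $\mathcal H=\mathrm{End}_G(\text{c-Ind}_{I_1}^G\mathbf 1)$ acts on the right on $\pi^{I_1}\cong\mathrm{Hom}_G(\text{c-Ind}_{I_1}^G\mathbf 1,\pi)$. It is generated by elements $T_{n_s},T_\Pi,T_\Pi^{-1}$,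 $e_\chi$ acting by $vT_{n_s}=\sum_{u\in I_1/K_1}un_s^{-1}v$, $vT_\Pi=\Pi^{-1}v$, $ve_\chi$ = projection to the $\chi$-isotypic part for $I/I_1\cong H$. $M_\gamma$ is the right $\mathcal H$-module with basis $v_1,v_2$, with $v_1T_\Pi=v_2$, $v_2T_\Pi=v_1$, $v_1e_\chi=v_1$, $v_2e_{\chi^s}=v_2$, $v_2T_{n_s}=0$, and $v_1T_{n_s}=-v_1$ if $\chi=\chi^s$, $v_1T_{n_s}=0$ if $\chi\ne\chi^s$. Irreducibles of $\Gamma$: $J_0(\chi)=\{s\}$ if $\chi=\chi^s$, $\emptyset$ otherwise; for $J\subseteq J_0(\chi)$, $\overline J=J_0(\chi)\setminus J$. If $\chi\neq\chi^s$, $\rho_{\chi,\emptyset}$ is the unique irreducible representation of $\Gamma$ on whose (one-dimensional) $U$-invariants $B$ acts by $\chi$. If $\chi=\chi^s=\chi'\circ\det$, $\rho_{\chi,\{s\}}=\chi'\circ\det$, $\rho_{\chi,\emptyset}=\mathrm{St}\otimes\chi'\circ\det$, $\mathrm{St}$ the $q$-dimensional Steinberg representation. $\tilde\rho$ is the extension of $\rho$ to $F^\times K$ with $\varpi_F$ acting trivially. Coefficient systems: $X$ is the Bruhat–Tits tree of $G$ (vertices: homothety classes of $\mathfrak o_F$-lattices in $F^2=\langle v_1,v_2\rangle$); $\sigma_0=[\mathfrak o_Fv_1+\mathfrak o_Fv_2]$, $\sigma_1=\{\sigma_0,[\mathfrak o_Fv_1+\mathfrak p_Fv_2]\}$, with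 $G$-stabilisers $\mathfrak K(\sigma_0)=F^\times K$, $\mathfrak K(\sigma_1)=\langle I,\Pi\rangle$. For a $G$-equivariant coefficient system $\mathcal V$ (vector spaces $V_\sigma$ for simplices $\sigma$, restriction maps $r^{\sigma'}_\sigma:V_{\sigma'}\to V_\sigma$ for $\sigma\subseteq\sigma'$ with $r^\sigma_\sigma=\mathrm{id}$, and compatible maps $g_\sigma:V_\sigma\to V_{g\sigma}$ forming a $G$-action, smooth on stabilisers), $H_0(X,\mathcal V)$ is the cokernel of $\partial:C_1\to C_0$, where $C_0$ is the space of finitely supported $\omega$ on vertices with $\omega(\sigma)\in V_\sigma$, $C_1$ the space of finitely supported $\omega$ on oriented edges with $\omega((\sigma,\sigma'))\in V_{\{\sigma,\sigma'\}}$, $\omega((\sigma',\sigma))=-\omega((\sigma,\sigma'))$, and $\partial(\omega)(\sigma)=\sum_{\sigma'}r^{\{\sigma,\sigma'\}}_\sigma(\omega((\sigma,\sigma')))$ over neighbours $\sigma'$ of $\sigma$; it is a smooth $G$-representation. $\mathcal V_\gamma$: choose $J\subseteq J_0(\chi)$ and nonzero $v_{\chi,J}\in\rho_{\chi,J}^{I_1}$, $v_{\chi^s,\overline J}\in\rho_{\chi^s,\overline J}^{I_1}$. Let $D_0=\tilde\rho_{\chi,J}\oplus\tilde\rho_{\chi^s,\overline J}$ (a representation of $\mathfrak K(\sigma_0)$), $D_1=D_0^{I_1}$ with $F^\times I$-action extended to $\mathfrak K(\sigma_1)$ by $\Pi^{-1}v_{\chi,J}=v_{\chi^s,\overline J}$,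 $\Pi^{-1}v_{\chi^s,\overline J}=v_{\chi,J}$, and $r:D_1\to D_0$ the inclusion. $\mathcal V_\gamma$ is the coefficient system with $V_{g\sigma_i}=\{f\in\text{c-Ind}_{\mathfrak K(\sigma_i)}^GD_i:\mathrm{supp}f\subseteq\mathfrak K(\sigma_i)g^{-1}\}$, $G$ acting by right translation, the restriction map $V_{g\sigma_1}\to V_{g\sigma_0}$ sending $f$ to the element with value $r(f(g^{-1}))$ at $g^{-1}$. It is, up to isomorphism, the unique $G$-equivariant coefficient system with $(V_{\sigma_0},V_{\sigma_1},r^{\sigma_1}_{\sigma_0})\cong(D_0,D_1,r)$, and is independent of the choices up to isomorphism. *)

theory Defs
  imports
    "HOL-Analysis.Analysis"
    "HOL-Algebra.Algebraic_Closure_Type"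
    "HOL-Library.Set_Algebras"
    "HOL-Library.Function_Algebras"
    "Berlekamp_Zassenhaus.Finite_Field"
begin

section \<open>Non-Archimedean local fields\<close>

text \<open>
  A field complete for a discrete valuation with finite residue field, together with its
  normalised valuation and a fixed uniformiser \<open>unif\<close>. The value of \<open>val 0\<close> is irrelevant;
  the convention \<open>val 0 = \<infinity>\<close> is spelled out by a disjunct wherever it matters.
\<close>

class nonarch_local_field = Fields.field +
  fixes val :: "'a \<Rightarrow> int" and unif :: 'a
  assumes val_mult: "x \<noteq> 0 \<Longrightarrow> y \<noteq> 0 \<Longrightarrow> val (x * y) = val x + val y"
    and val_add: "x \<noteq> 0 \<Longrightarrow> y \<noteq> 0 \<Longrightarrow> x + y \<noteq> 0 \<Longrightarrow> min (val x) (val y) \<le> val (x + y)"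
    and unif_nonzero: "unif \<noteq> 0"
    and val_unif: "val unif = 1"
    and val_complete:
      "(\<And>n. \<exists>M::nat. \<forall>i\<ge>M. \<forall>j\<ge>M. Y i = Y j \<or> n \<le> val (Y i - Y j))
        \<Longrightarrow> \<exists>L. \<forall>n. \<exists>M. \<forall>i\<ge>M. Y i = L \<or> n \<le> val (Y i - L)"
    and finite_residues:
      "\<exists>S. finite S \<and> (\<forall>x. x = 0 \<or> 0 \<le> val x \<longrightarrow> (\<exists>s\<in>S. x = s \<or> 1 \<le> val (x - s)))"

definition pow_ideal :: "nat \<Rightarrow> 'f::nonarch_local_field set" where
  "pow_ideal n = {x. x = 0 \<or> int n \<le> val x}"

abbreviation int_ring :: "'f::nonarch_local_field set" where
  "int_ring \<equiv> pow_ideal 0"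

abbreviation max_ideal :: "'f::nonarch_local_field set" where
  "max_ideal \<equiv> pow_ideal 1"

lemma val_one [simp]: "val (1::'f::nonarch_local_field) = 0"
  using val_mult[of "1::'f" 1] by simp

lemma val_minus [simp]: "val (- x) = val (x::'f::nonarch_local_field)"
proof (cases "x = 0")
  case False
  have "val (-1::'f) + val (-1::'f) = val (1::'f)"
    using val_mult[of "-1::'f" "-1"] by simp
  then have "val (-1::'f) = 0" by simp
  then show ?thesis using val_mult[of "-1" x] False by simp
qed simp

lemma pow_ideal_zero [simp]: "0 \<in> pow_ideal n"
  by (simp add: pow_ideal_def)

lemma int_ring_one [simp]: "1 \<in> int_ring"
  by (simp add: pow_ideal_def)

lemma pow_ideal_add: "x \<in> pow_ideal n \<Longrightarrow> y \<in> pow_ideal n \<Longrightarrow> x + y \<in> pow_ideal n"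
  using val_add[of x y]
  by (cases "x = 0 \<or> y = 0 \<or> x + y = 0") (auto simp: pow_ideal_def)

lemma pow_ideal_minus: "x \<in> pow_ideal n \<Longrightarrow> - x \<in> pow_ideal n"
  by (auto simp: pow_ideal_def)

lemma pow_ideal_diff: "x \<in> pow_ideal n \<Longrightarrow> y \<in> pow_ideal n \<Longrightarrow> x - y \<in> pow_ideal n"
  using pow_ideal_add[of x n "- y"] pow_ideal_minus[of y n] by simp

lemma pow_ideal_mult: "x \<in> pow_ideal m \<Longrightarrow> y \<in> pow_ideal n \<Longrightarrow> x * y \<in> pow_ideal (m + n)"
  using val_mult[of x y]
  by (cases "x = 0 \<or> y = 0") (auto simp: pow_ideal_def)

lemma max_ideal_mult: "x \<in> max_ideal \<Longrightarrow> y \<in> int_ring \<Longrightarrow> x * y \<in> max_ideal"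
  using pow_ideal_mult[of x 1 y 0] by simp

lemma val_inverse: "x \<noteq> 0 \<Longrightarrow> val (inverse x) = - val (x::'f::nonarch_local_field)"
  using val_mult[of x "inverse x"] by simp

lemma unit_inverse: "x \<in> int_ring \<Longrightarrow> x \<notin> max_ideal \<Longrightarrow> inverse x \<in> int_ring"
  by (auto simp: pow_ideal_def val_inverse)

definition residue_rel :: "'f::nonarch_local_field \<Rightarrow> 'f \<Rightarrow> bool" where
  "residue_rel x y \<longleftrightarrow> x \<in> int_ring \<and> y \<in> int_ring \<and> x - y \<in> max_ideal"

quotient_type (overloaded) 'f residue_field = "'f::nonarch_local_field" / partial: residue_rel
  morphisms rep_residue_field residue
proof (rule part_equivpI)
  show "\<exists>x::'f. residue_rel x x"
    by (rule exI[of _ 0]) (simp add: residue_rel_def)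
  show "symp (residue_rel :: 'f \<Rightarrow> _)"
    unfolding symp_def residue_rel_def using pow_ideal_minus by fastforce
  show "transp (residue_rel :: 'f \<Rightarrow> _)"
    unfolding transp_def residue_rel_def
    by (metis (no_types, opaque_lifting) diff_add_cancel add_diff_eq pow_ideal_add)
qed

instantiation residue_field :: (nonarch_local_field) field
begin

lift_definition zero_residue_field :: "'a residue_field" is 0
  by (simp add: residue_rel_def)

lift_definition one_residue_field :: "'a residue_field" is 1
  by (simp add: residue_rel_def)

lift_definition plus_residue_field :: "'a residue_field \<Rightarrow> 'a residue_field \<Rightarrow> 'a residue_field"
  is "(+)"
  unfolding residue_rel_def by (metis pow_ideal_add add_diff_add)

lift_definition minus_residue_field :: "'a residue_field \<Rightarrow> 'a residue_field \<Rightarrow> 'a residue_field"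
  is "(-)"
proof -
  fix x x' y y' :: 'a
  assume "residue_rel x x'" "residue_rel y y'"
  moreover have "(x - y) - (x' - y') = (x - x') - (y - y')" by simp
  ultimately show "residue_rel (x - y) (x' - y')"
    unfolding residue_rel_def using pow_ideal_diff by metis
qed

lift_definition uminus_residue_field :: "'a residue_field \<Rightarrow> 'a residue_field"
  is "uminus"
proof -
  fix x x' :: 'a
  assume "residue_rel x x'"
  moreover have "(- x) - (- x') = - (x - x')" by simp
  ultimately show "residue_rel (- x) (- x')"
    unfolding residue_rel_def using pow_ideal_minus by metis
qed

lift_definition times_residue_field :: "'a residue_field \<Rightarrow> 'a residue_field \<Rightarrow> 'a residue_field"
  is "(*)"
proof -
  fix x x' y y' :: 'a
  assume *: "residue_rel x x'" "residue_rel y y'"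
  have "x * y - x' * y' = (x - x') * y + (y - y') * x'" by (simp add: algebra_simps)
  moreover have "(x - x') * y + (y - y') * x' \<in> max_ideal"
    using * unfolding residue_rel_def by (intro pow_ideal_add max_ideal_mult) auto
  ultimately show "residue_rel (x * y) (x' * y')"
    using * pow_ideal_mult[of _ 0 _ 0] unfolding residue_rel_def by auto
qed

lift_definition inverse_residue_field :: "'a residue_field \<Rightarrow> 'a residue_field"
  is "\<lambda>x. if x \<in> max_ideal then 0 else inverse x"
proof -
  fix x x' :: 'a
  assume *: "residue_rel x x'"
  have iff: "x \<in> max_ideal \<longleftrightarrow> x' \<in> max_ideal"
    using * pow_ideal_add[of "x - x'" 1 x'] pow_ideal_diff[of x 1 "x - x'"]
    unfolding residue_rel_def by auto
  show "residue_rel (if x \<in> max_ideal then 0 else inverse x)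
                    (if x' \<in> max_ideal then 0 else inverse x')"
  proof (cases "x \<in> max_ideal")
    case True
    then show ?thesis using iff by (simp add: residue_rel_def)
  next
    case False
    have nz: "x \<noteq> 0" "x' \<noteq> 0" using False iff by auto
    have inv: "inverse x \<in> int_ring" "inverse x' \<in> int_ring"
      using * False iff unit_inverse unfolding residue_rel_def by auto
    have eq: "inverse x - inverse x' = - ((x - x') * (inverse x * inverse x'))"
      using nz by (simp add: field_simps)
    have "(x - x') * (inverse x * inverse x') \<in> max_ideal"
      using * inv pow_ideal_mult[of "inverse x" 0 "inverse x'" 0]
      unfolding residue_rel_def by (intro max_ideal_mult) auto
    then have "inverse x - inverse x' \<in> max_ideal"
      unfolding eq by (rule pow_ideal_minus)
    then show ?thesis using False iff inv by (simp add: residue_rel_def)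
  qed
qed

definition divide_residue_field :: "'a residue_field \<Rightarrow> 'a residue_field \<Rightarrow> 'a residue_field" where
  "divide_residue_field x y = x * inverse y"

instance
proof
  fix a b c :: "'a residue_field"
  have m[intro]: "x * y \<in> int_ring" if "x \<in> int_ring" "y \<in> int_ring" for x y :: 'a
    using pow_ideal_mult[of x 0 y 0] that by simp
  show "a * b * c = a * (b * c)"
    by transfer (auto simp: residue_rel_def mult.assoc)
  show "a * b = b * a"
    by transfer (auto simp: residue_rel_def mult.commute)
  show "1 * a = a"
    by transfer (auto simp: residue_rel_def)
  show "a + b + c = a + (b + c)"
    by transfer (auto simp: residue_rel_def add.assoc intro!: pow_ideal_add)
  show "a + b = b + a"
    by transfer (auto simp: residue_rel_def add.commute intro!: pow_ideal_add)
  show "0 + a = a"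
    by transfer (auto simp: residue_rel_def)
  show "- a + a = 0"
    by transfer (auto simp: residue_rel_def)
  show "a - b = a + - b"
    by transfer (auto simp: residue_rel_def intro!: pow_ideal_diff)
  show "(a + b) * c = a * c + b * c"
    by transfer (auto simp: residue_rel_def distrib_right intro!: pow_ideal_add)
  show "(0::'a residue_field) \<noteq> 1"
    by transfer (simp add: residue_rel_def, simp add: pow_ideal_def)
  show "a \<noteq> 0 \<Longrightarrow> inverse a * a = 1"
  proof transfer
    fix a :: 'a
    assume "residue_rel a a" "\<not> residue_rel a 0"
    then have a: "a \<in> int_ring" "a \<notin> max_ideal" by (auto simp: residue_rel_def)
    then have "inverse a * a = 1" by (intro left_inverse) auto
    then show "residue_rel ((if a \<in> max_ideal then 0 else inverse a) * a) 1"
      using a by (simp add: residue_rel_def)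
  qed
  show "a div b = a * inverse b"
    by (rule divide_residue_field_def)
  show "inverse (0::'a residue_field) = 0"
    by transfer (simp add: residue_rel_def)
qed

end

instance residue_field :: (nonarch_local_field) finite
proof
  obtain S :: "'a set" where S: "finite S"
    "\<And>x. x = 0 \<or> 0 \<le> val x \<Longrightarrow> \<exists>s\<in>S. x = s \<or> 1 \<le> val (x - s)"
    using finite_residues by blast
  have "UNIV \<subseteq> (residue :: 'a \<Rightarrow> _) ` S"
  proof
    fix y :: "'a residue_field"
    obtain x where x: "residue x = y" "residue_rel x x"
      by (metis Quotient_residue_field Quotient_def)
    then obtain s where s: "s \<in> S" "x = s \<or> 1 \<le> val (x - s)"
      using S(2)[of x] by (auto simp: residue_rel_def pow_ideal_def)
    have "x - s \<in> max_ideal" using s(2) by (auto simp: pow_ideal_def)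
    moreover from this have "x - s \<in> int_ring" by (auto simp: pow_ideal_def)
    then have "s \<in> int_ring"
      using x(2) pow_ideal_diff[of x 0 "x - s"] by (simp add: residue_rel_def)
    ultimately have "residue_rel x s" using x(2) by (simp add: residue_rel_def)
    then have "residue x = residue s"
      using Quotient_residue_field Quotient_rel_abs by metis
    then show "y \<in> residue ` S" using s(1) x(1) by auto
  qed
  then show "finite (UNIV :: 'a residue_field set)"
    using S(1) finite_surj by blast
qed


section \<open>The groups\<close>

type_synonym 'a mat22 = "'a^2^2"

definition mat22 :: "'a \<Rightarrow> 'a \<Rightarrow> 'a \<Rightarrow> 'a \<Rightarrow> 'a::zero mat22" where
  "mat22 a b c d = vector [vector [a, b], vector [c, d]]"

text \<open>\<open>GL2\<close> over the local field is \<open>G\<close>; over the residue field it is \<open>\<Gamma>\<close>.\<close>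

definition GL2 :: "'a::field mat22 set" where
  "GL2 = {g. invertible g}"

definition borel_sub :: "'a::field mat22 set" where
  "borel_sub = {g \<in> GL2. g $ 2 $ 1 = 0}"

definition diag_sub :: "'a::field mat22 set" where
  "diag_sub = {g \<in> GL2. g $ 1 $ 2 = 0 \<and> g $ 2 $ 1 = 0}"

definition unip_sub :: "'a::field mat22 set" where
  "unip_sub = {g \<in> GL2. g $ 1 $ 1 = 1 \<and> g $ 2 $ 2 = 1 \<and> g $ 2 $ 1 = 0}"

definition max_compact :: "'f::nonarch_local_field mat22 set" where
  "max_compact = {g \<in> GL2. \<forall>i j. g $ i $ j \<in> int_ring \<and> matrix_inv g $ i $ j \<in> int_ring}"

definition reduction :: "'f::nonarch_local_field mat22 \<Rightarrow> 'f residue_field mat22" where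
  "reduction g = (\<chi> i j. residue (g $ i $ j))"

definition iwahori :: "'f::nonarch_local_field mat22 set" where
  "iwahori = {g \<in> max_compact. reduction g \<in> borel_sub}"

definition pro_p_iwahori :: "'f::nonarch_local_field mat22 set" where
  "pro_p_iwahori = {g \<in> max_compact. reduction g \<in> unip_sub}"

text \<open>
  The principal congruence subgroups form a neighbourhood basis of the identity in \<open>G\<close>; so a
  subgroup of \<open>G\<close> is open if and only if it contains one of them.
\<close>

definition congruence_sub :: "nat \<Rightarrow> 'f::nonarch_local_field mat22 set" where
  "congruence_sub n = {g \<in> max_compact. \<forall>i j. g $ i $ j - mat 1 $ i $ j \<in> pow_ideal n}"

definition weyl_s :: "'a::field mat22" where
  "weyl_s = mat22 0 1 1 0"

definition n_s :: "'a::field mat22" where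
  "n_s = mat22 0 (- 1) 1 0"

definition Pi_mat :: "'f::nonarch_local_field mat22" where
  "Pi_mat = mat22 0 1 unif 0"

text \<open>A set-theoretic section of the reduction map from \<open>K\<close> to \<open>\<Gamma>\<close>.\<close>

definition lift_mat :: "'f::nonarch_local_field residue_field mat22 \<Rightarrow> 'f mat22" where
  "lift_mat x = (SOME k. k \<in> max_compact \<and> reduction k = x)"


section \<open>Representations and modules\<close>

text \<open>
  A vector space with a family of operators, used both for representations of groups (operators
  indexed by matrices) and for right modules over algebras. The vectors form a subset of
  a type and are added by the addition of that type; this allows subspaces as well as quotients,
  whose elements are cosets, added by the Minkowski sum of theory \<open>Set_Algebras\<close>.
\<close>

record ('g, 'c, 'v) repr =
  vecs :: "'v set"
  scl :: "'c \<Rightarrow> 'v \<Rightarrow> 'v"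
  opr :: "'g \<Rightarrow> 'v \<Rightarrow> 'v"

text \<open>Maps out of a subset are normalised to be \<open>0\<close> outside it.\<close>

definition Hom ::
  "'g set \<Rightarrow> ('g, 'c, 'v::plus) repr \<Rightarrow> ('g, 'c, 'w::{plus, zero}) repr \<Rightarrow> ('v \<Rightarrow> 'w) set" where
  "Hom G V W = {f. f ` vecs V \<subseteq> vecs W
    \<and> (\<forall>x\<in>vecs V. \<forall>y\<in>vecs V. f (x + y) = f x + f y)
    \<and> (\<forall>c. \<forall>x\<in>vecs V. f (scl V c x) = scl W c (f x))
    \<and> (\<forall>g\<in>G. \<forall>x\<in>vecs V. f (opr V g x) = opr W g (f x))
    \<and> (\<forall>x. x \<notin> vecs V \<longrightarrow> f x = 0)}"

definition isomorphic ::
  "'g set \<Rightarrow> ('g, 'c, 'v::plus) repr \<Rightarrow> ('g, 'c, 'w::{plus, zero}) repr \<Rightarrow> bool" where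
  "isomorphic G V W \<longleftrightarrow> (\<exists>f\<in>Hom G V W. bij_betw f (vecs V) (vecs W))"

definition pointwise :: "('c \<Rightarrow> 'v \<Rightarrow> 'v) \<Rightarrow> 'c \<Rightarrow> ('x \<Rightarrow> 'v) \<Rightarrow> 'x \<Rightarrow> 'v" where
  "pointwise sc c f = (\<lambda>x. sc c (f x))"

text \<open>The spaces \<open>Hom\<close> as vector spaces, i.e. without operators.\<close>

definition Hom_space ::
  "'g set \<Rightarrow> ('g, 'c, 'v::plus) repr \<Rightarrow> ('g, 'c, 'w::{plus, zero}) repr
    \<Rightarrow> (unit, 'c, 'v \<Rightarrow> 'w) repr" where
  "Hom_space G V W = \<lparr>vecs = Hom G V W, scl = pointwise (scl W), opr = (\<lambda>_ f. f)\<rparr>"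

definition vs_isomorphic ::
  "(unit, 'c, 'v::plus) repr \<Rightarrow> (unit, 'c, 'w::{plus, zero}) repr \<Rightarrow> bool" where
  "vs_isomorphic V W \<longleftrightarrow> isomorphic {} V W"

definition lin_operators :: "'g set \<Rightarrow> ('g, 'c::field, 'v::ab_group_add) repr \<Rightarrow> bool" where
  "lin_operators G V \<longleftrightarrow> vector_space (scl V) \<and> Modules.module.subspace (scl V) (vecs V)
    \<and> (\<forall>g\<in>G. opr V g ` vecs V \<subseteq> vecs V
        \<and> (\<forall>x\<in>vecs V. \<forall>y\<in>vecs V. opr V g (x + y) = opr V g x + opr V g y)
        \<and> (\<forall>c. \<forall>x\<in>vecs V. opr V g (scl V c x) = scl V c (opr V g x)))"

definition is_rep :: "'a::field mat22 set \<Rightarrow> ('a mat22, 'c::field, 'v::ab_group_add) repr \<Rightarrow> bool"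
  where
  "is_rep G V \<longleftrightarrow> lin_operators G V \<and> (\<forall>x\<in>vecs V. opr V (mat 1) x = x)
    \<and> (\<forall>g\<in>G. \<forall>h\<in>G. \<forall>x\<in>vecs V. opr V (g ** h) x = opr V g (opr V h x))"

definition irreducible_rep ::
  "'a::field mat22 set \<Rightarrow> ('a mat22, 'c::field, 'v::ab_group_add) repr \<Rightarrow> bool" where
  "irreducible_rep G V \<longleftrightarrow> is_rep G V \<and> vecs V \<noteq> {0}
    \<and> (\<forall>W. W \<subseteq> vecs V \<and> Modules.module.subspace (scl V) W \<and> (\<forall>g\<in>G. opr V g ` W \<subseteq> W)
         \<longrightarrow> W = {0} \<or> W = vecs V)"

definition invariants :: "'g set \<Rightarrow> ('g, 'c, 'v) repr \<Rightarrow> 'v set" where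
  "invariants G V = {x \<in> vecs V. \<forall>g\<in>G. opr V g x = x}"

definition smooth_rep ::
  "('f::nonarch_local_field mat22, 'c::field, 'v::ab_group_add) repr \<Rightarrow> bool" where
  "smooth_rep V \<longleftrightarrow> is_rep GL2 V \<and> (\<forall>x\<in>vecs V. \<exists>n. \<forall>g\<in>congruence_sub n. opr V g x = x)"

definition quotient_rep :: "('g, 'c, 'v::plus) repr \<Rightarrow> 'v set \<Rightarrow> ('g, 'c, 'v set) repr" where
  "quotient_rep V N = \<lparr>vecs = (\<lambda>x. x +o N) ` vecs V,
    scl = (\<lambda>c Y. scl V c ` Y + N), opr = (\<lambda>g Y. opr V g ` Y)\<rparr>"

text \<open>The tensor product of a representation with a character.\<close>

definition twist :: "('g \<Rightarrow> 'c) \<Rightarrow> ('g, 'c, 'v) repr \<Rightarrow> ('g, 'c, 'v) repr" where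
  "twist \<psi> V = V\<lparr>opr := (\<lambda>g x. scl V (\<psi> g) (opr V g x))\<rparr>"

definition trivial_rep :: "('g, 'c::field, 'c) repr" where
  "trivial_rep = \<lparr>vecs = UNIV, scl = (*), opr = (\<lambda>_ x. x)\<rparr>"

definition right_transl :: "'a::field mat22 \<Rightarrow> ('a mat22 \<Rightarrow> 'w) \<Rightarrow> 'a mat22 \<Rightarrow> 'w" where
  "right_transl g f = (\<lambda>x. f (x ** g))"

text \<open>
  Smooth induction from an open subgroup \<open>H\<close> of \<open>G\<close>, with support compact modulo \<open>H\<close>, i.e.
  contained in finitely many cosets \<open>H g\<close>. Functions on \<open>G\<close> are extended by \<open>0\<close> to
  all matrices.
\<close>

definition c_Ind :: "'f::nonarch_local_field mat22 set \<Rightarrow> ('f mat22, 'c, 'w::zero) repr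
    \<Rightarrow> ('f mat22, 'c, 'f mat22 \<Rightarrow> 'w) repr" where
  "c_Ind H D = \<lparr>vecs = {f. (\<forall>x. x \<notin> GL2 \<longrightarrow> f x = 0) \<and> (\<forall>x\<in>GL2. f x \<in> vecs D)
      \<and> (\<forall>h\<in>H. \<forall>x\<in>GL2. f (h ** x) = opr D h (f x))
      \<and> (\<exists>n. \<forall>u\<in>congruence_sub n. right_transl u f = f)
      \<and> (\<exists>S. finite S \<and> {x. f x \<noteq> 0} \<subseteq> (\<Union>g\<in>S. (\<lambda>h. h ** g) ` H))},
    scl = pointwise (scl D), opr = right_transl\<rparr>"


section \<open>Irreducible representations of the finite group\<close>

definition diag_char :: "('a::field mat22 \<Rightarrow> 'c::field) \<Rightarrow> bool" where
  "diag_char chi \<longleftrightarrow> (\<forall>h\<in>diag_sub. chi h \<noteq> 0)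
    \<and> (\<forall>h\<in>diag_sub. \<forall>h'\<in>diag_sub. chi (h ** h') = chi h * chi h')"

definition conj_s :: "('a::field mat22 \<Rightarrow> 'c) \<Rightarrow> 'a mat22 \<Rightarrow> 'c" where
  "conj_s chi h = chi (matrix_inv weyl_s ** h ** weyl_s)"

text \<open>Values of a character off \<open>diag_sub\<close> are irrelevant.\<close>

definition char_eq :: "('a::field mat22 \<Rightarrow> 'c) \<Rightarrow> ('a mat22 \<Rightarrow> 'c) \<Rightarrow> bool" where
  "char_eq chi \<psi> \<longleftrightarrow> (\<forall>h\<in>diag_sub. chi h = \<psi> h)"

definition J0 :: "('a::field mat22 \<Rightarrow> 'c) \<Rightarrow> 'a mat22 set" where
  "J0 chi = (if char_eq chi (conj_s chi) then {weyl_s} else {})"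

definition mult_char :: "('a::field \<Rightarrow> 'c::field) \<Rightarrow> bool" where
  "mult_char \<psi> \<longleftrightarrow> (\<forall>a. a \<noteq> 0 \<longrightarrow> \<psi> a \<noteq> 0)
    \<and> (\<forall>a b. a \<noteq> 0 \<longrightarrow> b \<noteq> 0 \<longrightarrow> \<psi> (a * b) = \<psi> a * \<psi> b)"

definition diag_part :: "'a::field mat22 \<Rightarrow> 'a mat22" where
  "diag_part g = mat22 (g $ 1 $ 1) 0 0 (g $ 2 $ 2)"

text \<open>
  The Steinberg representation over a finite field: functions on the cosets of the Borel subgroup
  modulo constants.
\<close>

definition borel_functions :: "('a::field mat22, 'c::field, 'a mat22 \<Rightarrow> 'c) repr" where
  "borel_functions = \<lparr>vecs = {f. (\<forall>x. x \<notin> GL2 \<longrightarrow> f x = 0)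
      \<and> (\<forall>b\<in>borel_sub. \<forall>x\<in>GL2. f (b ** x) = f x)},
    scl = pointwise (*), opr = right_transl\<rparr>"

definition constant_functions :: "('a::field mat22 \<Rightarrow> 'c::field) set" where
  "constant_functions = {f. \<exists>c. f = (\<lambda>x. if x \<in> GL2 then c else 0)}"

definition steinberg :: "('a::field mat22, 'c::field, ('a mat22 \<Rightarrow> 'c) set) repr" where
  "steinberg = quotient_rep borel_functions constant_functions"

text \<open>\<open>is_rho chi J V\<close>: the representation \<open>V\<close> of \<open>\<Gamma>\<close> is a copy of \<open>\<rho>\<^bsub>chi,J\<^esub>\<close>.\<close>

definition is_rho :: "('a::{field, finite} mat22 \<Rightarrow> 'c::field) \<Rightarrow> 'a mat22 set
    \<Rightarrow> ('a mat22, 'c, 'v::ab_group_add) repr \<Rightarrow> bool" where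
  "is_rho chi J V \<longleftrightarrow> is_rep GL2 V \<and> J \<subseteq> J0 chi \<and>
    (if char_eq chi (conj_s chi)
     then \<exists>\<psi>. mult_char \<psi> \<and> char_eq chi (\<psi> \<circ> det)
       \<and> (if J = {weyl_s} then isomorphic GL2 V (twist (\<psi> \<circ> det) trivial_rep)
          else isomorphic GL2 V (twist (\<psi> \<circ> det) steinberg))
     else irreducible_rep GL2 V
       \<and> vector_space.dim (scl V) (invariants unip_sub V) = 1
       \<and> (\<forall>b\<in>borel_sub. \<forall>x\<in>invariants unip_sub V. opr V b x = scl V (chi (diag_part b)) x))"

definition inflate :: "('f::nonarch_local_field residue_field mat22, 'c, 'v) repr
    \<Rightarrow> ('f mat22, 'c, 'v) repr" where
  "inflate V = \<lparr>vecs = vecs V, scl = scl V, opr = (\<lambda>g. opr V (reduction g))\<rparr>"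

text \<open>
  The extension to \<open>F\<^sup>\<times> K\<close> letting the uniformiser act trivially: every element of
  \<open>F\<^sup>\<times> K\<close> is uniquely a power of the uniformiser times an element of \<open>K\<close>.
\<close>

definition tilde :: "('f::nonarch_local_field residue_field mat22, 'c, 'v) repr
    \<Rightarrow> ('f mat22, 'c, 'v) repr" where
  "tilde V = \<lparr>vecs = vecs V, scl = scl V,
    opr = (\<lambda>g. opr (inflate V)
      (THE k. k \<in> max_compact \<and> (\<exists>n::int. g = mat (unif powi n) ** k)))\<rparr>"

definition direct_sum ::
  "('g, 'c, 'v) repr \<Rightarrow> ('g, 'c, 'w) repr \<Rightarrow> ('g, 'c, 'v \<times> 'w) repr" where
  "direct_sum V W = \<lparr>vecs = vecs V \<times> vecs W,
    scl = (\<lambda>c. map_prod (scl V c) (scl W c)), opr = (\<lambda>g. map_prod (opr V g) (opr W g))\<rparr>"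


section \<open>The tree and coefficient systems\<close>

type_synonym 'f vertex = "('f^2) set set"

definition lattices :: "('f::nonarch_local_field^2) set set" where
  "lattices = {L. \<exists>w1 w2. w1 \<noteq> w2 \<and> vec.independent {w1, w2}
    \<and> L = {a *s w1 + b *s w2 |a b. a \<in> int_ring \<and> b \<in> int_ring}}"

definition homothety_class :: "('f::nonarch_local_field^2) set \<Rightarrow> 'f vertex" where
  "homothety_class L = {(\<lambda>w. a *s w) ` L |a. a \<noteq> 0}"

definition tree_vertices :: "'f::nonarch_local_field vertex set" where
  "tree_vertices = homothety_class ` lattices"

definition neighbours :: "'f::nonarch_local_field vertex \<Rightarrow> 'f vertex set" where
  "neighbours x = {y. \<exists>L\<in>lattices. \<exists>L'\<in>lattices. x = homothety_class L \<and> y = homothety_class L'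
    \<and> (\<lambda>w. unif *s w) ` L \<subset> L' \<and> L' \<subset> L}"

definition vertex_act :: "'f::nonarch_local_field mat22 \<Rightarrow> 'f vertex \<Rightarrow> 'f vertex" where
  "vertex_act g x = (\<lambda>L. (\<lambda>v. g *v v) ` L) ` x"

text \<open>
  Simplices are represented by their sets of vertices: \<open>{x}\<close> for a vertex and \<open>{x, y}\<close> for an edge.
\<close>

definition simplex_act :: "'f::nonarch_local_field mat22 \<Rightarrow> 'f vertex set \<Rightarrow> 'f vertex set" where
  "simplex_act g \<sigma> = vertex_act g ` \<sigma>"

definition stabiliser :: "'f::nonarch_local_field vertex set \<Rightarrow> 'f mat22 set" where
  "stabiliser \<sigma> = {g \<in> GL2. simplex_act g \<sigma> = \<sigma>}"

definition vertex0 :: "'f::nonarch_local_field vertex" where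
  "vertex0 = homothety_class
    {a *s axis 1 1 + b *s axis 2 1 |a b. a \<in> int_ring \<and> b \<in> int_ring}"

definition vertex1 :: "'f::nonarch_local_field vertex" where
  "vertex1 = homothety_class
    {a *s axis 1 1 + b *s axis 2 1 |a b. a \<in> int_ring \<and> b \<in> max_ideal}"

definition sigma0 :: "'f::nonarch_local_field vertex set" where
  "sigma0 = {vertex0}"

definition sigma1 :: "'f::nonarch_local_field vertex set" where
  "sigma1 = {vertex0, vertex1}"

text \<open>
  The data of an equivariant coefficient system: the spaces \<open>V\<^sub>\<sigma>\<close>, all sitting inside one
  type; \<open>cs_restr V \<sigma>' \<sigma>\<close> restricts from \<open>\<sigma>'\<close> to a face \<open>\<sigma>\<close>; \<open>cs_trans V g \<sigma>\<close>
  is the map from \<open>V\<^sub>\<sigma>\<close> to the space at \<open>g \<sigma>\<close>.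
\<close>

record ('f, 'c, 'w) coeff_system =
  cs_space :: "'f vertex set \<Rightarrow> 'w set"
  cs_scl :: "'c \<Rightarrow> 'w \<Rightarrow> 'w"
  cs_restr :: "'f vertex set \<Rightarrow> 'f vertex set \<Rightarrow> 'w \<Rightarrow> 'w"
  cs_trans :: "'f mat22 \<Rightarrow> 'f vertex set \<Rightarrow> 'w \<Rightarrow> 'w"

definition chains0 :: "('f::nonarch_local_field, 'c, 'w::ab_group_add) coeff_system
    \<Rightarrow> ('f mat22, 'c, 'f vertex \<Rightarrow> 'w) repr" where
  "chains0 V = \<lparr>vecs = {\<omega>. finite {x. \<omega> x \<noteq> 0} \<and> (\<forall>x\<in>tree_vertices. \<omega> x \<in> cs_space V {x})
      \<and> (\<forall>x. x \<notin> tree_vertices \<longrightarrow> \<omega> x = 0)},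
    scl = pointwise (cs_scl V),
    opr = (\<lambda>g \<omega> x. if x \<in> tree_vertices
      then let y = vertex_act (matrix_inv g) x in cs_trans V g {y} (\<omega> y) else 0)\<rparr>"

definition chains1 :: "('f::nonarch_local_field, 'c, 'w::ab_group_add) coeff_system
    \<Rightarrow> ('f vertex \<times> 'f vertex \<Rightarrow> 'w) set" where
  "chains1 V = {\<omega>. finite {e. \<omega> e \<noteq> 0}
      \<and> (\<forall>x y. y \<in> neighbours x \<longrightarrow> \<omega> (x, y) \<in> cs_space V {x, y} \<and> \<omega> (y, x) = - \<omega> (x, y))
      \<and> (\<forall>x y. y \<notin> neighbours x \<longrightarrow> \<omega> (x, y) = 0)}"

definition boundary :: "('f::nonarch_local_field, 'c, 'w::ab_group_add) coeff_system
    \<Rightarrow> ('f vertex \<times> 'f vertex \<Rightarrow> 'w) \<Rightarrow> 'f vertex \<Rightarrow> 'w" where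
  "boundary V \<omega> = (\<lambda>x. \<Sum>y\<in>neighbours x. cs_restr V {x, y} {x} (\<omega> (x, y)))"

definition homology0 :: "('f::nonarch_local_field, 'c, 'w::ab_group_add) coeff_system
    \<Rightarrow> ('f mat22, 'c, ('f vertex \<Rightarrow> 'w) set) repr" where
  "homology0 V = quotient_rep (chains0 V) (boundary V ` chains1 V)"

text \<open>
  For \<open>\<sigma> = g \<sigma>\<^sub>i\<close>, the functions in the compact induction of \<open>D\<close> from the stabiliser
  of \<open>\<sigma>\<^sub>i\<close> supported on the coset of the inverse of \<open>g\<close>; this coset does not depend on \<open>g\<close>.
\<close>

definition induced_space :: "'f::nonarch_local_field vertex set
    \<Rightarrow> ('f mat22, 'c, 'w::zero) repr \<Rightarrow> 'f vertex set \<Rightarrow> ('f mat22 \<Rightarrow> 'w) set" where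
  "induced_space \<sigma>i D \<sigma> = {f \<in> vecs (c_Ind (stabiliser \<sigma>i) D).
    \<exists>g\<in>GL2. \<sigma> = simplex_act g \<sigma>i
      \<and> {x. f x \<noteq> 0} \<subseteq> (\<lambda>k. k ** matrix_inv g) ` stabiliser \<sigma>i}"

text \<open>
  The coefficient system attached to a representation \<open>D0\<close> of the stabiliser of \<open>\<sigma>\<^sub>0\<close>, a
  representation \<open>D1\<close> of the stabiliser of \<open>\<sigma>\<^sub>1\<close> with \<open>vecs D1 \<subseteq> vecs D0\<close>, and the
  inclusion.
\<close>

definition induced_system ::
  "('f::nonarch_local_field mat22, 'c, 'w::zero) repr \<Rightarrow> ('f mat22, 'c, 'w) repr
    \<Rightarrow> ('f, 'c, 'f mat22 \<Rightarrow> 'w) coeff_system" where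
  "induced_system D0 D1 = \<lparr>
    cs_space = (\<lambda>\<sigma>. if card \<sigma> = 1 then induced_space sigma0 D0 \<sigma> else induced_space sigma1 D1 \<sigma>),
    cs_scl = pointwise (scl D0),
    cs_restr = (\<lambda>\<sigma>' \<sigma> f. if \<sigma> = \<sigma>' then f
      else THE f'. f' \<in> induced_space sigma0 D0 \<sigma>
        \<and> (\<forall>g\<in>GL2. simplex_act g sigma1 = \<sigma>' \<and> simplex_act g sigma0 = \<sigma>
             \<longrightarrow> f' (matrix_inv g) = f (matrix_inv g))),
    cs_trans = (\<lambda>g \<sigma>. right_transl g)\<rparr>"

definition D0_rep :: "('f::nonarch_local_field residue_field mat22, 'c, 'v) repr
    \<Rightarrow> ('f residue_field mat22, 'c, 'w) repr \<Rightarrow> ('f mat22, 'c, 'v \<times> 'w) repr" where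
  "D0_rep V W = direct_sum (tilde V) (tilde W)"

text \<open>
  \<open>is_D1 V W v w D1\<close>: \<open>D1\<close> is the space of \<open>I\<^sub>1\<close>-invariants of \<open>D0_rep V W\<close> with the action
  of \<open>F\<^sup>\<times> I\<close> extended to the stabiliser of \<open>\<sigma>\<^sub>1\<close> so that \<open>\<Pi>\<close> interchanges \<open>v\<close> and \<open>w\<close>.
\<close>

definition is_D1 :: "('f::nonarch_local_field residue_field mat22, 'c::field, 'v::ab_group_add) repr
    \<Rightarrow> ('f residue_field mat22, 'c, 'w::ab_group_add) repr \<Rightarrow> 'v \<Rightarrow> 'w
    \<Rightarrow> ('f mat22, 'c, 'v \<times> 'w) repr \<Rightarrow> bool" where
  "is_D1 V W v w D1 \<longleftrightarrow> is_rep (stabiliser sigma1) D1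
    \<and> vecs D1 = invariants pro_p_iwahori (D0_rep V W)
    \<and> scl D1 = scl (D0_rep V W)
    \<and> (\<forall>a. \<forall>k\<in>iwahori. a \<noteq> 0 \<longrightarrow>
         (\<forall>x\<in>vecs D1. opr D1 (mat a ** k) x = opr (D0_rep V W) (mat a ** k) x))
    \<and> opr D1 (matrix_inv Pi_mat) (v, 0) = (0, w)
    \<and> opr D1 (matrix_inv Pi_mat) (0, w) = (v, 0)"


section \<open>The pro-p Iwahori-Hecke algebra\<close>

definition univ_rep :: "('f::nonarch_local_field mat22, 'c::field, 'f mat22 \<Rightarrow> 'c) repr" where
  "univ_rep = c_Ind pro_p_iwahori trivial_rep"

definition univ_vec :: "'f::nonarch_local_field mat22 \<Rightarrow> 'c::field" where
  "univ_vec = (\<lambda>x. if x \<in> pro_p_iwahori then 1 else 0)"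

type_synonym ('f, 'c) hecke_elt = "('f mat22 \<Rightarrow> 'c) \<Rightarrow> 'f mat22 \<Rightarrow> 'c"

definition hecke :: "('f::nonarch_local_field, 'c::field) hecke_elt set" where
  "hecke = Hom GL2 univ_rep univ_rep"

definition hecke_one :: "('f::nonarch_local_field, 'c::field) hecke_elt" where
  "hecke_one = (\<lambda>f. if f \<in> vecs univ_rep then f else 0)"

text \<open>
  Right modules over the Hecke algebra, whose product is composition: \<open>opr M T m\<close> is \<open>m T\<close>.
\<close>

definition right_hecke_module ::
  "(('f::nonarch_local_field, 'c::field) hecke_elt, 'c, 'm::ab_group_add) repr \<Rightarrow> bool" where
  "right_hecke_module M \<longleftrightarrow> lin_operators hecke M
    \<and> (\<forall>m\<in>vecs M. opr M hecke_one m = m)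
    \<and> (\<forall>S\<in>hecke. \<forall>T\<in>hecke. \<forall>m\<in>vecs M. opr M (S \<circ> T) m = opr M T (opr M S m))
    \<and> (\<forall>S\<in>hecke. \<forall>T\<in>hecke. \<forall>m\<in>vecs M. opr M (S + T) m = opr M S m + opr M T m)
    \<and> (\<forall>c. \<forall>T\<in>hecke. \<forall>m\<in>vecs M. opr M (pointwise (pointwise (*)) c T) m = scl M c (opr M T m))"

text \<open>
  Evaluation at \<open>univ_vec\<close> identifies \<open>Hom\<^sub>G(univ_rep, \<pi>)\<close> with \<open>\<pi>\<^bsup>I\<^sub>1\<^esup>\<close> (Frobenius
  reciprocity), and the Hecke algebra acts on the former by precomposition.
\<close>

definition hecke_invariants ::
  "('f::nonarch_local_field mat22, 'c::field, 'v::ab_group_add) repr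
    \<Rightarrow> (('f, 'c) hecke_elt, 'c, 'v) repr" where
  "hecke_invariants \<pi> = \<lparr>vecs = invariants pro_p_iwahori \<pi>, scl = scl \<pi>,
    opr = (\<lambda>T v. (THE \<phi>. \<phi> \<in> Hom GL2 univ_rep \<pi> \<and> \<phi> univ_vec = v) (T univ_vec))\<rparr>"

text \<open>
  The generators. An element \<open>T\<close> of the Hecke algebra is determined by its value on \<open>univ_vec\<close>,
  and its action on the invariants of any \<open>\<pi>\<close> is then given by the same formula with an
  arbitrary invariant vector in place of \<open>univ_vec\<close>. The sums over \<open>I\<^sub>1 / K\<^sub>1\<close>
  and \<open>I / I\<^sub>1\<close> are indexed by \<open>U\<close> and \<open>H\<close>; the last one is the usual idempotent
  projecting to the \<open>chi\<close>-isotypic part (the order of \<open>H\<close> is prime to \<open>p\<close>).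
\<close>

definition hecke_of_vec ::
  "('f::nonarch_local_field mat22 \<Rightarrow> 'c::field) \<Rightarrow> ('f, 'c) hecke_elt" where
  "hecke_of_vec f = (THE T. T \<in> hecke \<and> T univ_vec = f)"

definition T_n_s :: "('f::nonarch_local_field, 'c::field) hecke_elt" where
  "T_n_s = hecke_of_vec
    (\<Sum>u\<in>unip_sub. right_transl (lift_mat u) (right_transl (matrix_inv n_s) univ_vec))"

definition T_Pi :: "('f::nonarch_local_field, 'c::field) hecke_elt" where
  "T_Pi = hecke_of_vec (right_transl (matrix_inv Pi_mat) univ_vec)"

definition e_char :: "('f::nonarch_local_field residue_field mat22 \<Rightarrow> 'c::field)
    \<Rightarrow> ('f, 'c) hecke_elt" where
  "e_char chi = hecke_of_vec
    (\<Sum>h\<in>diag_sub. pointwise (*)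
       (inverse (of_nat (card (diag_sub :: 'f residue_field mat22 set))) * inverse (chi h))
       (right_transl (lift_mat h) univ_vec))"

definition is_M_gamma :: "('f::nonarch_local_field residue_field mat22 \<Rightarrow> 'c::field)
    \<Rightarrow> (('f, 'c) hecke_elt, 'c, 'm::ab_group_add) repr \<Rightarrow> bool" where
  "is_M_gamma chi M \<longleftrightarrow> right_hecke_module M \<and>
    (\<exists>v1 v2. v1 \<noteq> v2 \<and> \<not> Modules.module.dependent (scl M) {v1, v2}
      \<and> vecs M = Modules.module.span (scl M) {v1, v2}
      \<and> opr M T_Pi v1 = v2 \<and> opr M T_Pi v2 = v1
      \<and> opr M (e_char chi) v1 = v1 \<and> opr M (e_char (conj_s chi)) v2 = v2
      \<and> opr M T_n_s v2 = 0
      \<and> opr M T_n_s v1 = (if char_eq chi (conj_s chi) then - v1 else 0))"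

end

theory Submission
  imports Defs "HOL-Number_Theory.Residue_Primitive_Roots"
begin

text \<open>
  Both spaces are identified with the set of all \<open>w\<close> in \<open>\<pi>\<^bsup>I\<^sub>1\<^esup>\<close> that are fixed by the square
  of \<open>\<Pi>\<close>, on which \<open>H\<close> acts by \<open>\<chi>\<close>, and such that the sums of \<open>u n\<^sub>s\<^sup>-\<^sup>1 w\<close> and of
  \<open>u n\<^sub>s\<^sup>-\<^sup>1 \<Pi>\<^sup>-\<^sup>1 w\<close> over \<open>I\<^sub>1/K\<^sub>1\<close> are \<open>\<epsilon> w\<close> and \<open>0\<close>, where \<open>\<epsilon> = - 1\<close> if
  \<open>\<chi> = \<chi>\<^sup>s\<close> and \<open>\<epsilon> = 0\<close> otherwise.

  A map from the module sends a basis vector to such a \<open>w\<close>, and every \<open>w\<close> occurs, because the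
  Hecke algebra is generated by \<open>T\<^bsub>\<Pi>\<^esub>\<close>, its inverse, \<open>T\<^bsub>n\<^sub>s\<^esub>\<close> and the \<open>e\<^bsub>\<chi>\<^esub>\<close>. A map from the
  homology amounts to a \<open>F\<^sup>\<times> K\<close>-map from \<open>D\<^sub>0\<close> to \<open>\<pi>\<close> that commutes with \<open>\<Pi>\<close> on
  \<open>D\<^sub>1\<close>, hence to a pair of \<open>\<Gamma>\<close>-maps from \<open>\<rho>\<^bsub>\<chi>,J\<^esub>\<close> and its partner to the \<open>K\<^sub>1\<close>-invariants.
  What remains is that these two representations are presented by the relations satisfied by a
  \<open>U\<close>-invariant vector. If \<open>\<chi> = \<chi>\<^sup>s\<close> this is a computation with the Bruhat decomposition. If
  \<open>q = p\<close> it follows from the action of \<open>U\<close> on the vectors \<open>\<Sum>\<^sub>t t\<^sup>j u\<^sub>t n\<^sub>s\<^sup>-\<^sup>1 w\<close>, which is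
  given by binomial coefficients and shows that such a vector generates an irreducible
  representation.
\<close>

text \<open>Generation of the Hecke algebra is proved through supports. Bi-invariant functions are
  spanned by indicators of double cosets, and those of diag(1, (-unif)^n) arise from
  \<open>univ_vec\<close> by iterating \<open>T_Pi\<close> and \<open>T_n_s\<close>; each point is
  reached by exactly one summand, so no multiplicity divisible by \<open>p\<close> appears. The sign
  comes from \<open>n_s\<close>. All other double cosets differ from these by elements normalising
  \<open>I\<^sub>1\<close>.

  The obstacle is the presentation of \<open>rho\<close> when \<open>chi\<close> is not its own
  conjugate, because the target vector may lie in an arbitrary representation. For
  \<open>q = p\<close> the two vectors are put side by side: in the submodule generated by
  \<open>(v, w)\<close> every nonzero stable subspace contains \<open>(v, w)\<close>, so this
  submodule is the graph of a homomorphism. This rests on binomial coefficients with upper index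
  below \<open>p\<close> being invertible.

  The choice of \<open>J\<close> only decides which half of \<open>D0\<close> carries the sign -1.
  When it is the second half, evaluation takes place at the partner vector, and
  \<open>Pi_mat\<close> carries one set of solutions to the other.\<close>

no_notation fps_nth (infixl \<open>$\<close> 75)

text \<open>Keeps \<open>1\<close> from being rewritten to \<open>Suc 0\<close>, so that terms such
  as \<open>pow_ideal 1\<close> and \<open>congruence_sub 1\<close> retain the shape in which the
  lemmas mention them.\<close>

declare One_nat_def [simp del]

section \<open>Two-by-two matrices\<close>

lemma mat22_nth [simp]:
  "mat22 a b c d $ 1 $ 1 = a" "mat22 a b c d $ 1 $ 2 = b"
  "mat22 a b c d $ 2 $ 1 = c" "mat22 a b c d $ 2 $ 2 = d"
  by (simp_all add: mat22_def)

lemma mat22_eq_iff: "A = B \<longleftrightarrow> A $ 1 $ 1 = B $ 1 $ 1 \<and> A $ 1 $ 2 = B $ 1 $ 2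
    \<and> A $ 2 $ 1 = B $ 2 $ 1 \<and> A $ 2 $ 2 = B $ 2 $ 2"
  for A B :: "'a mat22"
  by (auto simp: vec_eq_iff forall_2)

lemma mat22_mult_nth: "((A :: 'a::semiring_1 mat22) ** B) $ i $ j = A $ i $ 1 * B $ 1 $ j + A $ i $ 2 * B $ 2 $ j"
  by (simp add: matrix_matrix_mult_def sum_2)

lemma mat22_mult: "mat22 a b c d ** mat22 a' b' c' d' =
    mat22 (a * a' + b * c') (a * b' + b * d') (c * a' + d * c') (c * b' + d * d')"
  for a :: "'a::semiring_1"
  by (simp add: mat22_eq_iff mat22_mult_nth)

lemma mat22_scalar_nth [simp]:
  "(mat a :: 'a::zero mat22) $ 1 $ 1 = a" "(mat a :: 'a mat22) $ 1 $ 2 = 0"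
  "(mat a :: 'a mat22) $ 2 $ 1 = 0" "(mat a :: 'a mat22) $ 2 $ 2 = a"
  by (simp_all add: mat_def)

lemma mat22_collapse: "mat22 (A $ 1 $ 1) (A $ 1 $ 2) (A $ 2 $ 1) (A $ 2 $ 2) = A"
  by (simp add: mat22_eq_iff)

lemma scalar_mult_nth [simp]: "(mat a ** (A :: 'a::semiring_1 mat22)) $ i $ j = a * A $ i $ j"
  using exhaust_2[of i] by (auto simp: mat22_mult_nth)

lemma scalar_commute: "(A :: 'a::comm_semiring_1 mat22) ** mat a = mat a ** A"
  by (simp add: mat22_eq_iff mat22_mult_nth mult.commute)

lemma scalar_scalar [simp]: "(mat a :: 'a::semiring_1 mat22) ** mat b = mat (a * b)"
  by (simp add: mat22_eq_iff)

lemma det_mat22 [simp]: "det (mat22 a b c d) = a * d - b * (c :: 'a::comm_ring_1)"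
  by (simp add: det_2)

lemma det_scalar [simp]: "det (mat a :: 'a::comm_ring_1 mat22) = a * a"
  by (simp add: det_2)

lemma GL2_iff: "g \<in> GL2 \<longleftrightarrow> det g \<noteq> 0"
  by (simp add: GL2_def invertible_det_nz)

lemma GL2_mult [simp, intro]: "g \<in> GL2 \<Longrightarrow> h \<in> GL2 \<Longrightarrow> g ** h \<in> GL2"
  by (simp add: GL2_iff det_mul)

lemma GL2_one [simp]: "mat 1 \<in> GL2"
  by (simp add: GL2_iff)

lemma GL2_scalar [simp]: "mat a \<in> GL2 \<longleftrightarrow> a \<noteq> 0"
  by (simp add: GL2_iff)

text \<open>\<open>matrix_inv\<close> is a choice operator. The explicit adjugate inverse is a
  witness, which yields the two equations, and associativity then identifies the chosen inverse with
  the witness.\<close>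

lemma matrix_inv_mat22:
  assumes "g \<in> GL2"
  shows "matrix_inv g = mat22 (g $ 2 $ 2 / det g) (- g $ 1 $ 2 / det g) (- g $ 2 $ 1 / det g) (g $ 1 $ 1 / det g)"
    (is "_ = ?h")
    and GL2_left_inv [simp]: "matrix_inv g ** g = mat 1"
    and GL2_right_inv [simp]: "g ** matrix_inv g = mat 1"
proof -
  have d: "det g \<noteq> 0" using assms by (simp add: GL2_iff)
  have h: "g ** ?h = mat 1" "?h ** g = mat 1"
    using d by (simp_all add: mat22_eq_iff mat22_mult_nth field_simps) (simp_all add: det_2 algebra_simps)
  have "g ** matrix_inv g = mat 1 \<and> matrix_inv g ** g = mat 1"
    unfolding matrix_inv_def by (rule someI_ex) (use h in blast)
  then show i: "matrix_inv g ** g = mat 1" "g ** matrix_inv g = mat 1" by auto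
  show "matrix_inv g = ?h"
  proof -
    have "matrix_inv g ** (g ** ?h) = (matrix_inv g ** g) ** ?h" by (rule matrix_mul_assoc)
    then show ?thesis using h(1) i(1) by simp
  qed
qed

lemma GL2_inv [simp, intro]: "g \<in> GL2 \<Longrightarrow> matrix_inv g \<in> GL2"
  by (metis GL2_iff GL2_left_inv det_mul GL2_one mult_eq_0_iff)

lemma GL2_cancel [simp]:
  assumes "g \<in> GL2"
  shows "x ** g ** matrix_inv g = x" "x ** matrix_inv g ** g = x"
  using assms by (simp_all add: matrix_mul_assoc[symmetric])

lemma GL2_cancel_left [simp]:
  assumes "g \<in> GL2"
  shows "g ** (matrix_inv g ** x) = x" "matrix_inv g ** (g ** x) = x"
  using assms by (simp_all add: matrix_mul_assoc)

text \<open>A one-sided inverse suffices for square matrices, so every later computation of an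
  inverse is a single product.\<close>

lemma matrix_inv_eq: "g ** h = mat 1 \<Longrightarrow> matrix_inv g = (h :: 'a::field mat22)"
  by (metis GL2_def GL2_left_inv invertible_right_inverse matrix_mul_assoc matrix_mul_lid
      matrix_mul_rid mem_Collect_eq)

lemma matrix_inv_inv [simp]: "g \<in> GL2 \<Longrightarrow> matrix_inv (matrix_inv g) = g"
  by (simp add: matrix_inv_eq)

lemma matrix_inv_mult: "g \<in> GL2 \<Longrightarrow> h \<in> GL2 \<Longrightarrow> matrix_inv (g ** h) = matrix_inv h ** matrix_inv g"
  by (rule matrix_inv_eq) (simp add: matrix_mul_assoc)

lemma matrix_inv_one [simp]: "matrix_inv (mat 1) = (mat 1 :: 'a::field mat22)"
  by (rule matrix_inv_eq) simp

lemma GL2_mult_iff [simp]: "g \<in> GL2 \<Longrightarrow> x ** g \<in> GL2 \<longleftrightarrow> x \<in> GL2"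
  "g \<in> GL2 \<Longrightarrow> g ** x \<in> GL2 \<longleftrightarrow> x \<in> GL2"
  by (auto simp: GL2_iff det_mul)

lemma det_matrix_inv: "g \<in> GL2 \<Longrightarrow> det (matrix_inv g) = inverse (det (g :: 'a::field mat22))"
  by (metis GL2_left_inv det_I det_mul inverse_unique mult.commute)

lemma matrix_inv_scalar: "a \<noteq> 0 \<Longrightarrow> matrix_inv (mat a :: 'a::field mat22) = mat (inverse a)"
  by (rule matrix_inv_eq) simp

section \<open>The valuation ring\<close>

lemma pow_ideal_0D: "x \<in> pow_ideal n \<Longrightarrow> x \<in> int_ring"
  by (auto simp: pow_ideal_def)

lemma pow_ideal_mono: "m \<le> n \<Longrightarrow> x \<in> pow_ideal n \<Longrightarrow> x \<in> pow_ideal m"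
  by (auto simp: pow_ideal_def)

lemma int_ring_mult: "x \<in> int_ring \<Longrightarrow> y \<in> int_ring \<Longrightarrow> x * y \<in> int_ring"
  using pow_ideal_mult[of x 0 y 0] by simp

lemma pow_ideal_mult_l: "x \<in> pow_ideal n \<Longrightarrow> y \<in> int_ring \<Longrightarrow> x * y \<in> pow_ideal n"
  using pow_ideal_mult[of x n y 0] by simp

lemma pow_ideal_mult_r: "x \<in> int_ring \<Longrightarrow> y \<in> pow_ideal n \<Longrightarrow> x * y \<in> pow_ideal n"
  using pow_ideal_mult[of x 0 y n] by simp

lemmas pow_ideal_intros = pow_ideal_add pow_ideal_minus pow_ideal_diff int_ring_mult
  pow_ideal_mult_l pow_ideal_mult_r

lemma max_ideal_one [simp]: "1 \<notin> max_ideal"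
  by (simp add: pow_ideal_def)

lemma val_divide: "x \<noteq> 0 \<Longrightarrow> y \<noteq> 0 \<Longrightarrow> val (x / y) = val x - val (y :: 'f::nonarch_local_field)"
  by (simp add: divide_inverse val_mult val_inverse)

lemma val_unif_powi: "val (unif powi n :: 'f::nonarch_local_field) = n"
proof -
  have *: "val (unif ^ k :: 'f) = int k" for k
    by (induction k) (auto simp: val_mult unif_nonzero val_unif)
  show ?thesis
    using *[of "nat n"] *[of "nat (- n)"]
    by (auto simp: power_int_def val_inverse unif_nonzero power_inverse)
qed

declare unif_nonzero [simp]

lemma unif_int_ring [simp]: "unif \<in> int_ring"
  by (simp add: pow_ideal_def val_unif)

lemma int_ring_unit_iff: "x \<in> int_ring \<Longrightarrow> x \<notin> max_ideal \<longleftrightarrow> x \<noteq> 0 \<and> val x = 0"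
  by (auto simp: pow_ideal_def)

lemma one_plus_max_ideal:
  assumes "x - 1 \<in> max_ideal"
  shows "x \<in> int_ring" "x \<noteq> 0" "val x = 0"
proof -
  show "x \<in> int_ring" using pow_ideal_add[of "x - 1" 0 1] assms pow_ideal_0D by fastforce
  moreover have "x \<notin> max_ideal"
    using pow_ideal_diff[of x 1 "x - 1"] assms by auto
  ultimately show "x \<noteq> 0" "val x = 0" by (auto simp: int_ring_unit_iff)
qed

lemma one_plus_mult:
  assumes "x - 1 \<in> max_ideal" "y - 1 \<in> max_ideal"
  shows "x * y - 1 \<in> max_ideal"
proof -
  have "x * y - 1 = (x - 1) * y + (y - 1)" by (simp add: algebra_simps)
  moreover have "(x - 1) * y + (y - 1) \<in> max_ideal"
    using assms one_plus_max_ideal(1)[of y] by (intro pow_ideal_add pow_ideal_mult_l) auto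
  ultimately show ?thesis by (simp only:)
qed

lemma one_plus_inverse:
  assumes "x - 1 \<in> max_ideal"
  shows "inverse x - 1 \<in> max_ideal"
proof -
  have x: "x \<noteq> 0" "x \<in> int_ring" "val x = 0" using one_plus_max_ideal[OF assms] by auto
  have "inverse x - 1 = - ((x - 1) * inverse x)" using x by (simp add: field_simps)
  moreover have "inverse x \<in> int_ring" using x by (simp add: pow_ideal_def val_inverse)
  ultimately show ?thesis using assms
    by (simp only:) (intro pow_ideal_minus pow_ideal_mult_l)
qed

lemma residue_eq_iff: "x \<in> int_ring \<Longrightarrow> y \<in> int_ring \<Longrightarrow> residue x = residue y \<longleftrightarrow> x - y \<in> max_ideal"
  using Quotient_rel[OF Quotient_residue_field, of x y] by (auto simp: residue_rel_def)

lemma residue_rel_refl: "x \<in> int_ring \<Longrightarrow> residue_rel x x"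
  by (simp add: residue_rel_def)

lemma residue_surj: "\<exists>x\<in>int_ring. residue x = y"
  by (metis Quotient_residue_field Quotient_def residue_rel_def)

lemma residue_add: "x \<in> int_ring \<Longrightarrow> y \<in> int_ring \<Longrightarrow> residue (x + y) = residue x + residue y"
  by (simp add: plus_residue_field.abs_eq residue_rel_refl)

lemma residue_diff: "x \<in> int_ring \<Longrightarrow> y \<in> int_ring \<Longrightarrow> residue (x - y) = residue x - residue y"
  by (simp add: minus_residue_field.abs_eq residue_rel_refl)

lemma residue_mult: "x \<in> int_ring \<Longrightarrow> y \<in> int_ring \<Longrightarrow> residue (x * y) = residue x * residue y"
  by (simp add: times_residue_field.abs_eq residue_rel_refl)

lemma residue_minus: "x \<in> int_ring \<Longrightarrow> residue (- x) = - residue x"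
  by (simp add: uminus_residue_field.abs_eq residue_rel_refl)

lemma residue_one [simp]: "residue 1 = 1"
  by (simp add: one_residue_field.abs_eq)

lemma residue_zero [simp]: "residue 0 = 0"
  by (simp add: zero_residue_field.abs_eq)

lemma residue_eq_0_iff: "x \<in> int_ring \<Longrightarrow> residue x = 0 \<longleftrightarrow> x \<in> max_ideal"
  using residue_eq_iff[of x 0] by simp

lemma residue_eq_1_iff: "x \<in> int_ring \<Longrightarrow> residue x = 1 \<longleftrightarrow> x - 1 \<in> max_ideal"
  using residue_eq_iff[of x 1] by simp

section \<open>Compact subgroups\<close>

text \<open>Integrality of the inverse is traded for the determinant being a unit: one way
  \<open>det g\<close> and its inverse are both integral, the other way the adjugate formula divides
  only by a unit.\<close>

lemma max_compact_iff: "g \<in> max_compact \<longleftrightarrow>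
    (\<forall>i j. g $ i $ j \<in> int_ring) \<and> det g \<noteq> 0 \<and> val (det g) = 0"
proof
  assume g: "g \<in> max_compact"
  have gl: "g \<in> GL2" using g by (simp add: max_compact_def)
  have e: "\<forall>i j. g $ i $ j \<in> int_ring" "\<forall>i j. matrix_inv g $ i $ j \<in> int_ring"
    using g by (auto simp: max_compact_def)
  then have "det g \<in> int_ring" "det (matrix_inv g) \<in> int_ring"
    by (auto simp: det_2 intro!: pow_ideal_intros)
  moreover have "det g \<noteq> 0" using gl by (simp add: GL2_iff)
  ultimately show "(\<forall>i j. g $ i $ j \<in> int_ring) \<and> det g \<noteq> 0 \<and> val (det g) = 0"
    using e gl by (auto simp: det_matrix_inv pow_ideal_def val_inverse)
next
  assume g: "(\<forall>i j. g $ i $ j \<in> int_ring) \<and> det g \<noteq> 0 \<and> val (det g) = 0"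
  then have gl: "g \<in> GL2" by (simp add: GL2_iff)
  have "inverse (det g) \<in> int_ring" using g by (simp add: pow_ideal_def val_inverse)
  then have "matrix_inv g $ i $ j \<in> int_ring" for i j
    using g gl exhaust_2[of i] exhaust_2[of j]
    by (auto simp: matrix_inv_mat22 divide_inverse intro!: pow_ideal_intros)
  then show "g \<in> max_compact" using g gl by (auto simp: max_compact_def)
qed

lemma max_compact_GL2: "g \<in> max_compact \<Longrightarrow> g \<in> GL2"
  by (simp add: max_compact_def)

lemma max_compact_nth: "g \<in> max_compact \<Longrightarrow> g $ i $ j \<in> int_ring"
  by (simp add: max_compact_def)

lemma max_compact_mult [simp, intro]: "g \<in> max_compact \<Longrightarrow> h \<in> max_compact \<Longrightarrow> g ** h \<in> max_compact"
  unfolding max_compact_iff by (auto simp: mat22_mult_nth det_mul val_mult intro!: pow_ideal_intros)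

lemma max_compact_inv [simp, intro]: "g \<in> max_compact \<Longrightarrow> matrix_inv g \<in> max_compact"
  by (auto simp: max_compact_def)

lemma max_compact_one [simp]: "mat 1 \<in> max_compact"
  by (auto simp: max_compact_iff) (auto simp: mat_def)

lemma reduction_nth [simp]: "reduction g $ i $ j = residue (g $ i $ j)"
  by (simp add: reduction_def)

lemma reduction_mult: "g \<in> max_compact \<Longrightarrow> h \<in> max_compact \<Longrightarrow> reduction (g ** h) = reduction g ** reduction h"
  by (simp add: mat22_eq_iff mat22_mult_nth max_compact_nth residue_add residue_mult int_ring_mult)

lemma reduction_one [simp]: "reduction (mat 1) = mat 1"
  by (simp add: mat22_eq_iff)

lemma det_reduction: "g \<in> max_compact \<Longrightarrow> det (reduction g) = residue (det g)"
  by (simp add: det_2 max_compact_nth residue_diff residue_mult int_ring_mult)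

lemma reduction_GL2 [simp, intro]: "g \<in> max_compact \<Longrightarrow> reduction g \<in> GL2"
proof -
  assume g: "g \<in> max_compact"
  then have "det g \<in> int_ring" "det g \<notin> max_ideal" by (auto simp: max_compact_iff pow_ideal_def)
  then show ?thesis using g by (simp add: GL2_iff det_reduction residue_eq_0_iff)
qed

lemma reduction_inv: "g \<in> max_compact \<Longrightarrow> reduction (matrix_inv g) = matrix_inv (reduction g)"
  by (rule matrix_inv_eq[symmetric]) (simp flip: reduction_mult add: max_compact_GL2)

lemma reduction_surj:
  assumes "x \<in> GL2" shows "\<exists>k\<in>max_compact. reduction k = x"
proof -
  obtain a b c d where *: "a \<in> int_ring" "residue a = x $ 1 $ 1" "b \<in> int_ring" "residue b = x $ 1 $ 2"
    "c \<in> int_ring" "residue c = x $ 2 $ 1" "d \<in> int_ring" "residue d = x $ 2 $ 2"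
    using residue_surj by metis
  have "residue (a * d - b * c) = det x" using *
    by (simp add: residue_diff residue_mult int_ring_mult det_2)
  moreover have i: "a * d - b * c \<in> int_ring" using * by (intro pow_ideal_intros)
  ultimately have "a * d - b * c \<notin> max_ideal"
    using assms by (metis GL2_iff residue_eq_0_iff)
  then have "mat22 a b c d \<in> max_compact"
    using * i int_ring_unit_iff[OF i] by (simp add: max_compact_iff forall_2)
  moreover have "reduction (mat22 a b c d) = x" using * by (simp add: mat22_eq_iff)
  ultimately show ?thesis by blast
qed

lemma lift_mat: "x \<in> GL2 \<Longrightarrow> lift_mat x \<in> max_compact" "x \<in> GL2 \<Longrightarrow> reduction (lift_mat x) = x"
  unfolding lift_mat_def using someI_ex[of "\<lambda>k. k \<in> max_compact \<and> reduction k = x"] reduction_surj[of x]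
  by auto

text \<open>Identifies the first congruence subgroup with the kernel \<open>K\<^sub>1\<close> of
  reduction, the form in which its action is handled throughout.\<close>

lemma congruence_1_iff: "g \<in> congruence_sub 1 \<longleftrightarrow> g \<in> max_compact \<and> reduction g = mat 1"
  by (auto simp: congruence_sub_def mat22_eq_iff forall_2 residue_eq_1_iff residue_eq_0_iff max_compact_nth)

lemma congruence_mono: "m \<le> n \<Longrightarrow> congruence_sub n \<subseteq> congruence_sub m"
  by (auto simp: congruence_sub_def intro: pow_ideal_mono)

lemma congruence_max_compact: "g \<in> congruence_sub n \<Longrightarrow> g \<in> max_compact"
  by (simp add: congruence_sub_def)

text \<open>No determinant condition remains: the congruences on the entries already force
  \<open>det g\<close> into \<open>1 + max_ideal\<close>.\<close>

lemma pro_p_iwahori_iff: "g \<in> pro_p_iwahori \<longleftrightarrow> g $ 1 $ 1 - 1 \<in> max_ideal \<and> g $ 2 $ 2 - 1 \<in> max_ideal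
    \<and> g $ 1 $ 2 \<in> int_ring \<and> g $ 2 $ 1 \<in> max_ideal" (is "_ \<longleftrightarrow> ?R")
proof
  assume "g \<in> pro_p_iwahori"
  then show ?R
    by (auto simp: pro_p_iwahori_def unip_sub_def max_compact_nth residue_eq_1_iff residue_eq_0_iff)
next
  assume r: ?R
  then have "g $ 1 $ 1 \<in> int_ring" "g $ 2 $ 2 \<in> int_ring" "g $ 2 $ 1 \<in> int_ring" "g $ 1 $ 2 \<in> int_ring"
    by (blast intro: one_plus_max_ideal(1) pow_ideal_0D)+
  then have i: "g $ i $ j \<in> int_ring" for i j
    using exhaust_2[of i] exhaust_2[of j] by auto
  have "det g - 1 = (g $ 1 $ 1 * g $ 2 $ 2 - 1) - g $ 1 $ 2 * g $ 2 $ 1" by (simp add: det_2)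
  moreover have "(g $ 1 $ 1 * g $ 2 $ 2 - 1) - g $ 1 $ 2 * g $ 2 $ 1 \<in> max_ideal"
    by (intro pow_ideal_diff[OF one_plus_mult pow_ideal_mult_r]) (use r in auto)
  ultimately have "det g - 1 \<in> max_ideal" by (simp only:)
  then have "g \<in> max_compact" using one_plus_max_ideal i by (auto simp: max_compact_iff)
  then show "g \<in> pro_p_iwahori" using r i
    by (auto simp: pro_p_iwahori_def unip_sub_def residue_eq_1_iff residue_eq_0_iff)
qed

lemma iwahori_iff: "g \<in> iwahori \<longleftrightarrow> g \<in> max_compact \<and> g $ 2 $ 1 \<in> max_ideal"
  by (auto simp: iwahori_def borel_sub_def residue_eq_0_iff max_compact_nth)

lemma pro_p_iwahori_max_compact: "g \<in> pro_p_iwahori \<Longrightarrow> g \<in> max_compact"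
  by (simp add: pro_p_iwahori_def)

lemma pro_p_iwahori_GL2: "g \<in> pro_p_iwahori \<Longrightarrow> g \<in> GL2"
  by (simp add: pro_p_iwahori_def max_compact_GL2)

lemma unip_sub_eq: "unip_sub = range (\<lambda>t. mat22 1 t 0 1)"
proof -
  have "x = mat22 1 (x $ 1 $ 2) 0 1" if "x \<in> unip_sub" for x :: "'a mat22"
    using that by (auto simp: unip_sub_def mat22_eq_iff)
  then show ?thesis by (auto simp: unip_sub_def GL2_iff)
qed

lemma unip_sub_GL2: "g \<in> unip_sub \<Longrightarrow> g \<in> GL2" by (simp add: unip_sub_def)

lemma unip_sub_mult: "g \<in> unip_sub \<Longrightarrow> h \<in> unip_sub \<Longrightarrow> g ** h \<in> unip_sub"
  by (auto simp: unip_sub_def mat22_mult_nth)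

lemma unip_sub_inv: "g \<in> unip_sub \<Longrightarrow> matrix_inv g \<in> unip_sub"
  by (auto simp: unip_sub_def matrix_inv_mat22 det_2 GL2_iff)

lemma pro_p_iwahori_mult [simp, intro]: "g \<in> pro_p_iwahori \<Longrightarrow> h \<in> pro_p_iwahori \<Longrightarrow> g ** h \<in> pro_p_iwahori"
  by (auto simp: pro_p_iwahori_def reduction_mult unip_sub_mult)

lemma pro_p_iwahori_inv [simp, intro]: "g \<in> pro_p_iwahori \<Longrightarrow> matrix_inv g \<in> pro_p_iwahori"
  by (auto simp: pro_p_iwahori_def reduction_inv unip_sub_inv)

lemma pro_p_iwahori_one [simp]: "mat 1 \<in> pro_p_iwahori"
  by (auto simp: pro_p_iwahori_iff)

lemma congruence_1_pro_p: "g \<in> congruence_sub 1 \<Longrightarrow> g \<in> pro_p_iwahori"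
  unfolding congruence_1_iff pro_p_iwahori_def unip_sub_def
  by (auto simp del: reduction_nth)

section \<open>Conjugation by the matrix \<open>Pi_mat\<close>\<close>

lemma Pi_GL2 [simp]: "Pi_mat \<in> GL2"
  by (simp add: GL2_iff Pi_mat_def)

lemma Pi_inv: "matrix_inv Pi_mat = mat22 0 (inverse unif) 1 0"
  by (rule matrix_inv_eq) (simp add: Pi_mat_def mat22_eq_iff mat22_mult_nth)

lemma Pi_square: "Pi_mat ** Pi_mat = mat unif"
  by (simp add: Pi_mat_def mat22_eq_iff mat22_mult_nth)

text \<open>Conjugation by \<open>Pi_mat\<close> and by its inverse agree because
  \<open>Pi_mat ** Pi_mat\<close> is scalar. The diagonal entries are exchanged, and a factor
  \<open>unif\<close> moves between the other two, which is why \<open>pro_p_iwahori\<close> is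
  normalised.\<close>

lemma Pi_conj: "Pi_mat ** g ** matrix_inv Pi_mat =
    mat22 (g $ 2 $ 2) (g $ 2 $ 1 / unif) (unif * g $ 1 $ 2) (g $ 1 $ 1)"
  unfolding Pi_inv by (simp add: Pi_mat_def mat22_eq_iff mat22_mult_nth field_simps)

lemma Pi_conj': "matrix_inv Pi_mat ** g ** Pi_mat =
    mat22 (g $ 2 $ 2) (g $ 2 $ 1 / unif) (unif * g $ 1 $ 2) (g $ 1 $ 1)"
  unfolding Pi_inv by (simp add: Pi_mat_def mat22_eq_iff mat22_mult_nth field_simps)

lemma max_ideal_div_unif: "x \<in> max_ideal \<longleftrightarrow> x / unif \<in> int_ring"
  by (cases "x = 0") (auto simp: pow_ideal_def val_divide val_unif)

lemma unif_mult_max_ideal: "unif * x \<in> max_ideal \<longleftrightarrow> x \<in> int_ring"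
  by (simp add: max_ideal_div_unif)

lemma Pi_conj_pro_p: "Pi_mat ** g ** matrix_inv Pi_mat \<in> pro_p_iwahori \<longleftrightarrow> g \<in> pro_p_iwahori"
  by (auto simp: Pi_conj pro_p_iwahori_iff unif_mult_max_ideal max_ideal_div_unif)

lemma Pi_conj_pro_p': "matrix_inv Pi_mat ** g ** Pi_mat \<in> pro_p_iwahori \<longleftrightarrow> g \<in> pro_p_iwahori"
  by (auto simp: Pi_conj' pro_p_iwahori_iff unif_mult_max_ideal max_ideal_div_unif)

section \<open>Continuity of conjugation\<close>

lemma matrix_add_rdistrib22: "(A + B) ** C = A ** C + B ** C"
  for A B C :: "'a::semiring_1 mat22"
  by (simp add: mat22_eq_iff mat22_mult_nth algebra_simps)

lemma scalar_bound:
  obtains m :: nat where "\<And>x i j. x \<in> pow_ideal (m + n) \<Longrightarrow> x * g $ i $ j \<in> pow_ideal n"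
proof -
  \<comment> \<open>\<open>m\<close> is the largest pole order among the four entries. The arbitrary
    value of \<open>val 0\<close> may enter the maximum, which can only enlarge
    \<open>m\<close>.\<close>
  define m where "m = nat (Max (range (\<lambda>(i, j). - val (g $ i $ j))) )"
  have "x * g $ i $ j \<in> pow_ideal n" if x: "x \<in> pow_ideal (m + n)" for x i j
  proof -
    have "- val (g $ i $ j) \<le> Max (range (\<lambda>(i, j). - val (g $ i $ j)))"
      by (rule Max_ge) (auto intro!: image_eqI[of _ _ "(i, j)"])
    then have "- val (g $ i $ j) \<le> int m" unfolding m_def by linarith
    then show ?thesis using x
      by (cases "x = 0 \<or> g $ i $ j = 0") (auto simp: pow_ideal_def val_mult)
  qed
  then show ?thesis using that by blast
qed

text \<open>With \<open>u = 1 + w\<close> the conjugate is \<open>1 + g w g^-1\<close>; the two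
  bounds \<open>m\<close> and \<open>m'\<close> absorb the loss of precision caused by
  \<open>g\<close> and by its inverse. This keeps translates of smooth functions smooth.\<close>

lemma conj_congruence:
  fixes g :: "'f::nonarch_local_field mat22"
  assumes g: "g \<in> GL2"
  shows "\<exists>n\<ge>1. \<forall>u\<in>congruence_sub n. g ** u ** matrix_inv g \<in> congruence_sub (Suc k)"
proof -
  obtain m where m: "\<And>x i j. x \<in> pow_ideal (m + Suc k) \<Longrightarrow> x * g $ i $ j \<in> pow_ideal (Suc k)"
    using scalar_bound by blast
  obtain m' where m': "\<And>x i j. x \<in> pow_ideal (m' + (m + Suc k)) \<Longrightarrow> x * matrix_inv g $ i $ j \<in> pow_ideal (m + Suc k)"
    using scalar_bound by blast
  show ?thesis
  proof (intro exI[of _ "m' + (m + Suc k)"] conjI ballI)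
    fix u :: "'f mat22" assume u: "u \<in> congruence_sub (m' + (m + Suc k))"
    let ?y = "g ** u ** matrix_inv g"
    define w where "w = u - mat 1"
    have w: "w $ i $ j \<in> pow_ideal (m' + (m + Suc k))" for i j
      using u by (simp add: congruence_sub_def w_def)
    have "u = w + mat 1" by (simp add: w_def)
    then have "?y = g ** w ** matrix_inv g + mat 1"
      using g by (simp add: matrix_add_ldistrib matrix_add_rdistrib22)
    then have y: "?y $ i $ j - mat 1 $ i $ j = (g ** w ** matrix_inv g) $ i $ j" for i j by simp
    have gw: "(g ** w ** matrix_inv g) $ i $ j \<in> pow_ideal (Suc k)" for i j
    proof -
      have t: "g $ i $ a * w $ a $ b * matrix_inv g $ b $ j \<in> pow_ideal (Suc k)" for a b
      proof -
        have "w $ a $ b * matrix_inv g $ b $ j * g $ i $ a \<in> pow_ideal (Suc k)"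
          by (intro m m' w)
        moreover have "w $ a $ b * matrix_inv g $ b $ j * g $ i $ a = g $ i $ a * w $ a $ b * matrix_inv g $ b $ j"
          by (simp add: algebra_simps)
        ultimately show ?thesis by simp
      qed
      show ?thesis
        using t[of 1 1] t[of 1 2] t[of 2 1] t[of 2 2]
        by (simp add: mat22_mult_nth distrib_right pow_ideal_add)
    qed
    have yi: "?y $ i $ j \<in> int_ring" for i j
    proof -
      have "(mat 1 :: 'f mat22) $ i $ j \<in> int_ring" by (simp add: mat_def)
      then have "(?y $ i $ j - mat 1 $ i $ j) + mat 1 $ i $ j \<in> int_ring"
        unfolding y by (intro pow_ideal_add pow_ideal_0D[OF gw])
      then show ?thesis by simp
    qed
    have "det ?y = det u"
      using g by (simp add: det_mul det_matrix_inv GL2_iff)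
    then have "?y \<in> max_compact" using congruence_max_compact[OF u] yi by (simp add: max_compact_iff)
    then show "?y \<in> congruence_sub (Suc k)" using y gw by (simp add: congruence_sub_def)
  qed simp
qed

section \<open>The tree\<close>

abbreviation img :: "'a::field mat22 \<Rightarrow> ('a^2) set \<Rightarrow> ('a^2) set" where
  "img g L \<equiv> (\<lambda>v. g *v v) ` L"

lemma mat22_vec_nth: "((g :: 'a::semiring_1 mat22) *v w) $ i = g $ i $ 1 * w $ 1 + g $ i $ 2 * w $ 2"
  by (simp add: matrix_vector_mult_def sum_2)

lemma vec2_eq_iff: "(v :: 'a^2) = w \<longleftrightarrow> v $ 1 = w $ 1 \<and> v $ 2 = w $ 2"
  by (simp add: vec_eq_iff forall_2)

lemma scalar_vec: "(mat a :: 'a::semiring_1 mat22) *v w = a *s w"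
  by (simp add: vec2_eq_iff mat22_vec_nth)

lemma img_img: "img g (img h L) = img (g ** h) L"
  by (auto simp: image_image matrix_vector_mul_assoc)

lemma img_one [simp]: "img (mat 1) L = L"
  by simp

definition lattice0 :: "('f::nonarch_local_field^2) set" where
  "lattice0 = {w. w $ 1 \<in> int_ring \<and> w $ 2 \<in> int_ring}"

definition lattice1 :: "('f::nonarch_local_field^2) set" where
  "lattice1 = {w. w $ 1 \<in> int_ring \<and> w $ 2 \<in> max_ideal}"

lemma lattice0_eq: "{a *s axis 1 1 + b *s axis 2 1 |a b. a \<in> int_ring \<and> b \<in> int_ring} = lattice0"
proof -
  have "w = w $ 1 *s axis 1 1 + w $ 2 *s axis 2 1" for w :: "'a^2"
    by (simp add: vec2_eq_iff axis_def)
  then show ?thesis by (auto simp: lattice0_def axis_def)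
qed

lemma lattice1_eq: "{a *s axis 1 1 + b *s axis 2 1 |a b. a \<in> int_ring \<and> b \<in> max_ideal} = lattice1"
proof -
  have "w = w $ 1 *s axis 1 1 + w $ 2 *s axis 2 1" for w :: "'a^2"
    by (simp add: vec2_eq_iff axis_def)
  then show ?thesis by (auto simp: lattice1_def axis_def)
qed

lemma img_Pi_lattice0: "img Pi_mat lattice0 = (lattice1 :: ('f::nonarch_local_field^2) set)"
proof (intro subset_antisym subsetI)
  fix w :: "'f^2" assume "w \<in> lattice1"
  then have "w = Pi_mat *v vector [w $ 2 / unif, w $ 1]" "vector [w $ 2 / unif, w $ 1] \<in> (lattice0 :: ('f^2) set)"
    by (auto simp: lattice0_def lattice1_def mat22_vec_nth Pi_mat_def vec2_eq_iff max_ideal_div_unif)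
  then show "w \<in> img Pi_mat lattice0" by blast
qed (auto simp: lattice0_def lattice1_def mat22_vec_nth Pi_mat_def unif_mult_max_ideal)

lemma homothety_class_eq: "homothety_class L = {img (mat a) L |a. a \<noteq> 0}"
  by (simp add: homothety_class_def scalar_vec)

lemma vertex0_eq: "vertex0 = homothety_class lattice0"
  by (simp add: vertex0_def lattice0_eq)

lemma vertex1_eq: "vertex1 = homothety_class lattice1"
  by (simp add: vertex1_def lattice1_eq)

lemma homothety_class_eq_iff:
  fixes L :: "('f::nonarch_local_field^2) set"
  shows "homothety_class L = homothety_class L' \<longleftrightarrow> (\<exists>a. a \<noteq> 0 \<and> L' = img (mat a) L)"
proof
  assume "homothety_class L = homothety_class L'"
  moreover have "L' \<in> homothety_class L'"
    unfolding homothety_class_eq using img_one[of L', symmetric] zero_neq_one[symmetric] by blast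
  ultimately have "L' \<in> homothety_class L" by simp
  then show "\<exists>a. a \<noteq> 0 \<and> L' = img (mat a) L"
    unfolding homothety_class_eq by blast
next
  assume "\<exists>a. a \<noteq> 0 \<and> L' = img (mat a) L"
  then obtain a where a: "a \<noteq> 0" "L' = img (mat a) L" by blast
  have *: "img (mat b) L = img (mat (b / a)) L'" for b
    unfolding a(2) img_img scalar_scalar using a(1) by simp
  have **: "img (mat b) L' = img (mat (b * a)) L" for b
    unfolding a(2) img_img scalar_scalar ..
  show "homothety_class L = homothety_class L'"
    unfolding homothety_class_eq
  proof (intro subset_antisym subsetI)
    fix M assume "M \<in> {img (mat a) L |a. a \<noteq> 0}"
    then obtain b where b: "b \<noteq> 0" "M = img (mat b) L" by blast
    then have "M = img (mat (b / a)) L'" "b / a \<noteq> 0" using *[of b] a(1) by simp_all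
    then show "M \<in> {img (mat a) L' |a. a \<noteq> 0}" by blast
  next
    fix M assume "M \<in> {img (mat a) L' |a. a \<noteq> 0}"
    then obtain b where b: "b \<noteq> 0" "M = img (mat b) L'" by blast
    then have "M = img (mat (b * a)) L" "b * a \<noteq> 0" using **[of b] a(1) by simp_all
    then show "M \<in> {img (mat a) L |a. a \<noteq> 0}" by blast
  qed
qed

lemma vertex_act_class: "vertex_act g (homothety_class L) = homothety_class (img g L)"
proof -
  have "vertex_act g (homothety_class L) = {img g (img (mat a) L) |a. a \<noteq> 0}"
    unfolding vertex_act_def homothety_class_eq by blast
  also have "\<dots> = homothety_class (img g L)"
    unfolding homothety_class_eq img_img scalar_commute ..
  finally show ?thesis .
qed

lemma vertex_act_mult: "vertex_act g (vertex_act h x) = vertex_act (g ** h) x"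
  by (simp add: vertex_act_def image_image matrix_vector_mul_assoc)

lemma vertex_act_one [simp]: "vertex_act (mat 1) x = x"
  by (simp add: vertex_act_def)

lemma vertex_act_inv [simp]:
  "g \<in> GL2 \<Longrightarrow> vertex_act (matrix_inv g) (vertex_act g x) = x"
  "g \<in> GL2 \<Longrightarrow> vertex_act g (vertex_act (matrix_inv g) x) = x"
  by (simp_all add: vertex_act_mult)

lemma vertex_act_eq_iff: "g \<in> GL2 \<Longrightarrow> vertex_act g x = y \<longleftrightarrow> x = vertex_act (matrix_inv g) y"
  by auto

lemma vertex1_Pi: "vertex1 = vertex_act Pi_mat vertex0"
  by (simp add: vertex0_eq vertex1_eq vertex_act_class img_Pi_lattice0)

lemma vertex_act_scalar: "a \<noteq> 0 \<Longrightarrow> vertex_act (mat a) (homothety_class L) = homothety_class L"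
  by (subst eq_commute) (auto simp: vertex_act_class homothety_class_eq_iff)

lemma vertex0_Pi: "vertex_act Pi_mat vertex1 = vertex0"
  unfolding vertex1_Pi vertex_act_mult Pi_square vertex0_eq by (simp add: vertex_act_scalar)

lemma independent_iff_det:
  fixes g :: "'f::nonarch_local_field mat22"
  shows "column 1 g \<noteq> column 2 g \<and> vec.independent {column 1 g, column 2 g} \<longleftrightarrow> g \<in> GL2"
proof -
  let ?v = "column 1 g" and ?w = "column 2 g"
  have n: "?v $ i = g $ i $ 1" "?w $ i = g $ i $ 2" for i by (simp_all add: column_def)
  have "?v \<noteq> ?w \<and> vec.independent {?v, ?w} \<longleftrightarrow> ?w \<noteq> 0 \<and> ?v \<notin> range (\<lambda>k. k *s ?w)"
  proof -
    have "?v \<in> range (\<lambda>k. k *s ?w)" if "?v = ?w"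
      using that by (metis rangeI vec.scale_one)
    then show ?thesis
      by (auto simp: vec.independent_insert vec.span_singleton)
  qed
  also have "\<dots> \<longleftrightarrow> det g \<noteq> 0"
  proof
    assume a: "?w \<noteq> 0 \<and> ?v \<notin> range (\<lambda>k. k *s ?w)"
    show "det g \<noteq> 0"
    proof
      assume d: "det g = 0"
      consider "?w $ 1 \<noteq> 0" | "?w $ 2 \<noteq> 0" using a by (auto simp: vec2_eq_iff)
      then have "\<exists>k. ?v = k *s ?w"
      proof cases
        case 1
        then have "?v = (?v $ 1 / ?w $ 1) *s ?w" using d
          by (simp add: vec2_eq_iff n det_2 field_simps)
        then show ?thesis by blast
      next
        case 2
        then have "?v = (?v $ 2 / ?w $ 2) *s ?w" using d
          by (simp add: vec2_eq_iff n det_2 field_simps)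
        then show ?thesis by blast
      qed
      then show False using a by blast
    qed
  next
    assume "det g \<noteq> 0"
    then show "?w \<noteq> 0 \<and> ?v \<notin> range (\<lambda>k. k *s ?w)"
      by (auto simp: vec2_eq_iff n det_2 algebra_simps)
  qed
  finally show ?thesis by (simp add: GL2_iff)
qed

text \<open>A basis of a lattice is recorded as the two columns of an invertible matrix, which turns
  statements on lattices into statements on matrices.\<close>

lemma lattices_iff: "L \<in> lattices \<longleftrightarrow> (\<exists>g\<in>GL2. L = img g lattice0)"
proof -
  have *: "{a *s column 1 g + b *s column 2 g |a b. a \<in> int_ring \<and> b \<in> int_ring} = img g lattice0" for g :: "'a mat22"
  proof -
    have 1: "a *s column 1 g + b *s column 2 g = g *v vector [a, b]" for a b
      by (simp add: vec2_eq_iff mat22_vec_nth column_def mult.commute)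
    have 2: "w = vector [w $ 1, w $ 2]" for w :: "'a^2" by (simp add: vec2_eq_iff)
    have 3: "vector [a, b] \<in> lattice0 \<longleftrightarrow> a \<in> int_ring \<and> b \<in> int_ring" for a b :: 'a
      by (simp add: lattice0_def)
    show ?thesis
    proof (intro subset_antisym subsetI)
      fix x assume "x \<in> {a *s column 1 g + b *s column 2 g |a b. a \<in> int_ring \<and> b \<in> int_ring}"
      then show "x \<in> img g lattice0" unfolding 1 using 3 by blast
    next
      fix x assume "x \<in> img g lattice0"
      then obtain w where w: "w \<in> lattice0" "x = g *v w" by blast
      then have "x = g *v vector [w $ 1, w $ 2]" using 2[of w] by simp
      then show "x \<in> {a *s column 1 g + b *s column 2 g |a b. a \<in> int_ring \<and> b \<in> int_ring}"
        unfolding 1 using w(1) unfolding lattice0_def by blast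
    qed
  qed
  have c: "\<exists>g :: 'a mat22. w1 = column 1 g \<and> w2 = column 2 g" for w1 w2
    by (rule exI[of _ "mat22 (w1 $ 1) (w2 $ 1) (w1 $ 2) (w2 $ 2)"])
      (simp add: column_def vec2_eq_iff)
  show ?thesis
  proof
    assume "L \<in> lattices"
    then obtain w1 w2 where w: "w1 \<noteq> w2" "vec.independent {w1, w2}"
      "L = {a *s w1 + b *s w2 |a b. a \<in> int_ring \<and> b \<in> int_ring}"
      unfolding lattices_def by blast
    obtain g :: "'a mat22" where g: "w1 = column 1 g" "w2 = column 2 g" using c by blast
    show "\<exists>g\<in>GL2. L = img g lattice0"
      using w independent_iff_det[of g] unfolding g * by blast
  next
    assume "\<exists>g\<in>GL2. L = img g lattice0"
    then obtain g where "g \<in> GL2" "L = img g lattice0" by blast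
    then show "L \<in> lattices"
      unfolding lattices_def using independent_iff_det[of g] *[of g] by blast
  qed
qed

lemma tree_vertices_eq: "tree_vertices = {vertex_act g vertex0 |g. g \<in> GL2}"
proof -
  have l: "lattices = (\<lambda>g. img g lattice0) ` GL2" using lattices_iff by (auto simp del: image_iff)
  show ?thesis unfolding tree_vertices_def vertex0_eq vertex_act_class l image_image
    by (simp only: Setcompr_eq_image Collect_mem_eq)
qed

section \<open>Stabilisers of the standard vertex and edge\<close>

lemma img_lattice0_sub: "(\<And>i j. g $ i $ j \<in> int_ring) \<Longrightarrow> img g lattice0 \<subseteq> lattice0"
  by (auto simp: lattice0_def mat22_vec_nth intro!: pow_ideal_add int_ring_mult)

lemma img_lattice0_subD:
  assumes "img g lattice0 \<subseteq> lattice0" shows "g $ i $ j \<in> int_ring"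
proof -
  have "axis j 1 \<in> (lattice0 :: ('a^2) set)" for j by (simp add: lattice0_def axis_def)
  then have "g *v axis j 1 \<in> lattice0" using assms by blast
  moreover have "(g *v axis j 1) $ i = g $ i $ j" for i
    using exhaust_2[of j] by (auto simp: mat22_vec_nth axis_def)
  ultimately show ?thesis using exhaust_2[of i] by (auto simp: lattice0_def)
qed

lemma img_lattice0_iff:
  assumes "g \<in> GL2"
  shows "img g lattice0 = lattice0 \<longleftrightarrow> g \<in> max_compact"
proof
  assume e: "img g lattice0 = lattice0"
  then have "img (matrix_inv g) lattice0 = img (matrix_inv g) (img g lattice0)" by simp
  also have "\<dots> = lattice0" by (simp only: img_img assms GL2_left_inv img_one)
  finally show "g \<in> max_compact"
    using e assms img_lattice0_subD[of g] img_lattice0_subD[of "matrix_inv g"] by (auto simp: max_compact_def)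
next
  assume g: "g \<in> max_compact"
  then have 1: "img g lattice0 \<subseteq> lattice0" "img (matrix_inv g) lattice0 \<subseteq> lattice0"
    by (auto intro!: img_lattice0_sub simp: max_compact_def)
  have "lattice0 = img g (img (matrix_inv g) lattice0)"
    by (simp only: img_img assms GL2_right_inv img_one)
  then show "img g lattice0 = lattice0" using 1 by blast
qed

lemma fixes_vertex0_iff:
  assumes "g \<in> GL2"
  shows "vertex_act g vertex0 = vertex0 \<longleftrightarrow> (\<exists>a k. a \<noteq> 0 \<and> k \<in> max_compact \<and> g = mat a ** k)"
proof -
  have "vertex_act g vertex0 = vertex0 \<longleftrightarrow> (\<exists>a. a \<noteq> 0 \<and> img g lattice0 = img (mat a) lattice0)"
    unfolding vertex0_eq vertex_act_class by (metis homothety_class_eq_iff)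
  also have "\<dots> \<longleftrightarrow> (\<exists>a. a \<noteq> 0 \<and> matrix_inv (mat a) ** g \<in> max_compact)"
  proof -
    have "img g lattice0 = img (mat a) lattice0 \<longleftrightarrow> matrix_inv (mat a) ** g \<in> max_compact" if a: "a \<noteq> 0" for a
    proof -
      have "img g lattice0 = img (mat a) lattice0 \<longleftrightarrow> img (matrix_inv (mat a)) (img g lattice0) = img (matrix_inv (mat a)) (img (mat a) lattice0)"
        (is "?A = ?B \<longleftrightarrow> _")
      proof
        assume "img (matrix_inv (mat a)) ?A = img (matrix_inv (mat a)) ?B"
        then have "img (mat a) (img (matrix_inv (mat a)) ?A) = img (mat a) (img (matrix_inv (mat a)) ?B)" by simp
        then show "?A = ?B" by (simp only: img_img a GL2_scalar GL2_cancel_left not_False_eq_True)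
      qed simp
      also have "\<dots> \<longleftrightarrow> img (matrix_inv (mat a) ** g) lattice0 = lattice0"
        by (simp only: img_img a GL2_scalar GL2_left_inv img_one not_False_eq_True)
      also have "\<dots> \<longleftrightarrow> matrix_inv (mat a) ** g \<in> max_compact"
        using a assms by (intro img_lattice0_iff) simp
      finally show ?thesis .
    qed
    then show ?thesis by blast
  qed
  also have "\<dots> \<longleftrightarrow> (\<exists>a k. a \<noteq> 0 \<and> k \<in> max_compact \<and> g = mat a ** k)"
    by (metis GL2_cancel_left GL2_scalar)
  finally show ?thesis .
qed

lemma det_Pi_conj: "det (matrix_inv Pi_mat ** k ** Pi_mat) = det k"
  by (simp add: Pi_conj' det_2 field_simps)

text \<open>Presents the Iwahori subgroup as the intersection of \<open>max_compact\<close>, the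
  stabiliser of \<open>lattice0\<close>, with its conjugate, the stabiliser of
  \<open>lattice1\<close>.\<close>

lemma Pi_conj_max_compact:
  assumes "k \<in> max_compact"
  shows "matrix_inv Pi_mat ** k ** Pi_mat \<in> max_compact \<longleftrightarrow> k \<in> iwahori"
proof -
  have "k $ i $ j \<in> int_ring" "unif * k $ i $ j \<in> int_ring" for i j
    using assms by (auto intro: max_compact_nth int_ring_mult)
  moreover have "det k \<noteq> 0" "val (det k) = 0" using assms by (simp_all add: max_compact_iff)
  ultimately show ?thesis
    unfolding max_compact_iff[of "_ ** _"] det_Pi_conj iwahori_iff
    by (simp add: Pi_conj' forall_2 max_ideal_div_unif assms)
qed

lemma fixes_edge_iff:
  assumes "g \<in> GL2"
  shows "vertex_act g vertex0 = vertex0 \<and> vertex_act g vertex1 = vertex1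
    \<longleftrightarrow> (\<exists>a k. a \<noteq> 0 \<and> k \<in> iwahori \<and> g = mat a ** k)"
proof -
  have gl: "k \<in> GL2" if "k \<in> max_compact" for k :: "'a mat22" using that by (rule max_compact_GL2)
  have *: "vertex_act (mat a ** k) vertex1 = vertex1 \<longleftrightarrow> k \<in> iwahori"
    if k: "k \<in> max_compact" "a \<noteq> 0" for a and k :: "'a mat22"
  proof -
    have "vertex_act (mat a ** k) vertex1 = vertex1 \<longleftrightarrow> vertex_act k vertex1 = vertex1"
      using k(2) unfolding scalar_commute[symmetric] vertex_act_mult[symmetric] vertex1_eq
      by (simp add: vertex_act_scalar)
    also have "\<dots> \<longleftrightarrow> vertex_act (matrix_inv Pi_mat ** k ** Pi_mat) vertex0 = vertex0"
      unfolding vertex1_Pi by (simp add: vertex_act_mult[symmetric] vertex_act_eq_iff[of "matrix_inv Pi_mat"])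
    also have "\<dots> \<longleftrightarrow> (\<exists>b m. b \<noteq> 0 \<and> m \<in> max_compact \<and> matrix_inv Pi_mat ** k ** Pi_mat = mat b ** m)"
      using k gl by (subst fixes_vertex0_iff) auto
    also have "\<dots> \<longleftrightarrow> matrix_inv Pi_mat ** k ** Pi_mat \<in> max_compact"
    proof
      assume "\<exists>b m. b \<noteq> 0 \<and> m \<in> max_compact \<and> matrix_inv Pi_mat ** k ** Pi_mat = mat b ** m"
      then obtain b m where b: "b \<noteq> 0" "m \<in> max_compact" "matrix_inv Pi_mat ** k ** Pi_mat = mat b ** m" by blast
      \<comment> \<open>Conjugation preserves the determinant, so comparing valuations shows that
        the homothety \<open>b\<close> is a unit and can be absorbed into
        \<open>max_compact\<close>.\<close>
      have "det k = b * b * det m" using arg_cong[OF b(3), of det] unfolding det_Pi_conj by (simp add: det_mul)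
      then have "val b = 0" using b k(1) by (simp add: max_compact_iff val_mult)
      then have "mat b \<in> max_compact" using b(1) by (simp add: max_compact_iff val_mult forall_2 pow_ideal_def)
      then show "matrix_inv Pi_mat ** k ** Pi_mat \<in> max_compact" unfolding b(3) using b(2) by blast
    next
      assume "matrix_inv Pi_mat ** k ** Pi_mat \<in> max_compact"
      then show "\<exists>b m. b \<noteq> 0 \<and> m \<in> max_compact \<and> matrix_inv Pi_mat ** k ** Pi_mat = mat b ** m"
        by (metis matrix_mul_lid zero_neq_one)
    qed
    also have "\<dots> \<longleftrightarrow> k \<in> iwahori" using k(1) by (rule Pi_conj_max_compact)
    finally show ?thesis .
  qed
  show ?thesis unfolding fixes_vertex0_iff[OF assms] using * by (auto simp: iwahori_iff)
qed

text \<open>The determinant of \<open>Pi_mat\<close> has odd valuation, whereas a scalar times an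
  element of \<open>max_compact\<close> has a determinant of even valuation.\<close>

lemma vertex0_neq_vertex1: "vertex0 \<noteq> (vertex1 :: 'f::nonarch_local_field vertex)"
proof
  assume "vertex0 = (vertex1 :: 'f vertex)"
  then have "vertex_act Pi_mat vertex0 = (vertex0 :: 'f vertex)" by (simp add: vertex1_Pi)
  then obtain a and k :: "'f mat22" where a: "a \<noteq> 0" "k \<in> max_compact" "Pi_mat = mat a ** k"
    using fixes_vertex0_iff[OF Pi_GL2] by blast
  have "- unif = a * a * det k" using arg_cong[OF a(3), of det] by (simp add: det_mul Pi_mat_def)
  then have "val (- unif :: 'f) = 2 * val a" using a by (simp add: val_mult max_compact_iff)
  then show False by (simp add: val_unif) presburger
qed

lemma stabiliser_sigma0: "g \<in> stabiliser sigma0 \<longleftrightarrow> g \<in> GL2 \<and> vertex_act g vertex0 = vertex0"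
  by (auto simp: stabiliser_def sigma0_def simplex_act_def)

lemma stabiliser_sigma1: "g \<in> stabiliser sigma1 \<longleftrightarrow> g \<in> GL2 \<and> {vertex_act g vertex0, vertex_act g vertex1} = {vertex0, vertex1}"
  by (auto simp: stabiliser_def sigma1_def simplex_act_def)

lemma simplex_act_mult: "simplex_act g (simplex_act h x) = simplex_act (g ** h) x"
  by (simp add: simplex_act_def image_image vertex_act_mult)

lemma simplex_act_one [simp]: "simplex_act (mat 1) x = x"
  by (simp add: simplex_act_def)

lemma stabiliser_GL2: "g \<in> stabiliser s \<Longrightarrow> g \<in> GL2"
  by (simp add: stabiliser_def)

lemma stabiliser_mult [intro]: "g \<in> stabiliser s \<Longrightarrow> h \<in> stabiliser s \<Longrightarrow> g ** h \<in> stabiliser s"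
  by (auto simp: stabiliser_def simp flip: simplex_act_mult)

lemma stabiliser_inv [intro]: "g \<in> stabiliser s \<Longrightarrow> matrix_inv g \<in> stabiliser s"
proof -
  assume g: "g \<in> stabiliser s"
  then have "simplex_act (matrix_inv g) s = simplex_act (matrix_inv g) (simplex_act g s)" by (simp add: stabiliser_def)
  also have "\<dots> = s" unfolding simplex_act_mult using g by (simp add: stabiliser_def)
  finally show "matrix_inv g \<in> stabiliser s" using g by (simp add: stabiliser_def)
qed

lemma stabiliser_one [simp]: "mat 1 \<in> stabiliser s"
  by (simp add: stabiliser_def)

lemma simplex_act_eq_iff:
  assumes "g \<in> GL2" "h \<in> GL2"
  shows "simplex_act g s = simplex_act h s \<longleftrightarrow> matrix_inv h ** g \<in> stabiliser s"
proof
  assume "simplex_act g s = simplex_act h s"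
  then have "simplex_act (matrix_inv h) (simplex_act g s) = simplex_act (matrix_inv h) (simplex_act h s)" by simp
  then show "matrix_inv h ** g \<in> stabiliser s"
    using assms by (simp add: stabiliser_def simplex_act_mult)
next
  assume "matrix_inv h ** g \<in> stabiliser s"
  then have "simplex_act h (simplex_act (matrix_inv h ** g) s) = simplex_act h s" by (simp add: stabiliser_def)
  then show "simplex_act g s = simplex_act h s" using assms by (simp add: simplex_act_mult)
qed

lemma Pi_stabiliser: "Pi_mat \<in> stabiliser sigma1"
  by (auto simp: stabiliser_sigma1 vertex0_Pi vertex1_Pi[symmetric])

lemma scalar_iwahori_stabiliser: "a \<noteq> 0 \<Longrightarrow> k \<in> iwahori \<Longrightarrow> mat a ** k \<in> stabiliser sigma1"
  using fixes_edge_iff[of "mat a ** k"] by (auto simp: stabiliser_sigma1 iwahori_iff max_compact_GL2)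

lemma scalar_max_compact_stabiliser: "a \<noteq> 0 \<Longrightarrow> k \<in> max_compact \<Longrightarrow> mat a ** k \<in> stabiliser sigma0"
  using fixes_vertex0_iff[of "mat a ** k"] by (auto simp: stabiliser_sigma0 max_compact_GL2)

lemma stabiliser_sigma0_cases:
  assumes "g \<in> stabiliser sigma0"
  obtains a k where "a \<noteq> 0" "k \<in> max_compact" "g = mat a ** k"
  using assms fixes_vertex0_iff[of g] that unfolding stabiliser_sigma0 by blast

lemma stabiliser_sigma01_cases:
  assumes "g \<in> stabiliser sigma0" "g \<in> stabiliser sigma1"
  obtains a k where "a \<noteq> 0" "k \<in> iwahori" "g = mat a ** k"
proof -
  have "vertex_act g vertex1 = vertex1"
    using assms by (auto simp: stabiliser_sigma0 stabiliser_sigma1 doubleton_eq_iff)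
  then show ?thesis using assms fixes_edge_iff[of g] that unfolding stabiliser_sigma0 by blast
qed

text \<open>Such a lattice corresponds to a line in the plane over the residue field. A vector
  \<open>e\<close> of \<open>M\<close> spanning that line is completed to the matrix
  \<open>k\<close> with first column \<open>e\<close>; anything in \<open>M\<close> outside
  \<open>k lattice1\<close> would make \<open>M\<close> all of \<open>lattice0\<close>.\<close>

lemma intermediate_lattice:
  fixes M :: "('f::nonarch_local_field^2) set"
  assumes M: "M \<in> lattices" and lo: "img (mat unif) lattice0 \<subset> M" and hi: "M \<subset> lattice0"
  shows "\<exists>k\<in>max_compact. M = img k lattice1"
proof -
  obtain h where h: "h \<in> GL2" "M = img h lattice0" using M lattices_iff by blast
  have comb: "a *s x + b *s y \<in> M" if xy: "x \<in> M" "y \<in> M" "a \<in> int_ring" "b \<in> int_ring" for a b x y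
  proof -
    obtain x' y' where xy': "x' \<in> lattice0" "y' \<in> lattice0" "x = h *v x'" "y = h *v y'"
      using xy h by blast
    have "a *s x + b *s y = h *v (a *s x' + b *s y')"
      by (simp add: xy' vec2_eq_iff mat22_vec_nth algebra_simps)
    moreover have "a *s x' + b *s y' \<in> lattice0"
      using xy xy' by (auto simp: lattice0_def intro!: pow_ideal_add int_ring_mult)
    ultimately show ?thesis using h by blast
  qed
  have lo': "x \<in> M" if "x $ 1 \<in> max_ideal" "x $ 2 \<in> max_ideal" for x
  proof -
    have "x = mat unif *v ((1 / unif) *s x)" by (simp add: scalar_vec vec2_eq_iff)
    moreover have "(1 / unif) *s x \<in> lattice0" using that by (simp add: lattice0_def max_ideal_div_unif)
    ultimately show ?thesis using lo by blast
  qed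
  obtain e where e: "e \<in> M" "e \<notin> img (mat unif) lattice0" using lo by blast
  have e0: "e \<in> lattice0" using e hi by blast
  have "\<not> (e $ 1 \<in> max_ideal \<and> e $ 2 \<in> max_ideal)"
  proof
    assume "e $ 1 \<in> max_ideal \<and> e $ 2 \<in> max_ideal"
    then have "e = mat unif *v ((1 / unif) *s e)" "(1 / unif) *s e \<in> lattice0"
      by (simp_all add: scalar_vec vec2_eq_iff lattice0_def max_ideal_div_unif)
    then show False using e(2) by blast
  qed
  \<comment> \<open>One coordinate of \<open>e\<close> is a unit; the second column is the standard
    basis vector that makes the determinant this unit up to sign.\<close>
  then have "\<exists>k\<in>max_compact. k *v axis 1 1 = e"
  proof (cases "e $ 1 \<in> max_ideal")
    case False
    then show ?thesis using e0 int_ring_unit_iff[of "e $ 1"]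
      by (intro bexI[of _ "mat22 (e $ 1) 0 (e $ 2) 1"])
        (auto simp: vec2_eq_iff mat22_vec_nth axis_def max_compact_iff forall_2 lattice0_def)
  next
    case True
    then show ?thesis using e0 int_ring_unit_iff[of "e $ 2"] \<open>\<not> (e $ 1 \<in> max_ideal \<and> e $ 2 \<in> max_ideal)\<close>
      by (intro bexI[of _ "mat22 (e $ 1) 1 (e $ 2) 0"])
        (auto simp: vec2_eq_iff mat22_vec_nth axis_def max_compact_iff forall_2 lattice0_def pow_ideal_minus)
  qed
  then obtain k where k: "k \<in> max_compact" "k *v axis 1 1 = e" by blast
  have k2: "k *v axis 2 1 \<in> lattice0"
    using k(1) by (auto simp: lattice0_def mat22_vec_nth axis_def max_compact_nth)
  have exp: "k *v w = w $ 1 *s e + w $ 2 *s (k *v axis 2 1)" for w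
    unfolding k(2)[symmetric] by (simp add: vec2_eq_iff mat22_vec_nth axis_def)
  have "img k lattice1 \<subseteq> M"
  proof
    fix x assume "x \<in> img k lattice1"
    then obtain w where w: "w \<in> lattice1" "x = k *v w" by blast
    have "w $ 2 *s (k *v axis 2 1) \<in> M"
      using w(1) k2 by (intro lo') (auto simp: lattice1_def lattice0_def intro: pow_ideal_mult_l)
    then have "w $ 1 *s e + 1 *s (w $ 2 *s (k *v axis 2 1)) \<in> M"
      using w(1) e by (intro comb) (auto simp: lattice1_def)
    then show "x \<in> M" using w(2) exp[of w] by simp
  qed
  moreover have "M \<subseteq> img k lattice1"
  proof
    fix x assume x: "x \<in> M"
    then have "x \<in> img k lattice0" using hi img_lattice0_iff[of k] k(1) max_compact_GL2 by blast
    then obtain w where w: "w \<in> lattice0" "x = k *v w" by blast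
    \<comment> \<open>Were \<open>w $ 2\<close> a unit, removing the \<open>e\<close>-component of
      \<open>x\<close> would put the second column of \<open>k\<close> into \<open>M\<close>, and
      with \<open>e\<close> it generates \<open>lattice0\<close>.\<close>
    have "w $ 2 \<in> max_ideal"
    proof (rule ccontr)
      assume u: "w $ 2 \<notin> max_ideal"
      have wi: "w $ 1 \<in> int_ring" "w $ 2 \<in> int_ring" using w by (auto simp: lattice0_def)
      then have inv: "inverse (w $ 2) \<in> int_ring" "w $ 2 \<noteq> 0" using u unit_inverse by auto
      have "inverse (w $ 2) *s x + (- (w $ 1 * inverse (w $ 2))) *s e \<in> M"
        using x e inv wi by (intro comb pow_ideal_minus int_ring_mult)
      moreover have "inverse (w $ 2) *s x + (- (w $ 1 * inverse (w $ 2))) *s e = k *v axis 2 1"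
        unfolding w(2) exp[of w] using inv(2) by (simp add: vec2_eq_iff field_simps)
      ultimately have k2M: "k *v axis 2 1 \<in> M" by simp
      have "lattice0 \<subseteq> M"
      proof
        fix y :: "'f^2" assume "y \<in> lattice0"
        then obtain w' where w': "w' \<in> lattice0" "y = k *v w'"
          using img_lattice0_iff[of k] k(1) max_compact_GL2 by blast
        show "y \<in> M" unfolding w'(2) exp[of w'] using w'(1) e k2M
          by (intro comb) (auto simp: lattice0_def)
      qed
      then show False using hi by blast
    qed
    then show "x \<in> img k lattice1" using w by (auto simp: lattice0_def lattice1_def)
  qed
  ultimately show ?thesis using k(1) by blast
qed

text \<open>Transitivity on oriented edges: once the first lattice is moved to
  \<open>lattice0\<close>, the second is \<open>k lattice1\<close> for some \<open>k\<close> that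
  fixes \<open>lattice0\<close>.\<close>

lemma neighbours_iff: "y \<in> neighbours x \<longleftrightarrow> (\<exists>g\<in>GL2. x = vertex_act g vertex0 \<and> y = vertex_act g vertex1)"
proof
  assume "y \<in> neighbours x"
  then obtain L L' where L: "L \<in> lattices" "L' \<in> lattices" "x = homothety_class L" "y = homothety_class L'"
    "img (mat unif) L \<subset> L'" "L' \<subset> L"
    unfolding neighbours_def scalar_vec[symmetric] mem_Collect_eq by (elim bexE conjE) (rule that)
  obtain g where g: "g \<in> GL2" "L = img g lattice0" using L(1) lattices_iff[of L] by blast
  obtain g' where g': "g' \<in> GL2" "L' = img g' lattice0" using L(2) lattices_iff[of L'] by blast
  let ?M = "img (matrix_inv g) L'"
  have M: "?M \<in> lattices" unfolding g'(2) img_img using g(1) g'(1) lattices_iff by blast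
  have inj: "inj (\<lambda>v. matrix_inv g *v v)"
    by (rule inj_on_inverseI[of _ "\<lambda>v. g *v v"]) (simp add: matrix_vector_mul_assoc g(1))
  have ps: "img (matrix_inv g) A \<subset> img (matrix_inv g) B" if "A \<subset> B" for A B
    using that inj by (simp add: psubset_eq image_mono inj_image_eq_iff)
  have "img (matrix_inv g) (img (mat unif) L) = img (mat unif) lattice0"
    unfolding g(2) img_img using g(1) by (simp add: scalar_commute[of g unif, symmetric] matrix_mul_assoc)
  moreover have "img (matrix_inv g) L = lattice0" unfolding g(2) img_img using g(1) by simp
  ultimately have "\<exists>k\<in>max_compact. ?M = img k lattice1"
    using ps[OF L(5)] ps[OF L(6)] M by (intro intermediate_lattice) auto
  then obtain k where k: "k \<in> max_compact" "?M = img k lattice1" by blast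
  have "L' = img g ?M" unfolding img_img using g(1) by simp
  then have L': "L' = img (g ** k) lattice1" unfolding k(2) img_img .
  have L0: "L = img (g ** k) lattice0"
    using img_lattice0_iff[OF max_compact_GL2[OF k(1)]] k(1) g(2) by (simp flip: img_img)
  show "\<exists>g\<in>GL2. x = vertex_act g vertex0 \<and> y = vertex_act g vertex1"
    using g(1) k(1) max_compact_GL2 unfolding vertex0_eq vertex1_eq vertex_act_class L(3,4) L0 L'
    by blast
next
  assume "\<exists>g\<in>GL2. x = vertex_act g vertex0 \<and> y = vertex_act g vertex1"
  then obtain g where g: "g \<in> GL2" "x = vertex_act g vertex0" "y = vertex_act g vertex1" by blast
  have inj: "inj (\<lambda>v. g *v v)"
    by (rule inj_on_inverseI[of _ "\<lambda>v. matrix_inv g *v v"]) (simp add: matrix_vector_mul_assoc g(1))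
  have ps: "img g A \<subset> img g B" if "A \<subset> B" for A B
    using that inj by (simp add: psubset_eq image_mono inj_image_eq_iff)
  have "axis 2 1 \<in> lattice0 - (lattice1 :: ('a^2) set)" by (simp add: lattice0_def lattice1_def axis_def)
  moreover have "lattice1 \<subseteq> (lattice0 :: ('a^2) set)" by (auto simp: lattice0_def lattice1_def intro: pow_ideal_0D)
  ultimately have 1: "lattice1 \<subset> (lattice0 :: ('a^2) set)" by blast
  have "axis 1 1 \<in> lattice1 - img (mat unif) (lattice0 :: ('a^2) set)"
  proof -
    have "False" if "axis 1 1 = mat unif *v w" "w \<in> lattice0" for w :: "'a^2"
    proof -
      have "1 = unif * w $ 1" using arg_cong[OF that(1), of "\<lambda>v. v $ 1"] by (simp add: scalar_vec axis_def)
      then show False using that(2) unif_mult_max_ideal[of "w $ 1"] by (simp add: lattice0_def)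
    qed
    then show ?thesis by (auto simp: lattice1_def axis_def)
  qed
  moreover have "img (mat unif) lattice0 \<subseteq> (lattice1 :: ('a^2) set)"
    by (auto simp: scalar_vec lattice0_def lattice1_def unif_mult_max_ideal int_ring_mult)
  ultimately have 2: "img (mat unif) lattice0 \<subset> (lattice1 :: ('a^2) set)" by blast
  have 3: "img (mat unif) (img g lattice0) = img g (img (mat unif) lattice0)"
    by (simp only: img_img scalar_commute)
  have "img g lattice1 \<in> lattices" unfolding img_Pi_lattice0[symmetric] img_img
    using g(1) lattices_iff Pi_GL2 by blast
  moreover have "img g lattice0 \<in> lattices" using g(1) lattices_iff by blast
  moreover have "x = homothety_class (img g lattice0)" "y = homothety_class (img g lattice1)"
    using g by (simp_all add: vertex0_eq vertex1_eq vertex_act_class)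
  moreover have "img (mat unif) (img g lattice0) \<subset> img g lattice1" unfolding 3 by (rule ps[OF 2])
  ultimately show "y \<in> neighbours x"
    unfolding neighbours_def scalar_vec[symmetric] using ps[OF 1] by blast
qed

text \<open>\<open>Pi_mat\<close> reverses the standard edge, so right multiplication of
  \<open>g\<close> by it reverses the edge given by \<open>g\<close>.\<close>

lemma neighbours_sym: "y \<in> neighbours x \<Longrightarrow> x \<in> neighbours y"
  unfolding neighbours_iff
  by (elim bexE conjE, rule_tac x="g ** Pi_mat" in bexI)
    (simp_all add: vertex0_Pi vertex1_Pi[symmetric] flip: vertex_act_mult)

lemma neighbours_irrefl: "y \<in> neighbours x \<Longrightarrow> x \<noteq> y"
  unfolding neighbours_iff using vertex0_neq_vertex1 by (metis vertex_act_inv(1))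

lemma neighbours_vertices: "y \<in> neighbours x \<Longrightarrow> x \<in> tree_vertices \<and> y \<in> tree_vertices"
  unfolding neighbours_iff tree_vertices_eq vertex1_Pi vertex_act_mult using Pi_GL2 by blast

lemma neighbours_act:
  assumes "g \<in> GL2"
  shows "vertex_act g y \<in> neighbours (vertex_act g x) \<longleftrightarrow> y \<in> neighbours x"
proof -
  have *: "vertex_act g y \<in> neighbours (vertex_act g x)" if g: "g \<in> GL2" and y: "y \<in> neighbours x"
    for g :: "'a mat22" and x y
  proof -
    obtain h where "h \<in> GL2" "x = vertex_act h vertex0" "y = vertex_act h vertex1"
      using y neighbours_iff by blast
    then show ?thesis using g unfolding neighbours_iff
      by (intro bexI[of _ "g ** h"]) (simp_all add: vertex_act_mult)
  qed
  show ?thesis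
  proof
    assume "vertex_act g y \<in> neighbours (vertex_act g x)"
    from *[OF GL2_inv[OF assms] this] show "y \<in> neighbours x" using assms by simp
  qed (rule *[OF assms])
qed

lemma tree_vertices_act:
  assumes "g \<in> GL2"
  shows "vertex_act g x \<in> tree_vertices \<longleftrightarrow> x \<in> tree_vertices"
proof -
  have *: "vertex_act g x \<in> tree_vertices" if g: "g \<in> GL2" and x: "x \<in> tree_vertices"
    for g :: "'a mat22" and x
    using x g GL2_mult unfolding tree_vertices_eq by (auto simp: vertex_act_mult)
  show ?thesis
  proof
    assume "vertex_act g x \<in> tree_vertices"
    from *[OF GL2_inv[OF assms] this] show "x \<in> tree_vertices" using assms by simp
  qed (rule *[OF assms])
qed

text \<open>The neighbours of \<open>vertex0\<close> correspond to cosets of \<open>iwahori\<close>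
  in \<open>max_compact\<close>. An element and the chosen lift of its reduction differ by
  \<open>K\<^sub>1\<close>, which lies in \<open>iwahori\<close>, so the finitely many residue
  matrices account for all of them.\<close>

lemma finite_neighbours: "finite (neighbours (x :: 'f::nonarch_local_field vertex))"
proof (cases "\<exists>g\<in>GL2. x = vertex_act g vertex0")
  case True
  then obtain g where g: "g \<in> GL2" "x = vertex_act g vertex0" by blast
  have "neighbours x \<subseteq> (\<lambda>c. vertex_act (g ** lift_mat c) vertex1) ` UNIV"
  proof
    fix y assume "y \<in> neighbours x"
    then obtain g' where g': "g' \<in> GL2" "vertex_act g vertex0 = vertex_act g' vertex0" "y = vertex_act g' vertex1"
      using neighbours_iff g by metis
    have "vertex_act (matrix_inv g ** g') vertex0 = vertex0"
      using g g' by (simp flip: vertex_act_mult) (metis g'(2) vertex_act_inv(1))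
    then obtain a k where a: "a \<noteq> 0" "k \<in> max_compact" "matrix_inv g ** g' = mat a ** k"
      using fixes_vertex0_iff[of "matrix_inv g ** g'"] g g' by auto
    let ?l = "lift_mat (reduction k)"
    have l: "?l \<in> max_compact" "reduction ?l = reduction k" using a lift_mat by auto
    then have "reduction (matrix_inv ?l ** k) = mat 1" using a
      by (simp add: reduction_mult reduction_inv)
    then have "matrix_inv ?l ** k \<in> iwahori" using a l by (auto simp: iwahori_def borel_sub_def simp del: reduction_nth)
    then have "vertex_act (mat a ** (matrix_inv ?l ** k)) vertex1 = vertex1"
      using a(1) l(1) a(2) fixes_edge_iff[of "mat a ** (matrix_inv ?l ** k)"]
      by (auto simp: max_compact_GL2)
    moreover have "g' = g ** ?l ** (mat a ** (matrix_inv ?l ** k))"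
    proof -
      have "g ** ?l ** (mat a ** (matrix_inv ?l ** k)) = g ** (mat a ** (?l ** (matrix_inv ?l ** k)))"
        by (metis matrix_mul_assoc scalar_commute)
      also have "\<dots> = g ** (matrix_inv g ** g')" using l(1)[THEN max_compact_GL2] a by simp
      finally show ?thesis using g by simp
    qed
    ultimately have "y = vertex_act (g ** ?l) vertex1" using g'(3) by (metis vertex_act_mult)
    then show "y \<in> (\<lambda>c. vertex_act (g ** lift_mat c) vertex1) ` UNIV" by blast
  qed
  then show ?thesis by (rule finite_subset) simp
next
  case False
  then have "neighbours x = {}" using neighbours_iff by blast
  then show ?thesis by simp
qed

section \<open>Representations\<close>

lemma is_rep_vector_space: "is_rep G V \<Longrightarrow> vector_space (scl V)"
  by (simp add: is_rep_def lin_operators_def)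

lemma is_rep_subspace: "is_rep G V \<Longrightarrow> Modules.module.subspace (scl V) (vecs V)"
  by (simp add: is_rep_def lin_operators_def)

lemma vector_space_module: "vector_space s \<Longrightarrow> Modules.module s"
  by (simp add: module_iff_vector_space)

text \<open>Scalar multiplications are record fields here rather than locale parameters; the closure
  facts are therefore exported once from the \<open>vector_space\<close> locale.\<close>

lemma subspaceD:
  assumes "vector_space s" "Modules.module.subspace s W"
  shows "0 \<in> W" "x \<in> W \<Longrightarrow> y \<in> W \<Longrightarrow> x + y \<in> W" "x \<in> W \<Longrightarrow> s c x \<in> W"
    "x \<in> W \<Longrightarrow> - x \<in> W" "x \<in> W \<Longrightarrow> y \<in> W \<Longrightarrow> x - y \<in> W"
    "(\<And>i. i \<in> I \<Longrightarrow> f i \<in> W) \<Longrightarrow> sum f I \<in> W"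
proof -
  interpret vector_space s by (rule assms)
  note a = assms(2)
  show "0 \<in> W" "x \<in> W \<Longrightarrow> y \<in> W \<Longrightarrow> x + y \<in> W" "x \<in> W \<Longrightarrow> s c x \<in> W"
    "x \<in> W \<Longrightarrow> - x \<in> W" "x \<in> W \<Longrightarrow> y \<in> W \<Longrightarrow> x - y \<in> W"
    "(\<And>i. i \<in> I \<Longrightarrow> f i \<in> W) \<Longrightarrow> sum f I \<in> W"
    using a by (auto intro: subspace_0 subspace_add subspace_scale subspace_neg subspace_diff subspace_sum)
qed

lemma vector_spaceD:
  assumes "vector_space s"
  shows "s a (x + y) = s a x + s a y" "s (a + b) x = s a x + s b x" "s a (s b x) = s (a * b) x"
    "s 1 x = x" "s 0 x = 0" "s a 0 = 0" "s (- 1) x = - x" "s a (- x) = - s a x" "s (- a) x = - s a x"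
    "s a (x - y) = s a x - s a y" "s a (sum f I) = (\<Sum>i\<in>I. s a (f i))"
    "s (sum g I) x = (\<Sum>i\<in>I. s (g i) x)" "a \<noteq> 0 \<Longrightarrow> s a x = 0 \<Longrightarrow> x = 0"
proof -
  interpret vector_space s by (rule assms)
  show "s a (x + y) = s a x + s a y" "s (a + b) x = s a x + s b x" "s a (s b x) = s (a * b) x"
    "s 1 x = x" "s 0 x = 0" "s a 0 = 0" "s (- 1) x = - x" "s a (- x) = - s a x" "s (- a) x = - s a x"
    "s a (x - y) = s a x - s a y" "s a (sum f I) = (\<Sum>i\<in>I. s a (f i))"
    "s (sum g I) x = (\<Sum>i\<in>I. s (g i) x)" "a \<noteq> 0 \<Longrightarrow> s a x = 0 \<Longrightarrow> x = 0"
    by (auto simp: scale_right_distrib scale_left_distrib scale_right_diff_distrib scale_sum_right scale_sum_left)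
qed

lemma subspaceI:
  assumes "vector_space s" "0 \<in> W" "\<And>x y. x \<in> W \<Longrightarrow> y \<in> W \<Longrightarrow> x + y \<in> W"
    "\<And>c x. x \<in> W \<Longrightarrow> s c x \<in> W"
  shows "Modules.module.subspace s W"
  using assms by (simp add: module.subspace_def vector_space_module)

lemma vector_space_pointwise:
  assumes "vector_space s" shows "vector_space (pointwise s)"
  by unfold_locales (auto simp: pointwise_def vector_spaceD[OF assms] plus_fun_def)

locale rep =
  fixes G and V :: "('a::field mat22, 'c::field, 'v::ab_group_add) repr"
  assumes is_rep: "is_rep G V"
begin

lemmas vs = is_rep_vector_space[OF is_rep]
lemmas scl_simps = vector_spaceD[OF vs]
lemmas vecs_closed = subspaceD[OF vs is_rep_subspace[OF is_rep]]

lemma opr_closed: "g \<in> G \<Longrightarrow> x \<in> vecs V \<Longrightarrow> opr V g x \<in> vecs V"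
  using is_rep unfolding is_rep_def lin_operators_def by blast

lemma opr_add: "g \<in> G \<Longrightarrow> x \<in> vecs V \<Longrightarrow> y \<in> vecs V \<Longrightarrow> opr V g (x + y) = opr V g x + opr V g y"
  using is_rep by (auto simp: is_rep_def lin_operators_def)

lemma opr_scl: "g \<in> G \<Longrightarrow> x \<in> vecs V \<Longrightarrow> opr V g (scl V c x) = scl V c (opr V g x)"
  using is_rep by (auto simp: is_rep_def lin_operators_def)

lemma opr_one: "x \<in> vecs V \<Longrightarrow> opr V (mat 1) x = x"
  using is_rep by (auto simp: is_rep_def)

lemma opr_mult: "g \<in> G \<Longrightarrow> h \<in> G \<Longrightarrow> x \<in> vecs V \<Longrightarrow> opr V (g ** h) x = opr V g (opr V h x)"
  using is_rep by (auto simp: is_rep_def)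

lemma opr_zero: "g \<in> G \<Longrightarrow> opr V g 0 = 0"
  using opr_scl[of g 0 0] vecs_closed(1) by (simp add: scl_simps)

lemma opr_minus: "g \<in> G \<Longrightarrow> x \<in> vecs V \<Longrightarrow> opr V g (- x) = - opr V g x"
  using opr_scl[of g x "- 1"] by (simp add: scl_simps)

lemma opr_sum:
  assumes "g \<in> G" shows "(\<And>i. i \<in> I \<Longrightarrow> f i \<in> vecs V) \<Longrightarrow> opr V g (sum f I) = (\<Sum>i\<in>I. opr V g (f i))"
proof (induction I rule: infinite_finite_induct)
  case (insert i I)
  then show ?case using assms by (simp add: opr_add vecs_closed)
qed (use assms in \<open>simp_all add: opr_zero\<close>)

lemma opr_inv:
  assumes "g \<in> G" "matrix_inv g \<in> G" "g \<in> GL2" "x \<in> vecs V"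
  shows "opr V g (opr V (matrix_inv g) x) = x" "opr V (matrix_inv g) (opr V g x) = x"
  using assms by (simp_all add: opr_mult[symmetric] opr_one)

end

lemma HomD:
  assumes "f \<in> Hom G V W"
  shows "x \<in> vecs V \<Longrightarrow> f x \<in> vecs W" "x \<in> vecs V \<Longrightarrow> y \<in> vecs V \<Longrightarrow> f (x + y) = f x + f y"
    "x \<in> vecs V \<Longrightarrow> f (scl V c x) = scl W c (f x)"
    "g \<in> G \<Longrightarrow> x \<in> vecs V \<Longrightarrow> f (opr V g x) = opr W g (f x)" "x \<notin> vecs V \<Longrightarrow> f x = 0"
  using assms by (auto simp: Hom_def)

lemma HomI:
  assumes "\<And>x. x \<in> vecs V \<Longrightarrow> f x \<in> vecs W"
    "\<And>x y. x \<in> vecs V \<Longrightarrow> y \<in> vecs V \<Longrightarrow> f (x + y) = f x + f y"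
    "\<And>c x. x \<in> vecs V \<Longrightarrow> f (scl V c x) = scl W c (f x)"
    "\<And>g x. g \<in> G \<Longrightarrow> x \<in> vecs V \<Longrightarrow> f (opr V g x) = opr W g (f x)" "\<And>x. x \<notin> vecs V \<Longrightarrow> f x = 0"
  shows "f \<in> Hom G V W"
  using assms by (auto simp: Hom_def)

lemma Hom_linear:
  fixes V :: "('g, 'c::field, 'v::ab_group_add) repr" and W :: "('g, 'c, 'w::ab_group_add) repr"
  assumes f: "f \<in> Hom G V W" and V: "vector_space (scl V)" "Modules.module.subspace (scl V) (vecs V)"
  shows "f 0 = 0" "x \<in> vecs V \<Longrightarrow> f (- x) = - f x"
    "x \<in> vecs V \<Longrightarrow> y \<in> vecs V \<Longrightarrow> f (x - y) = f x - f y"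
    "(\<And>i. i \<in> I \<Longrightarrow> v i \<in> vecs V) \<Longrightarrow> f (sum v I) = (\<Sum>i\<in>I. f (v i))"
proof -
  note cl = subspaceD[OF V]
  show 0: "f 0 = 0" using HomD(2)[OF f cl(1) cl(1)] by simp
  have m: "f (- x) = - f x" if "x \<in> vecs V" for x
    using HomD(2)[OF f that cl(4)[OF that]] 0 by (simp add: eq_neg_iff_add_eq_0 add.commute)
  then show "x \<in> vecs V \<Longrightarrow> f (- x) = - f x" .
  show "x \<in> vecs V \<Longrightarrow> y \<in> vecs V \<Longrightarrow> f (x - y) = f x - f y"
    using HomD(2)[OF f, of x "- y"] m[of y] cl(4)[of y] by simp
  show "(\<And>i. i \<in> I \<Longrightarrow> v i \<in> vecs V) \<Longrightarrow> f (sum v I) = (\<Sum>i\<in>I. f (v i))"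
  proof (induction I rule: infinite_finite_induct)
    case (insert i I)
    then show ?case using HomD(2)[OF f, of "v i" "sum v I"] cl(6)[of I v] by simp
  qed (simp_all add: 0)
qed

text \<open>No map between the two Hom spaces has to be written down: each is evaluated bijectively
  onto the same \<open>S\<close>, and linearity of the composite with an inverse is checked after
  applying the injective \<open>q\<close>.\<close>

lemma vs_isomorphic_via:
  fixes A :: "(unit, 'c, 'x::plus) repr" and B :: "(unit, 'c, 'y::{plus, zero}) repr"
    and p :: "'x \<Rightarrow> 'v::ab_group_add" and q :: "'y \<Rightarrow> 'v"
  assumes p: "bij_betw p (vecs A) S" "\<And>x y. x \<in> vecs A \<Longrightarrow> y \<in> vecs A \<Longrightarrow> p (x + y) = p x + p y"
      "\<And>c x. x \<in> vecs A \<Longrightarrow> p (scl A c x) = s c (p x)"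
    and q: "bij_betw q (vecs B) S" "\<And>x y. x \<in> vecs B \<Longrightarrow> y \<in> vecs B \<Longrightarrow> q (x + y) = q x + q y"
      "\<And>c x. x \<in> vecs B \<Longrightarrow> q (scl B c x) = s c (q x)"
    and B: "\<And>x y. x \<in> vecs B \<Longrightarrow> y \<in> vecs B \<Longrightarrow> x + y \<in> vecs B" "\<And>c x. x \<in> vecs B \<Longrightarrow> scl B c x \<in> vecs B"
    and A: "\<And>x y. x \<in> vecs A \<Longrightarrow> y \<in> vecs A \<Longrightarrow> x + y \<in> vecs A" "\<And>c x. x \<in> vecs A \<Longrightarrow> scl A c x \<in> vecs A"
  shows "vs_isomorphic A B"
proof -
  define f where "f x = (if x \<in> vecs A then inv_into (vecs B) q (p x) else 0)" for x
  have f: "f x \<in> vecs B" "q (f x) = p x" if "x \<in> vecs A" for x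
    using that p(1) q(1) unfolding f_def bij_betw_def
    by (auto simp: inv_into_into f_inv_into_f)
  have inj: "x = y" if "x \<in> vecs B" "y \<in> vecs B" "q x = q y" for x y
    using that q(1) by (auto simp: bij_betw_def inj_on_def)
  have "f \<in> Hom {} A B"
  proof (rule HomI)
    fix x y assume xy: "x \<in> vecs A" "y \<in> vecs A"
    show "f (x + y) = f x + f y"
      by (rule inj) (use xy in \<open>simp_all add: f A B p q\<close>)
  next
    fix c x assume x: "x \<in> vecs A"
    show "f (scl A c x) = scl B c (f x)"
      by (rule inj) (use x in \<open>simp_all add: f A B p q\<close>)
  qed (simp_all add: f(1), simp add: f_def)
  moreover have "bij_betw f (vecs A) (vecs B)"
  proof -
    have "bij_betw (inv_into (vecs B) q \<circ> p) (vecs A) (vecs B)"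
      by (rule bij_betw_trans[OF p(1) bij_betw_inv_into[OF q(1)]])
    then show ?thesis by (rule bij_betw_cong[THEN iffD1, rotated]) (simp add: f_def)
  qed
  ultimately show ?thesis unfolding vs_isomorphic_def isomorphic_def by blast
qed

section \<open>Quotients\<close>

locale quotient = rep G C for G and C :: "('a::field mat22, 'c::field, 'v::ab_group_add) repr" +
  fixes N
  assumes G: "\<And>g. g \<in> G \<Longrightarrow> g \<in> GL2 \<and> matrix_inv g \<in> G"
    and N_sub: "N \<subseteq> vecs C" and N_space: "Modules.module.subspace (scl C) N"
    and N_stable: "\<And>g x. g \<in> G \<Longrightarrow> x \<in> N \<Longrightarrow> opr C g x \<in> N"
begin

lemmas N_closed = subspaceD[OF vs N_space]

lemma coset_eq_iff: "x +o N = y +o N \<longleftrightarrow> x - y \<in> N"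
proof
  assume "x +o N = y +o N"
  moreover have "x + 0 \<in> x +o N" using N_closed(1) by blast
  ultimately have "x + 0 \<in> y +o N" by simp
  then obtain b where b: "b \<in> N" "x = y + b" by (auto simp: elt_set_plus_def)
  then show "x - y \<in> N" by simp
next
  have *: "x +o N \<subseteq> y +o N" if xy: "x - y \<in> N" for x y
  proof
    fix z assume "z \<in> x +o N"
    then obtain b where "b \<in> N" "z = x + b" by (auto simp: elt_set_plus_def)
    then have "z = y + ((x - y) + b)" "(x - y) + b \<in> N" using xy N_closed by auto
    then show "z \<in> y +o N" by blast
  qed
  assume "x - y \<in> N"
  moreover from this have "y - x \<in> N" using N_closed(4)[of "x - y"] by simp
  ultimately show "x +o N = y +o N" using * by blast
qed

lemma coset_add: "(x +o N) + (y +o N) = (x + y) +o N"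
proof -
  have "N + N = N" using N_closed(1,2) by (auto simp: set_plus_def) (metis add.right_neutral)
  then show ?thesis by (simp add: set_plus_rearrange)
qed

text \<open>The summand \<open>N\<close> matters for \<open>c = 0\<close>, where scaling a coset
  gives the single vector 0 instead of a coset.\<close>

lemma coset_scl: "scl C c ` (x +o N) + N = scl C c x +o N"
proof (intro subset_antisym subsetI)
  fix z assume "z \<in> scl C c ` (x +o N) + N"
  then obtain b b' where "b \<in> N" "b' \<in> N" "z = scl C c (x + b) + b'"
    by (auto simp: elt_set_plus_def set_plus_def)
  then have "z = scl C c x + (scl C c b + b')" "scl C c b + b' \<in> N"
    using N_closed by (auto simp: scl_simps)
  then show "z \<in> scl C c x +o N" by blast
next
  fix z assume "z \<in> scl C c x +o N"
  then obtain b where "b \<in> N" "z = scl C c (x + 0) + b" by (auto simp: elt_set_plus_def)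
  then show "z \<in> scl C c ` (x +o N) + N" using N_closed(1) by blast
qed

lemma coset_opr:
  assumes g: "g \<in> G" and x: "x \<in> vecs C"
  shows "opr C g ` (x +o N) = opr C g x +o N"
proof (intro subset_antisym subsetI)
  fix z assume "z \<in> opr C g ` (x +o N)"
  then obtain b where "b \<in> N" "z = opr C g (x + b)" by (auto simp: elt_set_plus_def)
  then have "z = opr C g x + opr C g b" "opr C g b \<in> N"
    using g x N_sub N_stable by (auto intro: opr_add)
  then show "z \<in> opr C g x +o N" by blast
next
  fix z assume "z \<in> opr C g x +o N"
  then obtain b where b: "b \<in> N" "z = opr C g x + b" by (auto simp: elt_set_plus_def)
  have b': "opr C (matrix_inv g) b \<in> N" "b \<in> vecs C" using b N_stable G g N_sub by auto
  then have "opr C g (x + opr C (matrix_inv g) b) = z"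
    using g x G[OF g] b N_sub by (simp add: opr_add opr_closed opr_inv)
  then show "z \<in> opr C g ` (x +o N)" using b' by blast
qed

lemma vecs_quotient: "vecs (quotient_rep C N) = (\<lambda>x. x +o N) ` vecs C"
  by (simp add: quotient_rep_def)

lemma Hom_quotient_lift:
  assumes f: "f \<in> Hom G (quotient_rep C N) W"
  defines "F \<equiv> (\<lambda>x. if x \<in> vecs C then f (x +o N) else 0)"
  shows "F \<in> Hom G C W" "\<And>x. x \<in> N \<Longrightarrow> F x = (0 :: 'w::ab_group_add)"
proof -
  note h = HomD[OF f, unfolded vecs_quotient]
  show FH: "F \<in> Hom G C W"
  proof (rule HomI)
    fix x y assume "x \<in> vecs C" "y \<in> vecs C"
    then show "F (x + y) = F x + F y"
      unfolding F_def using h(2)[of "x +o N" "y +o N"] by (simp add: coset_add vecs_closed)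
  next
    fix c x assume "x \<in> vecs C"
    then show "F (scl C c x) = scl W c (F x)"
      unfolding F_def using h(3)[of "x +o N" c] by (simp add: quotient_rep_def coset_scl vecs_closed)
  next
    fix g x assume "g \<in> G" "x \<in> vecs C"
    then show "F (opr C g x) = opr W g (F x)"
      unfolding F_def using h(4)[of g "x +o N"] by (simp add: quotient_rep_def coset_opr opr_closed)
  qed (auto simp: F_def h(1))
  fix x assume x: "x \<in> N"
  then have "x +o N = 0 +o N" using coset_eq_iff[of x 0] by (simp only: diff_zero)
  then have "F x = F 0" unfolding F_def using x N_sub vecs_closed(1) by auto
  also have "\<dots> = 0" using HomD(2)[OF FH, of 0 0] vecs_closed(1) by simp
  finally show "F x = 0" .
qed

text \<open>The value at a coset is taken at a chosen representative; two representatives differ by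
  an element of \<open>N\<close>, which \<open>F\<close> kills.\<close>

lemma Hom_quotient_factor:
  assumes F: "F \<in> Hom G C W" and kill: "\<And>x. x \<in> N \<Longrightarrow> F x = (0 :: 'w::ab_group_add)"
  obtains f where "f \<in> Hom G (quotient_rep C N) W" "\<And>x. x \<in> vecs C \<Longrightarrow> f (x +o N) = F x"
proof -
  define f where "f Y = (if Y \<in> vecs (quotient_rep C N) then F (SOME x. x \<in> vecs C \<and> Y = x +o N) else 0)" for Y
  have f: "f (x +o N) = F x" if x: "x \<in> vecs C" for x
  proof -
    define x' where "x' = (SOME x'. x' \<in> vecs C \<and> x +o N = x' +o N)"
    have x': "x' \<in> vecs C \<and> x +o N = x' +o N"
      unfolding x'_def by (rule someI[of _ x]) (use x in simp)
    then have "x' - x \<in> N" using coset_eq_iff[of x' x] by simp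
    then have "F (x' - x) = 0" by (rule kill)
    then have "F x' = F x" using x x' Hom_linear(3)[OF F vs is_rep_subspace[OF is_rep], of x' x] by simp
    then show ?thesis unfolding f_def vecs_quotient x'_def[symmetric] using x by simp
  qed
  have "f \<in> Hom G (quotient_rep C N) W"
  proof (rule HomI; unfold vecs_quotient)
    fix Y Z assume "Y \<in> (\<lambda>x. x +o N) ` vecs C" "Z \<in> (\<lambda>x. x +o N) ` vecs C"
    then show "f (Y + Z) = f Y + f Z" by (auto simp: coset_add f vecs_closed HomD(2)[OF F])
  next
    show "f Y = 0" if "Y \<notin> (\<lambda>x. x +o N) ` vecs C" for Y using that by (simp add: f_def vecs_quotient)
  qed (auto simp: quotient_rep_def coset_scl coset_opr f vecs_closed opr_closed HomD[OF F])
  then show ?thesis using f that by blast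
qed

end

section \<open>Zeroth homology of an equivariant coefficient system\<close>

lemma right_transl_simps [simp]:
  "right_transl g (f + f') = right_transl g f + right_transl g f'"
  "right_transl g 0 = 0"
  "right_transl g (pointwise s c f) = pointwise s c (right_transl g f)"
  by (simp_all add: right_transl_def fun_eq_iff pointwise_def plus_fun_def zero_fun_def)

lemma sum_fun_apply: "(sum f I) x = (\<Sum>i\<in>I. f i x)" for f :: "'i \<Rightarrow> 'a \<Rightarrow> 'b::comm_monoid_add"
  by (induction I rule: infinite_finite_induct) auto

lemma right_transl_mult: "right_transl g (right_transl h f) = right_transl (g ** h) f"
  by (simp add: right_transl_def matrix_mul_assoc)

lemma right_transl_one [simp]: "right_transl (mat 1) f = f"
  by (simp add: right_transl_def)

text \<open>The element of the compact induction supported on \<open>H g^-1\<close> with value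
  \<open>d\<close> at \<open>g^-1\<close>. The space attached to the simplex \<open>g s\<close>
  consists of these functions.\<close>

definition coset_fun :: "'f::nonarch_local_field mat22 set \<Rightarrow> ('f mat22, 'c, 'w::zero) repr
    \<Rightarrow> 'f mat22 \<Rightarrow> 'w \<Rightarrow> 'f mat22 \<Rightarrow> 'w" where
  "coset_fun H D g d = (\<lambda>x. if x \<in> GL2 \<and> x ** g \<in> H then opr D (x ** g) d else 0)"

text \<open>Smoothness of \<open>D\<close> enters in the strong form that \<open>K\<^sub>1\<close>
  acts trivially; a coset function is then fixed by a conjugate of \<open>K\<^sub>1\<close>.\<close>

locale open_rep = rep "stabiliser s" D
  for s and D :: "('f::nonarch_local_field mat22, 'c::field, 'w::ab_group_add) repr" +
  assumes cong_stab: "u \<in> congruence_sub 1 \<Longrightarrow> u \<in> stabiliser s"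
    and triv: "u \<in> congruence_sub 1 \<Longrightarrow> x \<in> vecs D \<Longrightarrow> opr D u x = x"
begin

abbreviation "cf \<equiv> coset_fun (stabiliser s) D"

lemma cf_at: "g \<in> GL2 \<Longrightarrow> d \<in> vecs D \<Longrightarrow> cf g d (matrix_inv g) = d"
  by (simp add: coset_fun_def opr_one)

lemma cf_add: "d \<in> vecs D \<Longrightarrow> d' \<in> vecs D \<Longrightarrow> cf g (d + d') = cf g d + cf g d'"
  by (simp add: coset_fun_def fun_eq_iff opr_add)

lemma cf_scl: "d \<in> vecs D \<Longrightarrow> cf g (scl D c d) = pointwise (scl D) c (cf g d)"
  by (simp add: coset_fun_def fun_eq_iff opr_scl pointwise_def scl_simps)

lemma cf_zero: "cf g 0 = 0"
  by (simp add: coset_fun_def fun_eq_iff opr_zero)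

lemma cf_minus: "d \<in> vecs D \<Longrightarrow> cf g (- d) = - cf g d"
  by (simp add: coset_fun_def fun_eq_iff opr_minus)

lemma mem_shift: "k \<in> stabiliser s \<Longrightarrow> x ** k \<in> stabiliser s \<longleftrightarrow> x \<in> stabiliser s"
  using stabiliser_mult[of x s k] stabiliser_mult[of "x ** k" s "matrix_inv k"]
  by (auto simp: stabiliser_GL2 stabiliser_inv)

lemma mem_shift': "k \<in> stabiliser s \<Longrightarrow> k ** x \<in> stabiliser s \<longleftrightarrow> x \<in> stabiliser s"
  using stabiliser_mult[of k s x] stabiliser_mult[of "matrix_inv k" s "k ** x"]
  by (auto simp: stabiliser_GL2 stabiliser_inv)

text \<open>Two elements carrying \<open>s\<close> to the same simplex differ by its stabiliser;
  this is the resulting change of coordinates in the space at that simplex.\<close>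

lemma cf_shift: "k \<in> stabiliser s \<Longrightarrow> d \<in> vecs D \<Longrightarrow> cf (g ** k) d = cf g (opr D k d)"
  by (simp add: coset_fun_def fun_eq_iff matrix_mul_assoc mem_shift opr_mult)

lemma cf_transl: "h \<in> GL2 \<Longrightarrow> right_transl h (cf g d) = cf (h ** g) d"
  unfolding coset_fun_def right_transl_def matrix_mul_assoc by simp

text \<open>Translation by \<open>u\<close> is undone once \<open>g^-1 u g\<close> lies in
  \<open>K\<^sub>1\<close>, which continuity of conjugation guarantees for \<open>u\<close> close to
  1.\<close>

lemma cf_c_Ind:
  assumes g: "g \<in> GL2" and d: "d \<in> vecs D"
  shows "cf g d \<in> vecs (c_Ind (stabiliser s) D)"
proof -
  obtain n where n: "\<forall>u\<in>congruence_sub n. matrix_inv g ** u ** matrix_inv (matrix_inv g) \<in> congruence_sub (Suc 0)"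
    using conj_congruence[OF GL2_inv[OF g], of 0] by blast
  have "right_transl u (cf g d) = cf g d" if u: "u \<in> congruence_sub n" for u
  proof -
    let ?k = "matrix_inv g ** u ** g"
    have k: "?k \<in> congruence_sub 1" using n u g by (simp add: One_nat_def)
    have "u \<in> GL2" using u by (simp add: congruence_max_compact max_compact_GL2)
    then have "right_transl u (cf g d) = cf (u ** g) d" by (rule cf_transl)
    also have "u ** g = g ** ?k" using g by (simp add: matrix_mul_assoc)
    also have "cf \<dots> d = cf g d" using k d by (simp add: cf_shift cong_stab triv)
    finally show ?thesis .
  qed
  moreover have "{x. cf g d x \<noteq> 0} \<subseteq> (\<Union>h\<in>{matrix_inv g}. (\<lambda>k. k ** h) ` stabiliser s)"
  proof
    fix x assume "x \<in> {x. cf g d x \<noteq> 0}"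
    then have "x ** g \<in> stabiliser s" by (auto simp: coset_fun_def split: if_splits)
    moreover have "x = (x ** g) ** matrix_inv g" using g by simp
    ultimately show "x \<in> (\<Union>h\<in>{matrix_inv g}. (\<lambda>k. k ** h) ` stabiliser s)" by blast
  qed
  moreover have "cf g d (h ** x) = opr D h (cf g d x)" if "h \<in> stabiliser s" "x \<in> GL2" for h x
    using that d by (auto simp: coset_fun_def mem_shift' opr_mult opr_zero stabiliser_GL2 simp flip: matrix_mul_assoc)
  moreover have "\<forall>x. x \<notin> GL2 \<longrightarrow> cf g d x = 0" "\<forall>x\<in>GL2. cf g d x \<in> vecs D"
    using d by (simp_all add: coset_fun_def opr_closed vecs_closed)
  ultimately show ?thesis
    unfolding c_Ind_def repr.simps mem_Collect_eq
    by (intro conjI exI[of _ n] exI[of _ "{matrix_inv g}"] ballI) simp_all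
qed

text \<open>Equivariance determines a function on a whole coset from one value, so evaluation at
  \<open>matrix_inv g\<close> recovers \<open>d\<close>.\<close>

lemma induced_space_eq:
  assumes g: "g \<in> GL2"
  shows "induced_space s D (simplex_act g s) = cf g ` vecs D"
proof (intro subset_antisym subsetI)
  fix f assume "f \<in> induced_space s D (simplex_act g s)"
  then obtain g' where f: "f \<in> vecs (c_Ind (stabiliser s) D)" and g': "g' \<in> GL2" "simplex_act g s = simplex_act g' s"
    "{x. f x \<noteq> 0} \<subseteq> (\<lambda>k. k ** matrix_inv g') ` stabiliser s"
    by (auto simp: induced_space_def)
  have c: "f x = 0" if "x \<notin> GL2" for x using f that by (auto simp: c_Ind_def)
  have fd: "f (matrix_inv g) \<in> vecs D" using f g by (auto simp: c_Ind_def)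
  have eq: "f (h ** x) = opr D h (f x)" if "h \<in> stabiliser s" "x \<in> GL2" for h x
    using f that by (auto simp: c_Ind_def)
  have "f x = cf g (f (matrix_inv g)) x" for x
  proof (cases "x \<in> GL2 \<and> x ** g \<in> stabiliser s")
    case True
    then have "f x = f ((x ** g) ** matrix_inv g)" using g by simp
    also have "\<dots> = opr D (x ** g) (f (matrix_inv g))" using True g by (intro eq) auto
    finally show ?thesis using True by (simp add: coset_fun_def)
  next
    case False
    have "f x = 0"
    proof (rule ccontr)
      assume "f x \<noteq> 0"
      then obtain k where k: "k \<in> stabiliser s" "x = k ** matrix_inv g'" using g'(3) by blast
      have "matrix_inv g' ** g \<in> stabiliser s" using g'(1,2) g by (simp add: simplex_act_eq_iff)
      then have "x ** g \<in> stabiliser s" unfolding k(2) using k(1) by (simp add: mem_shift' flip: matrix_mul_assoc)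
      then show False using False c[of x] \<open>f x \<noteq> 0\<close> by blast
    qed
    then show ?thesis using False by (auto simp: coset_fun_def)
  qed
  then have "f = cf g (f (matrix_inv g))" by blast
  then show "f \<in> cf g ` vecs D" using fd by blast
next
  fix f assume "f \<in> cf g ` vecs D"
  then obtain d where d: "d \<in> vecs D" "f = cf g d" by blast
  have "{x. f x \<noteq> 0} \<subseteq> (\<lambda>k. k ** matrix_inv g) ` stabiliser s"
  proof
    fix x assume "x \<in> {x. f x \<noteq> 0}"
    then have "x ** g \<in> stabiliser s" unfolding d by (auto simp: coset_fun_def split: if_splits)
    moreover have "x = (x ** g) ** matrix_inv g" using g by simp
    ultimately show "x \<in> (\<lambda>k. k ** matrix_inv g) ` stabiliser s" by blast
  qed
  then show "f \<in> induced_space s D (simplex_act g s)"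
    unfolding induced_space_def using g d cf_c_Ind by blast
qed

end

text \<open>Doubling the sum would prove nothing in characteristic 2, so the oriented edges are
  removed in pairs \<open>(x, y)\<close>, \<open>(y, x)\<close>.\<close>

lemma sum_antisymmetric:
  fixes E :: "'a \<times> 'a \<Rightarrow> 'b::ab_group_add"
  assumes "finite P" "\<And>x y. (x, y) \<in> P \<Longrightarrow> (y, x) \<in> P \<and> x \<noteq> y \<and> E (x, y) + E (y, x) = 0"
  shows "sum E P = 0"
  using assms
proof (induction P rule: finite_psubset_induct)
  case (psubset P)
  show ?case
  proof (cases "P = {}")
    case False
    then obtain x y where xy: "(x, y) \<in> P" by auto
    note p = psubset.prems[OF xy]
    let ?Q = "P - {(x, y), (y, x)}"
    have "sum E P = sum E ?Q + sum E {(x, y), (y, x)}"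
      using psubset.hyps xy p by (intro sum.subset_diff) auto
    also have "sum E ?Q = 0"
    proof (rule psubset.IH)
      show "?Q \<subset> P" using xy by blast
      fix a b assume "(a, b) \<in> ?Q"
      then show "(b, a) \<in> ?Q \<and> a \<noteq> b \<and> E (a, b) + E (b, a) = 0"
        using psubset.prems[of a b] by auto
    qed
    also have "sum E {(x, y), (y, x)} = 0" using p by simp
    finally show ?thesis by simp
  qed simp
qed

text \<open>The local data of a coefficient system whose restriction map is an inclusion. The
  assumption \<open>agree\<close> is equivariance of this inclusion under the intersection of the
  two stabilisers.\<close>

locale diagram =
  fixes D0 D1 :: "('f::nonarch_local_field mat22, 'c::field, 'w::ab_group_add) repr"
  assumes D0: "is_rep (stabiliser sigma0) D0" and D1: "is_rep (stabiliser sigma1) D1"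
    and sub: "vecs D1 \<subseteq> vecs D0" and scl_eq: "scl D1 = scl D0"
    and agree: "a \<noteq> 0 \<Longrightarrow> k \<in> iwahori \<Longrightarrow> x \<in> vecs D1 \<Longrightarrow> opr D1 (mat a ** k) x = opr D0 (mat a ** k) x"
    and trivial0: "u \<in> congruence_sub 1 \<Longrightarrow> x \<in> vecs D0 \<Longrightarrow> opr D0 u x = x"
begin

lemma congruence_1_iwahori: "u \<in> congruence_sub 1 \<Longrightarrow> u \<in> iwahori"
  using congruence_1_pro_p[of u] by (auto simp: iwahori_iff pro_p_iwahori_iff congruence_max_compact)

sublocale D0: open_rep sigma0 D0
proof
  show "is_rep (stabiliser sigma0) D0" by (rule D0)
  show "u \<in> stabiliser sigma0" if "u \<in> congruence_sub 1" for u :: "'f mat22"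
    using scalar_max_compact_stabiliser[of 1 u] that by (simp add: congruence_max_compact)
qed (rule trivial0)

sublocale D1: open_rep sigma1 D1
proof
  show "is_rep (stabiliser sigma1) D1" by (rule D1)
  fix u :: "'f mat22" assume u: "u \<in> congruence_sub 1"
  show "u \<in> stabiliser sigma1"
    using scalar_iwahori_stabiliser[of 1 u] u by (simp add: congruence_1_iwahori)
  show "opr D1 u x = x" if "x \<in> vecs D1" for x
    using agree[of 1 u x] u that sub trivial0[of u x] by (auto simp: congruence_1_iwahori)
qed

abbreviation "c0 \<equiv> coset_fun (stabiliser sigma0) D0"
abbreviation "c1 \<equiv> coset_fun (stabiliser sigma1) D1"
abbreviation "V \<equiv> induced_system D0 D1"
abbreviation "C0 \<equiv> chains0 V"
abbreviation "N \<equiv> boundary V ` chains1 V"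

lemma space0: "g \<in> GL2 \<Longrightarrow> cs_space V {vertex_act g vertex0} = c0 g ` vecs D0"
  using D0.induced_space_eq[of g] by (simp add: induced_system_def sigma0_def simplex_act_def)

lemma space1: "g \<in> GL2 \<Longrightarrow> cs_space V {vertex_act g vertex0, vertex_act g vertex1} = c1 g ` vecs D1"
proof -
  assume g: "g \<in> GL2"
  then have "vertex_act g vertex0 \<noteq> vertex_act g vertex1"
    using vertex0_neq_vertex1 by (metis vertex_act_inv(1))
  then show ?thesis
    using D1.induced_space_eq[OF g] by (simp add: induced_system_def sigma1_def simplex_act_def)
qed

text \<open>Resolves the definite description in \<open>cs_restr\<close>: the elements carrying the
  standard flag to the given one differ by a scalar times \<open>iwahori\<close>, where both actions
  agree, and the value at a single point determines the function.\<close>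

lemma restr_edge:
  assumes g: "g \<in> GL2" and d: "d \<in> vecs D1"
  shows "cs_restr V {vertex_act g vertex0, vertex_act g vertex1} {vertex_act g vertex0} (c1 g d) = c0 g d"
proof -
  let ?s = "{vertex_act g vertex0, vertex_act g vertex1}"
  have ne: "vertex_act g vertex0 \<noteq> vertex_act g vertex1"
    using vertex0_neq_vertex1 g by (metis vertex_act_inv(1))
  have s: "?s = simplex_act g sigma1" "{vertex_act g vertex0} = simplex_act g sigma0"
    by (simp_all add: sigma0_def sigma1_def simplex_act_def)
  have d0: "d \<in> vecs D0" using d sub by blast
  have "(THE f'. f' \<in> induced_space sigma0 D0 (simplex_act g sigma0)
      \<and> (\<forall>h\<in>GL2. simplex_act h sigma1 = simplex_act g sigma1 \<and> simplex_act h sigma0 = simplex_act g sigma0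
           \<longrightarrow> f' (matrix_inv h) = c1 g d (matrix_inv h))) = c0 g d"
  proof (rule the_equality, intro conjI ballI impI)
    show "c0 g d \<in> induced_space sigma0 D0 (simplex_act g sigma0)"
      using g d0 by (simp add: D0.induced_space_eq)
    fix h :: "'f mat22" assume h: "h \<in> GL2" and *: "simplex_act h sigma1 = simplex_act g sigma1 \<and> simplex_act h sigma0 = simplex_act g sigma0"
    then have k: "matrix_inv h ** g \<in> stabiliser sigma0" "matrix_inv h ** g \<in> stabiliser sigma1"
      using g by (metis simplex_act_eq_iff)+
    then obtain a k where "a \<noteq> 0" "k \<in> iwahori" "matrix_inv h ** g = mat a ** k"
      by (rule stabiliser_sigma01_cases)
    then have "opr D1 (matrix_inv h ** g) d = opr D0 (matrix_inv h ** g) d" using agree d by simp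
    then show "c0 g d (matrix_inv h) = c1 g d (matrix_inv h)"
      using k h by (simp add: coset_fun_def)
  next
    fix f' assume f': "f' \<in> induced_space sigma0 D0 (simplex_act g sigma0)
      \<and> (\<forall>h\<in>GL2. simplex_act h sigma1 = simplex_act g sigma1 \<and> simplex_act h sigma0 = simplex_act g sigma0
           \<longrightarrow> f' (matrix_inv h) = c1 g d (matrix_inv h))"
    then obtain d' where d': "d' \<in> vecs D0" "f' = c0 g d'" using g by (auto simp: D0.induced_space_eq)
    have "d' = f' (matrix_inv g)" using g d' D0.cf_at by simp
    also have "\<dots> = d" using f' g d D1.cf_at by simp
    finally show "f' = c0 g d" using d' by simp
  qed
  then show ?thesis using ne by (auto simp: induced_system_def s[symmetric] insert_eq_iff)
qed

text \<open>Coordinates for an edge seen from both ends. From the other end \<open>g\<close> becomes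
  \<open>g ** Pi_mat\<close>, which is compensated by the inverse of \<open>Pi_mat\<close> acting on
  \<open>d\<close>.\<close>

lemma edge_cases:
  assumes "y \<in> neighbours x"
  obtains g where "g \<in> GL2" "x = vertex_act g vertex0" "y = vertex_act g vertex1"
    "cs_space V {x, y} = c1 g ` vecs D1"
    "\<And>d. d \<in> vecs D1 \<Longrightarrow> cs_restr V {x, y} {x} (c1 g d) = c0 g d"
    "\<And>d. d \<in> vecs D1 \<Longrightarrow> cs_restr V {y, x} {y} (c1 g d) = c0 (g ** Pi_mat) (opr D1 (matrix_inv Pi_mat) d)"
proof -
  obtain g where g: "g \<in> GL2" "x = vertex_act g vertex0" "y = vertex_act g vertex1"
    using assms neighbours_iff by blast
  have xy: "y = vertex_act (g ** Pi_mat) vertex0" "x = vertex_act (g ** Pi_mat) vertex1"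
    using g by (simp_all add: vertex0_Pi vertex1_Pi[symmetric] flip: vertex_act_mult)
  have "cs_restr V {y, x} {y} (c1 g d) = c0 (g ** Pi_mat) (opr D1 (matrix_inv Pi_mat) d)" if d: "d \<in> vecs D1" for d
  proof -
    have "c1 g d = c1 (g ** Pi_mat ** matrix_inv Pi_mat) d" by simp
    also have "\<dots> = c1 (g ** Pi_mat) (opr D1 (matrix_inv Pi_mat) d)"
      using d Pi_stabiliser by (intro D1.cf_shift) (auto intro: stabiliser_inv)
    finally show ?thesis unfolding xy using g(1) d
      restr_edge[of "g ** Pi_mat" "opr D1 (matrix_inv Pi_mat) d"] D1.opr_closed[OF stabiliser_inv[OF Pi_stabiliser] d]
      by simp
  qed
  then show ?thesis using that[OF g] space1[OF g(1)] restr_edge[OF g(1)] g by simp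
qed

lemma vertex_cases:
  assumes "x \<in> tree_vertices"
  obtains g where "g \<in> GL2" "x = vertex_act g vertex0" "cs_space V {x} = c0 g ` vecs D0"
  using assms space0 unfolding tree_vertices_eq by blast

lemma vs_fun: "vector_space (pointwise (scl D0))"
  by (rule vector_space_pointwise[OF D0.vs])

lemma space0_subspace:
  assumes "x \<in> tree_vertices"
  shows "Modules.module.subspace (pointwise (scl D0)) (cs_space V {x})"
proof -
  obtain g where g: "g \<in> GL2" "cs_space V {x} = c0 g ` vecs D0" using vertex_cases[OF assms] by metis
  show ?thesis unfolding g(2)
  proof (rule subspaceI[OF vs_fun])
    show "0 \<in> c0 g ` vecs D0" using D0.vecs_closed(1) D0.cf_zero[of g] by (metis image_eqI)
    show "x + y \<in> c0 g ` vecs D0" if "x \<in> c0 g ` vecs D0" "y \<in> c0 g ` vecs D0" for x y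
      using that by (auto simp flip: D0.cf_add intro!: imageI D0.vecs_closed)
    show "pointwise (scl D0) c x \<in> c0 g ` vecs D0" if "x \<in> c0 g ` vecs D0" for c x
      using that by (auto simp flip: D0.cf_scl intro!: imageI D0.vecs_closed)
  qed
qed

lemmas space0_closed = subspaceD[OF vs_fun space0_subspace]

lemma space0_transl:
  assumes "g \<in> GL2" "x \<in> tree_vertices" "f \<in> cs_space V {x}"
  shows "right_transl g f \<in> cs_space V {vertex_act g x}"
proof -
  obtain h where h: "h \<in> GL2" "x = vertex_act h vertex0" "cs_space V {x} = c0 h ` vecs D0"
    using vertex_cases[OF assms(2)] by metis
  then show ?thesis using assms space0[of "g ** h"] by (auto simp: D0.cf_transl vertex_act_mult)
qed

lemma chains0_simps: "scl C0 = pointwise (pointwise (scl D0))"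
  "opr C0 g \<omega> x = (if x \<in> tree_vertices then right_transl g (\<omega> (vertex_act (matrix_inv g) x)) else 0)"
  by (simp_all add: chains0_def induced_system_def)

lemma chains0_iff: "\<omega> \<in> vecs C0 \<longleftrightarrow> finite {x. \<omega> x \<noteq> 0} \<and> (\<forall>x\<in>tree_vertices. \<omega> x \<in> cs_space V {x})
      \<and> (\<forall>x. x \<notin> tree_vertices \<longrightarrow> \<omega> x = 0)"
  by (simp add: chains0_def)

lemma chains0_support: "\<omega> \<in> vecs C0 \<Longrightarrow> {x. \<omega> x \<noteq> 0} \<subseteq> tree_vertices"
  by (auto simp: chains0_iff)

lemma is_rep_chains0: "is_rep GL2 C0"
proof -
  have vs: "vector_space (scl C0)"
    unfolding chains0_simps by (intro vector_space_pointwise D0.vs)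
  have sub: "Modules.module.subspace (scl C0) (vecs C0)"
  proof (rule subspaceI[OF vs])
    show "0 \<in> vecs C0" by (auto simp: chains0_iff space0_closed)
    fix x y assume x: "x \<in> vecs C0" and y: "y \<in> vecs C0"
    have "finite {z. (x + y) z \<noteq> 0}"
      by (rule finite_subset[of _ "{z. x z \<noteq> 0} \<union> {z. y z \<noteq> 0}"]) (use x y in \<open>auto simp: chains0_iff\<close>)
    then show "x + y \<in> vecs C0" using x y by (auto simp: chains0_iff space0_closed)
  next
    fix c x assume x: "x \<in> vecs C0"
    have z: "pointwise (scl D0) c 0 = 0" by (simp add: pointwise_def fun_eq_iff D0.scl_simps)
    have "finite {z. pointwise (pointwise (scl D0)) c x z \<noteq> 0}"
      by (rule finite_subset[of _ "{z. x z \<noteq> 0}"]) (use x in \<open>auto simp: chains0_iff pointwise_def[of "pointwise _"] z\<close>)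
    then show "scl C0 c x \<in> vecs C0" using x
      by (auto simp: chains0_iff chains0_simps pointwise_def[of "pointwise _"] z space0_closed)
  qed
  have opr: "opr C0 g x \<in> vecs C0" if g: "g \<in> GL2" and x: "x \<in> vecs C0" for g x
  proof -
    have "{z. opr C0 g x z \<noteq> 0} \<subseteq> vertex_act g ` {z. x z \<noteq> 0}"
    proof
      fix z assume "z \<in> {z. opr C0 g x z \<noteq> 0}"
      then have "x (vertex_act (matrix_inv g) z) \<noteq> 0" by (auto simp: chains0_simps split: if_splits)
      moreover have "z = vertex_act g (vertex_act (matrix_inv g) z)" using g by simp
      ultimately show "z \<in> vertex_act g ` {z. x z \<noteq> 0}" by blast
    qed
    then have "finite {z. opr C0 g x z \<noteq> 0}" by (rule finite_subset) (use x in \<open>simp add: chains0_iff\<close>)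
    moreover have "opr C0 g x z \<in> cs_space V {z}" if z: "z \<in> tree_vertices" for z
    proof -
      have z': "vertex_act (matrix_inv g) z \<in> tree_vertices" using z g by (simp add: tree_vertices_act)
      then have "right_transl g (x (vertex_act (matrix_inv g) z)) \<in> cs_space V {vertex_act g (vertex_act (matrix_inv g) z)}"
        using x by (intro space0_transl g) (auto simp: chains0_iff)
      then show ?thesis using z g by (simp add: chains0_simps)
    qed
    ultimately show ?thesis by (auto simp: chains0_iff) (simp add: chains0_simps)
  qed
  have one: "opr C0 (mat 1) x = x" if "x \<in> vecs C0" for x
    using that by (auto simp: fun_eq_iff chains0_simps chains0_iff)
  have mult: "opr C0 (g ** h) x = opr C0 g (opr C0 h x)" if "g \<in> GL2" "h \<in> GL2" for g h x
  proof
    fix z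
    show "opr C0 (g ** h) x z = opr C0 g (opr C0 h x) z"
      using that by (simp add: chains0_simps tree_vertices_act right_transl_mult matrix_inv_mult vertex_act_mult)
  qed
  show ?thesis unfolding is_rep_def lin_operators_def
    using vs sub opr one mult
    by (auto simp: fun_eq_iff[of "opr C0 _ _"] chains0_simps pointwise_def[of "pointwise _"]
        vector_spaceD(6)[OF vector_space_pointwise[OF D0.vs]])
qed

sublocale C0: rep GL2 C0
  by unfold_locales (rule is_rep_chains0)

lemma restr_closed:
  assumes "y \<in> neighbours x" "f \<in> cs_space V {x, y}"
  shows "cs_restr V {x, y} {x} f \<in> cs_space V {x}"
  using assms(1)
proof (rule edge_cases)
  fix g assume g: "g \<in> GL2" "x = vertex_act g vertex0" "cs_space V {x, y} = c1 g ` vecs D1"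
    "\<And>d. d \<in> vecs D1 \<Longrightarrow> cs_restr V {x, y} {x} (c1 g d) = c0 g d"
  then show ?thesis using assms(2) sub space0[OF g(1)] by auto
qed

lemma edge_subspace:
  assumes "y \<in> neighbours x"
  shows "Modules.module.subspace (pointwise (scl D0)) (cs_space V {x, y})"
  using assms
proof (rule edge_cases)
  fix g assume g: "cs_space V {x, y} = c1 g ` vecs D1"
  show ?thesis unfolding g
  proof (rule subspaceI[OF vs_fun])
    show "0 \<in> c1 g ` vecs D1" using D1.vecs_closed(1) D1.cf_zero[of g] by (metis image_eqI)
    show "x + y \<in> c1 g ` vecs D1" if "x \<in> c1 g ` vecs D1" "y \<in> c1 g ` vecs D1" for x y
      using that by (auto simp flip: D1.cf_add intro!: imageI D1.vecs_closed)
    show "pointwise (scl D0) c x \<in> c1 g ` vecs D1" if "x \<in> c1 g ` vecs D1" for c x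
      using that unfolding scl_eq[symmetric] by (auto simp flip: D1.cf_scl intro!: imageI D1.vecs_closed)
  qed
qed

lemmas edge_closed = subspaceD[OF vs_fun edge_subspace]

lemma restr_linear:
  assumes "y \<in> neighbours x" "f \<in> cs_space V {x, y}"
  shows "f' \<in> cs_space V {x, y} \<Longrightarrow> cs_restr V {x, y} {x} (f + f') = cs_restr V {x, y} {x} f + cs_restr V {x, y} {x} f'"
    "cs_restr V {x, y} {x} (pointwise (scl D0) c f) = pointwise (scl D0) c (cs_restr V {x, y} {x} f)"
    "h \<in> GL2 \<Longrightarrow> cs_restr V {vertex_act h x, vertex_act h y} {vertex_act h x} (right_transl h f)
      = right_transl h (cs_restr V {x, y} {x} f)"
    "cs_restr V {x, y} {x} 0 = 0"
    "h \<in> GL2 \<Longrightarrow> right_transl h f \<in> cs_space V {vertex_act h x, vertex_act h y}"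
proof -
  obtain g where g: "g \<in> GL2" "x = vertex_act g vertex0" "y = vertex_act g vertex1"
    "cs_space V {x, y} = c1 g ` vecs D1"
    "\<And>d. d \<in> vecs D1 \<Longrightarrow> cs_restr V {x, y} {x} (c1 g d) = c0 g d"
    using edge_cases[OF assms(1)] by metis
  obtain d where d: "d \<in> vecs D1" "f = c1 g d" using assms(2) g by blast
  have d0: "d \<in> vecs D0" using d sub by blast
  show "cs_restr V {x, y} {x} 0 = 0"
    using g(5)[OF D1.vecs_closed(1)] by (simp add: D0.cf_zero D1.cf_zero)
  show "cs_restr V {x, y} {x} (pointwise (scl D0) c f) = pointwise (scl D0) c (cs_restr V {x, y} {x} f)"
  proof -
    have e: "pointwise (scl D0) c f = c1 g (scl D1 c d)" using D1.cf_scl[OF d(1), of g c] unfolding d(2) scl_eq by simp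
    have "cs_restr V {x, y} {x} (c1 g (scl D1 c d)) = c0 g (scl D1 c d)" using d by (intro g(5) D1.vecs_closed)
    also have "\<dots> = pointwise (scl D0) c (c0 g d)" using d0 by (simp add: D0.cf_scl scl_eq)
    finally show ?thesis using d g(5) e by simp
  qed
  show "cs_restr V {x, y} {x} (f + f') = cs_restr V {x, y} {x} f + cs_restr V {x, y} {x} f'" if f': "f' \<in> cs_space V {x, y}"
  proof -
    obtain d' where d': "d' \<in> vecs D1" "f' = c1 g d'" using f' unfolding g(4) by blast
    then have "d' \<in> vecs D0" using sub by blast
    then show ?thesis using g(5)[of "d + d'"] d d' d0 by (simp add: D1.cf_add D0.cf_add g(5) D1.vecs_closed)
  qed
  show "cs_restr V {vertex_act h x, vertex_act h y} {vertex_act h x} (right_transl h f)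
      = right_transl h (cs_restr V {x, y} {x} f)" if "h \<in> GL2"
    using that g(1) d restr_edge[of "h ** g" d] g(5)[OF d(1)]
    by (simp add: D1.cf_transl D0.cf_transl g(2,3) vertex_act_mult)
  show "right_transl h f \<in> cs_space V {vertex_act h x, vertex_act h y}" if "h \<in> GL2"
    using that g(1) d space1[of "h ** g"] by (simp add: D1.cf_transl g(2,3) vertex_act_mult)
qed

lemma chains1D:
  assumes "\<omega> \<in> chains1 V"
  shows "finite {e. \<omega> e \<noteq> 0}" "y \<in> neighbours x \<Longrightarrow> \<omega> (x, y) \<in> cs_space V {x, y}"
    "y \<in> neighbours x \<Longrightarrow> \<omega> (y, x) = - \<omega> (x, y)" "y \<notin> neighbours x \<Longrightarrow> \<omega> (x, y) = 0"
  using assms by (auto simp: chains1_def)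

lemma boundary_closed:
  assumes w: "\<omega> \<in> chains1 V"
  shows "boundary V \<omega> \<in> vecs C0" "{x. boundary V \<omega> x \<noteq> 0} \<subseteq> fst ` {e. \<omega> e \<noteq> 0}"
proof -
  note c = chains1D[OF w]
  show supp: "{x. boundary V \<omega> x \<noteq> 0} \<subseteq> fst ` {e. \<omega> e \<noteq> 0}"
  proof
    fix x assume "x \<in> {x. boundary V \<omega> x \<noteq> 0}"
    then obtain y where y: "y \<in> neighbours x" "cs_restr V {x, y} {x} (\<omega> (x, y)) \<noteq> 0"
      unfolding boundary_def by (auto elim: sum.not_neutral_contains_not_neutral)
    then have "\<omega> (x, y) \<noteq> 0" using restr_linear(4)[OF y(1) c(2)[OF y(1)]] by auto
    then show "x \<in> fst ` {e. \<omega> e \<noteq> 0}" by force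
  qed
  have "boundary V \<omega> x \<in> cs_space V {x}" if "x \<in> tree_vertices" for x
    unfolding boundary_def using c(2) that by (intro space0_closed restr_closed) auto
  moreover have "boundary V \<omega> x = 0" if "x \<notin> tree_vertices" for x
  proof -
    have "neighbours x = {}" using that neighbours_vertices by blast
    then show ?thesis by (simp add: boundary_def)
  qed
  ultimately show "boundary V \<omega> \<in> vecs C0"
    using finite_subset[OF supp] c(1) by (auto simp: chains0_iff)
qed

lemma N_subspace: "Modules.module.subspace (scl C0) N"
proof (rule subspaceI[OF C0.vs])
  have z: "pointwise (scl D0) c 0 = 0" for c by (simp add: pointwise_def fun_eq_iff D0.scl_simps)
  have zero: "0 \<in> chains1 V" by (auto simp: chains1_def edge_closed)
  have "boundary V 0 = 0"
    using boundary_closed(2)[OF zero] by (auto simp: fun_eq_iff[of "boundary V 0"])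
  then show "0 \<in> N" using zero by (metis image_eqI)
  fix x y assume "x \<in> N" "y \<in> N"
  then obtain \<omega> \<omega>' where w: "\<omega> \<in> chains1 V" "x = boundary V \<omega>" "\<omega>' \<in> chains1 V" "y = boundary V \<omega>'" by blast
  note c = chains1D[OF w(1)] and c' = chains1D[OF w(3)]
  have "finite {e. (\<omega> + \<omega>') e \<noteq> 0}"
    by (rule finite_subset[of _ "{e. \<omega> e \<noteq> 0} \<union> {e. \<omega>' e \<noteq> 0}"]) (use c(1) c'(1) in auto)
  then have "\<omega> + \<omega>' \<in> chains1 V" unfolding chains1_def using c(2-4) c'(2-4) by (auto simp: edge_closed)
  moreover have "boundary V (\<omega> + \<omega>') = x + y"
  proof
    fix v
    have "boundary V (\<omega> + \<omega>') v = (\<Sum>y\<in>neighbours v. cs_restr V {v, y} {v} (\<omega> (v, y)) + cs_restr V {v, y} {v} (\<omega>' (v, y)))"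
      unfolding boundary_def plus_fun_apply[of \<omega>] using c(2) c'(2) by (intro sum.cong refl restr_linear(1))
    then show "boundary V (\<omega> + \<omega>') v = (x + y) v" by (simp add: w boundary_def sum.distrib)
  qed
  ultimately show "x + y \<in> N" by (metis image_eqI)
next
  have z: "pointwise (scl D0) c 0 = 0" for c by (simp add: pointwise_def fun_eq_iff D0.scl_simps)
  fix a x assume "x \<in> N"
  then obtain \<omega> where w: "\<omega> \<in> chains1 V" "x = boundary V \<omega>" by blast
  note c = chains1D[OF w(1)]
  let ?w = "\<lambda>e. pointwise (scl D0) a (\<omega> e)"
  have "finite {e. ?w e \<noteq> 0}"
    using c(1) by (rule rev_finite_subset) (auto simp: z)
  moreover have "pointwise (scl D0) a (- f) = - pointwise (scl D0) a f" for f
    by (simp add: pointwise_def fun_eq_iff D0.scl_simps)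
  ultimately have "?w \<in> chains1 V" unfolding chains1_def using c(2-4) by (auto simp: edge_closed z)
  moreover have "boundary V ?w = scl C0 a x"
  proof
    fix v
    have "boundary V ?w v = (\<Sum>y\<in>neighbours v. pointwise (scl D0) a (cs_restr V {v, y} {v} (\<omega> (v, y))))"
      unfolding boundary_def using c(2) by (intro sum.cong refl restr_linear(2))
    also have "\<dots> = scl C0 a x v"
      unfolding w boundary_def chains0_simps pointwise_def[of "pointwise _"]
      by (simp add: vector_spaceD(11)[OF vs_fun])
    finally show "boundary V ?w v = scl C0 a x v" .
  qed
  ultimately show "scl C0 a x \<in> N" by (metis image_eqI)
qed

text \<open>Translating a 1-chain translates its boundary: restriction commutes with
  \<open>g\<close>, and \<open>g\<close> permutes the neighbours over which the sum runs.\<close>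

lemma N_stable:
  assumes g: "g \<in> GL2" and x: "x \<in> N"
  shows "opr C0 g x \<in> N"
proof -
  obtain \<omega> where w: "\<omega> \<in> chains1 V" "x = boundary V \<omega>" using x by blast
  note c = chains1D[OF w(1)]
  let ?i = "vertex_act (matrix_inv g)"
  define w' where "w' e = right_transl g (\<omega> (?i (fst e), ?i (snd e)))" for e
  have "{e. w' e \<noteq> 0} \<subseteq> (\<lambda>e. (vertex_act g (fst e), vertex_act g (snd e))) ` {e. \<omega> e \<noteq> 0}"
  proof
    fix e assume "e \<in> {e. w' e \<noteq> 0}"
    then have "\<omega> (?i (fst e), ?i (snd e)) \<noteq> 0" by (auto simp: w'_def)
    moreover have "e = (\<lambda>e. (vertex_act g (fst e), vertex_act g (snd e))) (?i (fst e), ?i (snd e))" using g by simp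
    ultimately show "e \<in> (\<lambda>e. (vertex_act g (fst e), vertex_act g (snd e))) ` {e. \<omega> e \<noteq> 0}" by blast
  qed
  then have fin: "finite {e. w' e \<noteq> 0}" by (rule finite_subset) (simp add: c(1))
  have nb: "?i y \<in> neighbours (?i x) \<longleftrightarrow> y \<in> neighbours x" for x y using g by (simp add: neighbours_act)
  have m: "right_transl g (- f) = - right_transl g f" for f :: "'f mat22 \<Rightarrow> 'w" by (simp add: right_transl_def fun_eq_iff)
  have sp: "w' (x, y) \<in> cs_space V {x, y}" if "y \<in> neighbours x" for x y
    using restr_linear(5)[of "?i y" "?i x" "\<omega> (?i x, ?i y)" g] that g nb c(2) by (simp add: w'_def)
  have "w' \<in> chains1 V" unfolding chains1_def using fin sp c(3,4) nb by (auto simp: w'_def m)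
  moreover have "boundary V w' = opr C0 g x"
  proof
    fix v
    show "boundary V w' v = opr C0 g x v"
    proof (cases "v \<in> tree_vertices")
      case False
      then have "neighbours v = {}" using neighbours_vertices by blast
      then show ?thesis using False by (simp add: boundary_def chains0_simps)
    next
      case True
      have "boundary V w' v = (\<Sum>y\<in>neighbours v. right_transl g (cs_restr V {?i v, ?i y} {?i v} (\<omega> (?i v, ?i y))))"
        unfolding boundary_def
      proof (intro sum.cong refl)
        fix y assume "y \<in> neighbours v"
        then show "cs_restr V {v, y} {v} (w' (v, y)) = right_transl g (cs_restr V {?i v, ?i y} {?i v} (\<omega> (?i v, ?i y)))"
          using restr_linear(3)[of "?i y" "?i v" "\<omega> (?i v, ?i y)" g] g nb c(2) by (simp add: w'_def)
      qed
      also have "\<dots> = (\<Sum>y\<in>neighbours (?i v). right_transl g (cs_restr V {?i v, y} {?i v} (\<omega> (?i v, y))))"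
        by (rule sum.reindex_bij_witness[of _ "vertex_act g" ?i]) (use g nb in \<open>auto simp: neighbours_act[of g _ "?i v", symmetric]\<close>)
      also have "\<dots> = right_transl g (boundary V \<omega> (?i v))"
        unfolding boundary_def by (simp add: right_transl_def fun_eq_iff sum_fun_apply)
      finally show ?thesis using True w by (simp add: chains0_simps)
    qed
  qed
  ultimately show ?thesis by (metis image_eqI)
qed

sublocale Q: quotient GL2 C0 N
proof
  show "N \<subseteq> vecs C0" using boundary_closed(1) by blast
qed (simp_all only: GL2_inv simp_thms N_subspace N_stable)

end

section \<open>Generators and relations of zeroth homology\<close>

context diagram
begin

text \<open>The chain concentrated at the vertex \<open>g vertex0\<close>. It is the
  \<open>g\<close>-translate of \<open>chain (mat 1) d\<close>, and such chains span
  \<open>C0\<close>.\<close>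

definition chain :: "'f mat22 \<Rightarrow> 'w \<Rightarrow> 'f vertex \<Rightarrow> 'f mat22 \<Rightarrow> 'w" where
  "chain g d = (\<lambda>x. if x = vertex_act g vertex0 then c0 g d else 0)"

lemma act_vertex0 [simp]: "g \<in> GL2 \<Longrightarrow> vertex_act g vertex0 \<in> tree_vertices"
  unfolding tree_vertices_eq by blast

lemma chain_closed:
  assumes "g \<in> GL2" "d \<in> vecs D0"
  shows "chain g d \<in> vecs C0"
proof -
  have "{x. chain g d x \<noteq> 0} \<subseteq> {vertex_act g vertex0}" by (auto simp: chain_def)
  then have "finite {x. chain g d x \<noteq> 0}" by (rule finite_subset) simp
  then show ?thesis using assms space0[of g] by (auto simp: chains0_iff chain_def space0_closed)
qed

lemma chain_add: "d \<in> vecs D0 \<Longrightarrow> d' \<in> vecs D0 \<Longrightarrow> chain g (d + d') = chain g d + chain g d'"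
  by (auto simp: chain_def fun_eq_iff[of "\<lambda>x. if _ x then _ else _"] D0.cf_add)

lemma chain_scl: "d \<in> vecs D0 \<Longrightarrow> chain g (scl D0 c d) = scl C0 c (chain g d)"
  by (auto simp: chain_def chains0_simps pointwise_def[of "pointwise _"] D0.cf_scl vector_spaceD(6)[OF vs_fun])

lemma opr_chain:
  assumes "h \<in> GL2" "g \<in> GL2"
  shows "opr C0 h (chain g d) = chain (h ** g) d"
proof
  fix x
  have "vertex_act (matrix_inv h) x = vertex_act g vertex0 \<longleftrightarrow> x = vertex_act (h ** g) vertex0"
    using assms by (metis vertex_act_inv vertex_act_mult)
  then show "opr C0 h (chain g d) x = chain (h ** g) d x"
    using assms by (auto simp: chains0_simps chain_def D0.cf_transl)
qed

lemma chain_shift: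
  assumes "k \<in> stabiliser sigma0" "d \<in> vecs D0"
  shows "chain (g ** k) d = chain g (opr D0 k d)"
  using assms by (auto simp: chain_def D0.cf_shift stabiliser_sigma0 simp flip: vertex_act_mult)

lemma chain_decompose:
  assumes w: "\<omega> \<in> vecs C0"
  shows "\<exists>gg dd. (\<forall>x\<in>{x. \<omega> x \<noteq> 0}. gg x \<in> GL2 \<and> dd x \<in> vecs D0)
    \<and> \<omega> = (\<Sum>x\<in>{x. \<omega> x \<noteq> 0}. chain (gg x) (dd x))"
proof -
  let ?S = "{x. \<omega> x \<noteq> 0}"
  have "\<forall>x\<in>?S. \<exists>g d. g \<in> GL2 \<and> d \<in> vecs D0 \<and> x = vertex_act g vertex0 \<and> \<omega> x = c0 g d"
  proof
    fix x assume "x \<in> ?S"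
    then have x: "x \<in> tree_vertices" using chains0_support[OF w] by blast
    obtain g where g: "g \<in> GL2" "x = vertex_act g vertex0" "cs_space V {x} = c0 g ` vecs D0"
      using vertex_cases[OF x] by metis
    have "\<omega> x \<in> cs_space V {x}" using w x by (auto simp: chains0_iff)
    then show "\<exists>g d. g \<in> GL2 \<and> d \<in> vecs D0 \<and> x = vertex_act g vertex0 \<and> \<omega> x = c0 g d"
      using g by blast
  qed
  then obtain gg dd where gd: "\<And>x. x \<in> ?S \<Longrightarrow> gg x \<in> GL2 \<and> dd x \<in> vecs D0 \<and> x = vertex_act (gg x) vertex0 \<and> \<omega> x = c0 (gg x) (dd x)"
    by metis
  have fin: "finite ?S" using w by (simp add: chains0_iff)
  have "\<omega> z = (\<Sum>x\<in>?S. chain (gg x) (dd x)) z" for z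
  proof -
    have "(\<Sum>x\<in>?S. chain (gg x) (dd x)) z = (\<Sum>x\<in>?S. chain (gg x) (dd x) z)"
      by (rule sum_fun_apply)
    also have "\<dots> = (\<Sum>x\<in>?S. if x = z then \<omega> x else 0)"
    proof (intro sum.cong refl)
      fix x assume "x \<in> ?S"
      then have "vertex_act (gg x) vertex0 = x" "c0 (gg x) (dd x) = \<omega> x" using gd[of x] by simp_all
      then show "chain (gg x) (dd x) z = (if x = z then \<omega> x else 0)" by (auto simp: chain_def)
    qed
    also have "\<dots> = \<omega> z" by (subst sum.delta[OF fin]) auto
    finally show ?thesis by simp
  qed
  then have "\<omega> = (\<Sum>x\<in>?S. chain (gg x) (dd x))" by (rule ext)
  moreover have "\<forall>x\<in>?S. gg x \<in> GL2 \<and> dd x \<in> vecs D0" using gd by blast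
  ultimately show ?thesis by (intro exI[of _ gg] exI[of _ dd]) (rule conjI)
qed

text \<open>This is the boundary of the standard edge, with the second end written as
  \<open>Pi_mat vertex0\<close>. In the quotient it turns the inclusion of \<open>D1\<close> into
  compatibility with \<open>Pi_mat\<close>.\<close>

lemma edge_relation:
  assumes d: "d \<in> vecs D1"
  shows "chain (mat 1) d - chain Pi_mat (opr D1 (matrix_inv Pi_mat) d) \<in> N"
proof -
  let ?f = "c1 (mat 1) d"
  define w where "w e = (if e = (vertex0, vertex1) then ?f else if e = (vertex1, vertex0) then - ?f else 0)"
    for e :: "'f vertex \<times> 'f vertex"
  have nb: "vertex1 \<in> neighbours (vertex0 :: 'f vertex)" "vertex0 \<in> neighbours (vertex1 :: 'f vertex)"
    using neighbours_iff[of vertex1 vertex0] neighbours_sym by (metis GL2_one vertex_act_one)+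
  have ne: "vertex0 \<noteq> (vertex1 :: 'f vertex)" by (rule vertex0_neq_vertex1)
  have sp: "cs_space V {vertex0, vertex1} = c1 (mat 1) ` vecs D1" using space1[of "mat 1"] by simp
  have f: "?f \<in> cs_space V {vertex0, vertex1}" "- ?f \<in> cs_space V {vertex1, vertex0}"
    using d sp edge_closed(4)[OF nb(1)] by (auto simp: insert_commute)
  have "finite {e. w e \<noteq> 0}"
    by (rule finite_subset[of _ "{(vertex0, vertex1), (vertex1, vertex0)}"]) (auto simp: w_def)
  then have "w \<in> chains1 V"
    unfolding chains1_def using nb f ne by (auto simp: w_def edge_closed)
  moreover have "boundary V w = chain (mat 1) d - chain Pi_mat (opr D1 (matrix_inv Pi_mat) d)"
  proof
    fix v
    have z: "cs_restr V {v, y} {v} 0 = 0" if "y \<in> neighbours v" for y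
      using restr_linear(4)[OF that edge_closed(1)[OF that]] .
    show "boundary V w v = (chain (mat 1) d - chain Pi_mat (opr D1 (matrix_inv Pi_mat) d)) v"
    proof (cases "v = vertex0 \<or> v = vertex1")
      case False
      then have "w (v, y) = 0" for y by (auto simp: w_def)
      then show ?thesis using False z by (simp add: boundary_def chain_def vertex1_Pi[symmetric])
    next
      case True
      define u where "u = (if v = vertex0 then vertex1 else (vertex0 :: 'f vertex))"
      have u: "u \<in> neighbours v" using True nb by (auto simp: u_def)
      have "boundary V w v = (\<Sum>y\<in>neighbours v. if y = u then cs_restr V {v, u} {v} (w (v, u)) else 0)"
        unfolding boundary_def by (intro sum.cong refl) (use True ne z in \<open>auto simp: w_def u_def\<close>)
      also have "\<dots> = cs_restr V {v, u} {v} (w (v, u))" using u by (subst sum.delta[OF finite_neighbours]) simp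
      also have "\<dots> = (chain (mat 1) d - chain Pi_mat (opr D1 (matrix_inv Pi_mat) d)) v"
      proof (cases "v = vertex0")
        case v: True
        then show ?thesis using d ne restr_edge[of "mat 1" d] by (simp add: w_def u_def chain_def vertex1_Pi[symmetric])
      next
        case v: False
        have Pi: "(matrix_inv Pi_mat :: 'f mat22) \<in> stabiliser sigma1" using Pi_stabiliser by (rule stabiliser_inv)
        \<comment> \<open>Restriction to \<open>vertex1\<close> is computed by seeing the edge from
          its other end, as the \<open>Pi_mat\<close>-translate of the standard edge.\<close>
        have "- ?f = c1 (mat 1) (- d)" using d by (simp add: D1.cf_minus)
        also have "\<dots> = c1 (Pi_mat ** matrix_inv Pi_mat) (- d)" by simp
        also have "\<dots> = c1 Pi_mat (opr D1 (matrix_inv Pi_mat) (- d))"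
          using Pi d by (intro D1.cf_shift) (auto intro: D1.vecs_closed)
        also have "\<dots> = c1 Pi_mat (- opr D1 (matrix_inv Pi_mat) d)"
          using Pi d by (simp add: D1.opr_minus)
        finally have "cs_restr V {v, u} {v} (w (v, u)) = c0 Pi_mat (- opr D1 (matrix_inv Pi_mat) d)"
          using v True ne restr_edge[of Pi_mat "- opr D1 (matrix_inv Pi_mat) d"] Pi d
          by (auto simp: w_def u_def vertex1_Pi[symmetric] vertex0_Pi D1.vecs_closed D1.opr_closed)
        then show ?thesis using v True Pi d sub D1.opr_closed[OF Pi d]
          by (auto simp: chain_def vertex1_Pi[symmetric] D0.cf_minus)
      qed
      finally show ?thesis .
    qed
  qed
  ultimately show ?thesis by (metis image_eqI)
qed

end

section \<open>Maps out of zeroth homology\<close>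

locale diagram_hom = diagram D0 D1 + P: rep GL2 \<pi>
  for D0 D1 :: "('f::nonarch_local_field mat22, 'c::field, 'w::ab_group_add) repr"
    and \<pi> :: "('f mat22, 'c, 'v::ab_group_add) repr"
begin

text \<open>Restriction of \<open>f\<close> to the fibre at \<open>vertex0\<close>: Frobenius
  reciprocity, the 0-chains being a compact induction of \<open>D0\<close>.\<close>

definition frob :: "(('f vertex \<Rightarrow> 'f mat22 \<Rightarrow> 'w) set \<Rightarrow> 'v) \<Rightarrow> 'w \<Rightarrow> 'v" where
  "frob f d = (if d \<in> vecs D0 then f (chain (mat 1) d +o N) else 0)"

lemma frob_Hom:
  assumes f: "f \<in> Hom GL2 (homology0 V) \<pi>"
  shows "frob f \<in> Hom (stabiliser sigma0) D0 \<pi>"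
    and "\<And>d. d \<in> vecs D1 \<Longrightarrow> frob f (opr D1 (matrix_inv Pi_mat) d) = opr \<pi> (matrix_inv Pi_mat) (frob f d)"
proof -
  define F where "F = (\<lambda>x. if x \<in> vecs C0 then f (x +o N) else 0)"
  have F: "F \<in> Hom GL2 C0 \<pi>" "\<And>x. x \<in> N \<Longrightarrow> F x = 0"
    unfolding F_def using Q.Hom_quotient_lift f unfolding homology0_def by blast+
  note h = HomD[OF F(1)]
  have fr: "frob f d = F (chain (mat 1) d)" if "d \<in> vecs D0" for d
    using that by (simp add: frob_def F_def chain_closed)
  show "frob f \<in> Hom (stabiliser sigma0) D0 \<pi>"
  proof (rule HomI)
    fix k :: "'f mat22" and d assume k: "k \<in> stabiliser sigma0" and d: "d \<in> vecs D0"
    have "chain (mat 1) (opr D0 k d) = chain (mat 1 ** k) d" using k d by (simp only: chain_shift)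
    also have "\<dots> = opr C0 k (chain (mat 1) d)" using stabiliser_GL2[OF k] by (simp add: opr_chain)
    finally show "frob f (opr D0 k d) = opr \<pi> k (frob f d)"
      using k d stabiliser_GL2[OF k] by (simp add: fr D0.opr_closed h(4) chain_closed)
  next
    show "frob f d = 0" if "d \<notin> vecs D0" for d using that by (simp add: frob_def)
  qed (auto simp: fr h chain_closed chain_add chain_scl D0.vecs_closed)
  fix d assume d: "d \<in> vecs D1"
  have d0: "d \<in> vecs D0" using d sub by blast
  let ?d = "opr D1 (matrix_inv Pi_mat) d"
  have d': "?d \<in> vecs D0" using D1.opr_closed[OF stabiliser_inv[OF Pi_stabiliser] d] sub by blast
  have "F (chain (mat 1) d - chain Pi_mat ?d) = 0" using edge_relation[OF d] by (rule F(2))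
  then have "frob f d = F (chain Pi_mat ?d)"
    using Hom_linear(3)[OF F(1) C0.vs is_rep_subspace[OF is_rep_chains0]] d0 d' by (simp add: fr chain_closed)
  also have "\<dots> = opr \<pi> Pi_mat (frob f ?d)"
    using h(4)[of Pi_mat "chain (mat 1) ?d"] d' by (simp add: opr_chain chain_closed fr)
  finally show "frob f ?d = opr \<pi> (matrix_inv Pi_mat) (frob f d)"
    using d' by (simp add: P.opr_inv fr h(1) chain_closed)
qed

text \<open>The translates of the chains at \<open>vertex0\<close> span all 0-chains, so the fibre
  there determines the map.\<close>

lemma frob_inj:
  assumes f: "f \<in> Hom GL2 (homology0 V) \<pi>" and f': "f' \<in> Hom GL2 (homology0 V) \<pi>"
    and eq: "\<And>d. d \<in> vecs D0 \<Longrightarrow> frob f d = frob f' d"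
  shows "f = f'"
proof
  fix Y
  have *: "f (\<omega> +o N) = (\<Sum>x\<in>{x. \<omega> x \<noteq> 0}. opr \<pi> (gg x) (frob f (dd x)))"
    if f: "f \<in> Hom GL2 (homology0 V) \<pi>"
      and w: "\<forall>x\<in>{x. \<omega> x \<noteq> 0}. gg x \<in> GL2 \<and> dd x \<in> vecs D0"
      "\<omega> = (\<Sum>x\<in>{x. \<omega> x \<noteq> 0}. chain (gg x) (dd x))" "\<omega> \<in> vecs C0" for f \<omega> gg dd
  proof -
    define F where "F = (\<lambda>x. if x \<in> vecs C0 then f (x +o N) else 0)"
    have F: "F \<in> Hom GL2 C0 \<pi>"
      unfolding F_def using Q.Hom_quotient_lift f unfolding homology0_def by blast
    have "f (\<omega> +o N) = F \<omega>" using w(3) by (simp add: F_def)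
    also have "\<dots> = (\<Sum>x\<in>{x. \<omega> x \<noteq> 0}. F (chain (gg x) (dd x)))"
      by (subst w(2)) (rule Hom_linear(4)[OF F C0.vs is_rep_subspace[OF is_rep_chains0]], use w(1) in \<open>simp add: chain_closed\<close>)
    also have "\<dots> = (\<Sum>x\<in>{x. \<omega> x \<noteq> 0}. opr \<pi> (gg x) (frob f (dd x)))"
    proof (intro sum.cong refl)
      fix x assume "x \<in> {x. \<omega> x \<noteq> 0}"
      then have x: "gg x \<in> GL2" "dd x \<in> vecs D0" using w(1) by auto
      then show "F (chain (gg x) (dd x)) = opr \<pi> (gg x) (frob f (dd x))"
        using HomD(4)[OF F, of "gg x" "chain (mat 1) (dd x)"]
        by (simp add: opr_chain chain_closed) (simp add: F_def frob_def chain_closed)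
    qed
    finally show ?thesis .
  qed
  show "f Y = f' Y"
  proof (cases "Y \<in> vecs (homology0 V)")
    case True
    then obtain \<omega> where w: "\<omega> \<in> vecs C0" "Y = \<omega> +o N"
      unfolding homology0_def Q.vecs_quotient by blast
    obtain gg dd where gd: "\<forall>x\<in>{x. \<omega> x \<noteq> 0}. gg x \<in> GL2 \<and> dd x \<in> vecs D0"
      "\<omega> = (\<Sum>x\<in>{x. \<omega> x \<noteq> 0}. chain (gg x) (dd x))" using chain_decompose[OF w(1)] by blast
    show ?thesis unfolding w(2) *[OF f gd w(1)] *[OF f' gd w(1)]
      by (intro sum.cong refl) (use gd(1) eq in auto)
  qed (use HomD(5)[OF f] HomD(5)[OF f'] in simp)
qed

text \<open>Transports \<open>\<phi>\<close> to the fibre at an arbitrary vertex \<open>x\<close>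
  through some \<open>g\<close> carrying \<open>vertex0\<close> to \<open>x\<close>; equivariance of
  \<open>\<phi>\<close> under the stabiliser makes the choice immaterial.\<close>

definition locval :: "('w \<Rightarrow> 'v) \<Rightarrow> 'f vertex \<Rightarrow> ('f mat22 \<Rightarrow> 'w) \<Rightarrow> 'v" where
  "locval \<phi> x f = (let g = SOME g. g \<in> GL2 \<and> vertex_act g vertex0 = x in opr \<pi> g (\<phi> (f (matrix_inv g))))"

context
  fixes \<phi> assumes \<phi>: "\<phi> \<in> Hom (stabiliser sigma0) D0 \<pi>"
begin

lemma locval:
  assumes g: "g \<in> GL2" and d: "d \<in> vecs D0"
  shows "locval \<phi> (vertex_act g vertex0) (c0 g d) = opr \<pi> g (\<phi> d)"
proof -
  define h where "h = (SOME h :: 'f mat22. h \<in> GL2 \<and> vertex_act h vertex0 = vertex_act g vertex0)"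
  have h: "h \<in> GL2" "vertex_act h vertex0 = vertex_act g vertex0"
    unfolding h_def using someI[of "\<lambda>h. h \<in> GL2 \<and> vertex_act h vertex0 = vertex_act g vertex0" g] g by auto
  have k: "matrix_inv h ** g \<in> stabiliser sigma0"
    using h g by (simp add: stabiliser_sigma0 flip: vertex_act_mult) (metis h(2) vertex_act_inv(1))
  have "locval \<phi> (vertex_act g vertex0) (c0 g d) = opr \<pi> h (\<phi> (opr D0 (matrix_inv h ** g) d))"
    unfolding locval_def h_def[symmetric] Let_def using h k by (simp add: coset_fun_def)
  also have "\<dots> = opr \<pi> h (opr \<pi> (matrix_inv h ** g) (\<phi> d))" using HomD(4)[OF \<phi> k d] by simp
  also have "\<dots> = opr \<pi> g (\<phi> d)"
    using h g k d HomD(1)[OF \<phi> d] by (simp flip: P.opr_mult add: matrix_mul_assoc)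
  finally show ?thesis .
qed

lemma locval_space:
  assumes x: "x \<in> tree_vertices" and f: "f \<in> cs_space V {x}"
  shows "locval \<phi> x f \<in> vecs \<pi>" "f' \<in> cs_space V {x} \<Longrightarrow> locval \<phi> x (f + f') = locval \<phi> x f + locval \<phi> x f'"
    "locval \<phi> x (pointwise (scl D0) c f) = scl \<pi> c (locval \<phi> x f)"
    "h \<in> GL2 \<Longrightarrow> locval \<phi> (vertex_act h x) (right_transl h f) = opr \<pi> h (locval \<phi> x f)"
proof -
  obtain g where g: "g \<in> GL2" "x = vertex_act g vertex0" "cs_space V {x} = c0 g ` vecs D0"
    using vertex_cases[OF x] by metis
  obtain d where d: "d \<in> vecs D0" "f = c0 g d" using f g(3) by blast
  note l = locval[OF g(1)] and p = HomD[OF \<phi>]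
  show "locval \<phi> x f \<in> vecs \<pi>" unfolding g(2) d(2) l[OF d(1)] using g(1) p(1)[OF d(1)] by (rule P.opr_closed)
  show "locval \<phi> x (f + f') = locval \<phi> x f + locval \<phi> x f'" if f': "f' \<in> cs_space V {x}"
  proof -
    obtain d' where d': "d' \<in> vecs D0" "f' = c0 g d'" using f' unfolding g(3) by blast
    then show ?thesis using d g by (simp add: l D0.cf_add[symmetric] D0.vecs_closed p P.opr_add)
  qed
  show "locval \<phi> x (pointwise (scl D0) c f) = scl \<pi> c (locval \<phi> x f)"
    using d g by (simp add: l D0.cf_scl[symmetric] D0.vecs_closed p P.opr_scl)
  show "locval \<phi> (vertex_act h x) (right_transl h f) = opr \<pi> h (locval \<phi> x f)" if "h \<in> GL2"
    using d g that locval[of "h ** g" d] by (simp add: l D0.cf_transl vertex_act_mult P.opr_mult p)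
qed

lemma locval_zero: "x \<in> tree_vertices \<Longrightarrow> locval \<phi> x 0 = 0"
  using locval_space(2)[of x 0 0] space0_closed(1)[of x] by simp

lemma locval_sum:
  assumes x: "x \<in> tree_vertices" and "\<And>i. i \<in> I \<Longrightarrow> f i \<in> cs_space V {x}"
  shows "locval \<phi> x (sum f I) = (\<Sum>i\<in>I. locval \<phi> x (f i))"
  using assms(2)
proof (induction I rule: infinite_finite_induct)
  case (insert i I)
  have "sum f (insert i I) = f i + sum f I" using insert by (intro sum.insert)
  moreover have "locval \<phi> x (f i + sum f I) = locval \<phi> x (f i) + locval \<phi> x (sum f I)"
    using insert by (intro locval_space(2) space0_closed(6) x) auto
  ultimately show ?case using insert by (simp only: sum.insert) simp
qed (use locval_zero[OF x] in auto)

definition extend :: "('f vertex \<Rightarrow> 'f mat22 \<Rightarrow> 'w) \<Rightarrow> 'v" where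
  "extend \<omega> = (if \<omega> \<in> vecs C0 then \<Sum>x | \<omega> x \<noteq> 0. locval \<phi> x (\<omega> x) else 0)"

lemma extend_eq:
  assumes "\<omega> \<in> vecs C0" "finite S" "{x. \<omega> x \<noteq> 0} \<subseteq> S" "S \<subseteq> tree_vertices"
  shows "extend \<omega> = (\<Sum>x\<in>S. locval \<phi> x (\<omega> x))"
  unfolding extend_def using assms
  by (auto intro!: sum.mono_neutral_left locval_zero)

lemma extend_chain:
  assumes "g \<in> GL2" "d \<in> vecs D0"
  shows "extend (chain g d) = opr \<pi> g (\<phi> d)"
proof -
  have "extend (chain g d) = (\<Sum>x\<in>{vertex_act g vertex0}. locval \<phi> x (chain g d x))"
    using assms by (intro extend_eq chain_closed) (auto simp: chain_def)
  then show ?thesis using assms by (simp add: chain_def locval)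
qed

lemma extend_Hom: "extend \<in> Hom GL2 C0 \<pi>"
proof (rule HomI)
  fix \<omega> assume w: "\<omega> \<in> vecs C0"
  have fin: "finite {x. \<omega> x \<noteq> 0}" using w by (simp add: chains0_iff)
  have sp: "\<omega> x \<in> cs_space V {x}" if "x \<in> tree_vertices" for x using w that by (simp add: chains0_iff)
  note supp = chains0_support[OF w]
  show "extend \<omega> \<in> vecs \<pi>"
    unfolding extend_def using w supp sp by (auto intro!: P.vecs_closed locval_space)
  show "extend (\<omega> + \<omega>') = extend \<omega> + extend \<omega>'" if w': "\<omega>' \<in> vecs C0" for \<omega>'
  proof -
    let ?S = "{x. \<omega> x \<noteq> 0} \<union> {x. \<omega>' x \<noteq> 0}"
    have fin': "finite {x. \<omega>' x \<noteq> 0}" using w' by (simp add: chains0_iff)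
    have sp': "\<omega>' x \<in> cs_space V {x}" if "x \<in> tree_vertices" for x using w' that by (simp add: chains0_iff)
    have S: "finite ?S" "?S \<subseteq> tree_vertices" using fin fin' supp chains0_support[OF w'] by auto
    have "extend (\<omega> + \<omega>') = (\<Sum>x\<in>?S. locval \<phi> x ((\<omega> + \<omega>') x))"
      by (rule extend_eq[OF C0.vecs_closed(2)[OF w w'] S(1) _ S(2)]) auto
    also have "\<dots> = (\<Sum>x\<in>?S. locval \<phi> x (\<omega> x) + locval \<phi> x (\<omega>' x))"
      unfolding plus_fun_apply[of \<omega>] using S(2) by (intro sum.cong refl locval_space(2) sp sp') auto
    also have "\<dots> = extend \<omega> + extend \<omega>'"
      using extend_eq[of \<omega> ?S] extend_eq[of \<omega>' ?S] w w' S by (simp add: sum.distrib)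
    finally show ?thesis .
  qed
  show "extend (scl C0 c \<omega>) = scl \<pi> c (extend \<omega>)" for c
  proof -
    have "extend (scl C0 c \<omega>) = (\<Sum>x\<in>{x. \<omega> x \<noteq> 0}. locval \<phi> x (scl C0 c \<omega> x))"
      using w fin supp C0.vecs_closed(3)[OF w]
      by (intro extend_eq) (auto simp: chains0_simps pointwise_def[of "pointwise _"] vector_spaceD(6)[OF vs_fun])
    also have "\<dots> = (\<Sum>x\<in>{x. \<omega> x \<noteq> 0}. scl \<pi> c (locval \<phi> x (\<omega> x)))"
      unfolding chains0_simps pointwise_def[of "pointwise _"]
      using supp by (intro sum.cong refl locval_space(3) sp) auto
    finally show ?thesis using w by (simp add: extend_def P.scl_simps)
  qed
  show "extend (opr C0 g \<omega>) = opr \<pi> g (extend \<omega>)" if g: "g \<in> GL2" for g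
  proof -
    let ?S = "{x. \<omega> x \<noteq> 0}"
    have "extend (opr C0 g \<omega>) = (\<Sum>x\<in>vertex_act g ` ?S. locval \<phi> x (opr C0 g \<omega> x))"
    proof (rule extend_eq)
      show "opr C0 g \<omega> \<in> vecs C0" using g w by (rule C0.opr_closed)
      show "{x. opr C0 g \<omega> x \<noteq> 0} \<subseteq> vertex_act g ` ?S"
      proof
        fix x assume "x \<in> {x. opr C0 g \<omega> x \<noteq> 0}"
        then have "\<omega> (vertex_act (matrix_inv g) x) \<noteq> 0" by (auto simp: chains0_simps split: if_splits)
        moreover have "x = vertex_act g (vertex_act (matrix_inv g) x)" using g by simp
        ultimately show "x \<in> vertex_act g ` ?S" by blast
      qed
      show "vertex_act g ` ?S \<subseteq> tree_vertices" using supp g by (auto simp: tree_vertices_act)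
    qed (use fin in simp)
    also have "\<dots> = (\<Sum>x\<in>?S. locval \<phi> (vertex_act g x) (opr C0 g \<omega> (vertex_act g x)))"
      by (subst sum.reindex) (use g in \<open>auto intro: inj_on_inverseI[of _ "vertex_act (matrix_inv g)"]\<close>)
    also have "\<dots> = (\<Sum>x\<in>?S. opr \<pi> g (locval \<phi> x (\<omega> x)))"
      using supp g sp by (intro sum.cong refl) (auto simp: chains0_simps tree_vertices_act locval_space(4))
    also have "\<dots> = opr \<pi> g (extend \<omega>)"
      using w supp sp by (subst P.opr_sum[OF g, symmetric]) (auto simp: extend_def intro!: locval_space)
    finally show ?thesis .
  qed
qed (simp add: extend_def)

text \<open>Compatibility with \<open>Pi_mat\<close> on \<open>D1\<close> makes the contributions of
  an oriented edge and of its reverse opposite, so the sum over the support of the 1-chain cancels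
  in pairs.\<close>

lemma extend_boundary:
  assumes Pi: "\<And>d. d \<in> vecs D1 \<Longrightarrow> \<phi> (opr D1 (matrix_inv Pi_mat) d) = opr \<pi> (matrix_inv Pi_mat) (\<phi> d)"
    and B: "B \<in> N"
  shows "extend B = 0"
proof -
  obtain \<omega> where w: "\<omega> \<in> chains1 V" "B = boundary V \<omega>" using B by blast
  note c = chains1D[OF w(1)]
  let ?P = "{e. \<omega> e \<noteq> 0}"
  \<comment> \<open>The contribution of one oriented edge to \<open>extend B\<close>, located at its
    first vertex.\<close>
  define E where "E e = locval \<phi> (fst e) (cs_restr V {fst e, snd e} {fst e} (\<omega> e))" for e
  have nb: "y \<in> neighbours x" if "(x, y) \<in> ?P" for x y using that c(4) by auto
  have supp: "fst ` ?P \<subseteq> tree_vertices" using nb neighbours_vertices by force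
  have "extend B = (\<Sum>x\<in>fst ` ?P. locval \<phi> x (B x))"
    using boundary_closed[OF w(1)] c(1) supp unfolding w(2) by (intro extend_eq) auto
  also have "\<dots> = (\<Sum>x\<in>fst ` ?P. \<Sum>y\<in>neighbours x. E (x, y))"
    unfolding w(2) boundary_def E_def fst_conv snd_conv
    using supp c(2) by (intro sum.cong refl locval_sum restr_closed) auto
  also have "\<dots> = sum E (Sigma (fst ` ?P) neighbours)"
    using c(1) finite_neighbours by (subst sum.Sigma) auto
  also have "\<dots> = sum E ?P"
  proof (rule sum.mono_neutral_right)
    show "finite (Sigma (fst ` ?P) neighbours)" using c(1) finite_neighbours by auto
    show "?P \<subseteq> Sigma (fst ` ?P) neighbours" using nb by force
    show "\<forall>e\<in>Sigma (fst ` ?P) neighbours - ?P. E e = 0"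
    proof
      fix e assume e: "e \<in> Sigma (fst ` ?P) neighbours - ?P"
      then obtain x y where xy: "e = (x, y)" "y \<in> neighbours x" "\<omega> e = 0" by auto
      then show "E e = 0" using restr_linear(4)[OF xy(2) c(2)[OF xy(2)]] neighbours_vertices[OF xy(2)]
        by (simp add: E_def locval_zero)
    qed
  qed
  also have "\<dots> = 0"
  proof (rule sum_antisymmetric[OF c(1)])
    fix x y assume xy: "(x, y) \<in> ?P"
    note n = nb[OF xy]
    obtain g where g: "g \<in> GL2" "x = vertex_act g vertex0" "y = vertex_act g vertex1"
      "cs_space V {x, y} = c1 g ` vecs D1"
      "\<And>d. d \<in> vecs D1 \<Longrightarrow> cs_restr V {x, y} {x} (c1 g d) = c0 g d"
      "\<And>d. d \<in> vecs D1 \<Longrightarrow> cs_restr V {y, x} {y} (c1 g d) = c0 (g ** Pi_mat) (opr D1 (matrix_inv Pi_mat) d)"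
      using edge_cases[OF n] by metis
    obtain d where d: "d \<in> vecs D1" "\<omega> (x, y) = c1 g d" using c(2)[OF n] g(4) by blast
    have d0: "d \<in> vecs D0" using d sub by blast
    let ?d = "opr D1 (matrix_inv Pi_mat) (- d)"
    have md: "- d \<in> vecs D1" using d by (simp add: D1.vecs_closed)
    have d': "?d \<in> vecs D0" using D1.opr_closed[OF stabiliser_inv[OF Pi_stabiliser] md] sub by blast
    have 1: "E (x, y) = opr \<pi> g (\<phi> d)" using d g d0 by (simp add: E_def locval)
    have yx: "\<omega> (y, x) = c1 g (- d)" using c(3)[OF n] d by (simp add: D1.cf_minus)
    have "y = vertex_act (g ** Pi_mat) vertex0" using g by (simp add: vertex1_Pi vertex_act_mult)
    then have "E (y, x) = opr \<pi> (g ** Pi_mat) (\<phi> ?d)"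
      unfolding E_def fst_conv snd_conv yx g(6)[OF md] using d' g(1) by (simp add: locval)
    also have "\<dots> = opr \<pi> g (opr \<pi> Pi_mat (opr \<pi> (matrix_inv Pi_mat) (\<phi> (- d))))"
      using Pi[OF md] g(1) HomD(1)[OF \<phi> d'] by (simp add: P.opr_mult)
    also have "\<dots> = opr \<pi> g (\<phi> (- d))"
      using HomD(1)[OF \<phi>, of "- d"] d0 by (simp add: P.opr_inv D0.vecs_closed)
    also have "\<dots> = - E (x, y)" unfolding 1 using d0 g(1) HomD(1)[OF \<phi> d0]
      by (simp add: Hom_linear(2)[OF \<phi> D0.vs is_rep_subspace[OF D0]] P.opr_minus)
    finally show "(y, x) \<in> ?P \<and> x \<noteq> y \<and> E (x, y) + E (y, x) = 0"
      using xy c(3)[OF n] neighbours_irrefl[OF n] by auto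
  qed
  finally show ?thesis .
qed

end

lemma frob_surj:
  assumes \<phi>: "\<phi> \<in> Hom (stabiliser sigma0) D0 \<pi>"
    and Pi: "\<And>d. d \<in> vecs D1 \<Longrightarrow> \<phi> (opr D1 (matrix_inv Pi_mat) d) = opr \<pi> (matrix_inv Pi_mat) (\<phi> d)"
  obtains f where "f \<in> Hom GL2 (homology0 V) \<pi>" "\<And>d. d \<in> vecs D0 \<Longrightarrow> frob f d = \<phi> d"
proof -
  obtain f where f: "f \<in> Hom GL2 (homology0 V) \<pi>" "\<And>x. x \<in> vecs C0 \<Longrightarrow> f (x +o N) = extend \<phi> x"
    using Q.Hom_quotient_factor[OF extend_Hom[OF \<phi>] extend_boundary[OF \<phi> Pi]] unfolding homology0_def by blast
  have "frob f d = \<phi> d" if "d \<in> vecs D0" for d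
    using that f(2)[of "chain (mat 1) d"] HomD(1)[OF \<phi> that]
    by (simp add: frob_def chain_closed extend_chain[OF \<phi>] P.opr_one)
  then show ?thesis using f(1) that by blast
qed

end

section \<open>Frobenius reciprocity for the universal module\<close>

lemma univ_iff: "f \<in> vecs univ_rep \<longleftrightarrow> (\<forall>x. x \<notin> GL2 \<longrightarrow> f x = 0)
    \<and> (\<forall>k\<in>pro_p_iwahori. \<forall>x\<in>GL2. f (k ** x) = f x)
    \<and> (\<exists>n. \<forall>u\<in>congruence_sub n. right_transl u f = f)
    \<and> (\<exists>S. finite S \<and> {x. f x \<noteq> 0} \<subseteq> (\<Union>g\<in>S. (\<lambda>h. h ** g) ` pro_p_iwahori))"
  by (simp add: univ_rep_def c_Ind_def trivial_rep_def)

lemma univ_simps: "scl univ_rep = pointwise (*)" "opr univ_rep = right_transl"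
  by (simp_all add: univ_rep_def c_Ind_def trivial_rep_def)

lemma vs_times: "vector_space ((*) :: 'c::field \<Rightarrow> 'c \<Rightarrow> 'c)"
  by unfold_locales (auto simp: algebra_simps)

lemma is_rep_univ: "is_rep GL2 (univ_rep :: ('f::nonarch_local_field mat22, 'c::field, 'f mat22 \<Rightarrow> 'c) repr)"
proof -
  let ?V = "univ_rep :: ('f mat22, 'c, 'f mat22 \<Rightarrow> 'c) repr"
  have vs: "vector_space (scl ?V)" unfolding univ_simps by (intro vector_space_pointwise vs_times)
  have "Modules.module.subspace (scl ?V) (vecs ?V)"
  proof (rule subspaceI[OF vs])
    show "0 \<in> vecs ?V" by (auto simp: univ_iff intro: exI[of _ "{}"])
    fix f f' assume f: "f \<in> vecs ?V" and f': "f' \<in> vecs ?V"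
    obtain n S where n: "\<forall>u\<in>congruence_sub n. right_transl u f = f"
      and S: "finite S" "{x. f x \<noteq> 0} \<subseteq> (\<Union>g\<in>S. (\<lambda>h. h ** g) ` pro_p_iwahori)"
      using f unfolding univ_iff by blast
    obtain n' S' where n': "\<forall>u\<in>congruence_sub n'. right_transl u f' = f'"
      and S': "finite S'" "{x. f' x \<noteq> 0} \<subseteq> (\<Union>g\<in>S'. (\<lambda>h. h ** g) ` pro_p_iwahori)"
      using f' unfolding univ_iff by blast
    have "\<forall>u\<in>congruence_sub (max n n'). right_transl u (f + f') = f + f'"
    proof
      fix u :: "'f mat22" assume "u \<in> congruence_sub (max n n')"
      then have "u \<in> congruence_sub n" "u \<in> congruence_sub n'"
        using congruence_mono[of n "max n n'"] congruence_mono[of n' "max n n'"] by auto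
      then show "right_transl u (f + f') = f + f'" using n n' by simp
    qed
    moreover have "{x. (f + f') x \<noteq> 0} \<subseteq> (\<Union>g\<in>S \<union> S'. (\<lambda>h. h ** g) ` pro_p_iwahori)"
    proof
      fix x assume "x \<in> {x. (f + f') x \<noteq> 0}"
      then have "x \<in> {x. f x \<noteq> 0} \<or> x \<in> {x. f' x \<noteq> 0}" by auto
      then show "x \<in> (\<Union>g\<in>S \<union> S'. (\<lambda>h. h ** g) ` pro_p_iwahori)" using S(2) S'(2) by blast
    qed
    moreover have "\<forall>x. x \<notin> GL2 \<longrightarrow> (f + f') x = 0" "\<forall>k\<in>pro_p_iwahori. \<forall>x\<in>GL2. (f + f') (k ** x) = (f + f') x"
      using f f' by (simp_all add: univ_iff)
    ultimately show "f + f' \<in> vecs ?V" unfolding univ_iff using S(1) S'(1)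
      by (intro conjI) (blast, blast, blast, blast intro: finite_UnI)
  next
    fix c f assume f: "f \<in> vecs ?V"
    obtain n S where n: "\<forall>u\<in>congruence_sub n. right_transl u f = f"
      and S: "finite S" "{x. f x \<noteq> 0} \<subseteq> (\<Union>g\<in>S. (\<lambda>h. h ** g) ` pro_p_iwahori)"
      using f unfolding univ_iff by blast
    have "{x. pointwise (*) c f x \<noteq> 0} \<subseteq> {x. f x \<noteq> 0}" by (auto simp: pointwise_def)
    then have "{x. pointwise (*) c f x \<noteq> 0} \<subseteq> (\<Union>g\<in>S. (\<lambda>h. h ** g) ` pro_p_iwahori)" using S(2) by blast
    moreover have "\<forall>x. x \<notin> GL2 \<longrightarrow> pointwise (*) c f x = 0"
      "\<forall>k\<in>pro_p_iwahori. \<forall>x\<in>GL2. pointwise (*) c f (k ** x) = pointwise (*) c f x"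
      using f by (simp_all add: univ_iff pointwise_def)
    ultimately show "scl ?V c f \<in> vecs ?V" unfolding univ_iff univ_simps using S(1) n
      by (intro conjI exI[of _ n] exI[of _ S]) auto
  qed
  moreover have "right_transl g f \<in> vecs ?V" if g: "g \<in> GL2" and f: "f \<in> vecs ?V" for g f
  proof -
    obtain n S where n: "\<forall>u\<in>congruence_sub n. right_transl u f = f"
      and S: "finite S" "{x. f x \<noteq> 0} \<subseteq> (\<Union>g\<in>S. (\<lambda>h. h ** g) ` pro_p_iwahori)"
      using f unfolding univ_iff by blast
    obtain m where m: "\<forall>u\<in>congruence_sub m. matrix_inv g ** u ** matrix_inv (matrix_inv g) \<in> congruence_sub (Suc n)"
      using conj_congruence[OF GL2_inv[OF g], of n] by blast
    have "right_transl u (right_transl g f) = right_transl g f" if u: "u \<in> congruence_sub m" for u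
    proof -
      let ?k = "matrix_inv g ** u ** g"
      have "?k \<in> congruence_sub n" using m u g congruence_mono[of n "Suc n"] by auto
      then have "right_transl g (right_transl ?k f) = right_transl g f" using n by simp
      moreover have "g ** ?k = u ** g" using g by (simp add: matrix_mul_assoc)
      ultimately show ?thesis by (simp add: right_transl_mult)
    qed
    moreover have "{x. right_transl g f x \<noteq> 0} \<subseteq> (\<Union>h\<in>(\<lambda>s. s ** matrix_inv g) ` S. (\<lambda>k. k ** h) ` pro_p_iwahori)"
    proof
      fix x assume "x \<in> {x. right_transl g f x \<noteq> 0}"
      then have "x ** g \<in> {x. f x \<noteq> 0}" by (simp add: right_transl_def)
      then have "x ** g \<in> (\<Union>g\<in>S. (\<lambda>h. h ** g) ` pro_p_iwahori)" using S(2) by blast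
      then obtain s k where s: "s \<in> S" "k \<in> pro_p_iwahori" "x ** g = k ** s" by blast
      have "x = k ** (s ** matrix_inv g)" using s(3) g by (metis GL2_cancel(1) matrix_mul_assoc)
      then show "x \<in> (\<Union>h\<in>(\<lambda>s. s ** matrix_inv g) ` S. (\<lambda>k. k ** h) ` pro_p_iwahori)" using s by blast
    qed
    moreover have "\<forall>x. x \<notin> GL2 \<longrightarrow> right_transl g f x = 0" using f g by (simp add: univ_iff right_transl_def)
    moreover have "\<forall>k\<in>pro_p_iwahori. \<forall>x\<in>GL2. right_transl g f (k ** x) = right_transl g f x"
      using f g by (simp add: univ_iff right_transl_def flip: matrix_mul_assoc)
    ultimately show ?thesis unfolding univ_iff using S(1)
      by (intro conjI exI[of _ m] exI[of _ "(\<lambda>s. s ** matrix_inv g) ` S"]) auto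
  qed
  ultimately show ?thesis unfolding is_rep_def lin_operators_def using vs
    by (auto simp: univ_simps right_transl_mult)
qed

interpretation univ: rep GL2 univ_rep
  by unfold_locales (rule is_rep_univ)

section \<open>The universal vector and its translates\<close>

lemma pro_p_iwahori_mult_iff:
  assumes k: "k \<in> pro_p_iwahori"
  shows "k ** x \<in> pro_p_iwahori \<longleftrightarrow> x \<in> pro_p_iwahori" "x ** k \<in> pro_p_iwahori \<longleftrightarrow> x \<in> pro_p_iwahori"
proof -
  have "x \<in> pro_p_iwahori" if "k ** x \<in> pro_p_iwahori"
    using pro_p_iwahori_mult[OF pro_p_iwahori_inv[OF k] that] pro_p_iwahori_GL2[OF k] by simp
  then show "k ** x \<in> pro_p_iwahori \<longleftrightarrow> x \<in> pro_p_iwahori" using k by blast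
  have "x \<in> pro_p_iwahori" if "x ** k \<in> pro_p_iwahori"
    using pro_p_iwahori_mult[OF that pro_p_iwahori_inv[OF k]] pro_p_iwahori_GL2[OF k] by simp
  then show "x ** k \<in> pro_p_iwahori \<longleftrightarrow> x \<in> pro_p_iwahori" using k by blast
qed

lemma univ_vec_in: "(univ_vec :: 'a::nonarch_local_field mat22 \<Rightarrow> 'b::field) \<in> vecs univ_rep"
proof -
  have "x \<in> (\<lambda>h. h ** mat 1) ` pro_p_iwahori" if "x \<in> pro_p_iwahori" for x :: "'a mat22"
    using that by (rule rev_image_eqI) simp
  then have "{x. univ_vec x \<noteq> (0 :: 'b)} \<subseteq> (\<Union>g\<in>{mat 1}. (\<lambda>h. h ** g) ` pro_p_iwahori)"
    by (auto simp: univ_vec_def split: if_splits)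
  moreover have "\<forall>u\<in>congruence_sub 1. right_transl u univ_vec = (univ_vec :: 'a mat22 \<Rightarrow> 'b)"
    by (auto simp: univ_vec_def right_transl_def pro_p_iwahori_mult_iff congruence_1_pro_p)
  moreover have "\<forall>x. x \<notin> GL2 \<longrightarrow> univ_vec x = (0 :: 'b)" by (auto simp: univ_vec_def pro_p_iwahori_GL2)
  moreover have "\<forall>k\<in>pro_p_iwahori. \<forall>x\<in>GL2. univ_vec (k ** x) = (univ_vec x :: 'b)" by (simp add: univ_vec_def pro_p_iwahori_mult_iff)
  moreover have "finite {mat 1 :: 'a mat22}" by simp
  ultimately show ?thesis unfolding univ_iff by blast
qed

text \<open>Chosen from the coset as a set, so that equal cosets have literally the same
  representative.\<close>

definition coset_rep :: "'f::nonarch_local_field mat22 \<Rightarrow> 'f mat22" where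
  "coset_rep x = (SOME y. y \<in> (\<lambda>k. k ** x) ` pro_p_iwahori)"

lemma coset_rep: "\<exists>k\<in>pro_p_iwahori. coset_rep x = k ** x"
proof -
  have "mat 1 ** x \<in> (\<lambda>k. k ** x) ` pro_p_iwahori" by (rule imageI) simp
  then have "coset_rep x \<in> (\<lambda>k. k ** x) ` pro_p_iwahori" unfolding coset_rep_def by (rule someI)
  then show ?thesis by blast
qed

lemma coset_rep_shift:
  assumes k: "k \<in> pro_p_iwahori" shows "coset_rep (k ** x) = coset_rep x"
proof -
  have "(\<lambda>l. l ** (k ** x)) ` pro_p_iwahori = (\<lambda>l. l ** x) ` pro_p_iwahori"
  proof (intro subset_antisym subsetI)
    fix y assume "y \<in> (\<lambda>l. l ** (k ** x)) ` pro_p_iwahori"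
    then obtain l where "l \<in> pro_p_iwahori" "y = (l ** k) ** x" by (auto simp: matrix_mul_assoc)
    then show "y \<in> (\<lambda>l. l ** x) ` pro_p_iwahori" using k by blast
  next
    fix y assume "y \<in> (\<lambda>l. l ** x) ` pro_p_iwahori"
    then obtain l where l: "l \<in> pro_p_iwahori" "y = l ** x" by blast
    have "y = (l ** matrix_inv k) ** (k ** x)" using l k pro_p_iwahori_GL2[of k] by (simp add: matrix_mul_assoc)
    then show "y \<in> (\<lambda>l. l ** (k ** x)) ` pro_p_iwahori" using l k by blast
  qed
  then show ?thesis by (simp add: coset_rep_def)
qed

lemma coset_rep_GL2 [simp]: "coset_rep x \<in> GL2 \<longleftrightarrow> x \<in> GL2"
  using coset_rep[of x] by (auto simp: pro_p_iwahori_GL2)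

lemma coset_rep_idem [simp]: "coset_rep (coset_rep x) = coset_rep x"
  using coset_rep[of x] coset_rep_shift by metis

lemma coset_rep_eq_iff:
  assumes "y \<in> GL2"
  shows "coset_rep x = coset_rep y \<longleftrightarrow> x ** matrix_inv y \<in> pro_p_iwahori"
proof
  assume e: "coset_rep x = coset_rep y"
  obtain k l where k: "k \<in> pro_p_iwahori" "coset_rep x = k ** x" "l \<in> pro_p_iwahori" "coset_rep y = l ** y"
    using coset_rep by metis
  have "matrix_inv k ** (k ** x) = matrix_inv k ** (l ** y)" using e k by simp
  then have "x = (matrix_inv k ** l) ** y" using k(1) pro_p_iwahori_GL2[of k] by (simp add: matrix_mul_assoc)
  then have "x ** matrix_inv y = matrix_inv k ** l" using assms by simp
  then show "x ** matrix_inv y \<in> pro_p_iwahori" using k by simp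
next
  assume "x ** matrix_inv y \<in> pro_p_iwahori"
  from coset_rep_shift[OF this, of y] show "coset_rep x = coset_rep y" using assms by simp
qed

definition transversal :: "'f::nonarch_local_field mat22 set" where
  "transversal = coset_rep ` GL2"

lemma transversal: "x \<in> transversal \<longleftrightarrow> x \<in> GL2 \<and> coset_rep x = x"
  unfolding transversal_def by (auto intro: rev_image_eqI)

lemma univ_coset_rep:
  assumes "f \<in> vecs univ_rep" shows "f (coset_rep x) = f x"
proof (cases "x \<in> GL2")
  case True
  then show ?thesis using assms coset_rep[of x] by (auto simp: univ_iff)
next
  case False
  then show ?thesis using assms by (simp add: univ_iff)
qed

lemma finite_univ_support:
  assumes "f \<in> vecs univ_rep" shows "finite {x \<in> transversal. f x \<noteq> 0}"
proof -
  obtain S where S: "finite S" "{x. f x \<noteq> 0} \<subseteq> (\<Union>g\<in>S. (\<lambda>h. h ** g) ` pro_p_iwahori)"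
    using assms unfolding univ_iff by blast
  have "{x \<in> transversal. f x \<noteq> 0} \<subseteq> coset_rep ` S"
  proof
    fix x assume x: "x \<in> {x \<in> transversal. f x \<noteq> 0}"
    then obtain s k where s: "s \<in> S" "k \<in> pro_p_iwahori" "x = k ** s" using S(2) by blast
    have "x = coset_rep x" using x by (simp add: transversal)
    also have "\<dots> = coset_rep s" unfolding s(3) using s(2) by (rule coset_rep_shift)
    finally show "x \<in> coset_rep ` S" using s(1) by blast
  qed
  then show ?thesis using S(1) by (rule finite_surj[rotated])
qed

text \<open>The indicator of the coset \<open>I\<^sub>1 x\<close> is the translate of
  \<open>univ_vec\<close> by the inverse of \<open>x\<close>; hence \<open>univ_vec\<close>
  generates the universal representation.\<close>

lemma univ_decompose:
  fixes f :: "'f::nonarch_local_field mat22 \<Rightarrow> 'c::field"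
  assumes f: "f \<in> vecs univ_rep"
  shows "f = (\<Sum>x\<in>{x \<in> transversal. f x \<noteq> 0}. pointwise (*) (f x) (right_transl (matrix_inv x) univ_vec))"
proof
  fix z
  show "f z = (\<Sum>x\<in>{x \<in> transversal. f x \<noteq> 0}. pointwise (*) (f x) (right_transl (matrix_inv x) univ_vec)) z"
  proof (cases "z \<in> GL2")
    case True
    have "(\<Sum>x\<in>{x \<in> transversal. f x \<noteq> 0}. pointwise (*) (f x) (right_transl (matrix_inv x) univ_vec)) z
      = (\<Sum>x\<in>{x \<in> transversal. f x \<noteq> 0}. if x = coset_rep z then f x else 0)"
      unfolding sum_fun_apply
    proof (intro sum.cong refl)
      fix x assume "x \<in> {x \<in> transversal. f x \<noteq> 0}"
      then have x: "x \<in> GL2" "coset_rep x = x" by (auto simp: transversal)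
      have "z ** matrix_inv x \<in> pro_p_iwahori \<longleftrightarrow> x = coset_rep z"
        using coset_rep_eq_iff[OF x(1), of z] x(2) by auto
      then show "pointwise (*) (f x) (right_transl (matrix_inv x) univ_vec) z = (if x = coset_rep z then f x else 0)"
        by (auto simp: pointwise_def right_transl_def univ_vec_def)
    qed
    also have "\<dots> = f (coset_rep z)"
      using finite_univ_support[OF f] True by (auto simp: transversal)
    finally show ?thesis using univ_coset_rep[OF f] by simp
  next
    case False
    have "univ_vec (z ** matrix_inv x) = (0 :: 'c)" if "x \<in> transversal" for x
      using False that GL2_mult_iff(1)[of "matrix_inv x" z] pro_p_iwahori_GL2[of "z ** matrix_inv x"]
      by (auto simp: univ_vec_def transversal)
    then have "(\<Sum>x\<in>{x \<in> transversal. f x \<noteq> 0}. pointwise (*) (f x) (right_transl (matrix_inv x) univ_vec)) z = 0"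
      unfolding sum_fun_apply by (intro sum.neutral) (auto simp: pointwise_def right_transl_def)
    then show ?thesis using False f by (simp add: univ_iff)
  qed
qed

lemma Hom_univ_formula:
  fixes f :: "'f::nonarch_local_field mat22 \<Rightarrow> 'c::field" and \<pi> :: "('f mat22, 'c, 'v::ab_group_add) repr"
  assumes P: "is_rep GL2 \<pi>" and \<psi>: "\<psi> \<in> Hom GL2 univ_rep \<pi>" and f: "f \<in> vecs univ_rep"
  shows "\<psi> f = (\<Sum>x\<in>{x \<in> transversal. f x \<noteq> 0}. scl \<pi> (f x) (opr \<pi> (matrix_inv x) (\<psi> univ_vec)))"
proof -
  have in_univ: "right_transl (matrix_inv x) univ_vec \<in> vecs (univ_rep :: ('f mat22, 'c, 'f mat22 \<Rightarrow> 'c) repr)" if "x \<in> transversal" for x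
    using univ.opr_closed[of "matrix_inv x" univ_vec] that by (auto simp: univ_simps transversal univ_vec_in)
  have "\<psi> f = (\<Sum>x\<in>{x \<in> transversal. f x \<noteq> 0}. \<psi> (pointwise (*) (f x) (right_transl (matrix_inv x) univ_vec)))"
    by (subst (1) univ_decompose[OF f], rule Hom_linear(4)[OF \<psi> univ.vs is_rep_subspace[OF is_rep_univ]])
      (use in_univ univ.vecs_closed(3) in \<open>auto simp: univ_simps\<close>)
  also have "\<dots> = (\<Sum>x\<in>{x \<in> transversal. f x \<noteq> 0}. scl \<pi> (f x) (opr \<pi> (matrix_inv x) (\<psi> univ_vec)))"
  proof (intro sum.cong refl)
    fix x assume x: "x \<in> {x \<in> transversal. f x \<noteq> 0}"
    then show "\<psi> (pointwise (*) (f x) (right_transl (matrix_inv x) univ_vec)) = scl \<pi> (f x) (opr \<pi> (matrix_inv x) (\<psi> univ_vec))"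
      using HomD(3)[OF \<psi>, of "right_transl (matrix_inv x) univ_vec" "f x"] HomD(4)[OF \<psi>, of "matrix_inv x" univ_vec]
        in_univ[of x] by (auto simp: univ_simps transversal univ_vec_in)
  qed
  finally show ?thesis .
qed

text \<open>The inverse of evaluation at \<open>univ_vec\<close>, read off from the expansion of
  \<open>f\<close> in translates of that vector.\<close>

definition recip :: "('f::nonarch_local_field mat22, 'c::field, 'v::ab_group_add) repr \<Rightarrow> 'v
    \<Rightarrow> ('f mat22 \<Rightarrow> 'c) \<Rightarrow> 'v" where
  "recip \<pi> v f = (if f \<in> vecs univ_rep
    then \<Sum>x\<in>{x \<in> transversal. f x \<noteq> 0}. scl \<pi> (f x) (opr \<pi> (matrix_inv x) v) else 0)"

locale G_rep = rep GL2 \<pi> for \<pi> :: "('f::nonarch_local_field mat22, 'c::field, 'v::ab_group_add) repr"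
begin

abbreviation "invs \<equiv> invariants pro_p_iwahori \<pi>"

lemma invsD: "v \<in> invs \<Longrightarrow> v \<in> vecs \<pi>" "v \<in> invs \<Longrightarrow> k \<in> pro_p_iwahori \<Longrightarrow> opr \<pi> k v = v"
  by (auto simp: invariants_def)

lemma invs_subspace: "Modules.module.subspace (scl \<pi>) invs"
  by (rule subspaceI[OF vs]) (auto simp: invariants_def vecs_closed opr_add opr_scl opr_zero pro_p_iwahori_GL2)

lemmas invs_closed = subspaceD[OF vs invs_subspace]

lemma recip_Hom:
  assumes v: "v \<in> invs"
  shows "recip \<pi> v \<in> Hom GL2 univ_rep \<pi>"
proof (rule HomI)
  let ?t = "\<lambda>f x. scl \<pi> (f x) (opr \<pi> (matrix_inv x) v)"
  have t: "?t f x \<in> vecs \<pi>" if "x \<in> GL2" for f x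
    using that invsD(1)[OF v] by (simp add: vecs_closed opr_closed)
  have eq: "recip \<pi> v f = (\<Sum>x\<in>S. ?t f x)"
    if "f \<in> vecs univ_rep" "finite S" "{x \<in> transversal. f x \<noteq> 0} \<subseteq> S" "S \<subseteq> transversal" for f S
    unfolding recip_def using that
    by (auto intro!: sum.mono_neutral_left simp: scl_simps)
  fix f :: "'f mat22 \<Rightarrow> 'c" assume f: "f \<in> vecs univ_rep"
  let ?S = "{x \<in> transversal. f x \<noteq> 0}"
  note fin = finite_univ_support[OF f]
  have closed: "(\<Sum>x\<in>?S. ?t f x) \<in> vecs \<pi>"
    by (rule vecs_closed(6)) (use t in \<open>auto simp: transversal\<close>)
  then show "recip \<pi> v f \<in> vecs \<pi>" using eq[OF f fin] by auto
  show "recip \<pi> v (f + f') = recip \<pi> v f + recip \<pi> v f'" if f': "f' \<in> vecs univ_rep" for f'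
  proof -
    let ?S' = "?S \<union> {x \<in> transversal. f' x \<noteq> 0}"
    have S: "finite ?S'" "?S' \<subseteq> transversal" using fin finite_univ_support[OF f'] by auto
    have "recip \<pi> v (f + f') = (\<Sum>x\<in>?S'. ?t (f + f') x)"
      by (rule eq[OF univ.vecs_closed(2)[OF f f'] S(1) _ S(2)]) auto
    also have "\<dots> = (\<Sum>x\<in>?S'. ?t f x) + (\<Sum>x\<in>?S'. ?t f' x)" by (simp add: scl_simps sum.distrib)
    also have "(\<Sum>x\<in>?S'. ?t f x) = recip \<pi> v f" by (rule eq[OF f S(1) _ S(2), symmetric]) auto
    also have "(\<Sum>x\<in>?S'. ?t f' x) = recip \<pi> v f'" by (rule eq[OF f' S(1) _ S(2), symmetric]) auto
    finally show ?thesis .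
  qed
  show "recip \<pi> v (scl univ_rep c f) = scl \<pi> c (recip \<pi> v f)" for c
  proof -
    have "recip \<pi> v (scl univ_rep c f) = (\<Sum>x\<in>?S. ?t (scl univ_rep c f) x)"
      by (rule eq[OF univ.vecs_closed(3)[OF f] fin]) (auto simp: univ_simps pointwise_def)
    also have "\<dots> = scl \<pi> c (\<Sum>x\<in>?S. ?t f x)" by (simp add: univ_simps pointwise_def scl_simps)
    also have "(\<Sum>x\<in>?S. ?t f x) = recip \<pi> v f" by (rule eq[OF f fin, symmetric]) auto
    finally show ?thesis .
  qed
  show "recip \<pi> v (opr univ_rep g f) = opr \<pi> g (recip \<pi> v f)" if g: "g \<in> GL2" for g
  proof -
    have gf: "opr univ_rep g f \<in> vecs univ_rep" using univ.opr_closed[OF g f] .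
    \<comment> \<open>The summand depends only on the coset of \<open>x\<close>, because
      \<open>v\<close> is fixed by \<open>I\<^sub>1\<close>.\<close>
    have shift: "?t f (coset_rep x) = ?t f x" if x: "x \<in> GL2" for x
    proof -
      obtain k where k: "k \<in> pro_p_iwahori" "coset_rep x = k ** x" using coset_rep by blast
      have "opr \<pi> (matrix_inv (k ** x)) v = opr \<pi> (matrix_inv x) (opr \<pi> (matrix_inv k) v)"
        using k x invsD(1)[OF v] pro_p_iwahori_GL2[of k] by (simp add: matrix_inv_mult opr_mult)
      also have "opr \<pi> (matrix_inv k) v = v" using k(1) v by (simp add: invsD)
      finally show ?thesis using univ_coset_rep[OF f, of x] k(2) by simp
    qed
    \<comment> \<open>Right multiplication by \<open>g\<close> permutes the cosets; on
      representatives it becomes \<open>?j\<close>, with inverse \<open>?i\<close>.\<close>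
    let ?i = "\<lambda>x. coset_rep (x ** matrix_inv g)" and ?j = "\<lambda>x. coset_rep (x ** g)"
    have ij: "?j (?i x) = coset_rep x" "?i (?j x) = coset_rep x" for x
    proof -
      obtain k where k: "k \<in> pro_p_iwahori" "coset_rep (x ** matrix_inv g) = k ** (x ** matrix_inv g)"
        using coset_rep by blast
      obtain l where l: "l \<in> pro_p_iwahori" "coset_rep (x ** g) = l ** (x ** g)"
        using coset_rep by blast
      show "?j (?i x) = coset_rep x" using k g coset_rep_shift[OF k(1), of x] by (simp add: matrix_mul_assoc)
      show "?i (?j x) = coset_rep x" using l g coset_rep_shift[OF l(1), of x] by (simp add: matrix_mul_assoc)
    qed
    have supp: "f (?j x) = opr univ_rep g f x" for x
      using univ_coset_rep[OF f, of "x ** g"] by (simp add: univ_simps right_transl_def)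
    have "recip \<pi> v (opr univ_rep g f) = (\<Sum>x\<in>{x \<in> transversal. opr univ_rep g f x \<noteq> 0}. ?t (opr univ_rep g f) x)"
      using gf by (simp add: recip_def)
    also have "\<dots> = (\<Sum>x\<in>{x \<in> transversal. opr univ_rep g f x \<noteq> 0}. opr \<pi> g (?t f (?j x)))"
    proof (intro sum.cong refl)
      fix x assume "x \<in> {x \<in> transversal. opr univ_rep g f x \<noteq> 0}"
      then have x: "x \<in> GL2" by (simp add: transversal)
      have "opr \<pi> g (?t f (?j x)) = opr \<pi> g (?t f (x ** g))" using shift[of "x ** g"] x g by simp
      also have "\<dots> = scl \<pi> (f (x ** g)) (opr \<pi> g (opr \<pi> (matrix_inv (x ** g)) v))"
        using x g invsD(1)[OF v] by (simp add: opr_scl opr_closed)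
      also have "\<dots> = ?t (opr univ_rep g f) x"
        using x g invsD(1)[OF v] by (simp add: univ_simps right_transl_def matrix_inv_mult matrix_mul_assoc flip: opr_mult)
      finally show "?t (opr univ_rep g f) x = opr \<pi> g (?t f (?j x))" by simp
    qed
    also have "\<dots> = (\<Sum>x\<in>?S. opr \<pi> g (?t f x))"
    proof (rule sum.reindex_bij_witness[of _ ?i ?j])
      fix x assume x: "x \<in> {x \<in> transversal. opr univ_rep g f x \<noteq> 0}"
      then show "?i (?j x) = x" "?j x \<in> ?S" using ij(2)[of x] supp[of x] g by (auto simp: transversal)
    next
      fix x assume x: "x \<in> ?S"
      then show "?j (?i x) = x" "?i x \<in> {x \<in> transversal. opr univ_rep g f x \<noteq> 0}"
        using ij(1)[of x] supp[of "?i x"] g by (auto simp: transversal)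
    qed simp
    also have "\<dots> = opr \<pi> g (\<Sum>x\<in>?S. ?t f x)"
      by (rule opr_sum[OF g, symmetric]) (use t in \<open>auto simp: transversal\<close>)
    also have "(\<Sum>x\<in>?S. ?t f x) = recip \<pi> v f" using f by (simp add: recip_def)
    finally show ?thesis .
  qed
qed (simp add: recip_def)

lemma recip_univ_vec:
  assumes v: "v \<in> invs" shows "recip \<pi> v univ_vec = v"
proof -
  obtain k :: "'f mat22" where k: "k \<in> pro_p_iwahori" "coset_rep (mat 1) = k ** mat 1" using coset_rep by blast
  have c: "coset_rep x = coset_rep (mat 1) \<longleftrightarrow> x \<in> pro_p_iwahori" for x :: "'f mat22"
    using coset_rep_eq_iff[of "mat 1" x] by simp
  have t: "x \<in> transversal \<and> x \<in> pro_p_iwahori \<longleftrightarrow> x = coset_rep (mat 1)" for x :: "'f mat22"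
    using c[of x] c[of "coset_rep (mat 1)"] by (auto simp: transversal)
  have "{x \<in> transversal. univ_vec x \<noteq> (0 :: 'c)} = {coset_rep (mat 1 :: 'f mat22)}"
    by (simp add: set_eq_iff univ_vec_def) (use t in blast)
  moreover have "univ_vec k = (1 :: 'c)" using k by (simp add: univ_vec_def)
  ultimately show ?thesis using k v by (simp add: recip_def univ_vec_in invsD scl_simps)
qed

lemma recip_unique:
  assumes "\<psi> \<in> Hom GL2 univ_rep \<pi>"
  shows "\<psi> = recip \<pi> (\<psi> univ_vec)"
proof
  fix f
  show "\<psi> f = recip \<pi> (\<psi> univ_vec) f"
    using Hom_univ_formula[OF is_rep assms, of f] HomD(5)[OF assms, of f] by (auto simp: recip_def)
qed

lemma Hom_univ_vec_invs:
  assumes "\<psi> \<in> Hom GL2 univ_rep \<pi>" shows "\<psi> univ_vec \<in> invs"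
proof -
  have "right_transl k univ_vec = (univ_vec :: 'f mat22 \<Rightarrow> 'c)" if k: "k \<in> pro_p_iwahori" for k
  proof -
    show ?thesis using k by (auto simp: right_transl_def univ_vec_def pro_p_iwahori_mult_iff)
  qed
  then have "opr \<pi> k (\<psi> univ_vec) = \<psi> univ_vec" if "k \<in> pro_p_iwahori" for k
    using that HomD(4)[OF assms pro_p_iwahori_GL2[OF that] univ_vec_in] by (simp add: univ_simps)
  then show ?thesis using HomD(1)[OF assms univ_vec_in] by (simp add: invariants_def)
qed

lemma recip_the: "v \<in> invs \<Longrightarrow> (THE \<phi>. \<phi> \<in> Hom GL2 univ_rep \<pi> \<and> \<phi> univ_vec = v) = recip \<pi> v"
  using recip_Hom recip_univ_vec recip_unique by (intro the_equality) auto

lemma hecke_invariants_simps [simp]: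
  "vecs (hecke_invariants \<pi>) = invs" "scl (hecke_invariants \<pi>) = scl \<pi>"
  "v \<in> invs \<Longrightarrow> opr (hecke_invariants \<pi>) T v = recip \<pi> v (T univ_vec)"
  by (simp_all add: hecke_invariants_def recip_the)

end

interpretation UG: G_rep univ_rep
  by unfold_locales

lemma univ_vec_invs: "(univ_vec :: 'f::nonarch_local_field mat22 \<Rightarrow> 'c::field) \<in> UG.invs"
proof -
  have "(\<lambda>f :: 'f mat22 \<Rightarrow> 'c. if f \<in> vecs univ_rep then f else 0) \<in> Hom GL2 univ_rep univ_rep"
    by (rule HomI) (auto simp: univ.vecs_closed univ.opr_closed)
  from UG.Hom_univ_vec_invs[OF this] show ?thesis by (simp add: univ_vec_in)
qed

lemma hecke_of_vec:
  assumes "f \<in> UG.invs"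
  shows "hecke_of_vec f = recip univ_rep f" "hecke_of_vec f \<in> hecke" "hecke_of_vec f univ_vec = f"
  using UG.recip_the[OF assms] UG.recip_Hom[OF assms] UG.recip_univ_vec[OF assms]
  by (simp_all add: hecke_of_vec_def hecke_def)

lemma hecke_univ_vec: "T \<in> hecke \<Longrightarrow> T univ_vec \<in> UG.invs"
  unfolding hecke_def by (rule UG.Hom_univ_vec_invs)

lemma hecke_eq_of_vec: "T \<in> hecke \<Longrightarrow> T = hecke_of_vec (T univ_vec)"
  using UG.recip_unique[of T] hecke_of_vec(1)[OF hecke_univ_vec[of T]] by (simp add: hecke_def)

lemma hecke_comp: "S \<in> hecke \<Longrightarrow> T \<in> hecke \<Longrightarrow> S \<circ> T \<in> hecke"
  unfolding hecke_def
  by (rule HomI) (auto simp: HomD Hom_linear(1)[OF _ univ.vs is_rep_subspace[OF is_rep_univ]])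

lemma hecke_add: "S \<in> hecke \<Longrightarrow> T \<in> hecke \<Longrightarrow> S + T \<in> hecke"
  unfolding hecke_def
  by (rule HomI) (auto simp: HomD univ.vecs_closed univ.scl_simps univ.opr_add add_ac)

lemma hecke_scl: "T \<in> hecke \<Longrightarrow> pointwise (pointwise (*)) c T \<in> hecke"
  unfolding hecke_def univ_simps(1)[symmetric]
  by (rule HomI) (auto simp: HomD pointwise_def[of "scl univ_rep"] univ.vecs_closed univ.scl_simps univ.opr_scl mult.commute)

lemma hecke_one: "hecke_one \<in> hecke"
  unfolding hecke_def hecke_one_def
  by (rule HomI) (auto simp: univ.vecs_closed univ.opr_closed)

context G_rep
begin

text \<open>Under reciprocity \<open>S \<circ> T\<close> acts by \<open>S\<close> and then by
  \<open>T\<close>, which is what makes the invariants a right module.\<close>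

lemma recip_comp:
  assumes v: "v \<in> invs" and S: "S \<in> hecke" and T: "T \<in> hecke"
  shows "recip \<pi> v (S (T univ_vec)) = recip \<pi> (recip \<pi> v (S univ_vec)) (T univ_vec)"
proof -
  have "recip \<pi> v \<circ> S \<in> Hom GL2 univ_rep \<pi>"
    using recip_Hom[OF v] S unfolding hecke_def
    by (intro HomI) (auto simp: HomD Hom_linear(1)[OF _ univ.vs is_rep_subspace[OF is_rep_univ]])
  from fun_cong[OF recip_unique[OF this], of "T univ_vec"] show ?thesis by simp
qed

lemma right_hecke_module_invariants: "right_hecke_module (hecke_invariants \<pi>)"
proof -
  have closed: "recip \<pi> v (T univ_vec) \<in> invs" if "v \<in> invs" "T \<in> hecke" for v T
  proof -
    have "recip \<pi> v \<circ> T \<in> Hom GL2 univ_rep \<pi>"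
      using recip_Hom[OF that(1)] that(2) unfolding hecke_def
      by (intro HomI) (auto simp: HomD Hom_linear(1)[OF _ univ.vs is_rep_subspace[OF is_rep_univ]])
    from Hom_univ_vec_invs[OF this] show ?thesis by simp
  qed
  have lin: "recip \<pi> (v + w) f = recip \<pi> v f + recip \<pi> w f" "recip \<pi> (scl \<pi> c v) f = scl \<pi> c (recip \<pi> v f)"
    if "v \<in> invs" "w \<in> invs" for v w f c
    unfolding recip_def using that
    by (auto simp: transversal opr_add opr_scl invsD scl_simps mult.commute simp flip: sum.distrib intro!: sum.cong)
  have T: "T univ_vec \<in> vecs univ_rep" if "T \<in> hecke" for T :: "('f, 'c) hecke_elt"
    using hecke_univ_vec[OF that] by (rule UG.invsD)
  note r = HomD[OF recip_Hom]
  have sc: "pointwise (pointwise (*)) c T univ_vec = scl univ_rep c (T univ_vec)" for c and T :: "('f, 'c) hecke_elt"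
    by (simp add: univ_simps pointwise_def)
  show ?thesis unfolding right_hecke_module_def lin_operators_def
    using vs invs_subspace closed lin
    by (auto simp: invs_closed T r recip_comp hecke_comp hecke_one_def univ_vec_in recip_univ_vec sc)
qed

end

section \<open>Generators of the Hecke algebra\<close>

lemma n_s_max_compact [simp]: "n_s \<in> max_compact"
  by (simp add: max_compact_iff n_s_def forall_2 pow_ideal_minus)

lemma reduction_n_s [simp]: "reduction n_s = n_s"
  by (simp add: mat22_eq_iff n_s_def residue_minus)

lemma n_s_GL2 [simp]: "n_s \<in> GL2"
  by (simp add: GL2_iff n_s_def)

text \<open>The element through which \<open>T_Pi\<close> followed by \<open>T_n_s\<close> acts. It
  accounts for the sign in the powers of \<open>- unif\<close> that label the double cosets.\<close>

lemma Pi_n_s_inv: "matrix_inv n_s ** matrix_inv Pi_mat = mat22 1 0 0 (- inverse unif)"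
proof -
  have "matrix_inv n_s = (mat22 0 1 (- 1) 0 :: 'a mat22)"
    by (rule matrix_inv_eq) (simp add: n_s_def mat22_eq_iff mat22_mult_nth)
  then show ?thesis by (simp add: Pi_inv mat22_mult)
qed

lemma diag_sub_eq: "h \<in> diag_sub \<longleftrightarrow> h = mat22 (h $ 1 $ 1) 0 0 (h $ 2 $ 2) \<and> h $ 1 $ 1 \<noteq> 0 \<and> h $ 2 $ 2 \<noteq> 0"
  by (auto simp: diag_sub_def GL2_iff mat22_eq_iff det_2)

lemma diag_sub_GL2: "h \<in> diag_sub \<Longrightarrow> h \<in> GL2" by (simp add: diag_sub_def)

lemma diag_sub_mult: "h \<in> diag_sub \<Longrightarrow> h' \<in> diag_sub \<Longrightarrow> h ** h' \<in> diag_sub"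
  by (auto simp: diag_sub_def mat22_mult_nth)

lemma diag_sub_inv: "h \<in> diag_sub \<Longrightarrow> matrix_inv h \<in> diag_sub"
  by (simp add: diag_sub_def) (simp add: matrix_inv_mat22)

lemma iwahori_max_compact: "h \<in> iwahori \<Longrightarrow> h \<in> max_compact" by (simp add: iwahori_def)

lemma borel_sub_inv: "b \<in> borel_sub \<Longrightarrow> matrix_inv b \<in> borel_sub"
  by (simp add: borel_sub_def) (simp add: matrix_inv_mat22)

lemma iwahori_inv [intro]: "h \<in> iwahori \<Longrightarrow> matrix_inv h \<in> iwahori"
  by (simp add: iwahori_def reduction_inv borel_sub_inv)

lemma iwahori_conj:
  assumes "h \<in> iwahori" "k \<in> pro_p_iwahori"
  shows "matrix_inv h ** k ** h \<in> pro_p_iwahori"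
proof -
  have hk: "h \<in> max_compact" "k \<in> max_compact" using assms by (auto simp: iwahori_def pro_p_iwahori_def)
  let ?b = "reduction h" and ?u = "reduction k"
  have b: "?b \<in> GL2" "?b $ 2 $ 1 = 0" using assms(1) by (auto simp: iwahori_def borel_sub_def)
  have u: "?u \<in> GL2" "?u $ 1 $ 1 = 1" "?u $ 2 $ 2 = 1" "?u $ 2 $ 1 = 0"
    using assms(2) by (auto simp: pro_p_iwahori_def unip_sub_def)
  have nz: "?b $ 1 $ 1 \<noteq> 0" "?b $ 2 $ 2 \<noteq> 0" using b by (auto simp: GL2_iff det_2)
  have "matrix_inv ?b ** ?u ** ?b \<in> unip_sub"
    using b u nz by (simp add: unip_sub_def del: reduction_nth)
      (simp add: matrix_inv_mat22 mat22_mult_nth det_2 field_simps del: reduction_nth)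
  then show ?thesis using hk by (simp add: pro_p_iwahori_def reduction_mult reduction_inv)
qed

lemma lift_diag_iwahori: "h \<in> diag_sub \<Longrightarrow> lift_mat h \<in> iwahori"
  using lift_mat[of h] by (auto simp: iwahori_def borel_sub_def diag_sub_def simp del: reduction_nth)

lemma max_compact_conj_congruence:
  assumes "k \<in> max_compact" "u \<in> congruence_sub 1"
  shows "matrix_inv k ** u ** k \<in> congruence_sub 1"
  using assms by (simp add: congruence_1_iff reduction_mult reduction_inv)

text \<open>Despite the name, \<open>t\<close> may be zero: the lifts serve as upper right entries
  of unipotent matrices.\<close>

definition unit_lift :: "'f::nonarch_local_field residue_field \<Rightarrow> 'f" where
  "unit_lift t = (SOME x. x \<in> int_ring \<and> residue x = t)"

lemma unit_lift: "unit_lift t \<in> int_ring" "residue (unit_lift t) = t"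
  using someI_ex[of "\<lambda>x. x \<in> int_ring \<and> residue x = t"] residue_surj[of t]
  by (auto simp: unit_lift_def)

text \<open>The elements of \<open>H\<close> as Hecke operators. They replace the idempotents
  \<open>e_char\<close> among the generators, since their action on an eigenvector is
  immediate.\<close>

definition T_diag :: "'f::nonarch_local_field residue_field mat22 \<Rightarrow> ('f, 'c::field) hecke_elt" where
  "T_diag h = hecke_of_vec (right_transl (lift_mat h) univ_vec)"

definition T_Pi_inv :: "('f::nonarch_local_field, 'c::field) hecke_elt" where
  "T_Pi_inv = hecke_of_vec (right_transl Pi_mat univ_vec)"

section \<open>Operators on the invariants of \<open>K\<^sub>1\<close> and
  \<open>I\<^sub>1\<close>\<close>

context G_rep
begin

abbreviation "invs1 \<equiv> invariants (congruence_sub 1) \<pi>"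

lemma invs1D: "v \<in> invs1 \<Longrightarrow> v \<in> vecs \<pi>" "v \<in> invs1 \<Longrightarrow> k \<in> congruence_sub 1 \<Longrightarrow> opr \<pi> k v = v"
  by (auto simp: invariants_def)

lemma invs_invs1: "v \<in> invs \<Longrightarrow> v \<in> invs1"
  by (auto simp: invariants_def congruence_1_pro_p)

lemma opr_conj_invariants:
  assumes g: "g \<in> GL2" and A: "\<And>k. k \<in> A \<Longrightarrow> k \<in> GL2" and B: "\<And>k. k \<in> A \<Longrightarrow> matrix_inv g ** k ** g \<in> B"
    and v: "v \<in> invariants B \<pi>"
  shows "opr \<pi> g v \<in> invariants A \<pi>"
proof -
  have v': "v \<in> vecs \<pi>" using v by (simp add: invariants_def)
  have "opr \<pi> k (opr \<pi> g v) = opr \<pi> g v" if k: "k \<in> A" for k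
  proof -
    have "k ** g = g ** (matrix_inv g ** k ** g)" using g by (simp add: matrix_mul_assoc)
    then have "opr \<pi> k (opr \<pi> g v) = opr \<pi> g (opr \<pi> (matrix_inv g ** k ** g) v)"
      using g A[OF k] v' by (simp flip: opr_mult)
    also have "\<dots> = opr \<pi> g v" using v B[OF k] by (simp add: invariants_def)
    finally show ?thesis .
  qed
  then show ?thesis using opr_closed[OF g v'] by (simp add: invariants_def)
qed

lemma invs1_opr: "k \<in> max_compact \<Longrightarrow> v \<in> invs1 \<Longrightarrow> opr \<pi> k v \<in> invs1"
  by (rule opr_conj_invariants) (auto intro: max_compact_GL2 congruence_max_compact max_compact_conj_congruence)

text \<open>On \<open>K\<^sub>1\<close>-invariants the action of \<open>max_compact\<close> factors
  through reduction, so any lift may replace the one chosen by \<open>lift_mat\<close>.\<close>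

lemma invs1_reduction:
  assumes k: "k \<in> max_compact" "k' \<in> max_compact" "reduction k = reduction k'" and v: "v \<in> invs1"
  shows "opr \<pi> k v = opr \<pi> k' v"
proof -
  have "matrix_inv k ** k' \<in> congruence_sub 1"
    using k by (simp add: congruence_1_iff reduction_mult reduction_inv)
  then have "opr \<pi> k v = opr \<pi> k (opr \<pi> (matrix_inv k ** k') v)" using v by (simp add: invs1D)
  also have "\<dots> = opr \<pi> (k ** (matrix_inv k ** k')) v"
    using k v by (intro opr_mult[symmetric]) (auto simp: max_compact_GL2 invs1D)
  finally show ?thesis using k by (simp add: max_compact_GL2)
qed

lemma Pi_invs: "v \<in> invs \<Longrightarrow> opr \<pi> Pi_mat v \<in> invs" "v \<in> invs \<Longrightarrow> opr \<pi> (matrix_inv Pi_mat) v \<in> invs"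
  by (rule opr_conj_invariants; auto simp: Pi_conj_pro_p Pi_conj_pro_p' pro_p_iwahori_GL2)+

lemma iwahori_invs: "h \<in> iwahori \<Longrightarrow> v \<in> invs \<Longrightarrow> opr \<pi> h v \<in> invs"
  by (rule opr_conj_invariants) (auto intro: iwahori_conj iwahori_max_compact max_compact_GL2 pro_p_iwahori_GL2)

text \<open>The operator by which \<open>T_n_s\<close> acts on invariants; applied to
  \<open>univ_vec\<close> it also yields the vector that defines \<open>T_n_s\<close>.\<close>

definition ns_sum :: "'v \<Rightarrow> 'v" where
  "ns_sum v = (\<Sum>u\<in>unip_sub. opr \<pi> (lift_mat u) (opr \<pi> (matrix_inv n_s) v))"

definition char_proj :: "('f residue_field mat22 \<Rightarrow> 'c) \<Rightarrow> 'v \<Rightarrow> 'v" where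
  "char_proj chi v = (\<Sum>h\<in>diag_sub. scl \<pi>
    (inverse (of_nat (card (diag_sub :: 'f residue_field mat22 set))) * inverse (chi h)) (opr \<pi> (lift_mat h) v))"

lemma opr_lift_mult:
  assumes "k \<in> max_compact" "u \<in> GL2" "v \<in> invs1"
  shows "opr \<pi> k (opr \<pi> (lift_mat u) v) = opr \<pi> (lift_mat (reduction k ** u)) v"
proof -
  have "opr \<pi> k (opr \<pi> (lift_mat u) v) = opr \<pi> (k ** lift_mat u) v"
    using assms by (intro opr_mult[symmetric]) (auto simp: max_compact_GL2 lift_mat invs1D)
  also have "\<dots> = opr \<pi> (lift_mat (reduction k ** u)) v"
    using assms by (intro invs1_reduction) (auto simp: lift_mat reduction_mult)
  finally show ?thesis .
qed

lemma ns_sum_invs: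
  assumes v: "v \<in> invs" shows "ns_sum v \<in> invs"
proof -
  let ?y = "opr \<pi> (matrix_inv n_s) v"
  have y: "?y \<in> invs1" using v by (intro invs1_opr invs_invs1) auto
  have cl: "opr \<pi> (lift_mat u) ?y \<in> vecs \<pi>" if "u \<in> unip_sub" for u
    using y that by (auto intro!: opr_closed[OF _ invs1D(1)] simp: lift_mat unip_sub_GL2 max_compact_GL2)
  have "opr \<pi> k (ns_sum v) = ns_sum v" if k: "k \<in> pro_p_iwahori" for k
  proof -
    have k': "k \<in> max_compact" "reduction k \<in> unip_sub" using k by (auto simp: pro_p_iwahori_def)
    have "opr \<pi> k (ns_sum v) = (\<Sum>u\<in>unip_sub. opr \<pi> k (opr \<pi> (lift_mat u) ?y))"
      unfolding ns_sum_def using k cl by (intro opr_sum) (auto simp: pro_p_iwahori_GL2)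
    also have "\<dots> = (\<Sum>u\<in>unip_sub. opr \<pi> (lift_mat (reduction k ** u)) ?y)"
      using y k' by (intro sum.cong refl opr_lift_mult) (auto simp: unip_sub_GL2)
    also have "\<dots> = ns_sum v" unfolding ns_sum_def
      by (rule sum.reindex_bij_witness[of _ "\<lambda>u. matrix_inv (reduction k) ** u" "\<lambda>u. reduction k ** u"])
        (use k' in \<open>auto simp: unip_sub_mult unip_sub_inv unip_sub_GL2\<close>)
    finally show ?thesis .
  qed
  moreover have "ns_sum v \<in> vecs \<pi>" unfolding ns_sum_def using cl by (rule vecs_closed(6))
  ultimately show ?thesis by (simp add: invariants_def)
qed

lemma lift_diag_invs: "h \<in> diag_sub \<Longrightarrow> v \<in> invs \<Longrightarrow> opr \<pi> (lift_mat h) v \<in> invs"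
  by (intro iwahori_invs lift_diag_iwahori)

lemma char_proj_invs: "v \<in> invs \<Longrightarrow> char_proj chi v \<in> invs"
  unfolding char_proj_def by (intro invs_closed(6) invs_closed(3) lift_diag_invs)

lemma char_proj_eigen:
  assumes chi: "diag_char chi" and h: "h \<in> diag_sub" and v: "v \<in> invs"
  shows "opr \<pi> (lift_mat h) (char_proj chi v) = scl \<pi> (chi h) (char_proj chi v)"
proof -
  let ?n = "inverse (of_nat (card (diag_sub :: 'f residue_field mat22 set))) :: 'c"
  have l: "lift_mat h \<in> max_compact" "reduction (lift_mat h) = h" using h by (auto simp: lift_mat diag_sub_GL2)
  have cl: "opr \<pi> (lift_mat h') v \<in> vecs \<pi>" if "h' \<in> diag_sub" for h'
    using lift_diag_invs[OF that v] by (rule invsD)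
  have "opr \<pi> (lift_mat h) (char_proj chi v)
      = (\<Sum>h'\<in>diag_sub. opr \<pi> (lift_mat h) (scl \<pi> (?n * inverse (chi h')) (opr \<pi> (lift_mat h') v)))"
    unfolding char_proj_def using cl l by (intro opr_sum vecs_closed) (auto simp: max_compact_GL2)
  also have "\<dots> = (\<Sum>h'\<in>diag_sub. scl \<pi> (chi h * (?n * inverse (chi (h ** h')))) (opr \<pi> (lift_mat (h ** h')) v))"
  proof (intro sum.cong refl)
    fix h' :: "'f residue_field mat22" assume h': "h' \<in> diag_sub"
    have "opr \<pi> (lift_mat h) (opr \<pi> (lift_mat h') v) = opr \<pi> (lift_mat (h ** h')) v"
      using opr_lift_mult[OF l(1), of h' v] h' v l by (simp add: diag_sub_GL2 invs_invs1)
    moreover have "chi h * (?n * inverse (chi (h ** h'))) = ?n * inverse (chi h')"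
      using chi h h' by (simp add: diag_char_def)
    moreover have "opr \<pi> (lift_mat h) (scl \<pi> (?n * inverse (chi h')) (opr \<pi> (lift_mat h') v))
        = scl \<pi> (?n * inverse (chi h')) (opr \<pi> (lift_mat h) (opr \<pi> (lift_mat h') v))"
      using cl[OF h'] l(1) by (intro opr_scl) (auto simp: max_compact_GL2)
    ultimately show "opr \<pi> (lift_mat h) (scl \<pi> (?n * inverse (chi h')) (opr \<pi> (lift_mat h') v))
      = scl \<pi> (chi h * (?n * inverse (chi (h ** h')))) (opr \<pi> (lift_mat (h ** h')) v)"
      by (simp only:)
  qed
  also have "\<dots> = (\<Sum>h'\<in>diag_sub. scl \<pi> (chi h * (?n * inverse (chi h'))) (opr \<pi> (lift_mat h') v))"
    by (rule sum.reindex_bij_witness[of _ "\<lambda>u. matrix_inv h ** u" "\<lambda>u. h ** u"])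
      (use h in \<open>auto simp: diag_sub_mult diag_sub_inv diag_sub_GL2\<close>)
  also have "\<dots> = scl \<pi> (chi h) (char_proj chi v)" by (simp add: char_proj_def scl_simps)
  finally show ?thesis .
qed

lemma recip_opr_univ_vec:
  assumes v: "v \<in> invs" and g: "g \<in> GL2"
  shows "recip \<pi> v (right_transl g univ_vec) = opr \<pi> g v"
  using HomD(4)[OF recip_Hom[OF v] g univ_vec_in] recip_univ_vec[OF v] by (simp add: univ_simps)

lemma right_transl_univ_vec: "g \<in> GL2 \<Longrightarrow> right_transl g univ_vec \<in> vecs univ_rep"
  using univ.opr_closed[of g univ_vec] by (simp add: univ_vec_in univ_simps)

end

section \<open>The generators as elements of the Hecke algebra\<close>

lemma hecke_ext: "S \<in> hecke \<Longrightarrow> T \<in> hecke \<Longrightarrow> S univ_vec = T univ_vec \<Longrightarrow> S = T"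
  using hecke_eq_of_vec by metis

lemma hecke_right_transl:
  "T \<in> hecke \<Longrightarrow> g \<in> GL2 \<Longrightarrow> f \<in> vecs univ_rep \<Longrightarrow> T (right_transl g f) = right_transl g (T f)"
  using HomD(4)[of T GL2 univ_rep univ_rep g f] by (simp add: hecke_def univ_simps)

lemma lift_mat_GL2: "x \<in> GL2 \<Longrightarrow> lift_mat x \<in> GL2"
  by (simp add: lift_mat max_compact_GL2)

lemma T_n_s:
  defines "T \<equiv> T_n_s :: ('f::nonarch_local_field, 'c::field) hecke_elt"
  shows "T \<in> hecke" "T univ_vec = UG.ns_sum univ_vec"
proof -
  have "T = hecke_of_vec (UG.ns_sum univ_vec)"
    by (simp add: T_def T_n_s_def UG.ns_sum_def univ_simps)
  then show "T \<in> hecke" "T univ_vec = UG.ns_sum univ_vec"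
    using hecke_of_vec(2,3)[OF UG.ns_sum_invs[OF univ_vec_invs]] by simp_all
qed

lemma e_char: "e_char chi \<in> hecke" "e_char chi univ_vec = UG.char_proj chi univ_vec"
proof -
  have "e_char chi = hecke_of_vec (UG.char_proj chi univ_vec)"
    by (simp add: e_char_def UG.char_proj_def univ_simps)
  then show "e_char chi \<in> hecke" "e_char chi univ_vec = UG.char_proj chi univ_vec"
    using hecke_of_vec(2,3)[OF UG.char_proj_invs[OF univ_vec_invs]] by simp_all
qed

lemma T_Pi: "T_Pi \<in> hecke" "T_Pi univ_vec = right_transl (matrix_inv Pi_mat) univ_vec"
  using hecke_of_vec(2,3)[OF UG.Pi_invs(2)[OF univ_vec_invs]] by (simp_all add: T_Pi_def univ_simps)

lemma T_Pi_inv: "T_Pi_inv \<in> hecke" "T_Pi_inv univ_vec = right_transl Pi_mat univ_vec"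
  using hecke_of_vec(2,3)[OF UG.Pi_invs(1)[OF univ_vec_invs]] by (simp_all add: T_Pi_inv_def univ_simps)

lemma T_diag:
  assumes "h \<in> diag_sub"
  shows "T_diag h \<in> hecke" "T_diag h univ_vec = right_transl (lift_mat h) univ_vec"
  using hecke_of_vec(2,3)[OF UG.lift_diag_invs[OF assms univ_vec_invs]] by (simp_all add: T_diag_def univ_simps)

text \<open>Turns the condition that \<open>e_char chi\<close> fixes a vector into an eigenvector
  condition for \<open>H\<close>: the vector may be replaced by its image under
  \<open>e_char chi\<close> before \<open>T_diag h\<close> is applied.\<close>

lemma e_char_T_diag:
  assumes "diag_char chi" "h \<in> diag_sub"
  shows "e_char chi \<circ> T_diag h = pointwise (pointwise (*)) (chi h) (e_char chi)"
proof (rule hecke_ext)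
  show "e_char chi \<circ> T_diag h \<in> hecke" using assms e_char T_diag by (intro hecke_comp) auto
  show "pointwise (pointwise (*)) (chi h) (e_char chi) \<in> hecke" using e_char by (intro hecke_scl) auto
  have "(e_char chi \<circ> T_diag h) univ_vec = right_transl (lift_mat h) (UG.char_proj chi univ_vec)"
    using assms(2) e_char[of chi] by (simp add: T_diag hecke_right_transl lift_mat_GL2 diag_sub_GL2 univ_vec_in)
  also have "\<dots> = pointwise (*) (chi h) (UG.char_proj chi univ_vec)"
    using UG.char_proj_eigen[OF assms univ_vec_invs] by (simp add: univ_simps)
  finally show "(e_char chi \<circ> T_diag h) univ_vec = pointwise (pointwise (*)) (chi h) (e_char chi) univ_vec"
    by (simp add: e_char pointwise_def)
qed

lemma T_Pi_T_Pi_inv: "T_Pi \<circ> T_Pi_inv = hecke_one"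
proof (rule hecke_ext)
  show "T_Pi \<circ> T_Pi_inv \<in> hecke" by (intro hecke_comp T_Pi T_Pi_inv)
  show "(T_Pi \<circ> T_Pi_inv) univ_vec = hecke_one univ_vec"
    using T_Pi(1) by (simp add: T_Pi_inv T_Pi hecke_right_transl univ_vec_in hecke_one_def right_transl_mult)
qed (rule hecke_one)

context G_rep
begin

lemma recip_T_n_s:
  assumes v: "v \<in> invs" shows "recip \<pi> v (T_n_s univ_vec) = ns_sum v"
proof -
  let ?y = "right_transl (matrix_inv n_s) univ_vec :: 'f mat22 \<Rightarrow> 'c"
  have y: "?y \<in> vecs univ_rep" by (rule right_transl_univ_vec) simp
  have y': "right_transl (lift_mat u) ?y \<in> vecs univ_rep" if "u \<in> unip_sub" for u
    using univ.opr_closed[OF lift_mat_GL2[OF unip_sub_GL2[OF that]] y] by (simp add: univ_simps)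
  have "recip \<pi> v (T_n_s univ_vec) = recip \<pi> v (\<Sum>u\<in>unip_sub. right_transl (lift_mat u) ?y)"
    by (simp add: T_n_s UG.ns_sum_def univ_simps)
  also have "\<dots> = (\<Sum>u\<in>unip_sub. recip \<pi> v (right_transl (lift_mat u) ?y))"
    by (rule Hom_linear(4)[OF recip_Hom[OF v] univ.vs is_rep_subspace[OF is_rep_univ]]) (rule y')
  also have "\<dots> = ns_sum v" unfolding ns_sum_def
  proof (intro sum.cong refl)
    fix u :: "'f residue_field mat22" assume "u \<in> unip_sub"
    then show "recip \<pi> v (right_transl (lift_mat u) ?y) = opr \<pi> (lift_mat u) (opr \<pi> (matrix_inv n_s) v)"
      using HomD(4)[OF recip_Hom[OF v] _ y, of "lift_mat u"] v
      by (simp add: univ_simps lift_mat_GL2 unip_sub_GL2 recip_opr_univ_vec)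
  qed
  finally show ?thesis .
qed

lemma recip_e_char:
  assumes v: "v \<in> invs" shows "recip \<pi> v (e_char chi univ_vec) = char_proj chi v"
proof -
  let ?n = "inverse (of_nat (card (diag_sub :: 'f residue_field mat22 set))) :: 'c"
  let ?y = "\<lambda>h. right_transl (lift_mat h) univ_vec :: 'f mat22 \<Rightarrow> 'c"
  have y: "?y h \<in> vecs univ_rep" if "h \<in> diag_sub" for h
    using that by (intro right_transl_univ_vec lift_mat_GL2 diag_sub_GL2)
  have "recip \<pi> v (e_char chi univ_vec) = recip \<pi> v (\<Sum>h\<in>diag_sub. scl univ_rep (?n * inverse (chi h)) (?y h))"
    by (simp add: e_char UG.char_proj_def univ_simps)
  also have "\<dots> = (\<Sum>h\<in>diag_sub. recip \<pi> v (scl univ_rep (?n * inverse (chi h)) (?y h)))"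
    by (rule Hom_linear(4)[OF recip_Hom[OF v] univ.vs is_rep_subspace[OF is_rep_univ]]) (intro univ.vecs_closed(3) y)
  also have "\<dots> = char_proj chi v" unfolding char_proj_def
  proof (intro sum.cong refl)
    fix h :: "'f residue_field mat22" assume h: "h \<in> diag_sub"
    show "recip \<pi> v (scl univ_rep (?n * inverse (chi h)) (?y h)) = scl \<pi> (?n * inverse (chi h)) (opr \<pi> (lift_mat h) v)"
      using HomD(3)[OF recip_Hom[OF v] y[OF h]] recip_opr_univ_vec[OF v lift_mat_GL2[OF diag_sub_GL2[OF h]]] by simp
  qed
  finally show ?thesis .
qed

lemma recip_T_Pi:
  assumes v: "v \<in> invs"
  shows "recip \<pi> v (T_Pi univ_vec) = opr \<pi> (matrix_inv Pi_mat) v"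
    "recip \<pi> v (T_Pi_inv univ_vec) = opr \<pi> Pi_mat v"
    "h \<in> diag_sub \<Longrightarrow> recip \<pi> v (T_diag h univ_vec) = opr \<pi> (lift_mat h) v"
  using v by (simp_all add: T_Pi T_Pi_inv T_diag recip_opr_univ_vec lift_mat_GL2 diag_sub_GL2)

end

section \<open>Generation of the Hecke algebra\<close>

text \<open>The double coset of \<open>diag(1, (-unif)\<^sup>n)\<close> modulo \<open>I\<^sub>1\<close>.\<close>

definition double_coset :: "nat \<Rightarrow> 'f::nonarch_local_field mat22 set" where
  "double_coset n = {z. z $ 1 $ 1 - 1 \<in> max_ideal \<and> z $ 1 $ 2 \<in> int_ring \<and> z $ 2 $ 1 \<in> max_ideal
    \<and> det z / (- unif) ^ n - 1 \<in> max_ideal}"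

lemma double_coset_0: "double_coset 0 = pro_p_iwahori"
proof (rule Set.set_eqI)
  fix z :: "'a mat22"
  have "z $ 2 $ 2 - 1 \<in> max_ideal \<longleftrightarrow> det z - 1 \<in> max_ideal"
    if z: "z $ 1 $ 1 - 1 \<in> max_ideal" "z $ 1 $ 2 \<in> int_ring" "z $ 2 $ 1 \<in> max_ideal"
  proof
    assume "z $ 2 $ 2 - 1 \<in> max_ideal"
    then have "z $ 1 $ 1 * z $ 2 $ 2 - 1 - z $ 1 $ 2 * z $ 2 $ 1 \<in> max_ideal"
      using z by (intro pow_ideal_diff[OF one_plus_mult pow_ideal_mult_r])
    then show "det z - 1 \<in> max_ideal" by (simp add: det_2 algebra_simps)
  next
    assume d: "det z - 1 \<in> max_ideal"
    have nz: "z $ 1 $ 1 \<noteq> 0" using one_plus_max_ideal(2)[OF z(1)] .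
    have "(det z - 1) + z $ 1 $ 2 * z $ 2 $ 1 \<in> max_ideal"
      using d z by (intro pow_ideal_add pow_ideal_mult_r)
    then have "(det z + z $ 1 $ 2 * z $ 2 $ 1) - 1 \<in> max_ideal" by (simp add: algebra_simps)
    then have "(det z + z $ 1 $ 2 * z $ 2 $ 1) * inverse (z $ 1 $ 1) - 1 \<in> max_ideal"
      using z(1) by (intro one_plus_mult one_plus_inverse)
    then show "z $ 2 $ 2 - 1 \<in> max_ideal" using nz by (simp add: det_2 field_simps)
  qed
  then show "z \<in> double_coset 0 \<longleftrightarrow> z \<in> pro_p_iwahori"
    by (auto simp: double_coset_def pro_p_iwahori_iff)
qed

text \<open>Elimination with pivot at \<open>(1, 1)\<close>: that entry lies in
  \<open>1 + max_ideal\<close>, so both triangular factors lie in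
  \<open>pro_p_iwahori\<close>.\<close>

lemma double_coset_factor:
  assumes z: "z \<in> double_coset n"
  shows "\<exists>k\<in>pro_p_iwahori. \<exists>l\<in>pro_p_iwahori. z = k ** mat22 1 0 0 ((- unif) ^ n) ** l"
proof -
  let ?a = "z $ 1 $ 1"
  have a: "?a \<noteq> 0" "inverse ?a - 1 \<in> max_ideal" "inverse ?a \<in> int_ring"
    using z one_plus_max_ideal[of ?a] one_plus_inverse[of ?a] one_plus_max_ideal[of "inverse ?a"]
    by (auto simp: double_coset_def)
  let ?k = "mat22 1 0 (z $ 2 $ 1 * inverse ?a) 1"
  let ?l = "mat22 ?a (z $ 1 $ 2) 0 (det z / (- unif) ^ n * inverse ?a)"
  have "?k \<in> pro_p_iwahori" using z a
    by (auto simp: pro_p_iwahori_iff double_coset_def intro: pow_ideal_mult_l)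
  moreover have "?l \<in> pro_p_iwahori" using z one_plus_mult[OF _ a(2), of "det z / (- unif) ^ n"]
    by (simp add: pro_p_iwahori_iff double_coset_def)
  moreover have "z = ?k ** mat22 1 0 0 ((- unif) ^ n) ** ?l"
    using a(1) by (simp add: mat22_mult) (simp add: mat22_eq_iff det_2 field_simps)
  ultimately show ?thesis by blast
qed

definition ind :: "'a set \<Rightarrow> 'a \<Rightarrow> 'c::field" where
  "ind A x = (if x \<in> A then 1 else 0)"

text \<open>Combines \<open>T_Pi\<close> and \<open>T_n_s\<close>. The product of the inverses of
  \<open>n_s\<close> and \<open>Pi_mat\<close> is diagonal, and the lifts \<open>unit_lift t\<close>
  permit a computation that \<open>lift_mat\<close> would hide.\<close>

lemma ns_sum_Pi_eq:
  fixes f :: "'f::nonarch_local_field mat22 \<Rightarrow> 'c::field"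
  assumes f: "f \<in> UG.invs"
  shows "UG.ns_sum (right_transl (matrix_inv Pi_mat) f) z
    = (\<Sum>t\<in>UNIV. f (z ** mat22 1 (unit_lift t) 0 1 ** mat22 1 0 0 (- inverse unif)))"
proof -
  define y where "y = right_transl (matrix_inv n_s) (right_transl (matrix_inv Pi_mat) f)"
  have "right_transl (matrix_inv Pi_mat) f \<in> UG.invs" using UG.Pi_invs(2)[OF f] by (simp add: univ_simps)
  then have y: "y \<in> UG.invs1" unfolding y_def
    using UG.invs1_opr[OF max_compact_inv[OF n_s_max_compact] UG.invs_invs1] by (simp add: univ_simps)
  have inj: "inj (\<lambda>t :: 'f residue_field. mat22 1 t 0 1)" by (auto simp: inj_def mat22_eq_iff)
  have lu: "mat22 1 (unit_lift t) 0 1 \<in> max_compact" "reduction (mat22 1 (unit_lift t) 0 1) = mat22 1 t 0 1" for t :: "'f residue_field"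
    using unit_lift[of t] by (auto simp: max_compact_iff forall_2 mat22_eq_iff)
  have m: "mat22 1 t 0 1 \<in> GL2" for t :: "'f residue_field" by (simp add: GL2_iff)
  have "UG.ns_sum (right_transl (matrix_inv Pi_mat) f) = (\<Sum>u\<in>unip_sub. right_transl (lift_mat u) y)"
    by (simp add: UG.ns_sum_def univ_simps y_def)
  also have "\<dots> = (\<Sum>t\<in>UNIV. right_transl (lift_mat (mat22 1 t 0 1)) y)"
    unfolding unip_sub_eq by (subst sum.reindex[OF inj]) simp
  also have "\<dots> = (\<Sum>t\<in>UNIV. right_transl (mat22 1 (unit_lift t) 0 1) y)"
    using UG.invs1_reduction[OF lift_mat(1)[OF m] lu(1) _ y] lift_mat(2)[OF m] lu(2)
    by (simp add: univ_simps)
  finally have "UG.ns_sum (right_transl (matrix_inv Pi_mat) f) z = (\<Sum>t\<in>UNIV. right_transl (mat22 1 (unit_lift t) 0 1) y z)"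
    by (simp add: sum_fun_apply)
  also have "\<dots> = (\<Sum>t\<in>UNIV. f (z ** mat22 1 (unit_lift t) 0 1 ** mat22 1 0 0 (- inverse unif)))"
    unfolding Pi_n_s_inv[symmetric] y_def right_transl_def by (simp add: matrix_mul_assoc)
  finally show ?thesis .
qed

text \<open>The summation index is forced by the residue of the \<open>(1, 2)\<close> entry. Each
  point of the next double coset is therefore met exactly once, so no multiplicity that vanishes in
  characteristic \<open>p\<close> can occur.\<close>

lemma double_coset_step:
  "z ** mat22 1 (unit_lift t) 0 1 ** mat22 1 0 0 (- inverse unif) \<in> double_coset n
    \<longleftrightarrow> z \<in> double_coset (Suc n) \<and> t = - residue (z $ 1 $ 2)"
proof -
  let ?y = "z ** mat22 1 (unit_lift t) 0 1 ** mat22 1 0 0 (- inverse unif)"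
  let ?s = "unit_lift t"
  have e: "?y $ 1 $ 1 = z $ 1 $ 1" "?y $ 2 $ 1 = z $ 2 $ 1"
    "?y $ 1 $ 2 = - ((z $ 1 $ 1 * ?s + z $ 1 $ 2) / unif)"
    "det ?y / (- unif) ^ n = det z / (- unif) ^ Suc n"
    by (simp_all add: mat22_mult_nth det_mul field_simps)
  have "- ((z $ 1 $ 1 * ?s + z $ 1 $ 2) / unif) \<in> int_ring \<longleftrightarrow> z $ 1 $ 2 \<in> int_ring \<and> t = - residue (z $ 1 $ 2)"
    if a: "z $ 1 $ 1 - 1 \<in> max_ideal"
  proof -
    have "- ((z $ 1 $ 1 * ?s + z $ 1 $ 2) / unif) \<in> int_ring \<longleftrightarrow> (z $ 1 $ 1 * ?s + z $ 1 $ 2) \<in> max_ideal"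
      unfolding max_ideal_div_unif using pow_ideal_minus by fastforce
    also have "\<dots> \<longleftrightarrow> ?s + z $ 1 $ 2 \<in> max_ideal"
    proof -
      have m: "(z $ 1 $ 1 - 1) * ?s \<in> max_ideal" using a unit_lift(1) by (rule pow_ideal_mult_l)
      have 1: "z $ 1 $ 1 * ?s + z $ 1 $ 2 = (z $ 1 $ 1 - 1) * ?s + (?s + z $ 1 $ 2)"
        and 2: "?s + z $ 1 $ 2 = (z $ 1 $ 1 * ?s + z $ 1 $ 2) - (z $ 1 $ 1 - 1) * ?s"
        by (simp_all add: algebra_simps)
      show ?thesis using pow_ideal_add[OF m, of "?s + z $ 1 $ 2"] pow_ideal_diff[OF _ m, of "z $ 1 $ 1 * ?s + z $ 1 $ 2"]
        unfolding 1[symmetric] 2[symmetric] by blast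
    qed
    also have "\<dots> \<longleftrightarrow> z $ 1 $ 2 \<in> int_ring \<and> t = - residue (z $ 1 $ 2)"
    proof -
      have "z $ 1 $ 2 \<in> int_ring" if "?s + z $ 1 $ 2 \<in> max_ideal"
        using pow_ideal_diff[OF pow_ideal_0D[OF that] unit_lift(1)[of t]] by simp
      moreover have "?s + z $ 1 $ 2 \<in> max_ideal \<longleftrightarrow> t = - residue (z $ 1 $ 2)" if "z $ 1 $ 2 \<in> int_ring"
        using residue_eq_0_iff[OF pow_ideal_add[OF unit_lift(1)[of t] that]] unit_lift[of t] that
        by (simp add: residue_add eq_neg_iff_add_eq_0)
      ultimately show ?thesis by blast
    qed
    finally show ?thesis .
  qed
  then show ?thesis unfolding double_coset_def mem_Collect_eq e by blast
qed

lemma ns_sum_Pi_ind: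
  assumes g: "g \<in> GL2" and f: "(ind {x. g ** x \<in> double_coset n} :: 'f::nonarch_local_field mat22 \<Rightarrow> 'c::field) \<in> UG.invs"
  shows "UG.ns_sum (right_transl (matrix_inv Pi_mat) (ind {x. g ** x \<in> double_coset n}))
    = (ind {x. g ** x \<in> double_coset (Suc n)} :: 'f mat22 \<Rightarrow> 'c)"
proof
  fix z :: "'f mat22"
  have "UG.ns_sum (right_transl (matrix_inv Pi_mat) (ind {x. g ** x \<in> double_coset n})) z
    = (\<Sum>t\<in>UNIV. if t = - residue ((g ** z) $ 1 $ 2) then ind {x. g ** x \<in> double_coset (Suc n)} z else (0 :: 'c))"
    unfolding ns_sum_Pi_eq[OF f]
    by (intro sum.cong refl) (use double_coset_step[of "g ** z"] in \<open>auto simp: ind_def matrix_mul_assoc\<close>)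
  then show "UG.ns_sum (right_transl (matrix_inv Pi_mat) (ind {x. g ** x \<in> double_coset n})) z
    = (ind {x. g ** x \<in> double_coset (Suc n)} z :: 'c)" by simp
qed

text \<open>Multiplying by \<open>Pi_mat\<close> on one or both sides moves an entry of minimal valuation to the
  position \<open>(1, 1)\<close>, with all entries of the other column divisible by it and the entry below it
  divisible by \<open>unif\<close> times it.\<close>

lemma pivot:
  fixes z :: "'f::nonarch_local_field mat22"
  assumes z: "z \<in> GL2"
  shows "\<exists>g\<in>{mat 1, Pi_mat}. \<exists>r\<in>{mat 1, Pi_mat}. (g ** z ** r) $ 1 $ 1 \<noteq> 0
    \<and> (g ** z ** r) $ 1 $ 2 / (g ** z ** r) $ 1 $ 1 \<in> int_ring
    \<and> (g ** z ** r) $ 2 $ 1 / (g ** z ** r) $ 1 $ 1 \<in> max_ideal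
    \<and> (g ** z ** r) $ 2 $ 2 / (g ** z ** r) $ 1 $ 1 \<in> int_ring"
proof -
  \<comment> \<open>The case where an entry of minimal valuation is already in the first column:
    either it can be taken at \<open>(1, 1)\<close> with the entry below strictly more divisible, or
    left multiplication by \<open>Pi_mat\<close> brings the lower entry up.\<close>
  have col: "\<exists>g\<in>{mat 1, Pi_mat}. (g ** y) $ 1 $ 1 \<noteq> 0
    \<and> (g ** y) $ 1 $ 2 / (g ** y) $ 1 $ 1 \<in> int_ring
    \<and> (g ** y) $ 2 $ 1 / (g ** y) $ 1 $ 1 \<in> max_ideal
    \<and> (g ** y) $ 2 $ 2 / (g ** y) $ 1 $ 1 \<in> int_ring"
    if nz: "y $ i $ 1 \<noteq> 0" and min: "\<And>k l. y $ k $ l / y $ i $ 1 \<in> int_ring" for y :: "'f mat22" and i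
  proof (cases "y $ 1 $ 1 \<noteq> 0 \<and> y $ 2 $ 1 / y $ 1 $ 1 \<in> max_ideal")
    case True
    have "y $ i $ 1 / y $ 1 $ 1 \<in> int_ring"
      using True exhaust_2[of i] pow_ideal_0D[of "y $ 2 $ 1 / y $ 1 $ 1" 1] by auto
    then have "y $ k $ l / y $ 1 $ 1 \<in> int_ring" for k l
      using int_ring_mult[OF min[of k l], of "y $ i $ 1 / y $ 1 $ 1"] nz by simp
    then show ?thesis using True by (intro bexI[of _ "mat 1"]) auto
  next
    case False
    have c: "y $ 2 $ 1 \<noteq> 0 \<and> (\<forall>k l. y $ k $ l / y $ 2 $ 1 \<in> int_ring)"
    proof (cases "i = 2")
      case True
      then show ?thesis using nz min by auto
    next
      case i: False
      then have i1: "i = 1" using exhaust_2 by auto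
      then have "y $ 2 $ 1 / y $ 1 $ 1 \<in> int_ring" "y $ 2 $ 1 / y $ 1 $ 1 \<notin> max_ideal"
        using min[of 2 1] False nz by auto
      then have inv: "inverse (y $ 2 $ 1 / y $ 1 $ 1) \<in> int_ring" "y $ 2 $ 1 \<noteq> 0"
        by (rule unit_inverse) (use \<open>y $ 2 $ 1 / y $ 1 $ 1 \<notin> max_ideal\<close> in auto)
      then have "y $ k $ l / y $ 2 $ 1 \<in> int_ring" for k l
        using int_ring_mult[OF min[of k l] inv(1)] nz unfolding i1 by simp
      then show ?thesis using inv(2) by blast
    qed
    have P: "(Pi_mat ** y) $ 1 $ 1 = y $ 2 $ 1" "(Pi_mat ** y) $ 1 $ 2 = y $ 2 $ 2"
      "(Pi_mat ** y) $ 2 $ 1 = unif * y $ 1 $ 1" "(Pi_mat ** y) $ 2 $ 2 = unif * y $ 1 $ 2"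
      by (simp_all add: Pi_mat_def mat22_mult_nth)
    have "unif * (y $ 1 $ 1 / y $ 2 $ 1) \<in> max_ideal" "unif * (y $ 1 $ 2 / y $ 2 $ 1) \<in> max_ideal"
      using c by (simp_all only: unif_mult_max_ideal)
    then show ?thesis using c by (intro bexI[of _ Pi_mat]) (auto simp: P intro: pow_ideal_0D)
  qed
  \<comment> \<open>Only nonzero entries compete for minimal valuation, because \<open>val 0\<close>
    carries no meaning.\<close>
  define S where "S = {q :: 2 \<times> 2. z $ fst q $ snd q \<noteq> 0}"
  have "(1, 1) \<in> S \<or> (1, 2) \<in> S" using z by (auto simp: S_def GL2_iff det_2)
  then have "S \<noteq> {}" by blast
  then obtain p where p: "p \<in> S" "\<And>q. q \<in> S \<Longrightarrow> val (z $ fst p $ snd p) \<le> val (z $ fst q $ snd q)"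
    using ex_is_arg_min_if_finite[of S "\<lambda>q. val (z $ fst q $ snd q)"] by (force simp: is_arg_min_linorder)
  obtain i j where ij: "p = (i, j)" by (cases p)
  have nz: "z $ i $ j \<noteq> 0" using p(1) by (simp add: S_def ij)
  have min: "z $ k $ l / z $ i $ j \<in> int_ring" for k l
    using p(2)[of "(k, l)"] nz by (cases "z $ k $ l = 0") (auto simp: S_def ij pow_ideal_def val_divide)
  \<comment> \<open>An admissible entry in the first column is preferred. Failing that, all of the
    first column is strictly more divisible than the pivot in the second, so exchanging columns by
    \<open>Pi_mat\<close> keeps the quotients integral.\<close>
  show ?thesis
  proof (cases "j = 1 \<or> (\<exists>k. z $ k $ 1 \<noteq> 0 \<and> (\<forall>l m. z $ l $ m / z $ k $ 1 \<in> int_ring))")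
    case True
    then obtain k where "z $ k $ 1 \<noteq> 0" "\<And>l m. z $ l $ m / z $ k $ 1 \<in> int_ring" using nz min by blast
    from col[OF this] show ?thesis by (elim bexE, rule_tac x = g in bexI, rule_tac x = "mat 1" in bexI) simp_all
  next
    case False
    then have j: "j = 2" using exhaust_2 by auto
    have c1: "z $ k $ 1 / z $ i $ 2 \<in> max_ideal" for k
    proof (rule ccontr)
      assume n: "z $ k $ 1 / z $ i $ 2 \<notin> max_ideal"
      have inv: "inverse (z $ k $ 1 / z $ i $ 2) \<in> int_ring" "z $ k $ 1 \<noteq> 0"
        using unit_inverse[OF min[of k 1, unfolded j] n] n by auto
      then have "z $ l $ m / z $ k $ 1 \<in> int_ring" for l m
        using int_ring_mult[OF min[of l m] inv(1)] nz unfolding j by simp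
      then show False using False inv(2) by blast
    qed
    have P: "(z ** Pi_mat) $ k $ 1 = z $ k $ 2 * unif" "(z ** Pi_mat) $ k $ 2 = z $ k $ 1" for k
      by (simp_all add: Pi_mat_def mat22_mult_nth)
    have "(z ** Pi_mat) $ k $ l / (z ** Pi_mat) $ i $ 1 \<in> int_ring" for k l
    proof (cases "l = 1")
      case True
      then show ?thesis using min[of k 2] by (simp add: P j)
    next
      case l: False
      then have "l = 2" using exhaust_2 by auto
      then show ?thesis using c1[of k] nz by (simp add: P j max_ideal_div_unif)
    qed
    moreover have "(z ** Pi_mat) $ i $ 1 \<noteq> 0" using nz by (simp add: P j)
    ultimately show ?thesis using col[of "z ** Pi_mat" i] by (auto simp: matrix_mul_assoc)
  qed
qed

text \<open>After \<open>pivot\<close>, a power of \<open>unif\<close> makes the leading entry a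
  unit, and an element of \<open>H\<close> then makes this entry, and the unit part of the
  determinant, congruent to 1.\<close>

lemma double_coset_decomposition:
  fixes z :: "'f::nonarch_local_field mat22"
  assumes z: "z \<in> GL2"
  shows "\<exists>g\<in>{mat 1, Pi_mat}. \<exists>r\<in>{mat 1, Pi_mat}. \<exists>m n. \<exists>h\<in>diag_sub.
    g ** z ** r ** mat (unif powi m) ** lift_mat h \<in> double_coset n"
proof -
  obtain g r where gr: "g \<in> {mat 1, Pi_mat}" "r \<in> {mat 1, Pi_mat}" and a: "(g ** z ** r) $ 1 $ 1 \<noteq> 0"
    "(g ** z ** r) $ 1 $ 2 / (g ** z ** r) $ 1 $ 1 \<in> int_ring"
    "(g ** z ** r) $ 2 $ 1 / (g ** z ** r) $ 1 $ 1 \<in> max_ideal"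
    "(g ** z ** r) $ 2 $ 2 / (g ** z ** r) $ 1 $ 1 \<in> int_ring"
    using pivot[OF z] by blast
  define y where "y = g ** z ** r"
  have yGL: "y \<in> GL2" using gr z by (auto simp: y_def)
  define m where "m = val (y $ 1 $ 1)"
  define x where "x = y ** mat (unif powi (- m))"
  have x: "x $ i $ j = unif powi (- m) * y $ i $ j" for i j
    unfolding x_def scalar_commute by simp
  define u where "u = x $ 1 $ 1"
  have u: "u \<noteq> 0" "val u = 0" "u \<in> int_ring" "u \<notin> max_ideal"
    using a(1) by (auto simp: u_def x y_def[symmetric] val_mult val_unif_powi m_def pow_ideal_def)
  have xq: "x $ i $ j = u * (y $ i $ j / y $ 1 $ 1)" for i j
    using a(1) by (simp add: u_def x y_def)
  have xi: "x $ 1 $ 2 \<in> int_ring" "x $ 2 $ 1 \<in> max_ideal" "x $ 2 $ 2 \<in> int_ring"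
    unfolding xq using a by (auto intro: int_ring_mult[OF u(3)] pow_ideal_mult_r[OF u(3)] simp: y_def simp del: times_divide_eq_right)
  have di: "det x \<in> int_ring" unfolding det_2 using xi u(3) pow_ideal_0D[OF xi(2)]
    by (auto simp: u_def intro!: pow_ideal_diff int_ring_mult)
  have dn: "det x \<noteq> 0" using yGL by (simp add: x_def det_mul GL2_iff)
  \<comment> \<open>The other entries of the scaled matrix are integral, so its determinant has
    valuation at least 0, and this valuation labels the double coset.\<close>
  define n where "n = nat (val (det x))"
  have vn: "val ((- unif) ^ n :: 'f) = int n"
    by (induction n) (auto simp: val_mult val_unif)
  define e where "e = det x / (- unif) ^ n"
  have e: "e \<noteq> 0" "val e = 0" using di dn vn by (auto simp: e_def val_divide n_def pow_ideal_def)
  then have ei: "e \<in> int_ring" "e \<notin> max_ideal" by (auto simp: pow_ideal_def)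
  have ru: "residue u \<noteq> 0" "residue e \<noteq> 0" using u e ei by (simp_all add: residue_eq_0_iff)
  \<comment> \<open>The first entry inverts the residue of the pivot \<open>u\<close>; the second
    makes \<open>det h\<close> the inverse of the residue of \<open>e\<close>.\<close>
  define h where "h = mat22 (inverse (residue u)) 0 0 (residue u * inverse (residue e))"
  have h: "h \<in> diag_sub" using ru by (simp add: h_def diag_sub_eq)
  let ?l = "lift_mat h"
  have l: "?l \<in> max_compact" "reduction ?l = h" using h by (auto simp: lift_mat diag_sub_GL2)
  have li: "?l $ i $ j \<in> int_ring" for i j using l(1) by (rule max_compact_nth)
  have lr: "residue (?l $ i $ j) = h $ i $ j" for i j using l(2) by (metis reduction_nth)
  have l0: "?l $ 2 $ 1 \<in> max_ideal" using lr[of 2 1] li[of 2 1] by (simp add: h_def residue_eq_0_iff)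
  have dl: "det ?l \<in> int_ring" "residue (det ?l) = inverse (residue e)"
  proof -
    show "det ?l \<in> int_ring" using l(1) by (simp add: max_compact_iff pow_ideal_def)
    have "det h = inverse (residue e)" using ru by (simp add: h_def)
    then show "residue (det ?l) = inverse (residue e)" using det_reduction[OF l(1)] l(2) by metis
  qed
  have "x ** ?l \<in> double_coset n"
    unfolding double_coset_def mem_Collect_eq
  proof (intro conjI)
    have "residue (x $ 1 $ 1 * ?l $ 1 $ 1) = 1"
      using u(3) li ru lr by (simp add: residue_mult u_def[symmetric] h_def)
    then have "x $ 1 $ 1 * ?l $ 1 $ 1 - 1 \<in> max_ideal"
      using u(3) li by (subst residue_eq_1_iff[symmetric]) (auto simp: u_def intro: int_ring_mult)
    then have "(x $ 1 $ 1 * ?l $ 1 $ 1 - 1) + x $ 1 $ 2 * ?l $ 2 $ 1 \<in> max_ideal"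
      using xi l0 by (intro pow_ideal_add pow_ideal_mult_r)
    then show "(x ** ?l) $ 1 $ 1 - 1 \<in> max_ideal" by (simp add: mat22_mult_nth algebra_simps)
    show "(x ** ?l) $ 1 $ 2 \<in> int_ring" using u(3) xi li
      by (auto simp: mat22_mult_nth u_def intro!: pow_ideal_add int_ring_mult)
    show "(x ** ?l) $ 2 $ 1 \<in> max_ideal" using xi li l0
      by (auto simp: mat22_mult_nth intro!: pow_ideal_add pow_ideal_mult_l[of "x $ 2 $ 1"] pow_ideal_mult_r[of "x $ 2 $ 2"])
    have "det (x ** ?l) / (- unif) ^ n = e * det ?l" by (simp add: det_mul e_def)
    moreover have "residue (e * det ?l) = 1" using ei dl ru by (simp add: residue_mult)
    ultimately show "det (x ** ?l) / (- unif) ^ n - 1 \<in> max_ideal"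
      using residue_eq_1_iff[OF int_ring_mult[OF ei(1) dl(1)]] by simp
  qed
  then show ?thesis using gr h unfolding x_def y_def by blast
qed

text \<open>Generation of the algebra as an induction rule. Indicators of the double cosets of
  diag(1, (-unif)^n) come from \<open>univ_vec\<close> by repeating \<open>T_Pi\<close> and
  \<open>T_n_s\<close>, all others by translations normalising \<open>I\<^sub>1\<close>, and these
  indicators span the invariant functions.\<close>

lemma hecke_induct:
  fixes P :: "('f::nonarch_local_field, 'c::field) hecke_elt \<Rightarrow> bool"
  assumes T: "T \<in> hecke"
    and one: "P hecke_one" and gens: "P T_Pi" "P T_Pi_inv" "P T_n_s" "\<And>h. h \<in> diag_sub \<Longrightarrow> P (T_diag h)"
    and add: "\<And>S T. S \<in> hecke \<Longrightarrow> T \<in> hecke \<Longrightarrow> P S \<Longrightarrow> P T \<Longrightarrow> P (S + T)"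
    and scl: "\<And>c T. T \<in> hecke \<Longrightarrow> P T \<Longrightarrow> P (pointwise (pointwise (*)) c T)"
    and comp: "\<And>S T. S \<in> hecke \<Longrightarrow> T \<in> hecke \<Longrightarrow> P S \<Longrightarrow> P T \<Longrightarrow> P (S \<circ> T)"
  shows "P T"
proof -
  \<comment> \<open>Moves the claim from operators to the vectors \<open>T univ_vec\<close>, whose
    supports and translates can be computed.\<close>
  define Q where "Q f \<longleftrightarrow> f \<in> UG.invs \<and> P (hecke_of_vec f)" for f :: "'f mat22 \<Rightarrow> 'c"
  have Q_hecke: "Q (T univ_vec)" if "T \<in> hecke" "P T" for T
    using that hecke_univ_vec hecke_eq_of_vec[OF that(1)] by (simp add: Q_def)
  have Q_comp: "Q (recip univ_rep f (T univ_vec))" if "Q f" "T \<in> hecke" "P T" for f T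
    using Q_hecke[of "hecke_of_vec f \<circ> T"] comp[of "hecke_of_vec f" T] hecke_comp[of "hecke_of_vec f" T]
      hecke_of_vec[of f] that by (simp add: Q_def)
  have Q_add: "Q (f + f')" if "Q f" "Q f'" for f f'
    using Q_hecke[of "hecke_of_vec f + hecke_of_vec f'"] add[of "hecke_of_vec f" "hecke_of_vec f'"]
      hecke_add[of "hecke_of_vec f" "hecke_of_vec f'"] hecke_of_vec[of f] hecke_of_vec[of f'] that
    by (simp add: Q_def)
  have Q_scl: "Q (pointwise (*) c f)" if "Q f" for f c
    using Q_hecke[of "pointwise (pointwise (*)) c (hecke_of_vec f)"] scl[of "hecke_of_vec f" c]
      hecke_scl[of "hecke_of_vec f" c] hecke_of_vec[of f] that
    by (simp add: Q_def pointwise_def)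
  have QD: "f \<in> UG.invs" if "Q f" for f using that by (simp add: Q_def)
  have Q_Pi: "Q (right_transl (matrix_inv Pi_mat) f)" "Q (right_transl Pi_mat f)" if "Q f" for f
    using Q_comp[OF that T_Pi(1) gens(1)] Q_comp[OF that T_Pi_inv(1) gens(2)] UG.recip_T_Pi[OF QD[OF that]]
    by (simp_all add: univ_simps)
  have Q_ns: "Q (UG.ns_sum f)" if "Q f" for f
    using Q_comp[OF that T_n_s(1) gens(3)] UG.recip_T_n_s[OF QD[OF that]] by simp
  have Q_diag: "Q (right_transl (lift_mat h) f)" if "Q f" "h \<in> diag_sub" for f h
    using Q_comp[OF that(1) T_diag(1) gens(4)] UG.recip_T_Pi(3)[OF QD[OF that(1)]] that(2) by (simp add: univ_simps)
  have Q_unif: "Q (right_transl (mat (unif powi m)) f)" if f: "Q f" for m :: int and f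
  proof (induction m rule: int_induct[of _ 0])
    case base
    show ?case using f by simp
  next
    case (step1 i)
    have "Q (right_transl Pi_mat (right_transl Pi_mat (right_transl (mat (unif powi i)) f)))"
      using step1 by (intro Q_Pi)
    then show ?case by (simp add: right_transl_mult Pi_square matrix_mul_assoc power_int_add mult.commute)
  next
    case (step2 i)
    have e: "matrix_inv Pi_mat ** matrix_inv Pi_mat = (mat (inverse unif) :: 'f mat22)"
      using matrix_inv_mult[of Pi_mat "Pi_mat :: 'f mat22"] by (simp add: Pi_square matrix_inv_scalar)
    have "Q (right_transl (matrix_inv Pi_mat) (right_transl (matrix_inv Pi_mat) (right_transl (mat (unif powi i)) f)))"
      using step2 by (intro Q_Pi)
    then show ?case by (simp add: right_transl_mult e matrix_mul_assoc power_int_diff field_simps)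
  qed
  have Q_one: "Q univ_vec" using Q_hecke[OF hecke_one one] by (simp add: hecke_one_def univ_vec_in)
  have Q_ind: "Q (ind {x. g ** x \<in> double_coset n})" if g: "g \<in> {mat 1, Pi_mat}" for g n
  proof (induction n)
    case 0
    \<comment> \<open>Since \<open>Pi_mat\<close> normalises \<open>I\<^sub>1\<close>, left
      multiplication by it in the base case becomes a right translation of
      \<open>univ_vec\<close>.\<close>
    have 1: "Pi_mat ** x \<in> pro_p_iwahori \<longleftrightarrow> x ** Pi_mat \<in> pro_p_iwahori" for x :: "'f mat22"
      using Pi_conj_pro_p'[of "Pi_mat ** x"] by (simp add: matrix_mul_assoc)
    have "ind {x. g ** x \<in> double_coset 0} = univ_vec \<or> ind {x. g ** x \<in> double_coset 0} = right_transl Pi_mat univ_vec"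
      using g by (auto simp: double_coset_0 ind_def univ_vec_def right_transl_def 1)
    then show ?case using Q_one Q_Pi(2)[OF Q_one] by metis
  next
    case (Suc n)
    have "g \<in> GL2" using g by auto
    then show ?case using Q_ns[OF Q_Pi(1)[OF Suc]] ns_sum_Pi_ind[OF _ QD[OF Suc]] by simp
  qed
  \<comment> \<open>Conjugation by such an \<open>s\<close> preserves \<open>I\<^sub>1\<close>, so
    translating by \<open>s\<close> keeps a function constant on double cosets.\<close>
  define nrm where "nrm s \<longleftrightarrow> s \<in> GL2 \<and> (\<forall>k\<in>pro_p_iwahori. s ** k ** matrix_inv s \<in> pro_p_iwahori)" for s :: "'f mat22"
  have nrm_mult: "nrm (s ** t)" if "nrm s" "nrm t" for s t
  proof -
    have "s ** t ** k ** matrix_inv (s ** t) = s ** (t ** k ** matrix_inv t) ** matrix_inv s" for k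
      using that by (simp add: nrm_def matrix_inv_mult matrix_mul_assoc)
    then show ?thesis using that by (simp add: nrm_def)
  qed
  have nrm_g: "nrm g" "nrm (matrix_inv g)" if "g \<in> {mat 1, Pi_mat}" for g
    using that by (auto simp: nrm_def Pi_conj_pro_p Pi_conj_pro_p')
  have nrm_scalar: "nrm (mat (unif powi m))" for m
  proof -
    have "mat (unif powi m) ** k ** matrix_inv (mat (unif powi m)) = k" for k :: "'f mat22"
      by (simp flip: scalar_commute)
    then show ?thesis by (simp add: nrm_def)
  qed
  have nrm_h: "nrm (lift_mat h)" if "h \<in> diag_sub" for h
    using iwahori_conj[OF iwahori_inv[OF lift_diag_iwahori[OF that]]] that
    by (auto simp: nrm_def lift_mat_GL2 diag_sub_GL2)
  \<comment> \<open>Every point lies in a set \<open>B\<close> whose indicator is available and on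
    which every invariant function is constant.\<close>
  have cover: "\<exists>B. z \<in> B \<and> Q (ind B) \<and> (\<forall>f\<in>(UG.invs :: ('f mat22 \<Rightarrow> 'c) set). \<forall>x\<in>B. f x = f z)" if z: "z \<in> GL2" for z
  proof -
    obtain g r m n h where gr: "g \<in> {mat 1, Pi_mat}" "r \<in> {mat 1, Pi_mat}" "h \<in> diag_sub"
      and d: "g ** z ** r ** mat (unif powi m) ** lift_mat h \<in> double_coset n"
      using double_coset_decomposition[OF z] by blast
    define s where "s = r ** mat (unif powi m) ** lift_mat h"
    have s: "nrm s" unfolding s_def by (intro nrm_mult nrm_g nrm_scalar nrm_h gr)
    then have sGL: "s \<in> GL2" by (simp add: nrm_def)
    have gGL: "g \<in> GL2" using gr(1) by auto
    define B where "B = {x. g ** x ** s \<in> double_coset n}"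
    have zB: "z \<in> B" using d by (simp add: B_def s_def matrix_mul_assoc)
    have "Q (right_transl r (right_transl (mat (unif powi m)) (right_transl (lift_mat h) (ind {x. g ** x \<in> double_coset n}))))"
      using gr(2) Q_Pi(2)[OF Q_unif[OF Q_diag[OF Q_ind[OF gr(1)] gr(3)]]] Q_unif[OF Q_diag[OF Q_ind[OF gr(1)] gr(3)]] by auto
    moreover have "right_transl r (right_transl (mat (unif powi m)) (right_transl (lift_mat h) (ind {x. g ** x \<in> double_coset n}))) = (ind B :: 'f mat22 \<Rightarrow> 'c)"
      by (simp add: right_transl_def ind_def B_def s_def matrix_mul_assoc fun_eq_iff)
    ultimately have QB: "Q (ind B)" by simp
    have const: "f x = f z" if f: "f \<in> UG.invs" and x: "x \<in> B" for f :: "'f mat22 \<Rightarrow> 'c" and x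
    proof -
      let ?d = "mat22 1 0 0 ((- unif) ^ n) :: 'f mat22"
      obtain k l where kl: "k \<in> pro_p_iwahori" "l \<in> pro_p_iwahori" "g ** x ** s = k ** ?d ** l"
        using double_coset_factor x unfolding B_def by blast
      obtain k' l' where kl': "k' \<in> pro_p_iwahori" "l' \<in> pro_p_iwahori" "g ** z ** s = k' ** ?d ** l'"
        using double_coset_factor zB unfolding B_def by blast
      have gl: "k \<in> GL2" "l \<in> GL2" "k' \<in> GL2" "l' \<in> GL2" using kl kl' pro_p_iwahori_GL2 by auto
      have "?d = matrix_inv k' ** (g ** z ** s) ** matrix_inv l'" unfolding kl'(3) using gl by (simp flip: matrix_mul_assoc)
      then have "g ** x ** s = k ** (matrix_inv k' ** (g ** z ** s) ** matrix_inv l') ** l" using kl(3) by simp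
      then have "matrix_inv g ** (g ** x ** s) ** matrix_inv s
        = matrix_inv g ** (k ** (matrix_inv k' ** (g ** z ** s) ** matrix_inv l') ** l) ** matrix_inv s" by simp
      then have "x = (matrix_inv g ** (k ** matrix_inv k') ** g) ** z ** (s ** (matrix_inv l' ** l) ** matrix_inv s)"
        using gGL sGL by (simp add: matrix_mul_assoc) 
      moreover have "matrix_inv g ** (k ** matrix_inv k') ** g \<in> pro_p_iwahori"
        using nrm_g(2)[OF gr(1)] kl kl' gGL unfolding nrm_def by fastforce
      moreover have "s ** (matrix_inv l' ** l) ** matrix_inv s \<in> pro_p_iwahori"
        using s kl kl' unfolding nrm_def by blast
      ultimately obtain p q where pq: "p \<in> pro_p_iwahori" "q \<in> pro_p_iwahori" "x = p ** z ** q" by blast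
      have "f x = right_transl q f (p ** z)" by (simp add: pq right_transl_def)
      also have "right_transl q f = f" using f pq(2) by (simp add: invariants_def univ_simps)
      also have "f (p ** z) = f z" using f pq(1) z by (simp add: invariants_def univ_iff)
      finally show ?thesis .
    qed
    show ?thesis by (intro exI[of _ B] conjI ballI zB QB const)
  qed
  have "Q f" if "f \<in> UG.invs" for f
    using that
  \<comment> \<open>Subtracting the right multiple of \<open>ind B\<close> clears all of
    \<open>B\<close> from the support and adds nothing elsewhere.\<close>
  proof (induction "card {x \<in> transversal. f x \<noteq> 0}" arbitrary: f rule: less_induct)
    case less
    have fin: "finite {x \<in> transversal. f x \<noteq> 0}" using UG.invsD(1)[OF less.prems] by (rule finite_univ_support)
    show ?case
    proof (cases "\<exists>z\<in>transversal. f z \<noteq> 0")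
      case False
      then have "f x = 0" for x
        using univ_coset_rep[OF UG.invsD(1)[OF less.prems], of x] UG.invsD(1)[OF less.prems]
        by (cases "x \<in> GL2") (auto simp: transversal univ_iff)
      then have "f = pointwise (*) 0 univ_vec" by (auto simp: pointwise_def)
      then show ?thesis using Q_scl[OF Q_one] by metis
    next
      case True
      then obtain z where z: "z \<in> transversal" "f z \<noteq> 0" by blast
      then obtain B where B: "z \<in> B" "Q (ind B)" "\<forall>f\<in>(UG.invs :: ('f mat22 \<Rightarrow> 'c) set). \<forall>x\<in>B. f x = f z"
        using cover[of z] by (auto simp: transversal)
      define f' where "f' = f - pointwise (*) (f z) (ind B)"
      have f': "f' \<in> UG.invs" unfolding f'_def
        using UG.invs_closed(3)[OF QD[OF B(2)], of "f z"] less.prems UG.invs_closed(5) by (simp add: univ_simps)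
      have val: "f' x = (if x \<in> B then 0 else f x)" for x
        using B(3) less.prems by (auto simp: f'_def pointwise_def ind_def)
      have "{x \<in> transversal. f' x \<noteq> 0} \<subset> {x \<in> transversal. f x \<noteq> 0}"
        using z B(1) by (auto simp: val)
      then have "card {x \<in> transversal. f' x \<noteq> 0} < card {x \<in> transversal. f x \<noteq> 0}"
        using fin by (rule psubset_card_mono[rotated])
      then have "Q f'" using less.hyps f' by blast
      then have "Q (f' + pointwise (*) (f z) (ind B))" using Q_scl[OF B(2)] by (rule Q_add)
      then show ?thesis by (simp add: f'_def)
    qed
  qed
  then have "Q (T univ_vec)" using hecke_univ_vec[OF T] by blast
  then show ?thesis using hecke_eq_of_vec[OF T] by (simp add: Q_def)
qed

section \<open>Homomorphisms out of the module \<open>M_gamma\<close>\<close>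

lemma weyl_conj: "matrix_inv weyl_s ** h ** weyl_s = mat22 (h $ 2 $ 2) (h $ 2 $ 1) (h $ 1 $ 2) (h $ 1 $ 1)"
proof -
  have "matrix_inv weyl_s = (weyl_s :: 'a::field mat22)"
    by (rule matrix_inv_eq) (simp add: weyl_s_def mat22_eq_iff mat22_mult_nth)
  then show ?thesis by (simp add: weyl_s_def mat22_eq_iff mat22_mult_nth)
qed

lemma conj_s_eq: "conj_s chi h = chi (mat22 (h $ 2 $ 2) (h $ 2 $ 1) (h $ 1 $ 2) (h $ 1 $ 1))"
  by (simp add: conj_s_def weyl_conj)

lemma diag_char_conj_s: "diag_char chi \<Longrightarrow> diag_char (conj_s chi)"
proof -
  assume chi: "diag_char chi"
  have d: "mat22 (h $ 2 $ 2) (h $ 2 $ 1) (h $ 1 $ 2) (h $ 1 $ 1) \<in> diag_sub" if "h \<in> diag_sub" for h :: "'a mat22"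
    using that by (auto simp: diag_sub_def GL2_iff det_2)
  have "mat22 ((h ** h') $ 2 $ 2) ((h ** h') $ 2 $ 1) ((h ** h') $ 1 $ 2) ((h ** h') $ 1 $ 1)
    = mat22 (h $ 2 $ 2) (h $ 2 $ 1) (h $ 1 $ 2) (h $ 1 $ 1) ** mat22 (h' $ 2 $ 2) (h' $ 2 $ 1) (h' $ 1 $ 2) (h' $ 1 $ 1)"
    for h h' :: "'a mat22"
    by (simp add: mat22_eq_iff mat22_mult_nth add.commute)
  then show "diag_char (conj_s chi)" using chi d unfolding diag_char_def conj_s_eq by simp
qed

lemma conj_s_conj_s: "conj_s (conj_s chi) = chi"
  by (rule ext) (simp add: conj_s_eq mat22_collapse)

lemma diag_part_diag_sub: "b \<in> borel_sub \<Longrightarrow> diag_part b \<in> diag_sub"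
  by (auto simp: borel_sub_def diag_sub_def diag_part_def GL2_iff det_2)

lemma diag_part_unip:
  assumes b: "b \<in> borel_sub" shows "matrix_inv (diag_part b) ** b \<in> unip_sub"
proof -
  have g: "diag_part b \<in> GL2" using diag_part_diag_sub[OF b] by (rule diag_sub_GL2)
  have nz: "b $ 1 $ 1 \<noteq> 0" "b $ 2 $ 2 \<noteq> 0" "b \<in> GL2" "b $ 2 $ 1 = 0" using b by (auto simp: borel_sub_def GL2_iff det_2)
  have "matrix_inv (diag_part b) = mat22 (inverse (b $ 1 $ 1)) 0 0 (inverse (b $ 2 $ 2))"
    by (rule matrix_inv_eq) (use nz in \<open>simp add: diag_part_def mat22_eq_iff mat22_mult_nth\<close>)
  then show ?thesis using nz by (simp add: unip_sub_def mat22_mult_nth) (simp add: GL2_iff)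
qed

context G_rep
begin

lemma iwahori_eigen:
  assumes w: "w \<in> invs" "\<And>h. h \<in> diag_sub \<Longrightarrow> opr \<pi> (lift_mat h) w = scl \<pi> (chi h) w" and k: "k \<in> iwahori"
  shows "opr \<pi> k w = scl \<pi> (chi (diag_part (reduction k))) w"
proof -
  let ?d = "diag_part (reduction k)"
  have b: "reduction k \<in> borel_sub" "k \<in> max_compact" using k by (auto simp: iwahori_def)
  then have d: "?d \<in> diag_sub" by (intro diag_part_diag_sub)
  have l: "lift_mat ?d \<in> max_compact" "reduction (lift_mat ?d) = ?d" using d by (auto simp: lift_mat diag_sub_GL2)
  have "matrix_inv (lift_mat ?d) ** k \<in> pro_p_iwahori"
    using l b diag_part_unip[OF b(1)] by (simp add: pro_p_iwahori_def reduction_mult reduction_inv)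
  then have "opr \<pi> (matrix_inv (lift_mat ?d) ** k) w = w" using w by (simp add: invsD)
  then have "opr \<pi> (lift_mat ?d) w = opr \<pi> (lift_mat ?d) (opr \<pi> (matrix_inv (lift_mat ?d) ** k) w)" by simp
  also have "\<dots> = opr \<pi> k w"
    using l b invsD(1)[OF w(1)] by (subst opr_mult[symmetric]) (auto simp: max_compact_GL2)
  finally show ?thesis using w(2)[OF d] by simp
qed

text \<open>Conjugation by \<open>Pi_mat\<close> exchanges the diagonal entries of the lift of
  \<open>h\<close>, which turns \<open>chi\<close> into \<open>conj_s chi\<close>.\<close>

lemma Pi_eigen:
  assumes w: "w \<in> invs" "\<And>h. h \<in> diag_sub \<Longrightarrow> opr \<pi> (lift_mat h) w = scl \<pi> (chi h) w" and h: "h \<in> diag_sub"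
  shows "opr \<pi> (lift_mat h) (opr \<pi> (matrix_inv Pi_mat) w) = scl \<pi> (conj_s chi h) (opr \<pi> (matrix_inv Pi_mat) w)"
proof -
  let ?l = "lift_mat h" and ?k = "Pi_mat ** lift_mat h ** matrix_inv Pi_mat"
  have l: "?l \<in> iwahori" "reduction ?l = h" "?l \<in> max_compact"
    using h by (auto simp: lift_diag_iwahori lift_mat diag_sub_GL2)
  have li: "?l $ i $ j \<in> int_ring" for i j using l(3) by (rule max_compact_nth)
  have lr: "residue (?l $ i $ j) = h $ i $ j" for i j using l(2) by (metis reduction_nth)
  have "det ?k = det ?l" by (simp add: Pi_conj det_2 field_simps)
  then have "det ?k \<noteq> 0" "val (det ?k) = 0" using l(3) by (simp_all add: max_compact_iff)
  moreover have "?l $ 2 $ 1 / unif \<in> int_ring" "unif * ?l $ 1 $ 2 \<in> max_ideal"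
    using l(1) li[of 1 2] by (simp_all add: iwahori_iff unif_mult_max_ideal flip: max_ideal_div_unif)
  ultimately have k: "?k \<in> iwahori" unfolding iwahori_iff max_compact_iff forall_2
    using li pow_ideal_0D[of "unif * ?l $ 1 $ 2" 1] by (simp add: Pi_conj)
  have "opr \<pi> ?l (opr \<pi> (matrix_inv Pi_mat) w) = opr \<pi> (matrix_inv Pi_mat) (opr \<pi> ?k w)"
    using invsD(1)[OF w(1)] l(3) by (simp add: matrix_mul_assoc max_compact_GL2 flip: opr_mult)
  also have "\<dots> = opr \<pi> (matrix_inv Pi_mat) (scl \<pi> (chi (diag_part (reduction ?k))) w)"
    using iwahori_eigen[OF w k] by simp
  also have "diag_part (reduction ?k) = mat22 (h $ 2 $ 2) (h $ 2 $ 1) (h $ 1 $ 2) (h $ 1 $ 1)"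
    using h lr by (simp add: diag_part_def Pi_conj mat22_eq_iff diag_sub_def)
  finally show ?thesis using invsD(1)[OF w(1)] by (simp add: conj_s_eq opr_scl)
qed

text \<open>Both eigenvalues \<open>e\<close> and \<open>e'\<close> are parameters, so that the set
  can be compared with its image under \<open>Pi_mat\<close> and serves every choice of
  \<open>J\<close>.\<close>

definition hecke_eigen :: "('f residue_field mat22 \<Rightarrow> 'c) \<Rightarrow> 'c \<Rightarrow> 'c \<Rightarrow> 'v set" where
  "hecke_eigen chi e e' = {w \<in> invs. opr \<pi> (matrix_inv Pi_mat) (opr \<pi> (matrix_inv Pi_mat) w) = w
    \<and> (\<forall>h\<in>diag_sub. opr \<pi> (lift_mat h) w = scl \<pi> (chi h) w)
    \<and> ns_sum w = scl \<pi> e w \<and> ns_sum (opr \<pi> (matrix_inv Pi_mat) w) = scl \<pi> e' (opr \<pi> (matrix_inv Pi_mat) w)}"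

lemma hecke_eigen_swap:
  assumes w: "w \<in> hecke_eigen chi e e'"
  shows "opr \<pi> (matrix_inv Pi_mat) w \<in> hecke_eigen (conj_s chi) e' e"
  using w Pi_eigen[of w chi] Pi_invs(2)[of w] unfolding hecke_eigen_def by simp

text \<open>\<open>v1\<close> generates the module, \<open>v2\<close> being its image under
  \<open>T_Pi\<close>, so evaluation there is injective. Conversely a vector of the eigenspace
  prescribes a linear map, and the operators it respects are closed under the rules of
  \<open>hecke_induct\<close>, which leaves only the generators.\<close>

lemma Hom_M_gamma:
  assumes chi: "diag_char chi" and M: "is_M_gamma chi M"
  obtains m where "m \<in> vecs M" "bij_betw (\<lambda>F. F m) (Hom hecke M (hecke_invariants \<pi>))
    (hecke_eigen chi (if char_eq chi (conj_s chi) then - 1 else 0) 0)"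
proof -
  let ?H = "hecke_invariants \<pi>"
  have rM: "right_hecke_module M" using M by (simp add: is_M_gamma_def)
  obtain v1 v2 where v: "v1 \<noteq> v2" "\<not> Modules.module.dependent (scl M) {v1, v2}"
    "vecs M = Modules.module.span (scl M) {v1, v2}"
    "opr M T_Pi v1 = v2" "opr M T_Pi v2 = v1"
    "opr M (e_char chi) v1 = v1" "opr M (e_char (conj_s chi)) v2 = v2"
    "opr M T_n_s v2 = 0" "opr M T_n_s v1 = (if char_eq chi (conj_s chi) then - v1 else 0)"
    using M unfolding is_M_gamma_def by blast
  have vsM: "vector_space (scl M)" "Modules.module.subspace (scl M) (vecs M)"
    using rM by (simp_all add: right_hecke_module_def lin_operators_def)
  interpret MV: vector_space "scl M" by (rule vsM)
  note M_closed = subspaceD[OF vsM] and M_scl = vector_spaceD[OF vsM(1)]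
  have rH: "right_hecke_module ?H" by (rule right_hecke_module_invariants)
  note mod = right_hecke_module_def lin_operators_def
  have M1: "opr M T m \<in> vecs M" if "T \<in> hecke" "m \<in> vecs M" for T m
    using rM that unfolding mod by blast
  have M2: "opr M T (m + m') = opr M T m + opr M T m'" if "T \<in> hecke" "m \<in> vecs M" "m' \<in> vecs M" for T m m'
    using rM that unfolding mod by blast
  have M3: "opr M T (scl M c m) = scl M c (opr M T m)" if "T \<in> hecke" "m \<in> vecs M" for T m c
    using rM that unfolding mod by blast
  have M4: "opr M (S + T) m = opr M S m + opr M T m" if "S \<in> hecke" "T \<in> hecke" "m \<in> vecs M" for S T m
    using rM that unfolding mod by blast
  have M5: "opr M (S \<circ> T) m = opr M T (opr M S m)" if "S \<in> hecke" "T \<in> hecke" "m \<in> vecs M" for S T m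
    using rM that unfolding mod by blast
  have M6: "opr M (pointwise (pointwise (*)) c T) m = scl M c (opr M T m)" if "T \<in> hecke" "m \<in> vecs M" for T m c
    using rM that unfolding mod by blast
  have M7: "opr M hecke_one m = m" if "m \<in> vecs M" for m
    using rM that unfolding mod by blast
  note M_opr = M1 M2 M3 M4 M5 M6 M7
  have H1: "opr ?H T m \<in> invs" if "T \<in> hecke" "m \<in> invs" for T m
    using rH that unfolding mod hecke_invariants_simps(1,2) by blast
  have H2: "opr ?H T (m + m') = opr ?H T m + opr ?H T m'" if "T \<in> hecke" "m \<in> invs" "m' \<in> invs" for T m m'
    using rH that unfolding mod hecke_invariants_simps(1,2) by blast
  have H3: "opr ?H T (scl \<pi> c m) = scl \<pi> c (opr ?H T m)" if "T \<in> hecke" "m \<in> invs" for T m c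
    using rH that unfolding mod hecke_invariants_simps(1,2) by blast
  have H4: "opr ?H (S + T) m = opr ?H S m + opr ?H T m" if "S \<in> hecke" "T \<in> hecke" "m \<in> invs" for S T m
    using rH that unfolding mod hecke_invariants_simps(1,2) by blast
  have H5: "opr ?H (S \<circ> T) m = opr ?H T (opr ?H S m)" if "S \<in> hecke" "T \<in> hecke" "m \<in> invs" for S T m
    using rH that unfolding mod hecke_invariants_simps(1,2) by blast
  have H6: "opr ?H (pointwise (pointwise (*)) c T) m = scl \<pi> c (opr ?H T m)" if "T \<in> hecke" "m \<in> invs" for T m c
    using rH that unfolding mod hecke_invariants_simps(1,2) by blast
  have H7: "opr ?H hecke_one m = m" if "m \<in> invs" for m
    using rH that unfolding mod hecke_invariants_simps(1,2) by blast
  note H_opr = H1 H2 H3 H4 H5 H6 H7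
  have gen_hecke: "T_Pi \<in> hecke" "T_n_s \<in> hecke" "e_char \<psi> \<in> hecke" "T_Pi_inv \<in> hecke" for \<psi> :: "'f residue_field mat22 \<Rightarrow> 'c"
    using T_Pi(1) T_n_s(1) e_char(1) T_Pi_inv(1) by auto
  have vin: "v1 \<in> vecs M" "v2 \<in> vecs M" unfolding v(3) by (auto intro: MV.span_base)
  have v2nz: "v2 \<noteq> 0" and v1n: "v1 \<notin> MV.span {v2}"
    using v(1,2) MV.dependent_zero[of "{v1, v2}"] by (auto simp: MV.independent_insert)
  have coord: "\<exists>a b. m = scl M a v1 + scl M b v2" if m: "m \<in> vecs M" for m
  proof -
    obtain a where "m - scl M a v1 \<in> MV.span {v2}" using m unfolding v(3) MV.span_breakdown_eq by blast
    then obtain b where "m - scl M a v1 = scl M b v2" by (auto simp: MV.span_singleton)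
    then have "m = scl M a v1 + scl M b v2" by (simp add: algebra_simps)
    then show ?thesis by blast
  qed
  have uniq: "a = a' \<and> b = b'" if e: "scl M a v1 + scl M b v2 = scl M a' v1 + scl M b' v2" for a b a' b'
  proof -
    have d: "scl M (a - a') v1 = scl M (b' - b) v2" using e by (simp add: MV.scale_left_diff_distrib algebra_simps)
    have "a = a'"
    proof (rule ccontr)
      assume "a \<noteq> a'"
      then have "v1 = scl M (inverse (a - a')) (scl M (a - a') v1)" by simp
      then have "v1 = scl M (inverse (a - a') * (b' - b)) v2" unfolding d by simp
      then show False using v1n by (auto simp: MV.span_singleton)
    qed
    moreover from this have "b = b'" using d v2nz by simp
    ultimately show ?thesis by simp
  qed
  have act: "opr ?H T_Pi w = opr \<pi> (matrix_inv Pi_mat) w" "opr ?H T_n_s w = ns_sum w"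
    "opr ?H (e_char \<psi>) w = char_proj \<psi> w" "opr ?H T_Pi_inv w = opr \<pi> Pi_mat w"
    "h \<in> diag_sub \<Longrightarrow> opr ?H (T_diag h) w = opr \<pi> (lift_mat h) w" if "w \<in> invs" for w h and \<psi> :: "'f residue_field mat22 \<Rightarrow> 'c"
    using that by (simp_all add: recip_T_Pi recip_T_n_s recip_e_char)
  let ?e = "if char_eq chi (conj_s chi) then - 1 else 0 :: 'c"
  let ?W = "hecke_eigen chi ?e 0"
  have "bij_betw (\<lambda>F. F v1) (Hom hecke M ?H) ?W"
    unfolding bij_betw_def
  proof (intro conjI inj_onI subset_antisym subsetI)
    fix F F' assume F: "F \<in> Hom hecke M ?H" and F': "F' \<in> Hom hecke M ?H" and eq: "F v1 = F' v1"
    have eq2: "F v2 = F' v2"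
      using HomD(4)[OF F gen_hecke(1) vin(1)] HomD(4)[OF F' gen_hecke(1) vin(1)] eq v(4) by simp
    show "F = F'"
    proof
      fix m
      show "F m = F' m"
      proof (cases "m \<in> vecs M")
        case True
        then obtain a b where "m = scl M a v1 + scl M b v2" using coord by blast
        then show ?thesis using HomD(2,3)[OF F] HomD(2,3)[OF F'] vin eq eq2 by (simp add: M_closed)
      qed (use HomD(5)[OF F] HomD(5)[OF F'] in simp)
    qed
  next
    fix w assume "w \<in> (\<lambda>F. F v1) ` Hom hecke M ?H"
    then obtain F where F: "F \<in> Hom hecke M ?H" and w: "w = F v1" by blast
    have inv: "F v1 \<in> invs" "F v2 \<in> invs" using HomD(1)[OF F] vin by simp_all
    note h = HomD(4)[OF F]
    have 1: "opr \<pi> (matrix_inv Pi_mat) w = F v2" "opr \<pi> (matrix_inv Pi_mat) (F v2) = w"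
      using h[OF gen_hecke(1) vin(1)] h[OF gen_hecke(1) vin(2)] v(4,5) act(1) inv w by simp_all
    have "char_proj chi w = w" using h[OF gen_hecke(3) vin(1), of chi] v(6) act(3) inv w by simp
    then have 2: "opr \<pi> (lift_mat h) w = scl \<pi> (chi h) w" if "h \<in> diag_sub" for h
      using char_proj_eigen[OF chi that inv(1)] w by simp
    have F0: "F 0 = 0" "F (- v1) = - F v1"
      using Hom_linear(1,2)[OF F vsM] vin by simp_all
    have 3: "ns_sum w = scl \<pi> ?e w" "ns_sum (F v2) = scl \<pi> 0 (F v2)"
      using h[OF gen_hecke(2) vin(1)] h[OF gen_hecke(2) vin(2)] v(8,9) act(2) inv w F0 by (auto simp: scl_simps)
    show "w \<in> ?W" unfolding hecke_eigen_def using inv 1 2 3 w by simp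
  next
    fix w assume w: "w \<in> ?W"
    define w2 where "w2 = opr \<pi> (matrix_inv Pi_mat) w"
    have wi: "w \<in> invs" "w2 \<in> invs" using w Pi_invs(2) by (auto simp: hecke_eigen_def w2_def)
    have wv: "w \<in> vecs \<pi>" "w2 \<in> vecs \<pi>" using wi by (auto intro: invsD)
    have w1: "opr \<pi> (matrix_inv Pi_mat) w2 = w" using w by (simp add: hecke_eigen_def w2_def)
    have wh: "opr \<pi> (lift_mat h) w = scl \<pi> (chi h) w" if "h \<in> diag_sub" for h
      using w that by (simp add: hecke_eigen_def)
    have w2h: "opr \<pi> (lift_mat h) w2 = scl \<pi> (conj_s chi h) w2" if "h \<in> diag_sub" for h
      unfolding w2_def using Pi_eigen[OF wi(1) wh that] .
    have wns: "ns_sum w = scl \<pi> ?e w" "ns_sum w2 = 0" using w by (auto simp: hecke_eigen_def w2_def scl_simps)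
    define F where "F m = (if m \<in> vecs M then
      let c = SOME c. m = scl M (fst c) v1 + scl M (snd c) v2 in scl \<pi> (fst c) w + scl \<pi> (snd c) w2 else 0)" for m
    have F: "F (scl M a v1 + scl M b v2) = scl \<pi> a w + scl \<pi> b w2" for a b
    proof -
      define c where "c = (SOME c. scl M a v1 + scl M b v2 = scl M (fst c) v1 + scl M (snd c) v2)"
      have "scl M a v1 + scl M b v2 = scl M (fst c) v1 + scl M (snd c) v2"
        unfolding c_def by (rule someI[of _ "(a, b)"]) simp
      then have "a = fst c \<and> b = snd c" by (rule uniq)
      moreover have "scl M a v1 + scl M b v2 \<in> vecs M" using vin by (simp add: M_closed)
      ultimately show ?thesis unfolding F_def c_def[symmetric] Let_def by simp
    qed
    have Fv: "F v1 = w" "F v2 = w2" using F[of 1 0] F[of 0 1] by (simp_all add: scl_simps)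
    have F0: "F 0 = 0" using F[of 0 0] by (simp add: scl_simps)
    have Finv: "F m \<in> invs" if "m \<in> vecs M" for m
      using coord[OF that] F wi by (auto simp: invs_closed)
    have Fadd: "F (m + m') = F m + F m'" if m: "m \<in> vecs M" "m' \<in> vecs M" for m m'
    proof -
      obtain a b a' b' where e: "m = scl M a v1 + scl M b v2" "m' = scl M a' v1 + scl M b' v2" using coord m by metis
      have "m + m' = scl M (a + a') v1 + scl M (b + b') v2" unfolding e by (simp add: MV.scale_left_distrib)
      then have "F (m + m') = scl \<pi> (a + a') w + scl \<pi> (b + b') w2" using F by simp
      then show ?thesis unfolding e F by (simp add: scl_simps)
    qed
    have Fscl: "F (scl M c m) = scl \<pi> c (F m)" if m: "m \<in> vecs M" for c m
    proof -
      obtain a b where e: "m = scl M a v1 + scl M b v2" using coord m by metis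
      have "scl M c m = scl M (c * a) v1 + scl M (c * b) v2" unfolding e by (simp add: MV.scale_right_distrib)
      then have "F (scl M c m) = scl \<pi> (c * a) w + scl \<pi> (c * b) w2" using F by simp
      then show ?thesis unfolding e F by (simp add: scl_simps)
    qed
    define P where "P T \<longleftrightarrow> (\<forall>m\<in>vecs M. F (opr M T m) = opr ?H T (F m))" for T
    \<comment> \<open>By linearity an operator is respected as soon as this holds on the two basis
      vectors.\<close>
    have ext: "P T" if T: "T \<in> hecke" and t: "F (opr M T v1) = opr ?H T w" "F (opr M T v2) = opr ?H T w2" for T
      unfolding P_def
    proof
      fix m assume m: "m \<in> vecs M"
      obtain a b where e: "m = scl M a v1 + scl M b v2" using coord m by metis
      show "F (opr M T m) = opr ?H T (F m)" unfolding e F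
        using T t vin wi by (simp add: M_opr H_opr M_closed invs_closed Fadd Fscl
            del: hecke_invariants_simps(3))
    qed
    have p1: "P hecke_one"
    proof -
      show ?thesis unfolding P_def using Finv by (simp add: M7 H7 del: hecke_invariants_simps(3))
    qed
    have p2: "P T_Pi"
    proof -
      show ?thesis by (rule ext) (simp_all only: gen_hecke v act wi Fv w1 w2_def[symmetric])
    qed
    have p3: "P T_Pi_inv"
    proof -
      \<comment> \<open>The module is described through \<open>T_Pi\<close> alone; the action of its
        inverse follows from \<open>T_Pi \<circ> T_Pi_inv = hecke_one\<close> in the order of a
        right module.\<close>
      have i: "opr M T_Pi_inv (opr M T_Pi m) = m" if "m \<in> vecs M" for m
        using M5[OF gen_hecke(1) gen_hecke(4) that] M7[OF that]
        by (simp add: T_Pi_T_Pi_inv)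
      have "opr M T_Pi_inv v2 = v1" "opr M T_Pi_inv v1 = v2" using i[OF vin(1)] i[OF vin(2)] v(4,5) by simp_all
      moreover have "opr \<pi> Pi_mat w2 = w" "opr \<pi> Pi_mat w = w2"
        using opr_inv(1)[of Pi_mat w] opr_inv(1)[of Pi_mat w2] wv by (simp_all add: w1 flip: w2_def)
      ultimately show ?thesis by (intro ext) (simp_all only: gen_hecke act wi Fv)
    qed
    have p4: "P T_n_s"
    proof -
      have "F (- v1) = - w" using Fscl[OF vin(1), of "- 1"] by (simp add: scl_simps Fv)
      then show ?thesis by (intro ext) (simp_all add: gen_hecke v act wi Fv F0 wns scl_simps del: hecke_invariants_simps(3))
    qed
    have p5: "P (T_diag h)" if 5: "h \<in> diag_sub" for h
    proof -
      \<comment> \<open>Only the idempotents are prescribed on the module; inserting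
        \<open>e_char chi\<close>, which fixes \<open>v1\<close>, brings out the eigenvalue
        \<open>chi h\<close>.\<close>
      have "opr M (T_diag h) v1 = opr M (e_char chi \<circ> T_diag h) v1"
        using M5[OF gen_hecke(3) T_diag(1)[OF 5] vin(1), of chi] v(6) by simp
      also have "\<dots> = scl M (chi h) v1"
        unfolding e_char_T_diag[OF chi 5] using M6[OF gen_hecke(3) vin(1)] v(6) by simp
      finally have a: "opr M (T_diag h) v1 = scl M (chi h) v1" .
      have "opr M (T_diag h) v2 = opr M (e_char (conj_s chi) \<circ> T_diag h) v2"
        using M5[OF gen_hecke(3) T_diag(1)[OF 5] vin(2), of "conj_s chi"] v(7) by simp
      also have "\<dots> = scl M (conj_s chi h) v2"
        unfolding e_char_T_diag[OF diag_char_conj_s[OF chi] 5]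
        using M6[OF gen_hecke(3) vin(2)] v(7) by simp
      finally have b: "opr M (T_diag h) v2 = scl M (conj_s chi h) v2" .
      show ?thesis using 5 by (intro ext) (simp_all only: T_diag act wi a b Fscl vin Fv wh w2h)
    qed
    have p6: "P (S + T)" if 6: "S \<in> hecke" "T \<in> hecke" "P S" "P T" for S T
    proof -
      from 6 show ?thesis unfolding P_def using Finv by (simp add: M_opr H_opr Fadd del: hecke_invariants_simps(3))
    qed
    have p7: "P (pointwise (pointwise (*)) c T)" if 7: "T \<in> hecke" "P T" for c T
    proof -
      from 7 show ?thesis unfolding P_def using Finv by (simp add: M_opr H_opr Fscl del: hecke_invariants_simps(3))
    qed
    have p8: "P (S \<circ> T)" if 8: "S \<in> hecke" "T \<in> hecke" "P S" "P T" for S T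
    proof -
      from 8 show ?thesis unfolding P_def using Finv by (simp add: M_opr H_opr del: hecke_invariants_simps(3))
    qed
    have "P T" if "T \<in> hecke" for T
      by (rule hecke_induct[where P = P, OF that p1 p2 p3 p4 p5 p6 p7 p8])
    then have "F \<in> Hom hecke M ?H"
      unfolding P_def by (intro HomI) (simp_all add: Finv Fadd Fscl, simp add: F_def)
    then show "w \<in> (\<lambda>F. F v1) ` Hom hecke M ?H" using Fv(1) by blast
  qed
  then show ?thesis using that vin(1) by blast
qed

end

section \<open>Representations of the finite group\<close>

abbreviation upr :: "'a::field \<Rightarrow> 'a mat22" where
  "upr t \<equiv> mat22 1 t 0 1"

lemma n_s_inv: "matrix_inv n_s = (mat22 0 1 (- 1) 0 :: 'a::field mat22)"
  by (rule matrix_inv_eq) (simp add: n_s_def mat22_eq_iff mat22_mult_nth)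

lemma upr_GL2 [simp]: "upr t \<in> GL2" by (simp add: GL2_iff)

lemma upr_unip [simp]: "upr t \<in> unip_sub" by (simp add: unip_sub_def)

lemma upr_mult: "upr s ** upr t = upr (s + t)"
  by (simp add: mat22_mult add.commute)

lemma det_n_s_inv [simp]: "det (matrix_inv n_s :: 'a::field mat22) = 1"
  by (simp add: n_s_inv)

lemma borel_sub_GL2: "b \<in> borel_sub \<Longrightarrow> b \<in> GL2" by (simp add: borel_sub_def)

lemma mult_charD:
  assumes "mult_char \<psi>"
  shows "\<psi> 1 = 1" "a \<noteq> 0 \<Longrightarrow> \<psi> a \<noteq> 0" "a \<noteq> 0 \<Longrightarrow> b \<noteq> 0 \<Longrightarrow> \<psi> (a * b) = \<psi> a * \<psi> b"
proof -
  have "\<psi> (1 * 1) = \<psi> 1 * \<psi> 1" "\<psi> 1 \<noteq> 0" using assms unfolding mult_char_def by (metis zero_neq_one)+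
  then show "\<psi> 1 = 1" by simp
qed (use assms in \<open>auto simp: mult_char_def\<close>)

locale fin_rep = rep GL2 V for V :: "('a::{field,finite} mat22, 'c::field, 'v::ab_group_add) repr"
begin

text \<open>The action of the element of the group algebra with coefficients \<open>c\<close>; the
  kernel of \<open>c \<mapsto> comb c v\<close> is the annihilator of \<open>v\<close>.\<close>

definition comb :: "('a mat22 \<Rightarrow> 'c) \<Rightarrow> 'v \<Rightarrow> 'v" where
  "comb c v = (\<Sum>g\<in>GL2. scl V (c g) (opr V g v))"

definition orbit_span :: "'v \<Rightarrow> 'v set" where
  "orbit_span v = range (\<lambda>c. comb c v)"

context
  fixes v assumes v: "v \<in> vecs V"
begin

lemma comb_closed: "comb c v \<in> vecs V"
  unfolding comb_def using v by (intro vecs_closed opr_closed)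

lemma comb_add: "comb c v + comb c' v = comb (\<lambda>g. c g + c' g) v"
  by (simp add: comb_def scl_simps sum.distrib)

lemma comb_scl: "scl V a (comb c v) = comb (\<lambda>g. a * c g) v"
  by (simp add: comb_def scl_simps)

lemma opr_comb:
  assumes h: "h \<in> GL2"
  shows "opr V h (comb c v) = comb (\<lambda>g. c (matrix_inv h ** g)) v"
proof -
  have "opr V h (comb c v) = (\<Sum>g\<in>GL2. opr V h (scl V (c g) (opr V g v)))"
    unfolding comb_def using h v by (intro opr_sum vecs_closed opr_closed)
  also have "\<dots> = (\<Sum>g\<in>GL2. scl V (c g) (opr V (h ** g) v))"
    using h v by (intro sum.cong refl) (simp add: opr_scl opr_closed opr_mult)
  also have "\<dots> = comb (\<lambda>g. c (matrix_inv h ** g)) v" unfolding comb_def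
    by (rule sum.reindex_bij_witness[of _ "\<lambda>g. matrix_inv h ** g" "\<lambda>g. h ** g"])
      (use h in \<open>auto simp: matrix_mul_assoc\<close>)
  finally show ?thesis .
qed

lemma opr_eq_comb: "g \<in> GL2 \<Longrightarrow> opr V g v = comb (\<lambda>h. if h = g then 1 else 0) v"
proof -
  assume g: "g \<in> GL2"
  have "comb (\<lambda>h. if h = g then 1 else 0) v = (\<Sum>h\<in>GL2. if h = g then opr V h v else 0)"
    unfolding comb_def by (intro sum.cong refl) (auto simp: scl_simps)
  then show ?thesis using g by simp
qed

lemma orbit_span_subspace: "Modules.module.subspace (scl V) (orbit_span v)"
proof (rule subspaceI[OF vs])
  show "0 \<in> orbit_span v" unfolding orbit_span_def by (rule range_eqI[of _ _ "\<lambda>_. 0"]) (simp add: comb_def scl_simps)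
qed (auto simp: orbit_span_def comb_add comb_scl)

lemma orbit_span_opr: "h \<in> GL2 \<Longrightarrow> x \<in> orbit_span v \<Longrightarrow> opr V h x \<in> orbit_span v"
  by (auto simp: orbit_span_def opr_comb)

lemma orbit_in_span: "g \<in> GL2 \<Longrightarrow> opr V g v \<in> orbit_span v"
  by (simp add: orbit_span_def opr_eq_comb)

lemma in_orbit_span: "v \<in> orbit_span v"
  using orbit_in_span[OF GL2_one] v by (simp add: opr_one)

lemma orbit_span_sub: "orbit_span v \<subseteq> vecs V"
  using comb_closed by (auto simp: orbit_span_def)

lemma orbit_span_least:
  assumes "Modules.module.subspace (scl V) W" "\<And>g. g \<in> GL2 \<Longrightarrow> opr V g v \<in> W"
  shows "orbit_span v \<subseteq> W"
  unfolding orbit_span_def comb_def using assms by (auto intro!: subspaceD[OF vs assms(1)])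

end

lemma orbit_span_irreducible:
  assumes "irreducible_rep GL2 V" "v \<in> vecs V" "v \<noteq> 0"
  shows "orbit_span v = vecs V"
proof -
  have "orbit_span v = {0} \<or> orbit_span v = vecs V"
    using assms(1) orbit_span_sub[OF assms(2)] orbit_span_subspace[OF assms(2)] orbit_span_opr[OF assms(2)]
    unfolding irreducible_rep_def by blast
  then show ?thesis using in_orbit_span[OF assms(2)] assms(3) by auto
qed

definition unip_sum :: "'v \<Rightarrow> 'v" where
  "unip_sum x = (\<Sum>u\<in>unip_sub. opr V u (opr V (matrix_inv n_s) x))"

lemma unip_sum_eq: "unip_sum x = (\<Sum>t\<in>UNIV. opr V (upr t) (opr V (matrix_inv n_s) x))"
proof -
  have inj: "inj (\<lambda>t :: 'a. mat22 1 t 0 1)" by (auto simp: inj_def mat22_eq_iff)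
  show ?thesis unfolding unip_sum_def unip_sub_eq by (subst sum.reindex[OF inj]) simp
qed

end

text \<open>Locates \<open>x\<close> among the cosets of the Borel subgroup acting on the left: off
  the Borel subgroup exactly one \<open>t\<close> works, on it none does.\<close>

lemma bruhat_right:
  assumes "x \<in> GL2"
  shows "x ** (upr t ** matrix_inv n_s) \<in> borel_sub \<longleftrightarrow> x $ 2 $ 1 \<noteq> 0 \<and> t = - x $ 2 $ 2 / x $ 2 $ 1"
proof -
  have "(x ** (upr t ** matrix_inv n_s)) $ 2 $ 1 = - (x $ 2 $ 1 * t + x $ 2 $ 2)"
    by (simp add: n_s_inv mat22_mult mat22_mult_nth)
  then have "x ** (upr t ** matrix_inv n_s) \<in> borel_sub \<longleftrightarrow> x $ 2 $ 1 * t + x $ 2 $ 2 = 0"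
    using assms unfolding borel_sub_def by (simp only: mem_Collect_eq neg_equal_0_iff_equal) simp
  also have "\<dots> \<longleftrightarrow> x $ 2 $ 1 \<noteq> 0 \<and> t = - x $ 2 $ 2 / x $ 2 $ 1"
  proof (cases "x $ 2 $ 1 = 0")
    case True
    then show ?thesis using assms by (auto simp: GL2_iff det_2)
  next
    case False
    then have "t = - x $ 2 $ 2 / x $ 2 $ 1 \<longleftrightarrow> x $ 2 $ 1 * t = - x $ 2 $ 2" 
      using nonzero_eq_divide_eq[OF False, of t "- x $ 2 $ 2"] by (simp only: mult.commute)
    then show ?thesis using False by (simp add: eq_neg_iff_add_eq_0)
  qed
  finally show ?thesis .
qed

lemma bruhat_left:
  assumes "g \<in> GL2"
  shows "n_s ** upr (- t) ** g \<in> borel_sub \<longleftrightarrow> g $ 2 $ 1 \<noteq> 0 \<and> t = g $ 1 $ 1 / g $ 2 $ 1"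
proof -
  have "n_s ** upr (- t) ** g \<in> borel_sub \<longleftrightarrow> g $ 1 $ 1 - t * g $ 2 $ 1 = 0"
    using assms by (simp add: borel_sub_def) (simp add: n_s_def mat22_mult mat22_mult_nth)
  also have "\<dots> \<longleftrightarrow> g $ 2 $ 1 \<noteq> 0 \<and> t = g $ 1 $ 1 / g $ 2 $ 1"
    using assms by (cases "g $ 2 $ 1 = 0") (auto simp: GL2_iff det_2 field_simps)
  finally show ?thesis .
qed

locale eigenvector = fin_rep V for V :: "('a::{field,finite} mat22, 'c::field, 'v::ab_group_add) repr" +
  fixes chi :: "'a mat22 \<Rightarrow> 'c" and x :: 'v
  assumes chi: "diag_char chi" and x: "x \<in> invariants unip_sub V"
    and diag: "\<And>h. h \<in> diag_sub \<Longrightarrow> opr V h x = scl V (chi h) x"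
begin

lemma x_in: "x \<in> vecs V" using x by (simp add: invariants_def)

lemma borel_eigen:
  assumes b: "b \<in> borel_sub" shows "opr V b x = scl V (chi (diag_part b)) x"
proof -
  have d: "diag_part b \<in> diag_sub" using b by (rule diag_part_diag_sub)
  have "b = diag_part b ** (matrix_inv (diag_part b) ** b)" using d by (simp add: diag_sub_GL2)
  then have "opr V b x = opr V (diag_part b ** (matrix_inv (diag_part b) ** b)) x" by simp
  also have "\<dots> = opr V (diag_part b) (opr V (matrix_inv (diag_part b) ** b) x)"
    using d b x_in by (intro opr_mult) (auto simp: diag_sub_GL2 borel_sub_GL2)
  also have "opr V (matrix_inv (diag_part b) ** b) x = x" using x diag_part_unip[OF b] by (simp add: invariants_def)
  finally show ?thesis using diag d by simp
qed

text \<open>By the Bruhat decomposition the orbit of \<open>x\<close> consists, up to scalars, of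
  \<open>x\<close> and the vectors \<open>y t\<close>.\<close>

definition y :: "'a \<Rightarrow> 'v" where
  "y t = opr V (upr t) (opr V (matrix_inv n_s) x)"

lemma y_in: "y t \<in> vecs V" unfolding y_def using x_in by (intro opr_closed) auto

lemma y_eq: "y t = opr V (upr t ** matrix_inv n_s) x"
  using x_in by (simp add: y_def opr_mult)

lemma upr_y: "opr V (upr s) (y t) = y (s + t)"
  using x_in by (simp add: y_eq matrix_mul_assoc upr_mult flip: opr_mult)

lemma sum_y: "(\<Sum>t\<in>UNIV. y t) = unip_sum x"
  by (simp add: unip_sum_eq y_def)

lemma opr_borel_y:
  assumes "b \<in> borel_sub"
  shows "opr V (upr t ** matrix_inv n_s ** b) x = scl V (chi (diag_part b)) (y t)"
  using assms x_in by (simp add: opr_mult borel_sub_GL2 borel_eigen opr_scl y_eq)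

lemma ns_y_zero: "opr V (matrix_inv n_s) (y 0) = scl V (chi (mat (- 1))) x"
proof -
  have "matrix_inv n_s ** (upr 0 ** matrix_inv n_s) = (mat (- 1) :: 'a mat22)"
    by (simp add: n_s_inv mat22_eq_iff mat22_mult)
  moreover have "(mat (- 1) :: 'a mat22) \<in> diag_sub" by (simp add: diag_sub_def)
  ultimately show ?thesis using x_in diag by (simp add: y_eq flip: opr_mult)
qed

text \<open>The rank one identity rewriting \<open>n_s^-1 upr(t) n_s^-1\<close> as an element of
  \<open>U n_s^-1 B\<close>; it carries the parameter \<open>t\<close> to
  \<open>- 1 / t\<close>.\<close>

lemma ns_y:
  assumes t: "t \<noteq> 0"
  shows "opr V (matrix_inv n_s) (y t) = scl V (chi (mat22 (- t) 0 0 (- 1 / t))) (y (- 1 / t))"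
proof -
  let ?b = "mat22 (- t) 1 0 (- 1 / t)"
  have b: "?b \<in> borel_sub" using t by (simp add: borel_sub_def GL2_iff)
  have "matrix_inv n_s ** (upr t ** matrix_inv n_s) = upr (- 1 / t) ** matrix_inv n_s ** ?b"
    using t by (simp add: n_s_inv mat22_eq_iff mat22_mult)
  then have "opr V (matrix_inv n_s) (y t) = opr V (upr (- 1 / t) ** matrix_inv n_s ** ?b) x"
    using x_in by (simp add: y_eq flip: opr_mult)
  then show ?thesis using opr_borel_y[OF b] by (simp add: diag_part_def)
qed

lemma opr_bruhat:
  assumes g: "g \<in> GL2" "g \<notin> borel_sub"
  defines "t \<equiv> g $ 1 $ 1 / g $ 2 $ 1"
  defines "b \<equiv> n_s ** upr (- t) ** g"
  shows "b \<in> borel_sub" "g = upr t ** matrix_inv n_s ** b" "opr V g x = scl V (chi (diag_part b)) (y t)"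
proof -
  have "g $ 2 $ 1 \<noteq> 0" using g by (simp add: borel_sub_def)
  then show b: "b \<in> borel_sub" unfolding b_def using bruhat_left[OF g(1), of t] by (simp add: t_def)
  have "upr t ** matrix_inv n_s ** b = upr t ** (matrix_inv n_s ** (n_s ** (upr (- t) ** g)))"
    by (simp only: b_def matrix_mul_assoc)
  also have "\<dots> = upr t ** (upr (- t) ** g)" by simp
  also have "\<dots> = g" unfolding matrix_mul_assoc upr_mult by (simp add: mat22_eq_iff mat22_mult_nth)
  finally show e: "g = upr t ** matrix_inv n_s ** b" by simp
  show "opr V g x = scl V (chi (diag_part b)) (y t)" using opr_borel_y[OF b, of t] e by simp
qed

lemma det_char:
  assumes "mult_char \<psi>" and \<psi>: "\<And>h. h \<in> diag_sub \<Longrightarrow> chi h = \<psi> (det h)" and b: "b \<in> borel_sub"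
  shows "chi (diag_part b) = \<psi> (det b)"
proof -
  have "det (diag_part b) = det b" using b by (simp add: diag_part_def borel_sub_def det_2)
  then show ?thesis using \<psi>[OF diag_part_diag_sub[OF b]] by simp
qed

text \<open>Applying the inverse of \<open>n_s\<close> to the vanishing sum permutes the terms with
  \<open>t \<noteq> 0\<close> and turns \<open>y 0\<close> into \<open>x\<close>; subtraction gives
  \<open>y 0 = x\<close>. As \<open>x\<close> is fixed by \<open>U\<close>, every \<open>y t\<close>
  equals \<open>x\<close>.\<close>

lemma unip_sum_zero_invariant:
  assumes \<psi>: "mult_char \<psi>" "\<And>h. h \<in> diag_sub \<Longrightarrow> chi h = \<psi> (det h)"
    and zero: "unip_sum x = 0" and g: "g \<in> GL2"
  shows "opr V g x = scl V (\<psi> (det g)) x"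
proof -
  have chi1: "chi (mat (- 1)) = 1" "t \<noteq> 0 \<Longrightarrow> chi (mat22 (- t) 0 0 (- 1 / t)) = 1" for t
  proof -
    show "chi (mat (- 1)) = 1" using \<psi>(2)[of "mat (- 1)"] mult_charD(1)[OF \<psi>(1)] by (simp add: diag_sub_def)
    show "t \<noteq> 0 \<Longrightarrow> chi (mat22 (- t) 0 0 (- 1 / t)) = 1"
      using \<psi>(2)[of "mat22 (- t) 0 0 (- 1 / t)"] mult_charD(1)[OF \<psi>(1)] by (simp add: diag_sub_def GL2_iff)
  qed
  have "0 = opr V (matrix_inv n_s) (\<Sum>t\<in>UNIV. y t)" using zero by (simp add: sum_y opr_zero)
  also have "\<dots> = (\<Sum>t\<in>UNIV. opr V (matrix_inv n_s) (y t))" using y_in by (intro opr_sum) auto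
  also have "\<dots> = opr V (matrix_inv n_s) (y 0) + (\<Sum>t\<in>UNIV - {0}. opr V (matrix_inv n_s) (y t))"
    by (rule sum.remove) auto
  also have "opr V (matrix_inv n_s) (y 0) = x" by (simp add: ns_y_zero chi1 scl_simps)
  also have "(\<Sum>t\<in>UNIV - {0}. opr V (matrix_inv n_s) (y t)) = (\<Sum>t\<in>UNIV - {0}. y (- 1 / t))"
  proof (intro sum.cong refl)
    fix t :: 'a assume "t \<in> UNIV - {0}"
    then have t: "t \<noteq> 0" by simp
    show "opr V (matrix_inv n_s) (y t) = y (- 1 / t)"
      unfolding ns_y[OF t] chi1(2)[OF t] by (simp only: scl_simps)
  qed
  also have "\<dots> = (\<Sum>t\<in>UNIV - {0}. y t)"
    by (rule sum.reindex_bij_witness[of _ "\<lambda>t. - 1 / t" "\<lambda>t. - 1 / t"]) auto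
  also have "\<dots> = (\<Sum>t\<in>UNIV. y t) - y 0" by (simp add: sum_diff1)
  finally have y0: "y 0 = x" using zero by (simp add: sum_y)
  have yt: "y t = x" for t
  proof -
    have "y t = opr V (upr t) (y 0)" by (simp add: upr_y)
    then show ?thesis using x unfolding y0 by (simp add: invariants_def)
  qed
  show ?thesis
  proof (cases "g \<in> borel_sub")
    case True
    then show ?thesis using borel_eigen det_char[OF \<psi>] by simp
  next
    case False
    note b = opr_bruhat[OF g False]
    let ?b = "n_s ** upr (- (g $ 1 $ 1 / g $ 2 $ 1)) ** g"
    have "det g = det (upr (g $ 1 $ 1 / g $ 2 $ 1) ** matrix_inv n_s ** ?b)" using b(2) by simp
    also have "\<dots> = det ?b" by (simp add: det_mul)
    finally show ?thesis using b(1,3) det_char[OF \<psi> b(1)] yt by simp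
  qed
qed

text \<open>Sorting the group elements by Borel cosets, the coefficients of \<open>x\<close> and of
  each \<open>y t\<close> are sums of the type in \<open>c\<close>, all equal to
  \<open>\<kappa>\<close>. The total is \<open>\<kappa>\<close> times \<open>x + unip_sum x\<close>,
  which is zero.\<close>

lemma comb_steinberg:
  assumes \<psi>: "mult_char \<psi>" "\<And>h. h \<in> diag_sub \<Longrightarrow> chi h = \<psi> (det h)"
    and st: "unip_sum x = - x"
    and c: "\<And>z. z \<in> GL2 \<Longrightarrow> (\<Sum>g\<in>GL2. if z ** g \<in> borel_sub then c g * \<psi> (det g) else 0) = \<kappa>"
  shows "comb c x = 0"
proof -
  let ?s = "\<lambda>z g. if z ** g \<in> borel_sub then c g * \<psi> (det g) else 0"
  have g: "scl V (c g) (opr V g x) = scl V (?s (mat 1) g) x + (\<Sum>t\<in>UNIV. scl V (?s (n_s ** upr (- t)) g) (y t))"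
    if g: "g \<in> GL2" for g
  proof (cases "g \<in> borel_sub")
    case True
    then have "n_s ** upr (- t) ** g \<notin> borel_sub" for t using bruhat_left[OF g] by (simp add: borel_sub_def)
    then show ?thesis using True borel_eigen[OF True] det_char[OF \<psi> True] by (simp add: scl_simps)
  next
    case False
    let ?t = "g $ 1 $ 1 / g $ 2 $ 1"
    note b = opr_bruhat[OF g False]
    have "det g = det (upr ?t ** matrix_inv n_s ** (n_s ** upr (- ?t) ** g))" using b(2) by simp
    then have d: "det (n_s ** upr (- ?t) ** g) = det g" by (simp add: det_mul)
    have "n_s ** upr (- t) ** g \<in> borel_sub \<longleftrightarrow> t = ?t" for t
      using bruhat_left[OF g, of t] g False by (simp add: borel_sub_def)
    then have "(\<Sum>t\<in>UNIV. scl V (?s (n_s ** upr (- t)) g) (y t)) = (\<Sum>t\<in>UNIV. if t = ?t then scl V (c g * \<psi> (det g)) (y ?t) else 0)"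
      by (intro sum.cong refl) (simp add: scl_simps)
    then show ?thesis using False b(3) det_char[OF \<psi> b(1)] d by (simp add: scl_simps)
  qed
  \<comment> \<open>The coefficient of \<open>x\<close> is the sum for \<open>z = mat 1\<close>,
    that of \<open>y t\<close> the sum for \<open>z = n_s ** upr (- t)\<close>.\<close>
  have "comb c x = scl V (\<Sum>g\<in>GL2. ?s (mat 1) g) x + (\<Sum>t\<in>UNIV. scl V (\<Sum>g\<in>GL2. ?s (n_s ** upr (- t)) g) (y t))"
    unfolding comb_def scl_simps(12)
    by (subst sum.swap) (simp add: g sum.distrib cong: sum.cong)
  also have "\<dots> = scl V \<kappa> x + (\<Sum>t\<in>UNIV. scl V \<kappa> (y t))" using c[OF GL2_one] c by simp
  also have "\<dots> = scl V \<kappa> (x + unip_sum x)" by (simp add: scl_simps sum_y[symmetric])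
  finally show ?thesis by (simp add: st scl_simps)
qed

end

section \<open>Characters of a prime field\<close>

text \<open>The embedding of a prime field. When both types have characteristic
  \<open>CARD('a)\<close>, the chosen natural number is determined modulo it, so the value is
  independent of the choice.\<close>

definition emb :: "'a::{field,finite} \<Rightarrow> 'c::field" where
  "emb t = of_nat (SOME n. of_nat n = t)"

text \<open>The dummy variables only tie the type variables \<open>'a\<close> and \<open>'c\<close>
  to the assumptions.\<close>

context
  fixes dummy_a :: "'a::{field,finite}" and dummy_c :: "'c::field"
  assumes prime: "Factorial_Ring.prime CARD('a)" and CHAR_a: "CHAR('a) = CARD('a)" and CHAR_c: "CHAR('c) = CARD('a)"
begin

private abbreviation "emb' \<equiv> emb :: 'a \<Rightarrow> 'c"

lemma of_nat_surj: "\<exists>n. of_nat n = (t :: 'a)"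
proof -
  have inj: "inj_on (of_nat :: nat \<Rightarrow> 'a) {..<CARD('a)}"
    by (auto simp: inj_on_def of_nat_eq_iff_cong_CHAR CHAR_a cong_less_modulus_unique_nat)
  have "of_nat ` {..<CARD('a)} = (UNIV :: 'a set)"
    using card_image[OF inj] by (intro card_subset_eq) auto
  then show ?thesis by (metis UNIV_I imageE)
qed

lemma emb_of_nat: "emb' (of_nat n) = of_nat n"
proof -
  have "of_nat (SOME m. of_nat m = (of_nat n :: 'a)) = (of_nat n :: 'a)"
    by (rule someI) simp
  then show ?thesis unfolding emb_def by (simp add: of_nat_eq_iff_cong_CHAR CHAR_a CHAR_c)
qed

lemma emb_simps [simp]: "emb' 0 = 0" "emb' 1 = 1" "emb' (s + t) = emb' s + emb' t" "emb' (s * t) = emb' s * emb' t"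
proof -
  show "emb' 0 = 0" "emb' 1 = 1" using emb_of_nat[of 0] emb_of_nat[of 1] by simp_all
  obtain m n where mn: "of_nat m = s" "of_nat n = t" using of_nat_surj by metis
  show "emb' (s + t) = emb' s + emb' t" "emb' (s * t) = emb' s * emb' t"
    using emb_of_nat[of "m + n"] emb_of_nat[of "m * n"] by (simp_all add: emb_of_nat flip: mn)
qed

lemma emb_power [simp]: "emb' (t ^ n) = emb' t ^ n"
  by (induction n) simp_all

lemma emb_minus [simp]: "emb' (- t) = - emb' t"
  using emb_simps(3)[of t "- t"] by (simp add: eq_neg_iff_add_eq_0 add.commute)

lemma emb_diff [simp]: "emb' (s - t) = emb' s - emb' t"
  using emb_simps(3)[of s "- t"] by simp

lemma emb_eq_0_iff [simp]: "emb' t = 0 \<longleftrightarrow> t = 0"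
proof
  assume t: "emb' t = 0"
  show "t = 0"
  proof (rule ccontr)
    assume "t \<noteq> 0"
    then have "emb' (t * inverse t) = 1" by simp
    then show False using t by (simp only: emb_simps) simp
  qed
qed simp

lemma inj_emb: "inj emb'"
proof (rule injI)
  fix s t :: 'a assume "emb' s = emb' t"
  then have "emb' (s - t) = 0" by (simp only: emb_diff) simp
  then show "s = t" by (simp only: emb_eq_0_iff) simp
qed

text \<open>A primitive root modulo the prime \<open>CARD('a)\<close>, transported by
  \<open>of_nat\<close>; congruence of natural numbers decides equality of their images.\<close>

lemma primitive_element:
  obtains \<gamma> :: 'a where "\<gamma> \<noteq> 0" "\<And>t. t \<noteq> 0 \<Longrightarrow> \<exists>k. t = \<gamma> ^ k" "\<And>m. \<gamma> ^ m = 1 \<longleftrightarrow> (CARD('a) - 1) dvd m"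
proof -
  let ?p = "CARD('a)"
  have p1: "?p > 1" using prime by (rule prime_gt_1_nat)
  obtain g where g: "residue_primroot ?p g" using prime_primitive_root_exists[OF p1 prime] by blast
  have cop: "coprime ?p g" and ordg: "ord ?p g = ?p - 1"
    using g prime by (auto simp: residue_primroot_def totient_prime)
  have pow: "(of_nat g :: 'a) ^ m = 1 \<longleftrightarrow> (?p - 1) dvd m" for m
    using ord_divides[of g m ?p] ordg of_nat_eq_iff_cong_CHAR[where ?'a = 'a, of "g ^ m" 1] by (simp add: CHAR_a)
  have nz: "(of_nat g :: 'a) \<noteq> 0"
  proof
    assume "(of_nat g :: 'a) = 0"
    then have "?p dvd g" by (simp add: of_nat_eq_0_iff_char_dvd CHAR_a)
    then have "is_unit ?p" using cop by (simp only: coprime_absorb_left)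
    then show False using p1 by simp
  qed
  have "\<exists>k. t = of_nat g ^ k" if t: "t \<noteq> 0" for t :: 'a
  proof -
    obtain n where n: "of_nat n = t" using of_nat_surj by blast
    have "n mod ?p \<in> totatives ?p"
      using t p1 by (auto simp: totatives_prime[OF prime] of_nat_eq_0_iff_char_dvd CHAR_a dvd_eq_mod_eq_0 simp flip: n)
    then obtain k where k: "n mod ?p = g ^ k mod ?p"
      using residue_primroot_is_generator[OF p1 g] by (auto simp: bij_betw_def)
    then have "of_nat n = (of_nat (g ^ k) :: 'a)" by (simp only: of_nat_eq_iff_cong_CHAR CHAR_a cong_def)
    then show ?thesis using n by auto
  qed
  then show ?thesis using that nz pow by blast
qed

lemma fermat: "t \<noteq> 0 \<Longrightarrow> (t :: 'a) ^ (CARD('a) - 1) = 1"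
proof -
  assume t: "t \<noteq> 0"
  obtain \<gamma> :: 'a where \<gamma>: "\<And>t. t \<noteq> 0 \<Longrightarrow> \<exists>k. t = \<gamma> ^ k" "\<And>m. \<gamma> ^ m = 1 \<longleftrightarrow> (CARD('a) - 1) dvd m"
    using primitive_element by metis
  obtain k where "t = \<gamma> ^ k" using \<gamma>(1)[OF t] by blast
  then show ?thesis using \<gamma>(2)[of "k * (CARD('a) - 1)"] by (simp add: power_mult)
qed

text \<open>Multiplying the variable by a primitive element permutes the terms and scales the sum by
  a factor different from 1.\<close>

lemma power_sum_zero:
  assumes "\<not> (CARD('a) - 1) dvd m"
  shows "(\<Sum>s\<in>UNIV. emb' s ^ m) = 0"
proof -
  obtain \<gamma> :: 'a where \<gamma>: "\<gamma> \<noteq> 0" "\<gamma> ^ m \<noteq> 1" using primitive_element assms by metis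
  have ne: "emb' \<gamma> ^ m \<noteq> 1" using \<gamma>(2) inj_emb by (metis emb_power emb_simps(2) injD)
  have "(\<Sum>s\<in>UNIV. emb' s ^ m) = (\<Sum>s\<in>UNIV. emb' (\<gamma> * s) ^ m)"
    by (rule sum.reindex_bij_witness[of _ "\<lambda>s. \<gamma> * s" "\<lambda>s. s / \<gamma>"]) (use \<gamma> in auto)
  also have "\<dots> = emb' \<gamma> ^ m * (\<Sum>s\<in>UNIV. emb' s ^ m)"
    by (simp add: power_mult_distrib sum_distrib_left)
  finally have "(1 - emb' \<gamma> ^ m) * (\<Sum>s\<in>UNIV. emb' s ^ m) = 0" by (simp add: algebra_simps)
  then show ?thesis using ne by simp
qed

text \<open>Each nonzero \<open>s\<close> contributes 1, and there are \<open>p - 1\<close> of them;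
  the exponent is positive, so \<open>s = 0\<close> contributes nothing.\<close>

lemma power_sum_minus_one: "(\<Sum>s\<in>UNIV. emb' s ^ (CARD('a) - 1)) = - 1"
proof -
  have p: "CARD('a) - 1 > 0" using prime_gt_1_nat[OF prime] by simp
  have "(\<Sum>s\<in>UNIV. emb' s ^ (CARD('a) - 1)) = (\<Sum>s\<in>UNIV - {0}. emb' s ^ (CARD('a) - 1))"
    by (rule sum.mono_neutral_right) (use p in auto)
  also have "\<dots> = (\<Sum>s\<in>UNIV - {0 :: 'a}. 1)"
    by (intro sum.cong refl) (use fermat in \<open>simp flip: emb_power\<close>)
  also have "\<dots> = of_nat (CARD('a) - 1)" by simp
  also have "\<dots> = of_nat CARD('a) - 1" using p by (simp add: of_nat_diff)
  also have "of_nat CARD('a) = (0 :: 'c)" by (simp add: of_nat_eq_0_iff_char_dvd CHAR_c)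
  finally show ?thesis by simp
qed

text \<open>The value at a primitive element is a root of X^(p-1) - 1, and the embedded nonzero
  elements already exhaust the roots of this polynomial.\<close>

lemma character_eq_power:
  fixes f :: "'a \<Rightarrow> 'c"
  assumes f1: "f 1 = 1" and f: "\<And>s t. s \<noteq> 0 \<Longrightarrow> t \<noteq> 0 \<Longrightarrow> f (s * t) = f s * f t"
  shows "\<exists>r<CARD('a) - 1. \<forall>t. t \<noteq> 0 \<longrightarrow> f t = emb t ^ r"
proof -
  let ?n = "CARD('a) - 1"
  have n: "?n > 0" using prime_gt_1_nat[OF prime] by simp
  obtain \<gamma> :: 'a where \<gamma>: "\<gamma> \<noteq> 0" "\<And>t. t \<noteq> 0 \<Longrightarrow> \<exists>k. t = \<gamma> ^ k" using primitive_element by metis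
  have fp: "f (t ^ k) = f t ^ k" if "t \<noteq> 0" for t k
    using that by (induction k) (simp_all add: f1 f)
  let ?P = "Polynomial.monom 1 ?n - 1 :: 'c poly"
  have deg: "Polynomial.degree ?P = ?n" using n by (subst diff_conv_add_uminus, subst degree_add_eq_left) (auto simp: degree_monom_eq)
  then have P0: "?P \<noteq> 0" using n by auto
  let ?R = "{z. poly ?P z = 0}"
  have R: "z \<in> ?R \<longleftrightarrow> z ^ ?n = 1" for z by (simp add: poly_monom)
  have sub: "emb' ` (UNIV - {0}) \<subseteq> ?R"
  proof
    fix z assume "z \<in> emb' ` (UNIV - {0})"
    then obtain t where t: "t \<noteq> 0" "z = emb' t" by auto
    then show "z \<in> ?R" unfolding R using fermat[OF t(1)] by (simp flip: emb_power)
  qed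
  have "card (emb' ` (UNIV - {0})) = ?n"
    using card_image[of emb' "UNIV - {0}"] inj_emb by (simp add: inj_on_subset card_Diff_singleton)
  moreover have "card ?R \<le> ?n" using card_poly_roots_bound[OF P0] deg by simp
  ultimately have "emb' ` (UNIV - {0}) = ?R"
    using sub poly_roots_finite[OF P0] by (intro card_seteq) auto
  moreover have "f \<gamma> \<in> ?R" unfolding R using fp[OF \<gamma>(1), of ?n] fermat[OF \<gamma>(1)] f1 by simp
  ultimately obtain t where t: "t \<noteq> 0" "f \<gamma> = emb' t" by auto
  obtain k where k: "t = \<gamma> ^ k" using \<gamma>(2)[OF t(1)] by blast
  have one: "emb' \<gamma> ^ ?n = 1" using fermat[OF \<gamma>(1)] by (simp flip: emb_power)
  let ?r = "k mod ?n"
  have "emb' \<gamma> ^ k = emb' \<gamma> ^ (?n * (k div ?n) + ?r)" by simp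
  also have "\<dots> = emb' \<gamma> ^ ?r" unfolding power_add power_mult one by simp
  finally have g: "f \<gamma> = emb' \<gamma> ^ ?r" using t k by simp
  have "f s = emb' s ^ ?r" if s: "s \<noteq> 0" for s
  proof -
    obtain l where "s = \<gamma> ^ l" using \<gamma>(2)[OF s] by blast
    then show ?thesis using fp[OF \<gamma>(1), of l] g by (simp add: mult.commute flip: power_mult)
  qed
  then show ?thesis using n by (intro exI[of _ ?r]) auto
qed

end

section \<open>Irreducibility over the prime field\<close>

locale prime_eigenvector = eigenvector V chi x
  for V :: "('a::{field,finite} mat22, 'c::field, 'v::ab_group_add) repr" and chi x +
  assumes prime: "Factorial_Ring.prime CARD('a)" and CHAR_a: "CHAR('a) = CARD('a)" and CHAR_c: "CHAR('c) = CARD('a)"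
    and nontrivial: "\<not> char_eq chi (conj_s chi)" and zero: "unip_sum x = 0"
begin

lemmas emb_facts [simp] = emb_simps[where ?'a = 'a and ?'c = 'c, OF prime CHAR_a CHAR_c]
  emb_power[where ?'a = 'a and ?'c = 'c, OF prime CHAR_a CHAR_c]
  emb_minus[where ?'a = 'a and ?'c = 'c, OF prime CHAR_a CHAR_c]
  emb_diff[where ?'a = 'a and ?'c = 'c, OF prime CHAR_a CHAR_c]
  emb_eq_0_iff[where ?'a = 'a and ?'c = 'c, OF prime CHAR_a CHAR_c]

text \<open>A change of basis from translates to power functions, on which \<open>U\<close> acts
  unitriangularly. Since \<open>0 ^ 0 = 1\<close>, \<open>Y 0\<close> is
  \<open>unip_sum x\<close>.\<close>

definition Y :: "nat \<Rightarrow> 'v" where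
  "Y j = (\<Sum>t\<in>UNIV. scl V (emb t ^ j) (y t))"

lemma Y_in: "Y j \<in> vecs V"
  unfolding Y_def using y_in by (intro vecs_closed) auto

lemma upr_Y_sum: "opr V (upr s) (Y j) = (\<Sum>t\<in>UNIV. scl V (emb t ^ j) (y (s + t)))"
proof -
  have "opr V (upr s) (Y j) = (\<Sum>t\<in>UNIV. opr V (upr s) (scl V (emb t ^ j) (y t)))"
    unfolding Y_def using y_in by (intro opr_sum vecs_closed) auto
  then show ?thesis using y_in by (simp add: opr_scl upr_y)
qed

lemma upr_Y: "opr V (upr s) (Y j) = (\<Sum>i\<le>j. scl V (of_nat (j choose i) * (- emb s) ^ (j - i)) (Y i))"
proof -
  have "opr V (upr s) (Y j) = (\<Sum>t\<in>UNIV. scl V (emb (t - s) ^ j) (y t))"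
    unfolding upr_Y_sum by (rule sum.reindex_bij_witness[of _ "\<lambda>t. t - s" "\<lambda>t. s + t"]) auto
  also have "\<dots> = (\<Sum>t\<in>UNIV. \<Sum>i\<le>j. scl V (of_nat (j choose i) * emb t ^ i * (- emb s) ^ (j - i)) (y t))"
  proof (intro sum.cong refl)
    fix t :: 'a
    have "(emb (t - s) :: 'c) ^ j = (emb t + (- emb s)) ^ j" by simp
    also have "\<dots> = (\<Sum>i\<le>j. of_nat (j choose i) * emb t ^ i * (- emb s) ^ (j - i))" by (rule binomial_ring)
    finally show "scl V (emb (t - s) ^ j) (y t) = (\<Sum>i\<le>j. scl V (of_nat (j choose i) * emb t ^ i * (- emb s) ^ (j - i)) (y t))"
      by (simp add: scl_simps(12))
  qed
  also have "\<dots> = (\<Sum>i\<le>j. \<Sum>t\<in>UNIV. scl V (of_nat (j choose i) * emb t ^ i * (- emb s) ^ (j - i)) (y t))"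
    by (rule sum.swap)
  also have "\<dots> = (\<Sum>i\<le>j. scl V (of_nat (j choose i) * (- emb s) ^ (j - i)) (Y i))"
    unfolding Y_def by (simp add: scl_simps mult_ac)
  finally show ?thesis .
qed

text \<open>Applying the inverse of \<open>n_s\<close> to \<open>unip_sum x = 0\<close> exhibits
  \<open>x\<close> as a nonzero multiple of \<open>Y r\<close>, where the exponent \<open>r\<close>
  describes \<open>chi\<close> on diagonal matrices of determinant 1. Invariance of \<open>x\<close>
  under \<open>U\<close> then annihilates the lower \<open>Y i\<close>.\<close>

lemma weight:
  obtains r where "0 < r" "r < CARD('a) - 1" "x \<noteq> 0 \<Longrightarrow> Y r \<noteq> 0" "\<exists>a. x = scl V a (Y r)" "\<And>i. i < r \<Longrightarrow> Y i = 0"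
proof -
  let ?p = "CARD('a)"
  have chiD: "chi (h ** h') = chi h * chi h'" "chi h \<noteq> 0" if "h \<in> diag_sub" "h' \<in> diag_sub" for h h'
    using chi that by (auto simp: diag_char_def)
  have d: "mat22 a 0 0 b \<in> diag_sub" if "a \<noteq> 0" "b \<noteq> 0" for a b :: 'a using that by (simp add: diag_sub_eq)
  \<comment> \<open>The restriction of \<open>chi\<close> to diagonal matrices of determinant 1, the
    factor that appears in \<open>ns_y\<close>.\<close>
  define f where "f s = chi (mat22 (1 / s) 0 0 s)" for s
  have f: "f (s * t) = f s * f t" if "s \<noteq> 0" "t \<noteq> 0" for s t
    using chiD(1)[OF d[of "1 / s" s] d[of "1 / t" t]] that by (simp add: f_def mat22_mult)
  have f1: "f 1 = 1"
  proof -
    have "f 1 \<noteq> 0" using chiD(2)[OF d[of 1 1] d[of 1 1]] by (simp add: f_def)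
    then show ?thesis using f[of 1 1] by simp
  qed
  obtain r where r: "r < ?p - 1" "\<And>t. t \<noteq> 0 \<Longrightarrow> f t = emb t ^ r"
    using character_eq_power[OF prime CHAR_a CHAR_c f1 f] by blast
  \<comment> \<open>A diagonal matrix and its conjugate by \<open>weyl_s\<close> differ by a
    diagonal matrix of determinant 1, so \<open>r = 0\<close> would make \<open>chi\<close> its own
    conjugate.\<close>
  have r0: "r \<noteq> 0"
  proof
    assume "r = 0"
    then have f1': "f t = 1" if "t \<noteq> 0" for t using r(2)[OF that] by simp
    have "chi h = conj_s chi h" if h: "h \<in> diag_sub" for h
    proof -
      let ?a = "h $ 1 $ 1" and ?b = "h $ 2 $ 2"
      have nz: "?a \<noteq> 0" "?b \<noteq> 0" "h = mat22 ?a 0 0 ?b" using h by (auto simp: diag_sub_eq)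
      have "mat22 (1 / (?b / ?a)) 0 0 (?b / ?a) ** mat22 ?b 0 0 ?a = mat22 ?a 0 0 ?b"
        using nz by (simp add: mat22_mult)
      then have "chi (mat22 ?a 0 0 ?b) = f (?b / ?a) * chi (mat22 ?b 0 0 ?a)"
        using chiD(1)[OF d[of "1 / (?b / ?a)" "?b / ?a"] d[of ?b ?a]] nz(1,2) by (simp add: f_def)
      then have "chi (mat22 ?a 0 0 ?b) = chi (mat22 ?b 0 0 ?a)" using f1'[of "?b / ?a"] nz(1,2) by simp
      moreover have "h $ 1 $ 2 = 0" "h $ 2 $ 1 = 0" using h by (auto simp: diag_sub_def)
      ultimately show ?thesis using nz(3) by (simp add: conj_s_eq)
    qed
    then show False using nontrivial by (simp add: char_eq_def)
  qed
  have Yr: "Y r = (\<Sum>t\<in>UNIV - {0}. scl V (f t) (y t))"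
  proof -
    have "Y r = (\<Sum>t\<in>UNIV - {0}. scl V (emb t ^ r) (y t))" unfolding Y_def
      by (rule sum.mono_neutral_right) (use r0 in \<open>auto simp: scl_simps zero_power\<close>)
    then show ?thesis by (simp add: r(2))
  qed
  let ?e = "chi (mat (- 1))"
  have e: "?e \<noteq> 0" using chi by (simp add: diag_char_def diag_sub_def)
  have "0 = opr V (matrix_inv n_s) (\<Sum>t\<in>UNIV. y t)" using zero by (simp add: sum_y opr_zero)
  also have "\<dots> = (\<Sum>t\<in>UNIV. opr V (matrix_inv n_s) (y t))" using y_in by (intro opr_sum) auto
  also have "\<dots> = opr V (matrix_inv n_s) (y 0) + (\<Sum>t\<in>UNIV - {0}. opr V (matrix_inv n_s) (y t))"
    by (rule sum.remove) auto
  also have "(\<Sum>t\<in>UNIV - {0}. opr V (matrix_inv n_s) (y t)) = (\<Sum>t\<in>UNIV - {0}. scl V (f t) (y t))"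
  proof (rule sum.reindex_bij_witness[of _ "\<lambda>t. - 1 / t" "\<lambda>t. - 1 / t"])
    fix t :: 'a assume "t \<in> UNIV - {0}"
    then have t: "t \<noteq> 0" by simp
    have "f (- 1 / t) = chi (mat22 (- t) 0 0 (- 1 / t))" using t by (simp add: f_def)
    then show "scl V (f (- 1 / t)) (y (- 1 / t)) = opr V (matrix_inv n_s) (y t)" unfolding ns_y[OF t] by (simp only:)
  qed auto
  finally have eq: "scl V ?e x + Y r = 0" by (simp add: ns_y_zero Yr)
  then have "Y r = scl V (- ?e) x" by (simp add: scl_simps eq_neg_iff_add_eq_0 add.commute)
  then have xY: "x = scl V (inverse (- ?e)) (Y r)" using e by (simp add: scl_simps)
  have inv: "opr V (upr s) (Y r) = Y r" for s
  proof -
    have "opr V (upr s) x = x" using x by (simp add: invariants_def)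
    then show ?thesis unfolding \<open>Y r = scl V (- ?e) x\<close> using x_in by (simp add: opr_scl)
  qed
  have Yz: "Y i = 0" if i: "i < r" for i
  \<comment> \<open>A power sum over \<open>s\<close> extracts the coefficient of \<open>Y i\<close> from the invariance of \<open>Y r\<close> under \<open>upr s\<close>.\<close>
  proof -
    have 0: "(\<Sum>j<r. scl V (of_nat (r choose j) * (- emb s) ^ (r - j)) (Y j)) = 0" for s :: 'a
      using inv[of s] upr_Y[of s r] by (simp add: lessThan_Suc_atMost[symmetric] scl_simps)
    \<comment> \<open>Complements the exponent \<open>r - i\<close> to \<open>p - 1\<close>. For
      other \<open>j < r\<close> the exponent \<open>k + (r - j)\<close> stays strictly between 0
      and \<open>2 * (p - 1)\<close> and misses \<open>p - 1\<close>, so its power sum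
      vanishes.\<close>
    define k where "k = (?p - 1) - (r - i)"
    have k: "k > 0" using r(1) i by (simp add: k_def)
    have ps: "(\<Sum>s\<in>(UNIV :: 'a set). (emb s :: 'c) ^ (k + (r - j))) = (if j = i then - 1 else 0)" if j: "j < r" for j
    proof (cases "j = i")
      case True
      then have "k + (r - j) = ?p - 1" using r(1) i by (simp add: k_def)
      then show ?thesis using True power_sum_minus_one[OF prime CHAR_a CHAR_c] by simp
    next
      case False
      have "\<not> (?p - 1) dvd (k + (r - j))"
      proof
        assume "(?p - 1) dvd (k + (r - j))"
        then obtain q where q: "k + (r - j) = (?p - 1) * q" by blast
        have b: "0 < k + (r - j)" "k + (r - j) < 2 * (?p - 1)" "k + (r - j) \<noteq> ?p - 1"
          using r(1) i j False by (auto simp: k_def)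
        have "q \<noteq> 0" "q \<noteq> 1" using b q by auto
        then have "(?p - 1) * 2 \<le> (?p - 1) * q" by (intro mult_le_mono2) simp
        then show False using b(2) q by simp
      qed
      then show ?thesis using False power_sum_zero[OF prime CHAR_a CHAR_c] by simp
    qed
    have "0 = (\<Sum>s\<in>(UNIV :: 'a set). scl V (emb s ^ k) (\<Sum>j<r. scl V (of_nat (r choose j) * (- emb s) ^ (r - j)) (Y j)))"
      unfolding 0 by (simp only: scl_simps(6) sum.neutral_const)
    also have "\<dots> = (\<Sum>s\<in>(UNIV :: 'a set). \<Sum>j<r. scl V (of_nat (r choose j) * (- 1) ^ (r - j) * emb s ^ (k + (r - j))) (Y j))"
    proof (intro sum.cong refl)
      fix s :: 'a
      have m: "(- emb s :: 'c) ^ (r - j) = (- 1) ^ (r - j) * emb s ^ (r - j)" for j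
        by (simp flip: power_mult_distrib)
      show "scl V (emb s ^ k) (\<Sum>j<r. scl V (of_nat (r choose j) * (- emb s) ^ (r - j)) (Y j))
        = (\<Sum>j<r. scl V (of_nat (r choose j) * (- 1) ^ (r - j) * emb s ^ (k + (r - j))) (Y j))"
        unfolding m scl_simps(11) by (simp only: scl_simps(3) power_add mult_ac)
    qed
    also have "\<dots> = (\<Sum>j<r. \<Sum>s\<in>(UNIV :: 'a set). scl V (of_nat (r choose j) * (- 1) ^ (r - j) * emb s ^ (k + (r - j))) (Y j))"
      by (rule sum.swap)
    also have "\<dots> = (\<Sum>j<r. scl V (of_nat (r choose j) * (- 1) ^ (r - j) * (\<Sum>s\<in>(UNIV :: 'a set). emb s ^ (k + (r - j)))) (Y j))"
      by (simp add: sum_distrib_left scl_simps(12))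
    also have "\<dots> = (\<Sum>j<r. if j = i then scl V (of_nat (r choose i) * (- 1) ^ (r - i) * (- 1)) (Y i) else 0)"
    proof (intro sum.cong refl)
      fix j assume "j \<in> {..<r}"
      then have j: "j < r" by simp
      show "scl V (of_nat (r choose j) * (- 1) ^ (r - j) * (\<Sum>s\<in>(UNIV :: 'a set). emb s ^ (k + (r - j)))) (Y j)
        = (if j = i then scl V (of_nat (r choose i) * (- 1) ^ (r - i) * (- 1)) (Y i) else 0)"
        unfolding ps[OF j] by (simp add: scl_simps)
    qed
    also have "\<dots> = scl V (of_nat (r choose i) * (- 1) ^ (r - i) * (- 1)) (Y i)" using i by simp
    finally have z: "scl V (of_nat (r choose i) * (- 1) ^ (r - i) * (- 1)) (Y i) = 0" by simp
    have "\<not> ?p dvd (r choose i)"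
    proof
      assume "?p dvd (r choose i)"
      moreover have "(r choose i) dvd fact r"
        using binomial_fact_lemma[of i r] i by (metis dvd_triv_right less_imp_le)
      ultimately have "?p dvd fact r" by (rule dvd_trans)
      then have "?p \<le> r" using prime_dvd_fact_iff[OF prime] by simp
      then show False using r(1) by simp
    qed
    then have "of_nat (r choose i) * (- 1) ^ (r - i) * (- 1) \<noteq> (0 :: 'c)"
      by (simp add: of_nat_eq_0_iff_char_dvd CHAR_c)
    then show ?thesis using z by (rule scl_simps(13))
  qed
  have "Y r \<noteq> 0" if "x \<noteq> 0" using that xY by (metis scl_simps(6))
  then show ?thesis using that[of r] r0 r(1) xY Yz by blast
qed

text \<open>It suffices to express each \<open>y t\<close>: the weight
  \<open>emb s ^ (p - 1)\<close> is 1 except at \<open>s = 0\<close>, and the full sum of the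
  \<open>y s\<close> vanishes, so \<open>y t\<close> is minus a translate of
  \<open>Y (p - 1)\<close>.\<close>

lemma orbit_span_sub_Y: "z \<in> orbit_span x \<Longrightarrow> \<exists>a. z = (\<Sum>i<CARD('a). scl V (a i) (Y i))"
proof -
  let ?p = "CARD('a)"
  let ?Z = "range (\<lambda>a. \<Sum>i<?p. scl V (a i) (Y i))"
  obtain r where r: "r < ?p - 1" "\<exists>a. x = scl V a (Y r)" using weight by metis
  have Z: "Modules.module.subspace (scl V) ?Z"
  proof (rule subspaceI[OF vs])
    show "0 \<in> ?Z" by (rule range_eqI[of _ _ "\<lambda>_. 0"]) (simp add: scl_simps)
    fix z z' assume "z \<in> ?Z" "z' \<in> ?Z"
    then obtain a a' where "z = (\<Sum>i<?p. scl V (a i) (Y i))" "z' = (\<Sum>i<?p. scl V (a' i) (Y i))" by blast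
    then show "z + z' \<in> ?Z" by (intro range_eqI[of _ _ "\<lambda>i. a i + a' i"]) (simp add: scl_simps sum.distrib)
  next
    fix c z assume "z \<in> ?Z"
    then obtain a where "z = (\<Sum>i<?p. scl V (a i) (Y i))" by blast
    then show "scl V c z \<in> ?Z" by (intro range_eqI[of _ _ "\<lambda>i. c * a i"]) (simp add: scl_simps)
  qed
  note Zc = subspaceD[OF vs Z]
  have YZ: "Y i \<in> ?Z" if "i < ?p" for i
  proof (rule range_eqI[of _ _ "\<lambda>j. if j = i then 1 else 0"])
    have "(\<Sum>j<?p. scl V (if j = i then 1 else 0) (Y j)) = (\<Sum>j<?p. if j = i then Y j else 0)"
      by (intro sum.cong refl) (simp add: scl_simps)
    then show "Y i = (\<Sum>j<?p. scl V (if j = i then 1 else 0) (Y j))" using that by simp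
  qed
  have xZ: "x \<in> ?Z" 
  proof -
    have "Y r \<in> ?Z" using r(1) by (intro YZ) simp
    then have *: "scl V a (Y r) \<in> ?Z" for a by (rule Zc(3))
    obtain a where "x = scl V a (Y r)" using r(2) by blast
    then show ?thesis using *[of a] by (simp only:)
  qed
  have yZ: "y t \<in> ?Z" for t
  proof -
    have p0: "?p - 1 \<noteq> 0" using prime_gt_1_nat[OF prime] by simp
    have "opr V (upr t) (Y (?p - 1)) = (\<Sum>s\<in>UNIV. if s = 0 then 0 else y (t + s))"
      unfolding upr_Y_sum
    proof (intro sum.cong refl)
      fix s :: 'a
      show "scl V (emb s ^ (?p - 1)) (y (t + s)) = (if s = 0 then 0 else y (t + s))"
        using p0 fermat[OF prime CHAR_a CHAR_c, of s]
        by (auto simp: scl_simps zero_power simp flip: emb_facts(5))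
    qed
    also have "\<dots> = (\<Sum>s\<in>UNIV - {0}. y (t + s))"
      by (rule sum.mono_neutral_cong_right) auto
    also have "\<dots> = (\<Sum>s\<in>UNIV. y (t + s)) - y t" by (simp add: sum_diff1)
    also have "(\<Sum>s\<in>UNIV. y (t + s)) = (\<Sum>s\<in>UNIV. y s)"
      by (rule sum.reindex_bij_witness[of _ "\<lambda>s. s - t" "\<lambda>s. t + s"]) auto
    finally have "y t = - opr V (upr t) (Y (?p - 1))" using zero by (simp add: sum_y)
    moreover have "opr V (upr t) (Y (?p - 1)) \<in> ?Z" unfolding upr_Y
      by (intro Zc(6) Zc(3) YZ) (use p0 in auto)
    ultimately show ?thesis using Zc(4) by simp
  qed
  have "orbit_span x \<subseteq> ?Z"
  proof (rule orbit_span_least[OF x_in Z])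
    fix g :: "'a mat22" assume g: "g \<in> GL2"
    show "opr V g x \<in> ?Z"
    proof (cases "g \<in> borel_sub")
      case True
      then show ?thesis using Zc(3)[OF xZ] by (simp add: borel_eigen)
    next
      case False
      show ?thesis unfolding opr_bruhat(3)[OF g False] by (rule Zc(3)[OF yZ])
    qed
  qed
  then show "z \<in> orbit_span x \<Longrightarrow> \<exists>a. z = (\<Sum>i<?p. scl V (a i) (Y i))" by blast
qed

text \<open>Applying \<open>upr 1 - 1\<close> lowers the largest index of a combination of the \<open>Y i\<close>, because the
  binomial coefficients involved are invertible. This leads from any non-zero vector of \<open>W\<close> to the
  first non-zero \<open>Y r\<close>, which is a multiple of \<open>x\<close>.\<close>

lemma orbit_span_minimal:
  assumes W: "Modules.module.subspace (scl V) W" "\<And>g z. g \<in> GL2 \<Longrightarrow> z \<in> W \<Longrightarrow> opr V g z \<in> W"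
    and sub: "W \<subseteq> orbit_span x" and nz: "W \<noteq> {0}"
  shows "x \<in> W"
proof -
  let ?p = "CARD('a)"
  note Wc = subspaceD[OF vs W(1)]
  obtain r where r: "0 < r" "r < ?p - 1" "\<exists>a. x = scl V a (Y r)" "\<And>i. i < r \<Longrightarrow> Y i = 0"
    using weight by metis
  have low: "Y r \<in> W" if "r \<le> m" "m < ?p" "a m \<noteq> 0" "(\<Sum>i\<le>m. scl V (a i) (Y i)) \<in> W" for m a
    using that
  proof (induction m arbitrary: a rule: dec_induct)
    case base
    have "(\<Sum>i\<le>r. scl V (a i) (Y i)) = (\<Sum>i<r. scl V (a i) (Y i)) + scl V (a r) (Y r)"
      by (simp add: lessThan_Suc_atMost[symmetric])
    also have "(\<Sum>i<r. scl V (a i) (Y i)) = 0" by (intro sum.neutral) (simp add: r(4) scl_simps)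
    finally have "scl V (a r) (Y r) \<in> W" using base by simp
    from Wc(3)[OF this, of "inverse (a r)"] show ?case using base by (simp add: scl_simps)
  next
    case (step m)
    let ?z = "\<Sum>i\<le>Suc m. scl V (a i) (Y i)"
    \<comment> \<open>The coefficients of \<open>upr 1 - 1\<close> applied to the combination; the
      binomial terms with \<open>j = i\<close> cancel, so the top index drops by one.\<close>
    define b where "b j = (\<Sum>i\<le>Suc m. if j < i then a i * (of_nat (i choose j) * (- 1) ^ (i - j)) else 0)" for j
    have "opr V (upr 1) ?z - ?z \<in> W" using step.prems W(2)[of "upr 1" ?z] by (intro Wc(5)) auto
    also have "opr V (upr 1) ?z - ?z = (\<Sum>j\<le>m. scl V (b j) (Y j))"
    proof -
      have "opr V (upr 1) ?z = (\<Sum>i\<le>Suc m. scl V (a i) (opr V (upr 1) (Y i)))"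
        using Y_in by (subst opr_sum) (auto simp: opr_scl vecs_closed)
      then have "opr V (upr 1) ?z - ?z = (\<Sum>i\<le>Suc m. scl V (a i) (opr V (upr 1) (Y i)) - scl V (a i) (Y i))"
        by (simp only: sum_subtractf)
      also have "\<dots> = (\<Sum>i\<le>Suc m. \<Sum>j\<le>m. scl V (if j < i then a i * (of_nat (i choose j) * (- 1) ^ (i - j)) else 0) (Y j))"
      proof (intro sum.cong refl)
        fix i assume i: "i \<in> {..Suc m}"
        have "opr V (upr 1) (Y i) = (\<Sum>j<i. scl V (of_nat (i choose j) * (- 1) ^ (i - j)) (Y j)) + Y i"
          unfolding upr_Y by (simp add: lessThan_Suc_atMost[symmetric] scl_simps)
        then have "scl V (a i) (opr V (upr 1) (Y i)) - scl V (a i) (Y i)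
          = (\<Sum>j<i. scl V (a i * (of_nat (i choose j) * (- 1) ^ (i - j))) (Y j))"
          by (simp add: scl_simps)
        also have "\<dots> = (\<Sum>j\<le>m. scl V (if j < i then a i * (of_nat (i choose j) * (- 1) ^ (i - j)) else 0) (Y j))"
          by (rule sum.mono_neutral_cong_left) (use i in \<open>auto simp: scl_simps\<close>)
        finally show "scl V (a i) (opr V (upr 1) (Y i)) - scl V (a i) (Y i)
          = (\<Sum>j\<le>m. scl V (if j < i then a i * (of_nat (i choose j) * (- 1) ^ (i - j)) else 0) (Y j))" .
      qed
      also have "\<dots> = (\<Sum>j\<le>m. \<Sum>i\<le>Suc m. scl V (if j < i then a i * (of_nat (i choose j) * (- 1) ^ (i - j)) else 0) (Y j))"
        by (rule sum.swap)
      also have "\<dots> = (\<Sum>j\<le>m. scl V (b j) (Y j))" by (simp only: b_def scl_simps(12))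
      finally show ?thesis .
    qed
    finally have bW: "(\<Sum>j\<le>m. scl V (b j) (Y j)) \<in> W" .
    \<comment> \<open>Only the top term reaches index \<open>m\<close>; its binomial coefficient is
      \<open>Suc m\<close>, which is below \<open>p\<close> and hence invertible.\<close>
    have "b m = (\<Sum>i\<in>{Suc m}. a i * (of_nat (i choose m) * (- 1) ^ (i - m)))"
      unfolding b_def by (rule sum.mono_neutral_cong_right) auto
    then have "b m = - (a (Suc m) * of_nat (Suc m))" by (simp add: algebra_simps)
    moreover have "of_nat (Suc m) \<noteq> (0 :: 'c)"
      using step.prems(1) by (auto simp: of_nat_eq_0_iff_char_dvd CHAR_c simp del: of_nat_Suc dest: dvd_imp_le)
    ultimately have "b m \<noteq> 0" using step.prems(2) by (simp del: of_nat_Suc)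
    then show ?case using step.IH[of b] step.prems(1) bW by simp
  qed
  obtain z where z: "z \<in> W" "z \<noteq> 0" using nz Wc(1) by auto
  obtain a where a: "z = (\<Sum>i<?p. scl V (a i) (Y i))" using orbit_span_sub_Y z(1) sub by blast
  have "\<exists>i. i < ?p \<and> a i \<noteq> 0"
  proof (rule ccontr)
    assume "\<not> ?thesis"
    then have "z = 0" unfolding a by (intro sum.neutral) (auto simp: scl_simps)
    then show False using z(2) by simp
  qed
  \<comment> \<open>The largest index with a nonzero coefficient; it is at least \<open>r\<close>,
    since the \<open>Y i\<close> below \<open>r\<close> vanish and \<open>z\<close> does
    not.\<close>
  define m where "m = Max {i. i < ?p \<and> a i \<noteq> 0}"
  have fin: "finite {i. i < ?p \<and> a i \<noteq> 0}" by simp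
  have m: "m < ?p" "a m \<noteq> 0" using Max_in[OF fin] \<open>\<exists>i. i < ?p \<and> a i \<noteq> 0\<close> by (auto simp: m_def)
  have above: "a i = 0" if "m < i" "i < ?p" for i
  proof (rule ccontr)
    assume "a i \<noteq> 0"
    then have "i \<le> m" unfolding m_def using that by (intro Max_ge) auto
    then show False using that by simp
  qed
  have zm: "z = (\<Sum>i\<le>m. scl V (a i) (Y i))" unfolding a
    by (rule sum.mono_neutral_right) (use m above in \<open>auto simp: scl_simps not_le\<close>)
  have "r \<le> m"
  proof (rule ccontr)
    assume "\<not> r \<le> m"
    then have "z = 0" unfolding zm by (intro sum.neutral) (auto simp: r(4) scl_simps)
    then show False using z(2) by simp
  qed
  then have "Y r \<in> W" using low[of m a] m z(1) zm by simp
  then show ?thesis using r(3) Wc(3)[of "Y r"] by metis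
qed

end

section \<open>The irreducible representations\<close>

lemma conj_n_s: "matrix_inv n_s ** mat22 b 0 0 a = mat22 a 0 0 b ** matrix_inv n_s"
  by (simp add: n_s_inv mat22_mult)

context fin_rep
begin

lemma comb_scl_right: "v \<in> vecs V \<Longrightarrow> comb c (scl V a v) = scl V a (comb c v)"
  by (simp add: comb_def opr_scl scl_simps mult.commute)

lemma unip_sum_scl: "v \<in> vecs V \<Longrightarrow> unip_sum (scl V a v) = scl V a (unip_sum v)"
  by (simp add: unip_sum_eq opr_scl opr_closed scl_simps)

lemma orbit_span_scl:
  assumes v: "v \<in> vecs V" and a: "a \<noteq> 0"
  shows "orbit_span (scl V a v) = orbit_span v"
proof -
  have "comb c v = comb (\<lambda>g. inverse a * c g) (scl V a v)" for c
    using a v by (simp add: comb_scl_right comb_scl[symmetric] scl_simps)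
  moreover have "comb c (scl V a v) = comb (\<lambda>g. a * c g) v" for c
    using v by (simp add: comb_scl_right comb_scl[symmetric])
  ultimately show ?thesis unfolding orbit_span_def by blast
qed

text \<open>\<open>comb c v\<close> can be sent to \<open>comb c w\<close> for all \<open>c\<close>
  as soon as the annihilator of \<open>v\<close> also annihilates \<open>w\<close>.\<close>

lemma Hom_of_comb:
  fixes W :: "('a mat22, 'c, 'w::ab_group_add) repr"
  assumes W: "is_rep GL2 W" and v: "v \<in> vecs V" "orbit_span v = vecs V" and w: "w \<in> vecs W"
    and kill: "\<And>c. comb c v = 0 \<Longrightarrow> fin_rep.comb W c w = 0"
  obtains \<phi> where "\<phi> \<in> Hom GL2 V W" "\<phi> v = w"
proof -
  interpret W: fin_rep W by unfold_locales (rule W)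
  define \<phi> where "\<phi> x = (if x \<in> vecs V then W.comb (SOME c. x = comb c v) w else 0)" for x
  have \<phi>: "\<phi> (comb c v) = W.comb c w" for c
  proof -
    define c' where "c' = (SOME c'. comb c v = comb c' v)"
    have eq: "comb c v = comb c' v" unfolding c'_def by (rule someI[of "\<lambda>c'. comb c v = comb c' v"]) (rule refl)
    have "comb (\<lambda>g. c g + (- 1) * c' g) v = comb c v + scl V (- 1) (comb c' v)"
      by (simp only: comb_add[OF v(1)] comb_scl[OF v(1)])
    then have "comb (\<lambda>g. c g + (- 1) * c' g) v = 0" unfolding eq by (simp add: scl_simps)
    then have "W.comb (\<lambda>g. c g + (- 1) * c' g) w = 0" by (rule kill)
    then have "W.comb c w + scl W (- 1) (W.comb c' w) = 0" by (simp only: W.comb_add[OF w] W.comb_scl[OF w])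
    then have "W.comb c w = W.comb c' w" by (simp add: W.scl_simps)
    then show ?thesis using comb_closed[OF v(1)] by (simp add: \<phi>_def c'_def)
  qed
  have ex: "\<exists>c. x = comb c v" if "x \<in> vecs V" for x
    using that unfolding v(2)[symmetric] orbit_span_def by blast
  have "\<phi> \<in> Hom GL2 V W"
  proof (rule HomI)
    fix x assume x: "x \<in> vecs V"
    obtain c where c: "x = comb c v" using ex[OF x] by blast
    show "\<phi> x \<in> vecs W" unfolding c \<phi> by (rule W.comb_closed[OF w])
    show "\<phi> (scl V a x) = scl W a (\<phi> x)" for a
      unfolding c comb_scl[OF v(1)] \<phi> by (simp only: W.comb_scl[OF w])
    show "\<phi> (opr V g x) = opr W g (\<phi> x)" if "g \<in> GL2" for g
      unfolding c opr_comb[OF v(1) that] \<phi> by (simp only: W.opr_comb[OF w that])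
    fix y assume y: "y \<in> vecs V"
    obtain d where d: "y = comb d v" using ex[OF y] by blast
    show "\<phi> (x + y) = \<phi> x + \<phi> y" unfolding c d comb_add[OF v(1)] \<phi> by (simp only: W.comb_add[OF w])
  qed (simp add: \<phi>_def)
  moreover have "\<phi> v = w"
  proof -
    have "v = comb (\<lambda>h. if h = mat 1 then 1 else 0) v" using opr_eq_comb[OF v(1) GL2_one] v(1) by (simp add: opr_one)
    then have "\<phi> v = W.comb (\<lambda>h. if h = mat 1 then 1 else 0) w" using \<phi> by metis
    then show ?thesis using W.opr_eq_comb[OF w GL2_one] w by (simp add: W.opr_one)
  qed
  ultimately show ?thesis by (rule that)
qed

end

lemma is_rep_direct_sum:
  assumes "is_rep G V" "is_rep G W"
  shows "is_rep G (direct_sum V W)"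
proof -
  interpret V: rep G V by unfold_locales (rule assms)
  interpret W: rep G W by unfold_locales (rule assms)
  have vs: "vector_space (scl (direct_sum V W))"
    by unfold_locales (auto simp: direct_sum_def V.scl_simps W.scl_simps)
  moreover have "Modules.module.subspace (scl (direct_sum V W)) (vecs (direct_sum V W))"
    by (rule subspaceI[OF vs]) (auto simp: direct_sum_def V.vecs_closed W.vecs_closed zero_prod_def)
  ultimately show ?thesis unfolding is_rep_def lin_operators_def
    by (auto simp: direct_sum_def V.opr_closed V.opr_add V.opr_scl V.opr_one V.opr_mult
      W.opr_closed W.opr_add W.opr_scl W.opr_one W.opr_mult)
qed

section \<open>The Steinberg representation\<close>

lemma is_rep_borel_functions: "is_rep GL2 (borel_functions :: ('a::field mat22, 'c::field, _) repr)"
proof -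
  have vs: "vector_space (scl (borel_functions :: ('a mat22, 'c, _) repr))"
    unfolding borel_functions_def by (simp add: vector_space_pointwise vs_times)
  moreover have "Modules.module.subspace (scl borel_functions) (vecs (borel_functions :: ('a mat22, 'c, _) repr))"
    by (rule subspaceI[OF vs]) (auto simp: borel_functions_def pointwise_def)
  ultimately show ?thesis unfolding is_rep_def lin_operators_def
    by (auto simp: borel_functions_def right_transl_def pointwise_def fun_eq_iff matrix_mul_assoc[symmetric])
qed

lemma mult_inv_cancel: "k \<in> GL2 \<Longrightarrow> x ** k ** matrix_inv k = x"
  by (simp add: matrix_mul_assoc[symmetric])

definition borel_ind :: "'a::field mat22 \<Rightarrow> 'c::field" where
  "borel_ind x = (if x \<in> borel_sub then 1 else 0)"

lemma borel_sub_mult_iff: "b \<in> borel_sub \<Longrightarrow> x \<in> GL2 \<Longrightarrow> b ** x \<in> borel_sub \<longleftrightarrow> x \<in> borel_sub"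
  by (auto simp: borel_sub_def mat22_mult_nth GL2_iff det_2)

lemma mult_borel_sub_iff: "b \<in> borel_sub \<Longrightarrow> x \<in> GL2 \<Longrightarrow> x ** b \<in> borel_sub \<longleftrightarrow> x \<in> borel_sub"
  by (auto simp: borel_sub_def mat22_mult_nth GL2_iff det_2)

lemma borel_functionsD:
  assumes "f \<in> vecs borel_functions"
  shows "x \<notin> GL2 \<Longrightarrow> f x = 0" "b \<in> borel_sub \<Longrightarrow> x \<in> GL2 \<Longrightarrow> f (b ** x) = f x"
  using assms by (auto simp: borel_functions_def)

lemma borel_ind_in: "borel_ind \<in> vecs borel_functions"
  by (auto simp: borel_functions_def borel_ind_def borel_sub_mult_iff borel_sub_GL2)

lemma right_transl_borel_functions: "g \<in> GL2 \<Longrightarrow> f \<in> vecs borel_functions \<Longrightarrow> right_transl g f \<in> vecs borel_functions"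
  by (auto simp: borel_functions_def right_transl_def GL2_mult_iff matrix_mul_assoc[symmetric])

text \<open>Expansion in indicators of the cosets of the Borel subgroup, namely that subgroup itself
  and the translates by \<open>upr t ** matrix_inv n_s\<close>.\<close>

lemma borel_function_expand:
  assumes f: "f \<in> vecs borel_functions"
  shows "f = pointwise (*) (f (mat 1)) borel_ind
    + (\<Sum>t\<in>UNIV. pointwise (*) (f (matrix_inv (upr t ** matrix_inv n_s)))
        (right_transl (upr t ** matrix_inv n_s) (borel_ind :: 'a::{field,finite} mat22 \<Rightarrow> 'c::field)))"
    (is "f = ?g")
proof
  fix x :: "'a mat22"
  have s: "?g x = f (mat 1) * borel_ind x + (\<Sum>t\<in>UNIV. f (matrix_inv (upr t ** matrix_inv n_s)) * borel_ind (x ** (upr t ** matrix_inv n_s)))"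
    by (simp add: pointwise_def right_transl_def sum_fun_apply)
  show "f x = ?g x"
  proof (cases "x \<in> GL2")
    case x: True
    show ?thesis
    proof (cases "x \<in> borel_sub")
      case True
      then have "x ** (upr t ** matrix_inv n_s) \<notin> borel_sub" for t using bruhat_right[OF x] by (simp add: borel_sub_def)
      then show ?thesis unfolding s using True borel_functionsD(2)[OF f True GL2_one] by (simp add: borel_ind_def)
    next
      case False
      let ?t = "- x $ 2 $ 2 / x $ 2 $ 1"
      have b: "x ** (upr t ** matrix_inv n_s) \<in> borel_sub \<longleftrightarrow> t = ?t" for t
        using bruhat_right[OF x] False x by (simp add: borel_sub_def)
      have "?g x = (\<Sum>t\<in>UNIV. if t = ?t then f (matrix_inv (upr t ** matrix_inv n_s)) else 0)"
        unfolding s by (simp add: borel_ind_def b False if_distrib cong: if_cong)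
      also have "\<dots> = f (matrix_inv (upr ?t ** matrix_inv n_s))" by simp
      also have "\<dots> = f (x ** (upr ?t ** matrix_inv n_s) ** matrix_inv (upr ?t ** matrix_inv n_s))"
        by (rule borel_functionsD(2)[OF f, symmetric]) (use b in simp_all)
      also have "\<dots> = f x" by (subst mult_inv_cancel) simp_all
      finally show ?thesis by simp
    qed
  next
    case False
    then have "x ** g \<notin> borel_sub" if "g \<in> GL2" for g
      using that borel_sub_GL2 GL2_mult_iff by blast
    then show ?thesis using False borel_functionsD(1)[OF f False] borel_sub_GL2 unfolding s
      by (auto simp: borel_ind_def)
  qed
qed

text \<open>The value at \<open>mat 1\<close> does not move, so the constants by which the
  translates differ are 0; being truly \<open>U\<close>-invariant, \<open>f\<close> is constant on
  each of the two Bruhat cells.\<close>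

lemma borel_function_unip_invariant:
  assumes f: "f \<in> vecs borel_functions"
    and inv: "\<And>t. right_transl (upr t) f - f \<in> constant_functions"
  shows "f - pointwise (*) (f (mat 1) - f n_s) borel_ind \<in> constant_functions"
proof -
  have u: "f (x ** upr t) = f x" if x: "x \<in> GL2" for x t
  proof -
    obtain c where c: "right_transl (upr t) f - f = (\<lambda>x. if x \<in> GL2 then c else 0)"
      using inv[of t] by (auto simp: constant_functions_def)
    have "upr t \<in> borel_sub" by (simp add: borel_sub_def)
    then have "f (upr t ** mat 1) = f (mat 1)" by (rule borel_functionsD(2)[OF f _ GL2_one])
    then have "c = 0" using fun_cong[OF c, of "mat 1"] by (simp add: right_transl_def)
    then show ?thesis using fun_cong[OF c, of x] x by (simp add: right_transl_def)
  qed
  have "f x = f n_s" if x: "x \<in> GL2" "x \<notin> borel_sub" for x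
  proof -
    let ?t = "- x $ 2 $ 2 / x $ 2 $ 1"
    have b: "x ** (upr ?t ** matrix_inv n_s) \<in> borel_sub" using bruhat_right[OF x(1)] x by (simp add: borel_sub_def)
    have "f n_s = f (x ** (upr ?t ** matrix_inv n_s) ** n_s)"
      by (rule borel_functionsD(2)[OF f b n_s_GL2, symmetric])
    also have "x ** (upr ?t ** matrix_inv n_s) ** n_s = x ** upr ?t"
      using mult_inv_cancel[of "matrix_inv n_s" "x ** upr ?t"] by (simp only: matrix_mul_assoc) simp
    finally show ?thesis using u[OF x(1)] by simp
  qed
  moreover have "f x = f (mat 1)" if "x \<in> borel_sub" for x
    using borel_functionsD(2)[OF f that GL2_one] by simp
  ultimately have "(f - pointwise (*) (f (mat 1) - f n_s) borel_ind) x = (if x \<in> GL2 then f n_s else 0)" for x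
    using borel_functionsD(1)[OF f, of x] borel_sub_GL2[of x]
    by (cases "x \<in> borel_sub"; cases "x \<in> GL2") (simp_all add: pointwise_def borel_ind_def)
  then have "f - pointwise (*) (f (mat 1) - f n_s) borel_ind = (\<lambda>x. if x \<in> GL2 then f n_s else 0)" by (rule ext)
  then show ?thesis by (auto simp: constant_functions_def)
qed

lemma quotient_steinberg: "quotient GL2 (borel_functions :: ('a::field mat22, 'c::field, _) repr) constant_functions"
proof
  show "is_rep GL2 (borel_functions :: ('a mat22, 'c, _) repr)" by (rule is_rep_borel_functions)
  show "constant_functions \<subseteq> vecs (borel_functions :: ('a mat22, 'c, _) repr)"
    by (auto simp: constant_functions_def borel_functions_def borel_sub_GL2)
  show "Modules.module.subspace (scl borel_functions) (constant_functions :: ('a mat22 \<Rightarrow> 'c) set)"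
  proof (rule subspaceI[OF is_rep_vector_space[OF is_rep_borel_functions]])
    show "0 \<in> constant_functions" by (auto simp: constant_functions_def intro!: exI[of _ 0])
    fix x y :: "'a mat22 \<Rightarrow> 'c" assume "x \<in> constant_functions" "y \<in> constant_functions"
    then obtain a b where "x = (\<lambda>x. if x \<in> GL2 then a else 0)" "y = (\<lambda>x. if x \<in> GL2 then b else 0)"
      by (auto simp: constant_functions_def)
    then show "x + y \<in> constant_functions" by (auto simp: constant_functions_def fun_eq_iff intro!: exI[of _ "a + b"])
  next
    fix c and x :: "'a mat22 \<Rightarrow> 'c" assume "x \<in> constant_functions"
    then obtain a where "x = (\<lambda>x. if x \<in> GL2 then a else 0)" by (auto simp: constant_functions_def)
    then show "scl borel_functions c x \<in> constant_functions"
      by (auto simp: constant_functions_def borel_functions_def pointwise_def fun_eq_iff intro!: exI[of _ "c * a"])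
  qed
  fix g :: "'a mat22" and x :: "'a mat22 \<Rightarrow> 'c" assume "g \<in> GL2" "x \<in> constant_functions"
  then show "opr borel_functions g x \<in> constant_functions"
    by (auto simp: constant_functions_def borel_functions_def right_transl_def GL2_mult_iff)
qed simp

lemma one_dim_subspace:
  assumes "vector_space s" "Modules.module.subspace s S" "vector_space.dim s S = 1"
    and v: "v \<in> S" "v \<noteq> 0" and u: "u \<in> S"
  shows "\<exists>c. u = s c v"
proof -
  interpret vector_space s by (rule assms)
  obtain B where B: "B \<subseteq> S" "S \<subseteq> span B" "card B = dim S" using basis_exists by metis
  then obtain b where "B = {b}" using assms(3) by (metis card_1_singletonE)
  then have "S \<subseteq> range (\<lambda>k. s k b)" using B(2) by (simp add: span_singleton)
  then obtain k l where k: "v = s k b" "u = s l b" using v(1) u by blast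
  then have "k \<noteq> 0" using v(2) by auto
  then have "u = s (l / k) v" using k by simp
  then show ?thesis by blast
qed

text \<open>The twisted Steinberg representation as the image of a map \<open>T\<close> from
  functions with the constants as kernel, which avoids computing with cosets.\<close>

locale steinberg_model = fin_rep V for V :: "('a::{field,finite} mat22, 'c::field, 'v::ab_group_add) repr" +
  fixes \<psi> :: "'a \<Rightarrow> 'c" and T :: "('a mat22 \<Rightarrow> 'c) \<Rightarrow> 'v"
  assumes \<psi>: "mult_char \<psi>"
    and T_closed: "\<And>f. f \<in> vecs borel_functions \<Longrightarrow> T f \<in> vecs V" and T_surj: "vecs V \<subseteq> T ` vecs borel_functions"
    and T_add: "\<And>f f'. f \<in> vecs borel_functions \<Longrightarrow> f' \<in> vecs borel_functions \<Longrightarrow> T (f + f') = T f + T f'"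
    and T_scl: "\<And>f c. f \<in> vecs borel_functions \<Longrightarrow> T (pointwise (*) c f) = scl V c (T f)"
    and T_opr: "\<And>f g. f \<in> vecs borel_functions \<Longrightarrow> g \<in> GL2 \<Longrightarrow> opr V g (T f) = scl V (\<psi> (det g)) (T (right_transl g f))"
    and T_zero_iff: "\<And>f. f \<in> vecs borel_functions \<Longrightarrow> T f = 0 \<longleftrightarrow> f \<in> constant_functions"
begin

abbreviation "B \<equiv> borel_functions :: ('a mat22, 'c, 'a mat22 \<Rightarrow> 'c) repr"

lemmas B_closed = subspaceD[OF is_rep_vector_space is_rep_subspace, OF is_rep_borel_functions is_rep_borel_functions]

lemma B_scl: "f \<in> vecs B \<Longrightarrow> pointwise (*) c f \<in> vecs B"
  using B_closed(3)[of f c] by (simp add: borel_functions_def)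

lemma T_sum: "(\<And>i. i \<in> I \<Longrightarrow> f i \<in> vecs B) \<Longrightarrow> T (sum f I) = (\<Sum>i\<in>I. T (f i))"
proof (induction I rule: infinite_finite_induct)
  case (insert i I)
  have "T (f i + sum f I) = T (f i) + T (sum f I)" using insert by (intro T_add B_closed(6)) auto
  moreover have "T (sum f I) = (\<Sum>i\<in>I. T (f i))" using insert by blast
  ultimately show ?case unfolding sum.insert[OF insert(1,2)] by (simp only:)
next
  case empty
  have "(0 :: 'a mat22 \<Rightarrow> 'c) \<in> constant_functions" by (auto simp: constant_functions_def intro!: exI[of _ 0])
  then show ?case using T_zero_iff[OF B_closed(1)] by (simp only: sum.empty)
next
  case (infinite I)
  have "(0 :: 'a mat22 \<Rightarrow> 'c) \<in> constant_functions" by (auto simp: constant_functions_def intro!: exI[of _ 0])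
  then have "T 0 = 0" using T_zero_iff[OF B_closed(1)] by blast
  then show ?case unfolding sum.infinite[OF infinite(1)] .
qed

definition x :: 'v where "x = T borel_ind"

lemma x_in: "x \<in> vecs V" unfolding x_def by (rule T_closed[OF borel_ind_in])

lemma opr_x: "g \<in> GL2 \<Longrightarrow> opr V g x = scl V (\<psi> (det g)) (T (right_transl g borel_ind))"
  unfolding x_def by (rule T_opr[OF borel_ind_in])

lemma borel_opr:
  assumes b: "b \<in> borel_sub" shows "opr V b x = scl V (\<psi> (det b)) x"
proof -
  have "borel_ind (z ** b) = (borel_ind z :: 'c)" for z
  proof (cases "z \<in> GL2")
    case True
    then show ?thesis using b by (simp add: borel_ind_def mult_borel_sub_iff)
  next
    case False
    then show ?thesis using borel_sub_GL2 GL2_mult_iff[OF borel_sub_GL2[OF b], of z] by (auto simp: borel_ind_def)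
  qed
  then have "right_transl b borel_ind = (borel_ind :: 'a mat22 \<Rightarrow> 'c)" by (simp add: right_transl_def)
  then show ?thesis using opr_x[OF borel_sub_GL2[OF b]] by (simp add: x_def)
qed

lemma diag_borel: "h \<in> diag_sub \<Longrightarrow> h \<in> borel_sub" by (simp add: diag_sub_def borel_sub_def)

text \<open>The indicator of the Borel subgroup and its translates over \<open>U n_s^-1\<close> add
  up to the constant 1, which is zero in \<open>V\<close>.\<close>

lemma unip_sum_x: "unip_sum x = - x"
proof -
  let ?r = "\<lambda>t. right_transl (upr t ** matrix_inv n_s) borel_ind :: 'a mat22 \<Rightarrow> 'c"
  have r: "?r t \<in> vecs B" for t by (intro right_transl_borel_functions borel_ind_in) simp
  have "opr V (upr t) (opr V (matrix_inv n_s) x) = T (?r t)" for t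
  proof -
    have "opr V (upr t) (opr V (matrix_inv n_s) x) = opr V (upr t ** matrix_inv n_s) x"
      using x_in by (simp add: opr_mult)
    also have "\<dots> = T (?r t)" using mult_charD(1)[OF \<psi>] by (subst opr_x) (simp_all add: det_mul scl_simps)
    finally show ?thesis .
  qed
  then have "unip_sum x = (\<Sum>t\<in>UNIV. T (?r t))" by (simp only: unip_sum_eq)
  also have "\<dots> = T (sum ?r UNIV)" using r by (simp add: T_sum)
  finally have u: "unip_sum x = T (sum ?r UNIV)" .
  have "(sum ?r UNIV + borel_ind) z = (if z \<in> GL2 then 1 else 0)" for z
  proof (cases "z \<in> GL2")
    case z: True
    have "sum ?r UNIV z = (\<Sum>t\<in>UNIV. if z $ 2 $ 1 \<noteq> 0 \<and> t = - z $ 2 $ 2 / z $ 2 $ 1 then 1 else 0)"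
      by (simp add: sum_fun_apply right_transl_def borel_ind_def bruhat_right[OF z])
    then show ?thesis using z by (cases "z $ 2 $ 1 = 0") (simp_all add: borel_ind_def borel_sub_def)
  next
    case False
    then show ?thesis using borel_functionsD(1)[OF B_closed(2)[OF B_closed(6)[of UNIV ?r, OF r] borel_ind_in] False] by (simp only: if_False)
  qed
  then have "sum ?r UNIV + borel_ind \<in> constant_functions" unfolding constant_functions_def by blast
  then have "T (sum ?r UNIV + borel_ind) = 0" using T_zero_iff[OF B_closed(2)[OF B_closed(6)[of UNIV ?r, OF r] borel_ind_in]] by blast
  then have "T (sum ?r UNIV) + x = 0"
    using T_add[OF B_closed(6)[of UNIV ?r, OF r] borel_ind_in] by (simp only: x_def)
  then show ?thesis unfolding u by (simp only: eq_neg_iff_add_eq_0)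
qed

lemma span: "orbit_span x = vecs V"
proof
  show "orbit_span x \<subseteq> vecs V" by (rule orbit_span_sub[OF x_in])
  show "vecs V \<subseteq> orbit_span x"
  proof
    fix u assume "u \<in> vecs V"
    then obtain f where f: "f \<in> vecs B" "u = T f" using T_surj by blast
    note O = subspaceD[OF vs orbit_span_subspace[OF x_in]]
    let ?r = "\<lambda>t. right_transl (upr t ** matrix_inv n_s) borel_ind :: 'a mat22 \<Rightarrow> 'c"
    let ?c = "\<lambda>t. f (matrix_inv (upr t ** matrix_inv n_s))"
    have r: "?r t \<in> vecs B" for t by (intro right_transl_borel_functions borel_ind_in) simp
    have "T f = T (pointwise (*) (f (mat 1)) borel_ind + (\<Sum>t\<in>UNIV. pointwise (*) (?c t) (?r t)))"
      using borel_function_expand[OF f(1)] by (rule arg_cong)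
    also have "\<dots> = scl V (f (mat 1)) x + T (\<Sum>t\<in>UNIV. pointwise (*) (?c t) (?r t))"
      using r by (subst T_add) (auto simp: x_def T_scl borel_ind_in intro!: B_scl B_closed(6))
    also have "T (\<Sum>t\<in>UNIV. pointwise (*) (?c t) (?r t)) = (\<Sum>t\<in>UNIV. T (pointwise (*) (?c t) (?r t)))"
      by (rule T_sum) (intro B_scl r)
    also have "\<dots> = (\<Sum>t\<in>UNIV. scl V (?c t) (T (?r t)))" by (intro sum.cong refl T_scl r)
    finally have "u = scl V (f (mat 1)) x + (\<Sum>t\<in>UNIV. scl V (?c t) (T (?r t)))" using f(2) by simp
    moreover have "T (?r t) = opr V (upr t ** matrix_inv n_s) x" for t
      using mult_charD(1)[OF \<psi>] by (simp add: opr_x det_mul scl_simps)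
    ultimately show "u \<in> orbit_span x"
      using in_orbit_span[OF x_in] orbit_in_span[OF x_in] by (auto intro!: O)
  qed
qed

lemma one_dim:
  assumes u: "u \<in> invariants unip_sub V" shows "\<exists>c. u = scl V c x"
proof -
  obtain f where f: "f \<in> vecs B" "u = T f" using T_surj u by (auto simp: invariants_def)
  have "right_transl (upr t) f - f \<in> constant_functions" for t
  proof -
    have r: "right_transl (upr t) f \<in> vecs B" using f by (intro right_transl_borel_functions) auto
    have "T f = T (right_transl (upr t) f)"
      using u f T_opr[OF f(1) upr_GL2, of t] mult_charD(1)[OF \<psi>] by (simp add: invariants_def scl_simps)
    moreover have "T (right_transl (upr t) f) = T (right_transl (upr t) f - f) + T f"
      using T_add[OF B_closed(5)[OF r f(1)] f(1)] by simp
    ultimately show ?thesis using T_zero_iff[OF B_closed(5)[OF r f(1)]] by simp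
  qed
  then have c: "f - pointwise (*) (f (mat 1) - f n_s) borel_ind \<in> constant_functions"
    by (rule borel_function_unip_invariant[OF f(1)])
  have p: "pointwise (*) (f (mat 1) - f n_s) borel_ind \<in> vecs B" by (rule B_scl[OF borel_ind_in])
  have "T f = T (f - pointwise (*) (f (mat 1) - f n_s) borel_ind) + T (pointwise (*) (f (mat 1) - f n_s) borel_ind)"
    using T_add[OF B_closed(5)[OF f(1) p] p] by simp
  then have "u = scl V (f (mat 1) - f n_s) x"
    using c T_zero_iff[OF B_closed(5)[OF f(1) p]] T_scl[OF borel_ind_in] by (simp add: f(2) x_def)
  then show ?thesis by blast
qed

text \<open>The conclusion is exactly the hypothesis of \<open>comb_steinberg\<close>; hence every
  relation satisfied by \<open>x\<close> holds for any eigenvector on which \<open>unip_sum\<close>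
  is -1.\<close>

lemma comb_eq_0:
  assumes "comb c x = 0"
  shows "\<exists>\<kappa>. \<forall>z\<in>GL2. (\<Sum>g\<in>GL2. if z ** g \<in> borel_sub then c g * \<psi> (det g) else 0) = \<kappa>"
proof -
  let ?r = "\<lambda>g. pointwise (*) (c g * \<psi> (det g)) (right_transl g borel_ind)"
  have r: "?r g \<in> vecs B" if "g \<in> GL2" for g
    using that by (intro B_scl right_transl_borel_functions borel_ind_in)
  have "comb c x = (\<Sum>g\<in>GL2. T (?r g))" unfolding comb_def
    by (intro sum.cong refl) (simp add: opr_x T_scl right_transl_borel_functions borel_ind_in scl_simps)
  also have "\<dots> = T (sum ?r GL2)" using r by (simp add: T_sum)
  finally have "sum ?r GL2 \<in> constant_functions" using assms T_zero_iff[OF B_closed(6)[of GL2 ?r, OF r]] by simp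
  then obtain \<kappa> where \<kappa>: "sum ?r GL2 = (\<lambda>z. if z \<in> GL2 then \<kappa> else 0)" by (auto simp: constant_functions_def)
  have "(\<Sum>g\<in>GL2. if z ** g \<in> borel_sub then c g * \<psi> (det g) else 0) = sum ?r GL2 z" for z
    unfolding sum_fun_apply by (intro sum.cong refl) (simp add: pointwise_def right_transl_def borel_ind_def)
  then show ?thesis using \<kappa> by auto
qed

end

text \<open>Brings the three kinds of \<open>rho\<close> under common hypotheses:
  \<open>card\<close> says that \<open>q\<close> vanishes in the coefficients, and
  \<open>prime\<close> records \<open>q = p\<close> whenever \<open>chi\<close> is not its own
  conjugate.\<close>

locale rho_vector = fin_rep V for V :: "('a::{field,finite} mat22, 'c::field, 'v::ab_group_add) repr" +
  fixes chi :: "'a mat22 \<Rightarrow> 'c" and J :: "'a mat22 set" and v :: 'v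
  assumes chi: "diag_char chi" and rho: "is_rho chi J V" and v: "v \<in> invariants unip_sub V" "v \<noteq> 0"
    and card: "of_nat CARD('a) = (0 :: 'c)"
    and prime: "\<not> char_eq chi (conj_s chi)
      \<Longrightarrow> Factorial_Ring.prime CARD('a) \<and> CHAR('a) = CARD('a) \<and> CHAR('c) = CARD('a)"
begin

lemma v_in: "v \<in> vecs V" using v by (simp add: invariants_def)

definition sign :: 'c where
  "sign = (if char_eq chi (conj_s chi) \<and> J \<noteq> {weyl_s} then - 1 else 0)"

lemma invs_subspace: "Modules.module.subspace (scl V) (invariants unip_sub V)"
  by (rule subspaceI[OF vs]) (auto simp: invariants_def vecs_closed opr_add opr_scl opr_zero unip_sub_def)

lemma trivial_case:
  assumes "char_eq chi (conj_s chi)" "J = {weyl_s}"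
  obtains \<psi> where "mult_char \<psi>" "\<And>h. h \<in> diag_sub \<Longrightarrow> chi h = \<psi> (det h)"
    "\<And>g x. g \<in> GL2 \<Longrightarrow> x \<in> vecs V \<Longrightarrow> opr V g x = scl V (\<psi> (det g)) x"
    "\<And>u. u \<in> vecs V \<Longrightarrow> \<exists>c. u = scl V c v"
proof -
  obtain \<psi> \<Theta> where \<psi>: "mult_char \<psi>" "char_eq chi (\<psi> \<circ> det)"
    and \<Theta>: "\<Theta> \<in> Hom GL2 V (twist (\<psi> \<circ> det) trivial_rep)" "inj_on \<Theta> (vecs V)"
    using rho assms unfolding is_rho_def isomorphic_def bij_betw_def by auto
  note h = HomD[OF \<Theta>(1), unfolded twist_def trivial_rep_def, simplified]
  have 0: "\<Theta> 0 = 0" using h(3)[of 0 0] vecs_closed(1) by (simp add: scl_simps)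
  have v0: "\<Theta> v \<noteq> 0" using \<Theta>(2) v_in v(2) 0 vecs_closed(1) by (metis inj_onD)
  show ?thesis
  proof (rule that[OF \<psi>(1)])
    show "chi h = \<psi> (det h)" if "h \<in> diag_sub" for h using \<psi>(2) that by (simp add: char_eq_def)
    show "opr V g x = scl V (\<psi> (det g)) x" if "g \<in> GL2" "x \<in> vecs V" for g x
      by (rule inj_onD[OF \<Theta>(2)]) (use that in \<open>simp_all add: h opr_closed vecs_closed\<close>)
    show "\<exists>c. u = scl V c v" if "u \<in> vecs V" for u
    proof
      show "u = scl V (\<Theta> u / \<Theta> v) v"
        by (rule inj_onD[OF \<Theta>(2)]) (use that v_in v0 in \<open>simp_all add: h vecs_closed\<close>)
    qed
  qed
qed

text \<open>\<open>T\<close> sends a function to the preimage of its coset under the given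
  isomorphism; each property is checked after applying that isomorphism.\<close>

lemma steinberg_case:
  assumes "char_eq chi (conj_s chi)" "J \<noteq> {weyl_s}"
  obtains \<psi> T where "\<And>h. h \<in> diag_sub \<Longrightarrow> chi h = \<psi> (det h)" "steinberg_model V \<psi> T"
proof -
  let ?B = "borel_functions :: ('a mat22, 'c, _) repr" and ?C = "constant_functions :: ('a mat22 \<Rightarrow> 'c) set"
  interpret Q: quotient GL2 ?B ?C by (rule quotient_steinberg)
  have B: "scl ?B = pointwise (*)" "opr ?B = right_transl" by (simp_all add: borel_functions_def)
  note coset_scl = Q.coset_scl[unfolded B] and coset_opr = Q.coset_opr[unfolded B]
  obtain \<psi> \<Theta> where \<psi>: "mult_char \<psi>" "char_eq chi (\<psi> \<circ> det)"
    and \<Theta>: "\<Theta> \<in> Hom GL2 V (twist (\<psi> \<circ> det) steinberg)" "bij_betw \<Theta> (vecs V) (vecs (twist (\<psi> \<circ> det) (steinberg :: ('a mat22, 'c, _) repr)))"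
    using rho assms unfolding is_rho_def isomorphic_def by auto
  have st: "vecs (twist (\<psi> \<circ> det) (steinberg :: ('a mat22, 'c, _) repr)) = (\<lambda>f. f +o ?C) ` vecs ?B"
    by (simp add: twist_def steinberg_def quotient_rep_def)
  note \<Theta>b = \<Theta>(2)[unfolded st]
  have h: "\<Theta> (x + y) = \<Theta> x + \<Theta> y" "\<Theta> (scl V c x) = pointwise (*) c ` \<Theta> x + ?C"
    "g \<in> GL2 \<Longrightarrow> \<Theta> (opr V g x) = pointwise (*) (\<psi> (det g)) ` (right_transl g ` \<Theta> x) + ?C"
    if "x \<in> vecs V" "y \<in> vecs V" for x y c g
    using HomD[OF \<Theta>(1)] that by (simp_all add: twist_def steinberg_def quotient_rep_def B)
  define T where "T f = inv_into (vecs V) \<Theta> (f +o ?C)" for f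
  have T: "T f \<in> vecs V" "\<Theta> (T f) = f +o ?C" if "f \<in> vecs ?B" for f
  proof -
    have m: "f +o ?C \<in> \<Theta> ` vecs V" using \<Theta>b that unfolding bij_betw_def by blast
    show "T f \<in> vecs V" unfolding T_def by (rule inv_into_into[OF m])
    show "\<Theta> (T f) = f +o ?C" unfolding T_def by (rule f_inv_into_f[OF m])
  qed
  have inj: "x = y" if "x \<in> vecs V" "y \<in> vecs V" "\<Theta> x = \<Theta> y" for x y
    using \<Theta>b that unfolding bij_betw_def inj_on_def by blast
  \<comment> \<open>Sets under Minkowski sum form no group, so linearity of \<open>\<Theta>\<close>
    does not give this directly. A coset equal to its own double is the zero coset.\<close>
  have T0: "T 0 = 0"
  proof (rule inj)
    have "\<Theta> 0 = \<Theta> 0 + \<Theta> 0" using h(1)[of 0 0] vecs_closed(1) by simp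
    moreover obtain f where f: "f \<in> vecs ?B" "\<Theta> 0 = f +o ?C" using \<Theta>b vecs_closed(1) unfolding bij_betw_def by blast
    ultimately have "f +o ?C = (f + f) +o ?C" by (simp only: Q.coset_add)
    then have "f - (f + f) \<in> ?C" by (simp only: Q.coset_eq_iff)
    then have "0 - f \<in> ?C" by simp
    then have "0 +o ?C = f +o ?C" by (simp only: Q.coset_eq_iff)
    then show "\<Theta> (T 0) = \<Theta> 0" using T(2)[of 0] Q.vecs_closed(1) f(2) by simp
  qed (use T(1)[OF Q.vecs_closed(1)] vecs_closed(1) in auto)
  have "steinberg_model V \<psi> T"
  proof
    show "mult_char \<psi>" by (rule \<psi>(1))
    show "vecs V \<subseteq> T ` vecs ?B"
    proof
      fix x assume x: "x \<in> vecs V"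
      then obtain f where f: "f \<in> vecs ?B" "\<Theta> x = f +o ?C" using \<Theta>b unfolding bij_betw_def by blast
      then have "x = T f" using T x inj by simp
      then show "x \<in> T ` vecs ?B" using f by blast
    qed
    fix f :: "'a mat22 \<Rightarrow> 'c" assume f: "f \<in> vecs ?B"
    show "T f \<in> vecs V" by (rule T(1)[OF f])
    show "T (f + f') = T f + T f'" if f': "f' \<in> vecs ?B" for f'
      by (rule inj) (use T[OF f] T[OF f'] T[OF Q.vecs_closed(2)[OF f f']] in \<open>simp_all add: h vecs_closed Q.coset_add\<close>)
    show "T (pointwise (*) c f) = scl V c (T f)" for c
    proof (rule inj)
      have p: "pointwise (*) c f \<in> vecs ?B" using Q.vecs_closed(3)[OF f] by (simp add: B)
      show "T (pointwise (*) c f) \<in> vecs V" "scl V c (T f) \<in> vecs V" using T[OF p] T[OF f] vecs_closed by auto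
      show "\<Theta> (T (pointwise (*) c f)) = \<Theta> (scl V c (T f))"
        unfolding T(2)[OF p] h(2)[OF T(1)[OF f] T(1)[OF f]] T(2)[OF f] coset_scl ..
    qed
    show "opr V g (T f) = scl V (\<psi> (det g)) (T (right_transl g f))" if g: "g \<in> GL2" for g
    proof (rule inj)
      have p: "right_transl g f \<in> vecs ?B" using right_transl_borel_functions[OF g f] .
      show "opr V g (T f) \<in> vecs V" "scl V (\<psi> (det g)) (T (right_transl g f)) \<in> vecs V"
        using T[OF p] T[OF f] vecs_closed opr_closed[OF g] by auto
      show "\<Theta> (opr V g (T f)) = \<Theta> (scl V (\<psi> (det g)) (T (right_transl g f)))"
        unfolding h(2)[OF T(1)[OF p] T(1)[OF p]] h(3)[OF T(1)[OF f] T(1)[OF f] g] T(2)[OF p] T(2)[OF f] coset_opr[OF g f] ..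
    qed
    have "\<Theta> (T f) = \<Theta> (T 0) \<longleftrightarrow> f \<in> ?C"
      unfolding T(2)[OF f] T(2)[OF Q.vecs_closed(1)] Q.coset_eq_iff by (simp only: diff_zero)
    then show "T f = 0 \<longleftrightarrow> f \<in> ?C"
      using inj[OF T(1)[OF f] T(1)[OF Q.vecs_closed(1)]] unfolding T0 by metis
  qed
  moreover have "chi h = \<psi> (det h)" if "h \<in> diag_sub" for h using \<psi>(2) that by (simp add: char_eq_def)
  ultimately show ?thesis using that by blast
qed

text \<open>The vector \<open>unip_sum v\<close> is \<open>U\<close>-invariant, so \<open>H\<close>
  acts on it by \<open>chi\<close>; passing through \<open>n_s\<close>, it also acts by
  \<open>conj_s chi\<close>. As the two characters differ, the vector is zero.\<close>

lemma generic_case: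
  assumes ne: "\<not> char_eq chi (conj_s chi)"
  shows "u \<in> invariants unip_sub V \<Longrightarrow> \<exists>c. u = scl V c v"
    "eigenvector V chi v" "unip_sum v = 0" "orbit_span v = vecs V"
proof -
  have irr: "irreducible_rep GL2 V" and dim: "vector_space.dim (scl V) (invariants unip_sub V) = 1"
    and eig: "\<And>b x. b \<in> borel_sub \<Longrightarrow> x \<in> invariants unip_sub V \<Longrightarrow> opr V b x = scl V (chi (diag_part b)) x"
    using rho ne by (auto simp: is_rho_def)
  show one: "\<exists>c. u = scl V c v" if "u \<in> invariants unip_sub V" for u
    by (rule one_dim_subspace[OF vs invs_subspace dim v that])
  have dg: "opr V h x = scl V (chi h) x" if "h \<in> diag_sub" "x \<in> invariants unip_sub V" for h x
  proof -
    have "h \<in> borel_sub" "diag_part h = h" using that by (auto simp: diag_sub_def borel_sub_def diag_part_def mat22_eq_iff)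
    then show ?thesis using eig[of h x] that by simp
  qed
  show "eigenvector V chi v" by unfold_locales (use chi v dg in auto)
  interpret eigenvector V chi v by unfold_locales (use chi v dg in auto)
  show "orbit_span v = vecs V" by (rule orbit_span_irreducible[OF irr v_in v(2)])
  let ?z = "\<Sum>t\<in>UNIV. y t"
  have zin: "?z \<in> vecs V" using y_in by (intro vecs_closed) auto
  have zinv: "?z \<in> invariants unip_sub V"
  proof -
    have "opr V (upr s) ?z = ?z" for s
    proof -
      have "opr V (upr s) ?z = (\<Sum>t\<in>UNIV. y (s + t))" using y_in by (subst opr_sum) (auto simp: upr_y)
      also have "\<dots> = ?z" by (rule sum.reindex_bij_witness[of _ "\<lambda>t. t - s" "\<lambda>t. s + t"]) auto
      finally show ?thesis .
    qed
    then show ?thesis using zin by (auto simp: invariants_def unip_sub_eq)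
  qed
  have conj: "opr V h ?z = scl V (conj_s chi h) ?z" if h: "h \<in> diag_sub" for h
  proof -
    let ?a = "h $ 1 $ 1" and ?b = "h $ 2 $ 2"
    let ?h = "mat22 ?b 0 0 ?a"
    have nz: "h = mat22 ?a 0 0 ?b" "?a \<noteq> 0" "?b \<noteq> 0" using h by (auto simp: diag_sub_eq)
    have hb: "?h \<in> borel_sub" using nz(2,3) by (simp add: borel_sub_def GL2_iff)
    have y: "opr V h (y t) = scl V (conj_s chi h) (y (?a / ?b * t))" for t
    proof -
      have "mat22 ?a 0 0 ?b ** upr t = upr (?a / ?b * t) ** mat22 ?a 0 0 ?b" using nz(3) by (simp add: mat22_mult)
      then have "h ** (upr t ** matrix_inv n_s) = upr (?a / ?b * t) ** matrix_inv n_s ** ?h"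
        using nz(1) conj_n_s[of ?b ?a] by (metis matrix_mul_assoc)
      then have "opr V h (y t) = opr V (upr (?a / ?b * t) ** matrix_inv n_s ** ?h) v"
        using v_in diag_sub_GL2[OF h] by (simp add: y_eq flip: opr_mult)
      then show ?thesis using opr_borel_y[OF hb] nz(1) by (simp add: diag_part_def conj_s_eq) (metis diag_sub_eq h mat22_nth)
    qed
    have "opr V h ?z = (\<Sum>t\<in>UNIV. scl V (conj_s chi h) (y (?a / ?b * t)))"
      using y_in h by (subst opr_sum) (auto simp: y diag_sub_GL2)
    also have "\<dots> = (\<Sum>t\<in>UNIV. scl V (conj_s chi h) (y t))"
      by (rule sum.reindex_bij_witness[of _ "\<lambda>t. ?b / ?a * t" "\<lambda>t. ?a / ?b * t"]) (use nz(2,3) in auto)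
    finally show ?thesis by (simp add: scl_simps)
  qed
  show "unip_sum v = 0"
  proof (rule ccontr)
    assume "unip_sum v \<noteq> 0"
    then have z: "?z \<noteq> 0" by (simp add: sum_y)
    have "chi h = conj_s chi h" if h: "h \<in> diag_sub" for h
    proof (rule ccontr)
      assume "chi h \<noteq> conj_s chi h"
      moreover have "scl V (chi h + - conj_s chi h) ?z = 0"
        unfolding scl_simps(2,9) dg[OF h zinv, symmetric] conj[OF h] by simp
      ultimately show False using scl_simps(13)[of "chi h + - conj_s chi h" ?z] z by simp
    qed
    then show False using ne by (simp add: char_eq_def)
  qed
qed

lemma rho_vector:
  shows one_dim: "u \<in> invariants unip_sub V \<Longrightarrow> \<exists>c. u = scl V c v"
    and eigen: "eigenvector V chi v" and unip_sum_v: "unip_sum v = scl V sign v"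
    and span: "orbit_span v = vecs V"
proof -
  have "(\<forall>u\<in>invariants unip_sub V. \<exists>c. u = scl V c v) \<and> eigenvector V chi v
    \<and> unip_sum v = scl V sign v \<and> orbit_span v = vecs V"
  proof (cases "char_eq chi (conj_s chi)")
    case False
    then show ?thesis using generic_case[OF False] by (simp add: sign_def scl_simps)
  next
    case ce: True
    show ?thesis
    proof (cases "J = {weyl_s}")
      case True
      obtain \<psi> where \<psi>: "mult_char \<psi>" "\<And>h. h \<in> diag_sub \<Longrightarrow> chi h = \<psi> (det h)"
        "\<And>g x. g \<in> GL2 \<Longrightarrow> x \<in> vecs V \<Longrightarrow> opr V g x = scl V (\<psi> (det g)) x"
        "\<And>u. u \<in> vecs V \<Longrightarrow> \<exists>c. u = scl V c v" by (rule trivial_case[OF ce True]) blast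
      \<comment> \<open>All elements involved have determinant 1, so the sum consists of
        \<open>q\<close> copies of \<open>v\<close> and vanishes in characteristic
        \<open>p\<close>.\<close>
      have "unip_sum v = (\<Sum>t\<in>(UNIV :: 'a set). v)"
        unfolding unip_sum_eq using v_in \<psi>(1) by (intro sum.cong refl) (simp add: \<psi>(3) opr_scl mult_charD scl_simps)
      also have "\<dots> = scl V (of_nat CARD('a)) v"
        using scl_simps(12)[of "\<lambda>_. 1" "UNIV :: 'a set" v] by (simp add: scl_simps)
      finally have us: "unip_sum v = 0" by (simp add: card scl_simps)
      have "eigenvector V chi v" by unfold_locales (use chi v v_in \<psi>(2,3) diag_sub_GL2 in auto)
      moreover have "vecs V \<subseteq> orbit_span v"
      proof
        fix u assume "u \<in> vecs V"
        then obtain c where "u = scl V c v" using \<psi>(4) by blast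
        then show "u \<in> orbit_span v"
          using subspaceD(3)[OF vs orbit_span_subspace[OF v_in] in_orbit_span[OF v_in]] by simp
      qed
      moreover have "sign = 0" unfolding sign_def using True by simp
      ultimately show ?thesis using us \<psi>(4) orbit_span_sub[OF v_in] by (auto simp: scl_simps invariants_def)
    next
      case False
      obtain \<psi> T where chi_eq: "\<And>h. h \<in> diag_sub \<Longrightarrow> chi h = \<psi> (det h)" and "steinberg_model V \<psi> T"
        by (rule steinberg_case[OF ce False]) blast
      then interpret steinberg_model V \<psi> T by simp
      obtain k where k: "v = scl V k x" using one_dim[OF v(1)] by blast
      have k0: "k \<noteq> 0" using k v(2) by (auto simp: scl_simps)
      have "\<exists>c. u = scl V c v" if u: "u \<in> invariants unip_sub V" for u
      proof -
        obtain l where "u = scl V l x" using one_dim[OF u] by blast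
        then have "u = scl V (l / k) v" unfolding k using k0 by (simp add: scl_simps)
        then show ?thesis by blast
      qed
      moreover have "eigenvector V chi v"
      proof
        show "opr V h v = scl V (chi h) v" if "h \<in> diag_sub" for h
          using borel_opr[OF diag_borel[OF that]] that x_in unfolding k
          by (simp add: opr_scl diag_sub_GL2 chi_eq scl_simps mult.commute)
      qed (use chi v in auto)
      moreover have "unip_sum v = scl V sign v"
        using ce False unfolding k unip_sum_scl[OF x_in] unip_sum_x by (simp add: sign_def scl_simps)
      moreover have "orbit_span v = vecs V" unfolding k orbit_span_scl[OF x_in k0] by (rule span)
      ultimately show ?thesis by blast
    qed
  qed
  then show "u \<in> invariants unip_sub V \<Longrightarrow> \<exists>c. u = scl V c v" "eigenvector V chi v"
    "unip_sum v = scl V sign v" "orbit_span v = vecs V" by auto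
qed

text \<open>If \<open>chi\<close> is not its own conjugate, the submodule generated by \<open>(v, w)\<close> in the direct sum has
  no stable subspace avoiding \<open>(v, w)\<close>, so it meets \<open>0 \<times> W\<close> trivially.\<close>

lemma comb_kill:
  fixes W :: "('a mat22, 'c, 'w::ab_group_add) repr"
  assumes W: "eigenvector W chi w" and us: "fin_rep.unip_sum W w = scl W sign w" and c: "comb c v = 0"
  shows "fin_rep.comb W c w = 0"
proof -
  interpret V: eigenvector V chi v by (rule eigen)
  interpret W: eigenvector W chi w by (rule W)
  show ?thesis
  proof (cases "char_eq chi (conj_s chi)")
    case False
    let ?D = "direct_sum V W"
    have D: "is_rep GL2 ?D" by (rule is_rep_direct_sum[OF is_rep W.is_rep])
    interpret D: fin_rep ?D by unfold_locales (rule D)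
    have DS: "scl ?D a (z, z') = (scl V a z, scl W a z')" "opr ?D g (z, z') = (opr V g z, opr W g z')" for a g z z'
      by (simp_all add: direct_sum_def)
    have comb: "D.comb d (v, w) = (comb d v, W.comb d w)" for d
      by (simp add: D.comb_def comb_def W.comb_def DS sum_prod)
    have "D.unip_sum (v, w) = (unip_sum v, W.unip_sum w)"
      by (simp add: D.unip_sum_def unip_sum_def W.unip_sum_def DS sum_prod)
    then have us0: "D.unip_sum (v, w) = 0"
      using us generic_case(3)[OF False] False by (simp add: sign_def W.scl_simps zero_prod_def)
    interpret D: prime_eigenvector ?D chi "(v, w)"
      by unfold_locales (use chi V.x W.x V.diag W.diag prime[OF False] False us0 in \<open>auto simp: direct_sum_def invariants_def\<close>)
    note S = D.orbit_span_subspace[OF D.x_in]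
    \<comment> \<open>The part of the submodule inside \<open>0 \<times> W\<close>. Were it nonzero,
      minimality would put \<open>(v, w)\<close> into it, although
      \<open>v \<noteq> 0\<close>.\<close>
    let ?K = "{z \<in> D.orbit_span (v, w). fst z = 0}"
    show ?thesis
    proof (rule ccontr)
      assume nz: "W.comb c w \<noteq> 0"
      have "(v, w) \<in> ?K"
      proof (rule D.orbit_span_minimal)
        show "Modules.module.subspace (scl ?D) ?K"
        proof (rule subspaceI[OF D.vs])
          show "scl ?D a z \<in> ?K" if "z \<in> ?K" for a z
            using that subspaceD(3)[OF D.vs S, of z a] by (cases z) (simp add: DS scl_simps)
        qed (simp_all add: subspaceD[OF D.vs S])
        show "opr ?D g z \<in> ?K" if "g \<in> GL2" "z \<in> ?K" for g z
          using that D.orbit_span_opr[OF D.x_in that(1), of z] by (cases z) (simp add: DS opr_zero)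
        have "(0, W.comb c w) = D.comb c (v, w)" by (simp only: comb c)
        then have "(0, W.comb c w) \<in> D.orbit_span (v, w)" unfolding D.orbit_span_def by blast
        then have K: "(0, W.comb c w) \<in> ?K" by (intro CollectI conjI fst_conv)
        show "?K \<noteq> {0}"
        proof
          assume e: "?K = {0}"
          have "(0 :: 'v, W.comb c w) \<in> {0}" using K unfolding e .
          then show False using nz by (simp add: zero_prod_def)
        qed
      qed auto
      then show False using v(2) by simp
    qed
  next
    case ce: True
    show ?thesis
    proof (cases "J = {weyl_s}")
      case True
      obtain \<psi> where \<psi>: "mult_char \<psi>" "\<And>h. h \<in> diag_sub \<Longrightarrow> chi h = \<psi> (det h)"
        "\<And>g x. g \<in> GL2 \<Longrightarrow> x \<in> vecs V \<Longrightarrow> opr V g x = scl V (\<psi> (det g)) x" by (rule trivial_case[OF ce True]) blast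
      have "sign = 0" unfolding sign_def using True by simp
      \<comment> \<open>Nothing is known in advance about the span of \<open>w\<close>; the relation
        \<open>unip_sum w = 0\<close> forces it to transform by the same character as
        \<open>v\<close>.\<close>
      then have w: "opr W g w = scl W (\<psi> (det g)) w" if "g \<in> GL2" for g
        using us by (intro W.unip_sum_zero_invariant[OF \<psi>(1,2) _ that]) (simp_all add: W.scl_simps)
      let ?s = "\<Sum>g\<in>GL2. c g * \<psi> (det g)"
      have "comb c v = scl V ?s v" unfolding comb_def scl_simps(12)
        by (intro sum.cong refl) (simp add: \<psi>(3) v_in scl_simps)
      then have "?s = 0" using c scl_simps(13)[of ?s v] v(2) by auto
      moreover have "W.comb c w = scl W ?s w" unfolding W.comb_def W.scl_simps(12)
        by (intro sum.cong refl) (simp add: w W.scl_simps)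
      ultimately show ?thesis by (simp add: W.scl_simps)
    next
      case False
      obtain \<psi> T where \<psi>: "\<And>h. h \<in> diag_sub \<Longrightarrow> chi h = \<psi> (det h)" and S: "steinberg_model V \<psi> T"
        by (rule steinberg_case[OF ce False]) blast
      interpret S: steinberg_model V \<psi> T by (rule S)
      obtain k where k: "v = scl V k S.x" using S.one_dim[OF v(1)] by blast
      have "k \<noteq> 0" using k v(2) by (auto simp: scl_simps)
      then have "comb c S.x = 0" using c scl_simps(13)[of k "comb c S.x"] by (simp add: k comb_scl_right[OF S.x_in])
      then obtain \<kappa> where "\<forall>z\<in>GL2. (\<Sum>g\<in>GL2. if z ** g \<in> borel_sub then c g * \<psi> (det g) else 0) = \<kappa>"
        using S.comb_eq_0 by blast
      moreover have "W.unip_sum w = - w" using us ce False by (simp add: sign_def W.scl_simps)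
      ultimately show ?thesis using W.comb_steinberg[OF S.\<psi> \<psi>] by blast
    qed
  qed
qed

text \<open>Injectivity is generation of \<open>V\<close> by \<open>v\<close>; surjectivity is
  \<open>comb_kill\<close>, by which every relation of \<open>v\<close> follows from the conditions
  defining the target set.\<close>

lemma Hom_bij:
  fixes W :: "('a mat22, 'c, 'w::ab_group_add) repr"
  assumes W: "is_rep GL2 W"
  shows "bij_betw (\<lambda>\<phi>. \<phi> v) (Hom GL2 V W)
    {w \<in> invariants unip_sub W. (\<forall>h\<in>diag_sub. opr W h w = scl W (chi h) w) \<and> fin_rep.unip_sum W w = scl W sign w}"
    (is "bij_betw _ _ ?S")
proof -
  interpret V: eigenvector V chi v by (rule eigen)
  interpret W: fin_rep W by unfold_locales (rule W)
  have ev: "\<phi> v \<in> ?S" if \<phi>: "\<phi> \<in> Hom GL2 V W" for \<phi>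
  proof -
    note h = HomD[OF \<phi>]
    have "\<phi> (unip_sum v) = W.unip_sum (\<phi> v)" unfolding unip_sum_eq W.unip_sum_eq
      using v_in by (subst Hom_linear(4)[OF \<phi> vs is_rep_subspace[OF is_rep]]) (simp_all add: h opr_closed)
    then have "W.unip_sum (\<phi> v) = scl W sign (\<phi> v)" unfolding unip_sum_v using h(3)[OF v_in] by simp
    moreover have "opr W u (\<phi> v) = \<phi> v" if "u \<in> unip_sub" for u
      using h(4)[OF unip_sub_GL2[OF that] v_in] v that by (simp add: invariants_def)
    moreover have "opr W k (\<phi> v) = scl W (chi k) (\<phi> v)" if "k \<in> diag_sub" for k
      using h(4)[OF diag_sub_GL2[OF that] v_in] h(3)[OF v_in] V.diag[OF that] by simp
    ultimately show ?thesis using h(1)[OF v_in] by (simp add: invariants_def)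
  qed
  have inj: "\<phi> = \<phi>'" if \<phi>: "\<phi> \<in> Hom GL2 V W" "\<phi>' \<in> Hom GL2 V W" "\<phi> v = \<phi>' v" for \<phi> \<phi>'
  proof
    have comb: "\<phi> (comb c v) = W.comb c (\<phi> v)" if \<phi>: "\<phi> \<in> Hom GL2 V W" for \<phi> c
      unfolding comb_def W.comb_def using v_in
      by (subst Hom_linear(4)[OF \<phi> vs is_rep_subspace[OF is_rep]]) (simp_all add: HomD[OF \<phi>] opr_closed vecs_closed)
    fix u
    show "\<phi> u = \<phi>' u"
    proof (cases "u \<in> vecs V")
      case True
      then obtain c where "u = comb c v" unfolding span[symmetric] orbit_span_def by blast
      then show ?thesis using \<phi>(3) by (simp add: comb[OF \<phi>(1)] comb[OF \<phi>(2)])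
    qed (simp add: HomD(5)[OF \<phi>(1)] HomD(5)[OF \<phi>(2)])
  qed
  have surj: "\<exists>\<phi>\<in>Hom GL2 V W. \<phi> v = w" if w: "w \<in> ?S" for w
  proof -
    have W: "eigenvector W chi w" by unfold_locales (use w chi in auto)
    have "w \<in> vecs W" using w by (simp add: invariants_def)
    then obtain \<phi> where "\<phi> \<in> Hom GL2 V W" "\<phi> v = w"
      using Hom_of_comb[OF W.is_rep v_in span _ comb_kill[OF W]] w by blast
    then show ?thesis by blast
  qed
  show ?thesis unfolding bij_betw_def
  proof
    show "inj_on (\<lambda>\<phi>. \<phi> v) (Hom GL2 V W)" by (rule inj_onI) (rule inj)
    show "(\<lambda>\<phi>. \<phi> v) ` Hom GL2 V W = ?S" using ev surj by blast
  qed
qed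

end

section \<open>The representations of the stabilisers\<close>

lemma stabiliser_sigma0_powi:
  assumes "g \<in> stabiliser sigma0"
  obtains n k where "k \<in> max_compact" "g = mat (unif powi n) ** k"
proof -
  obtain a k where a: "a \<noteq> 0" "k \<in> max_compact" "g = mat a ** k" using assms by (rule stabiliser_sigma0_cases)
  define u where "u = a / unif powi val a"
  have u: "u \<noteq> 0" "val u = 0" using a(1) by (simp_all add: u_def val_divide val_unif_powi)
  then have "mat u \<in> max_compact"
    by (auto simp: max_compact_iff val_mult pow_ideal_def forall_2)
  moreover have "g = mat (unif powi val a) ** (mat u ** k)"
    unfolding a(3) by (simp add: matrix_mul_assoc u_def)
  ultimately show ?thesis using that[of "mat u ** k" "val a"] a(2) by blast
qed

text \<open>The valuation of the determinant determines the power of \<open>unif\<close>; this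
  resolves the definite description in \<open>tilde\<close>.\<close>

lemma powi_max_compact_unique:
  assumes "k \<in> max_compact" "k' \<in> max_compact" "mat (unif powi n) ** k = mat (unif powi m) ** k'"
  shows "k = k'"
proof -
  have v: "val (det (mat (unif powi n) ** k)) = 2 * n" if "k \<in> max_compact" for k n
    using that by (simp add: det_mul max_compact_iff val_mult val_unif_powi)
  have "n = m" using v[OF assms(1), of n] v[OF assms(2), of m] assms(3) by simp
  then have "mat (inverse (unif powi n)) ** (mat (unif powi n) ** k) = mat (inverse (unif powi n)) ** (mat (unif powi n) ** k')"
    using assms(3) by simp
  then show ?thesis by (simp add: matrix_mul_assoc)
qed

lemma opr_tilde:
  assumes "k \<in> max_compact"
  shows "opr (tilde V) (mat (unif powi n) ** k) = opr V (reduction k)"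
proof -
  have "(THE k'. k' \<in> max_compact \<and> (\<exists>m::int. mat (unif powi n) ** k = mat (unif powi m) ** k')) = k"
    using assms by (intro the_equality) (blast, metis powi_max_compact_unique)
  then show ?thesis by (simp add: tilde_def inflate_def)
qed

lemma opr_tilde_max_compact: "k \<in> max_compact \<Longrightarrow> opr (tilde V) k = opr V (reduction k)"
  using opr_tilde[of k V 0] by simp

lemma tilde_simps [simp]: "vecs (tilde V) = vecs V" "scl (tilde V) = scl V"
  by (simp_all add: tilde_def)

lemma is_rep_tilde:
  assumes "is_rep GL2 V" shows "is_rep (stabiliser sigma0) (tilde V)"
proof -
  interpret rep GL2 V by unfold_locales (rule assms)
  have opr: "\<exists>\<gamma>\<in>GL2. opr (tilde V) g = opr V \<gamma>" if "g \<in> stabiliser sigma0" for g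
    using that by (metis stabiliser_sigma0_powi opr_tilde reduction_GL2)
  have mult: "opr (tilde V) (g ** h) x = opr (tilde V) g (opr (tilde V) h x)"
    if g: "g \<in> stabiliser sigma0" and h: "h \<in> stabiliser sigma0" and x: "x \<in> vecs V" for g h x
  proof -
    obtain n k where k: "k \<in> max_compact" "g = mat (unif powi n) ** k" using g by (rule stabiliser_sigma0_powi)
    obtain m l where l: "l \<in> max_compact" "h = mat (unif powi m) ** l" using h by (rule stabiliser_sigma0_powi)
    have "g ** h = mat (unif powi n) ** (k ** mat (unif powi m)) ** l" by (simp add: k l matrix_mul_assoc)
    also have "\<dots> = mat (unif powi (n + m)) ** (k ** l)"
      unfolding scalar_commute by (simp add: matrix_mul_assoc power_int_add)
    finally show ?thesis using k l x by (simp add: opr_tilde reduction_mult opr_mult)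
  qed
  have "opr (tilde V) (mat 1) x = x" if "x \<in> vecs V" for x using that by (simp add: opr_tilde_max_compact opr_one)
  moreover have "opr (tilde V) g ` vecs V \<subseteq> vecs V"
    "x \<in> vecs V \<Longrightarrow> y \<in> vecs V \<Longrightarrow> opr (tilde V) g (x + y) = opr (tilde V) g x + opr (tilde V) g y"
    "x \<in> vecs V \<Longrightarrow> opr (tilde V) g (scl V c x) = scl V c (opr (tilde V) g x)"
    if "g \<in> stabiliser sigma0" for g x y c
    using opr[OF that] by (auto simp: opr_closed opr_add opr_scl)
  ultimately show ?thesis using mult vs is_rep_subspace[OF is_rep]
    by (simp add: is_rep_def lin_operators_def)
qed

text \<open>Any action factoring through reduction sees \<open>I\<^sub>1\<close> only through its
  image \<open>U\<close>; stated abstractly to cover both \<open>inflate\<close> and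
  \<open>tilde\<close>.\<close>

lemma invariants_pro_p:
  fixes V :: "('f::nonarch_local_field residue_field mat22, 'c, 'v) repr"
  assumes "\<And>k. k \<in> pro_p_iwahori \<Longrightarrow> opr W k = opr V (reduction k)" "vecs W = vecs V"
  shows "invariants pro_p_iwahori W = invariants unip_sub V"
proof -
  have l: "lift_mat u \<in> pro_p_iwahori" "reduction (lift_mat u) = u"
    if "u \<in> unip_sub" for u :: "'f residue_field mat22"
    using lift_mat[OF unip_sub_GL2[OF that]] that by (simp_all add: pro_p_iwahori_def)
  have "(\<forall>k\<in>pro_p_iwahori. opr W k x = x) \<longleftrightarrow> (\<forall>u\<in>unip_sub. opr V u x = x)" for x
  proof safe
    fix u :: "'f residue_field mat22" assume *: "\<forall>k\<in>pro_p_iwahori. opr W k x = x" and u: "u \<in> unip_sub"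
    show "opr V u x = x" using bspec[OF * l(1)[OF u]] unfolding assms(1)[OF l(1)[OF u]] l(2)[OF u] .
  next
    fix k :: "'f mat22" assume *: "\<forall>u\<in>unip_sub. opr V u x = x" and k: "k \<in> pro_p_iwahori"
    have "reduction k \<in> unip_sub" using k by (simp add: pro_p_iwahori_def)
    then show "opr W k x = x" using * assms(1)[OF k] by simp
  qed
  then show ?thesis using assms(2) by (simp add: invariants_def)
qed

lemma invariants_inflate: "invariants pro_p_iwahori (inflate V) = invariants unip_sub V"
  by (rule invariants_pro_p) (simp_all add: inflate_def)

lemma invariants_tilde: "invariants pro_p_iwahori (tilde V) = invariants unip_sub V"
  by (rule invariants_pro_p) (simp_all add: opr_tilde_max_compact pro_p_iwahori_max_compact)

lemma D0_rep_simps [simp]: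
  "vecs (D0_rep V W) = vecs V \<times> vecs W" "scl (D0_rep V W) c (x, y) = (scl V c x, scl W c y)"
  "opr (D0_rep V W) g (x, y) = (opr (tilde V) g x, opr (tilde W) g y)"
  by (simp_all add: D0_rep_def direct_sum_def)

lemma invariants_D0_rep:
  "invariants pro_p_iwahori (D0_rep V W) = invariants unip_sub V \<times> invariants unip_sub W"
  unfolding invariants_tilde[of V, symmetric] invariants_tilde[of W, symmetric]
  by (auto simp: invariants_def simp del: split_paired_All)

lemma is_rep_D0_rep:
  "is_rep GL2 V \<Longrightarrow> is_rep GL2 W \<Longrightarrow> is_rep (stabiliser sigma0) (D0_rep V W)"
  unfolding D0_rep_def by (intro is_rep_direct_sum is_rep_tilde)

lemma diagram_D0_D1:
  assumes V: "is_rep GL2 V" and W: "is_rep GL2 W" and D1: "is_D1 V W v w D1"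
  shows "diagram (D0_rep V W) D1"
proof
  show "is_rep (stabiliser sigma0) (D0_rep V W)" using V W by (rule is_rep_D0_rep)
  show "opr (D0_rep V W) u x = x" if "u \<in> congruence_sub 1" "x \<in> vecs (D0_rep V W)" for u x
    using that V W by (cases x) (simp add: congruence_1_iff opr_tilde_max_compact is_rep_def)
qed (use D1 in \<open>auto simp: is_D1_def invariants_def\<close>)

section \<open>The representation of the finite group on \<open>K\<^sub>1\<close>-invariants\<close>

context G_rep
begin

text \<open>The largest part of \<open>\<pi>\<close> on which \<open>K\<^sub>1\<close> and
  \<open>unif\<close> act trivially, hence where the image of any map from \<open>tilde V\<close>
  must lie.\<close>

definition descend :: "('f residue_field mat22, 'c, 'v) repr" where
  "descend = \<lparr>vecs = {x \<in> invs1. opr \<pi> (mat unif) x = x}, scl = scl \<pi>, opr = (\<lambda>\<gamma>. opr \<pi> (lift_mat \<gamma>))\<rparr>"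

lemma descend_simps [simp]: "scl descend = scl \<pi>" "opr descend \<gamma> = opr \<pi> (lift_mat \<gamma>)"
  by (simp_all add: descend_def)

lemma vecs_descend: "x \<in> vecs descend \<longleftrightarrow> x \<in> invs1 \<and> opr \<pi> (mat unif) x = x"
  by (simp add: descend_def)

lemma opr_scalar_commute:
  "a \<noteq> 0 \<Longrightarrow> g \<in> GL2 \<Longrightarrow> x \<in> vecs \<pi> \<Longrightarrow> opr \<pi> (mat a) (opr \<pi> g x) = opr \<pi> g (opr \<pi> (mat a) x)"
  by (simp add: scalar_commute[symmetric] flip: opr_mult)

lemma opr_unif_powi:
  assumes x: "x \<in> vecs \<pi>" "opr \<pi> (mat unif) x = x"
  shows "opr \<pi> (mat (unif powi n)) x = x"
proof -
  have p: "opr \<pi> (mat (unif ^ m)) x = x" for m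
  proof (induction m)
    case (Suc m)
    have "opr \<pi> (mat (unif ^ Suc m)) x = opr \<pi> (mat unif ** mat (unif ^ m)) x" by simp
    also have "\<dots> = opr \<pi> (mat unif) (opr \<pi> (mat (unif ^ m)) x)" using x by (intro opr_mult) (auto simp: unif_nonzero)
    finally show ?case using Suc x by simp
  qed (use x in \<open>simp add: opr_one\<close>)
  have q: "opr \<pi> (mat (inverse (unif ^ m))) x = x" for m
  proof -
    have "opr \<pi> (mat (inverse (unif ^ m))) x = opr \<pi> (mat (inverse (unif ^ m))) (opr \<pi> (mat (unif ^ m)) x)" by (simp only: p)
    also have "\<dots> = opr \<pi> (mat (inverse (unif ^ m)) ** mat (unif ^ m)) x"
      using x by (intro opr_mult[symmetric]) (auto simp: unif_nonzero)
    finally show ?thesis using x by (simp add: opr_one unif_nonzero)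
  qed
  show ?thesis using p[of "nat n"] q[of "nat (- n)"] by (simp add: power_int_def power_inverse)
qed

lemma is_rep_descend: "is_rep GL2 descend"
proof -
  have sub: "Modules.module.subspace (scl descend) (vecs descend)"
    by (rule subspaceI) (auto simp: vs vecs_descend invariants_def vecs_closed opr_add opr_scl opr_zero
        congruence_max_compact max_compact_GL2 unif_nonzero)
  have cl: "opr \<pi> (lift_mat \<gamma>) x \<in> vecs descend" if "\<gamma> \<in> GL2" "x \<in> vecs descend" for \<gamma> x
    using that lift_mat(1)[OF that(1)] by (simp add: vecs_descend invs1_opr opr_scalar_commute max_compact_GL2 invs1D unif_nonzero)
  have "opr \<pi> (lift_mat (mat 1)) x = x" if "x \<in> vecs descend" for x
  proof -
    have "opr \<pi> (lift_mat (mat 1)) x = opr \<pi> (mat 1) x"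
      using that by (intro invs1_reduction) (auto simp: lift_mat vecs_descend)
    then show ?thesis using that by (simp add: opr_one vecs_descend invs1D)
  qed
  moreover have "opr \<pi> (lift_mat (g ** h)) x = opr \<pi> (lift_mat g) (opr \<pi> (lift_mat h) x)"
    if "g \<in> GL2" "h \<in> GL2" "x \<in> vecs descend" for g h x
    using that opr_lift_mult[of "lift_mat g" h x] by (simp add: lift_mat vecs_descend)
  ultimately show ?thesis using sub vs cl unfolding is_rep_def lin_operators_def
    by (auto simp: opr_add opr_scl lift_mat max_compact_GL2 vecs_descend invs1D)
qed

lemma invariants_descend: "invariants unip_sub descend = {w \<in> invs. opr \<pi> (mat unif) w = w}"
proof (intro Set.set_eqI iffI)
  fix w assume w: "w \<in> invariants unip_sub descend"
  then have w1: "w \<in> invs1" "opr \<pi> (mat unif) w = w" by (auto simp: invariants_def[of unip_sub] vecs_descend)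
  have "opr \<pi> k w = w" if k: "k \<in> pro_p_iwahori" for k
  proof -
    have "reduction k \<in> unip_sub" "k \<in> max_compact" using k by (auto simp: pro_p_iwahori_def)
    moreover from this have "opr \<pi> k w = opr \<pi> (lift_mat (reduction k)) w"
      using w1 by (intro invs1_reduction) (auto simp: lift_mat)
    ultimately show ?thesis using w by (simp add: invariants_def[of unip_sub])
  qed
  then show "w \<in> {w \<in> invs. opr \<pi> (mat unif) w = w}" using w1 by (auto simp: invariants_def)
next
  fix w assume "w \<in> {w \<in> invs. opr \<pi> (mat unif) w = w}"
  then have w: "w \<in> invs" "opr \<pi> (mat unif) w = w" by auto
  have "lift_mat u \<in> pro_p_iwahori" if "u \<in> unip_sub" for u :: "'f residue_field mat22"
    using lift_mat[OF unip_sub_GL2[OF that]] that by (simp add: pro_p_iwahori_def)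
  then show "w \<in> invariants unip_sub descend" using w
    unfolding invariants_def[of unip_sub]
    by (simp add: vecs_descend invs_invs1 invsD(2))
qed

lemma unip_sum_descend:
  assumes w: "w \<in> invs1" shows "fin_rep.unip_sum descend w = ns_sum w"
proof -
  interpret D: fin_rep descend by unfold_locales (rule is_rep_descend)
  have "opr \<pi> (lift_mat (matrix_inv n_s)) w = opr \<pi> (matrix_inv n_s) w"
    using w by (intro invs1_reduction) (auto simp: lift_mat reduction_inv)
  then show ?thesis by (simp add: D.unip_sum_def ns_sum_def)
qed

text \<open>\<open>K\<^sub>1\<close> and \<open>unif\<close> act trivially on the source, so images
  lie in \<open>descend\<close>; conversely these two and lifts of residue matrices account for the
  whole of \<open>stabiliser sigma0\<close>.\<close>

lemma Hom_tilde: "Hom (stabiliser sigma0) (tilde V) \<pi> = Hom GL2 V descend"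
  if V: "is_rep GL2 V" for V :: "('f residue_field mat22, 'c, 'w::ab_group_add) repr"
proof (intro Set.set_eqI iffI)
  fix \<phi> assume \<phi>: "\<phi> \<in> Hom (stabiliser sigma0) (tilde V) \<pi>"
  note h = HomD[OF \<phi>, simplified]
  have st: "k \<in> stabiliser sigma0" if "k \<in> max_compact" for k
    using scalar_max_compact_stabiliser[of 1 k] that by simp
  show "\<phi> \<in> Hom GL2 V descend"
  proof (rule HomI)
    fix x assume x: "x \<in> vecs V"
    have "opr \<pi> u (\<phi> x) = \<phi> x" if u: "u \<in> congruence_sub 1" for u
      using h(4)[OF st[OF congruence_max_compact[OF u]] x] u x V
      by (simp add: opr_tilde_max_compact congruence_1_iff is_rep_def)
    moreover have "opr \<pi> (mat unif) (\<phi> x) = \<phi> x"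
    proof -
      have "mat unif \<in> stabiliser sigma0" using scalar_max_compact_stabiliser[of unif "mat 1"] by (simp add: unif_nonzero)
      moreover have "opr (tilde V) (mat unif) x = x"
        using opr_tilde[of "mat 1" V 1] x V by (simp add: is_rep_def)
      ultimately show ?thesis using h(4)[of "mat unif" x] x by metis
    qed
    ultimately show "\<phi> x \<in> vecs descend" using h(1)[OF x] by (simp add: vecs_descend invariants_def)
    show "\<phi> (opr V \<gamma> x) = opr descend \<gamma> (\<phi> x)" if "\<gamma> \<in> GL2" for \<gamma>
      using h(4)[OF st x, of "lift_mat \<gamma>"] that by (simp add: lift_mat opr_tilde_max_compact)
  qed (simp_all add: h)
next
  fix \<phi> assume \<phi>: "\<phi> \<in> Hom GL2 V descend"
  note h = HomD[OF \<phi>, simplified]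
  have d: "\<phi> x \<in> invs1" "opr \<pi> (mat unif) (\<phi> x) = \<phi> x" "\<phi> x \<in> vecs \<pi>" if "x \<in> vecs V" for x
    using h(1)[OF that] by (auto simp: vecs_descend invs1D)
  show "\<phi> \<in> Hom (stabiliser sigma0) (tilde V) \<pi>"
  proof (rule HomI)
    fix g :: "'f mat22" and x assume g: "g \<in> stabiliser sigma0" and x: "x \<in> vecs (tilde V)"
    then have x: "x \<in> vecs V" by simp
    obtain n k where k: "k \<in> max_compact" "g = mat (unif powi n) ** k" using g by (rule stabiliser_sigma0_powi)
    have "\<phi> (opr (tilde V) g x) = opr \<pi> (lift_mat (reduction k)) (\<phi> x)"
      using k x by (simp add: opr_tilde h(4))
    also have "\<dots> = opr \<pi> k (\<phi> x)" using k d[OF x] by (intro invs1_reduction) (auto simp: lift_mat)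
    also have "\<dots> = opr \<pi> k (opr \<pi> (mat (unif powi n)) (\<phi> x))" using opr_unif_powi[OF d(3,2)[OF x]] by simp
    also have "\<dots> = opr \<pi> g (\<phi> x)" using k d(3)[OF x]
      by (simp add: k(2) scalar_commute[symmetric] opr_mult max_compact_GL2)
    finally show "\<phi> (opr (tilde V) g x) = opr \<pi> g (\<phi> x)" .
  qed (use h d in auto)
qed

end

section \<open>The isomorphism\<close>

lemma Hom_closed:
  fixes V :: "('g, 'c::field, 'x::plus) repr" and W :: "('g, 'c, 'w::ab_group_add) repr"
  assumes W: "lin_operators G W"
  shows "f \<in> Hom G V W \<Longrightarrow> f' \<in> Hom G V W \<Longrightarrow> f + f' \<in> Hom G V W"
    "f \<in> Hom G V W \<Longrightarrow> pointwise (scl W) c f \<in> Hom G V W"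
proof -
  have vs: "vector_space (scl W)" and sub: "Modules.module.subspace (scl W) (vecs W)"
    and opr: "\<And>g x y. g \<in> G \<Longrightarrow> x \<in> vecs W \<Longrightarrow> y \<in> vecs W \<Longrightarrow> opr W g (x + y) = opr W g x + opr W g y"
    "\<And>g c x. g \<in> G \<Longrightarrow> x \<in> vecs W \<Longrightarrow> opr W g (scl W c x) = scl W c (opr W g x)"
    using W by (auto simp: lin_operators_def)
  note cl = subspaceD[OF vs sub] and sc = vector_spaceD[OF vs]
  show "f + f' \<in> Hom G V W" if "f \<in> Hom G V W" "f' \<in> Hom G V W"
    using HomD[OF that(1)] HomD[OF that(2)] by (intro HomI) (auto simp: cl sc opr)
  show "pointwise (scl W) c f \<in> Hom G V W" if "f \<in> Hom G V W"
    using HomD[OF that] by (intro HomI) (auto simp: cl sc opr pointwise_def mult.commute)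
qed

text \<open>Because \<open>Pi_mat ** Pi_mat\<close> is the scalar \<open>unif\<close>, being fixed
  by the square amounts to lying in \<open>descend\<close>. The remaining conditions split into the
  target sets of \<open>Hom_bij\<close> for the two summands of \<open>D0\<close>.\<close>

lemma (in G_rep) hecke_eigen_iff:
  "w \<in> hecke_eigen chi e e' \<longleftrightarrow>
    w \<in> {w \<in> invariants unip_sub descend. (\<forall>h\<in>diag_sub. opr descend h w = scl descend (chi h) w)
      \<and> fin_rep.unip_sum descend w = scl descend e w} \<and>
    opr \<pi> (matrix_inv Pi_mat) w \<in> {w \<in> invariants unip_sub descend. (\<forall>h\<in>diag_sub. opr descend h w = scl descend (conj_s chi h) w)
      \<and> fin_rep.unip_sum descend w = scl descend e' w}"
  (is "_ \<longleftrightarrow> w \<in> ?S \<and> _ \<in> ?S'")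
proof -
  let ?P = "matrix_inv Pi_mat :: 'f mat22"
  have PP: "opr \<pi> ?P (opr \<pi> ?P w) = w \<longleftrightarrow> opr \<pi> (mat unif) w = w" if w: "w \<in> vecs \<pi>" for w
  proof -
    have 1: "opr \<pi> (mat unif) (opr \<pi> ?P (opr \<pi> ?P w)) = w"
      using w by (simp add: Pi_square[symmetric] opr_mult opr_closed opr_inv)
    have 2: "opr \<pi> ?P (opr \<pi> ?P (opr \<pi> (mat unif) w)) = w"
      using w by (simp add: Pi_square[symmetric] opr_mult opr_closed opr_inv)
    show ?thesis using 1 2 by metis
  qed
  have inv: "w \<in> vecs \<pi>" "w \<in> invs1" "opr \<pi> ?P w \<in> invs" "opr \<pi> ?P w \<in> invs1"
    "opr \<pi> (mat unif) w = w \<Longrightarrow> opr \<pi> (mat unif) (opr \<pi> ?P w) = opr \<pi> ?P w" if "w \<in> invs"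
    using that Pi_invs(2)[OF that] invs_invs1 invsD(1)[OF that] opr_scalar_commute[of unif ?P w]
    by (auto simp: unif_nonzero)
  show ?thesis
  proof (cases "w \<in> invs")
    case True
    note i = inv[OF True]
    show ?thesis unfolding hecke_eigen_def invariants_descend
      using True i PP[OF i(1)] Pi_eigen[OF True]
      by (auto simp: unip_sum_descend)
  qed (auto simp: hecke_eigen_def invariants_descend)
qed

locale gamma_data = G_rep \<pi> + V: rho_vector V chi J v + W: rho_vector W "conj_s chi" J' w
  for \<pi> :: "('f::nonarch_local_field mat22, 'c::field, 'v::ab_group_add) repr"
    and V :: "('f residue_field mat22, 'c, 'a::ab_group_add) repr" and chi J and v :: 'a
    and W :: "('f residue_field mat22, 'c, 'b::ab_group_add) repr" and J' and w :: 'b +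
  fixes D1 :: "('f mat22, 'c, 'a \<times> 'b) repr"
  assumes D1_data: "is_D1 V W v w D1"
begin

sublocale diagram_hom "D0_rep V W" D1 \<pi>
  by (intro diagram_hom.intro diagram_D0_D1[OF V.is_rep W.is_rep D1_data]) (rule rep_axioms)

abbreviation "homology \<equiv> homology0 (induced_system (D0_rep V W) D1)"

lemma vecs_D1: "vecs D1 = invariants unip_sub V \<times> invariants unip_sub W"
  using D1_data by (simp add: is_D1_def invariants_D0_rep)

lemma Pi_D1: "opr D1 (matrix_inv Pi_mat) (v, 0) = (0, w)" "opr D1 (matrix_inv Pi_mat) (0, w) = (v, 0)"
  using D1_data by (simp_all add: is_D1_def)

lemma tilde_zero: "g \<in> stabiliser sigma0 \<Longrightarrow> opr (tilde V) g 0 = 0" "g \<in> stabiliser sigma0 \<Longrightarrow> opr (tilde W) g 0 = 0"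
  using rep.opr_zero[OF rep.intro, OF is_rep_tilde[OF V.is_rep]] rep.opr_zero[OF rep.intro, OF is_rep_tilde[OF W.is_rep]]
  by auto

lemma restrict_Hom:
  assumes F: "F \<in> Hom (stabiliser sigma0) (D0_rep V W) \<pi>"
  shows "(\<lambda>x. F (x, 0)) \<in> Hom GL2 V descend" "(\<lambda>y. F (0, y)) \<in> Hom GL2 W descend"
    "x \<in> vecs V \<Longrightarrow> y \<in> vecs W \<Longrightarrow> F (x, y) = F (x, 0) + F (0, y)"
proof -
  note h = HomD[OF F]
  show "(\<lambda>x. F (x, 0)) \<in> Hom GL2 V descend" unfolding Hom_tilde[OF V.is_rep, symmetric]
  proof (rule HomI; simp only: tilde_simps)
    fix x x' assume x: "x \<in> vecs V" "x' \<in> vecs V"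
    show "F (x, 0) \<in> vecs \<pi>" using x by (intro h(1)) (simp add: V.vecs_closed W.vecs_closed)
    show "F (x + x', 0) = F (x, 0) + F (x', 0)" using x h(2)[of "(x, 0)" "(x', 0)"] by (simp add: W.vecs_closed)
    show "F (scl V c x, 0) = scl \<pi> c (F (x, 0))" for c
      using x h(3)[of "(x, 0)" c] by (simp add: W.vecs_closed W.scl_simps)
    show "F (opr (tilde V) g x, 0) = opr \<pi> g (F (x, 0))" if "g \<in> stabiliser sigma0" for g
      using x h(4)[OF that, of "(x, 0)"] that by (simp add: W.vecs_closed tilde_zero)
  next
    show "F (x, 0) = 0" if "x \<notin> vecs V" for x using that by (intro h(5)) (simp add: V.vecs_closed W.vecs_closed)
  qed
  show "(\<lambda>y. F (0, y)) \<in> Hom GL2 W descend" unfolding Hom_tilde[OF W.is_rep, symmetric]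
  proof (rule HomI; simp only: tilde_simps)
    fix x x' assume x: "x \<in> vecs W" "x' \<in> vecs W"
    show "F (0, x) \<in> vecs \<pi>" using x by (intro h(1)) (simp add: V.vecs_closed W.vecs_closed)
    show "F (0, x + x') = F (0, x) + F (0, x')" using x h(2)[of "(0, x)" "(0, x')"] by (simp add: V.vecs_closed)
    show "F (0, scl W c x) = scl \<pi> c (F (0, x))" for c
      using x h(3)[of "(0, x)" c] by (simp add: V.vecs_closed V.scl_simps)
    show "F (0, opr (tilde W) g x) = opr \<pi> g (F (0, x))" if "g \<in> stabiliser sigma0" for g
      using x h(4)[OF that, of "(0, x)"] that by (simp add: V.vecs_closed tilde_zero)
  next
    show "F (0, x) = 0" if "x \<notin> vecs W" for x using that by (intro h(5)) (simp add: V.vecs_closed W.vecs_closed)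
  qed
  show "F (x, y) = F (x, 0) + F (0, y)" if "x \<in> vecs V" "y \<in> vecs W"
    using that h(2)[of "(x, 0)" "(0, y)"] by (simp add: V.vecs_closed W.vecs_closed)
qed

lemma extend_Hom:
  assumes \<phi>: "\<phi> \<in> Hom GL2 V descend" "\<theta> \<in> Hom GL2 W descend"
  defines "F \<equiv> \<lambda>d. if d \<in> vecs (D0_rep V W) then \<phi> (fst d) + \<theta> (snd d) else 0"
  shows "F \<in> Hom (stabiliser sigma0) (D0_rep V W) \<pi>"
proof -
  note h = HomD[OF \<phi>(1)[folded Hom_tilde[OF V.is_rep]], simplified] and k = HomD[OF \<phi>(2)[folded Hom_tilde[OF W.is_rep]], simplified]
  note D0 = rep.intro[OF is_rep_D0_rep[OF V.is_rep W.is_rep]]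
  have F: "F (x, y) = \<phi> x + \<theta> y" if "x \<in> vecs V" "y \<in> vecs W" for x y using that by (simp add: F_def)
  show ?thesis
  proof (rule HomI)
    fix d d' assume d: "d \<in> vecs (D0_rep V W)" "d' \<in> vecs (D0_rep V W)"
    obtain x y x' y' where x: "d = (x, y)" "d' = (x', y')" "x \<in> vecs V" "y \<in> vecs W" "x' \<in> vecs V" "y' \<in> vecs W"
      using d by (cases d; cases d') auto
    show "F d \<in> vecs \<pi>" using x by (simp add: F h k vecs_closed)
    show "F (d + d') = F d + F d'" using x by (simp add: F h k V.vecs_closed W.vecs_closed)
    show "F (scl (D0_rep V W) c d) = scl \<pi> c (F d)" for c
      using x by (simp add: F h k V.vecs_closed W.vecs_closed scl_simps)
    show "F (opr (D0_rep V W) g d) = opr \<pi> g (F d)" if g: "g \<in> stabiliser sigma0" for g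
    proof -
      have "opr (D0_rep V W) g d \<in> vecs (D0_rep V W)" using rep.opr_closed[OF D0 g] d by blast
      then have "opr (tilde V) g x \<in> vecs V" "opr (tilde W) g y \<in> vecs W" using x by simp_all
      moreover have "g \<in> GL2" using g by (simp add: stabiliser_def)
      ultimately show ?thesis using x g by (simp add: F h k opr_add)
    qed
  qed (simp add: F_def)
qed

text \<open>A vector \<open>z\<close> of the eigenspace yields a map on \<open>V\<close> with value
  \<open>z\<close> at \<open>v\<close> and one on \<open>W\<close> with value the
  \<open>Pi_mat\<close>-partner of \<open>z\<close> at \<open>w\<close>. Their sum extends to
  homology because \<open>D1\<close> is spanned by \<open>(v, 0)\<close> and \<open>(0, w)\<close>,
  which \<open>Pi_mat\<close> exchanges.\<close>

lemma eval_bij: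
  "bij_betw (\<lambda>f. frob f (v, 0)) (Hom GL2 homology \<pi>) (hecke_eigen chi V.sign W.sign)"
  "f \<in> Hom GL2 homology \<pi> \<Longrightarrow> frob f (0, w) = opr \<pi> (matrix_inv Pi_mat) (frob f (v, 0))"
proof -
  note bV = V.Hom_bij[OF is_rep_descend] and bW = W.Hom_bij[OF is_rep_descend]
  have v1: "(v, 0) \<in> vecs D1" "(0, w) \<in> vecs D1"
    using V.v W.v V.invs_subspace W.invs_subspace by (auto simp: vecs_D1 subspaceD(1)[OF V.vs] subspaceD(1)[OF W.vs])
  have Pi: "frob f (0, w) = opr \<pi> (matrix_inv Pi_mat) (frob f (v, 0))" if "f \<in> Hom GL2 homology \<pi>" for f
    using frob_Hom(2)[OF that v1(1)] Pi_D1(1) by simp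
  then show "f \<in> Hom GL2 homology \<pi> \<Longrightarrow> frob f (0, w) = opr \<pi> (matrix_inv Pi_mat) (frob f (v, 0))" .
  have ev: "frob f (v, 0) \<in> hecke_eigen chi V.sign W.sign" if f: "f \<in> Hom GL2 homology \<pi>" for f
    unfolding hecke_eigen_iff Pi[OF f, symmetric]
    using bij_betwE[OF bV] bij_betwE[OF bW] restrict_Hom(1,2)[OF frob_Hom(1)[OF f]] by auto
  show "bij_betw (\<lambda>f. frob f (v, 0)) (Hom GL2 homology \<pi>) (hecke_eigen chi V.sign W.sign)"
    unfolding bij_betw_def
  proof
    show "inj_on (\<lambda>f. frob f (v, 0)) (Hom GL2 homology \<pi>)"
    proof (rule inj_onI)
      fix f f' assume f: "f \<in> Hom GL2 homology \<pi>" "f' \<in> Hom GL2 homology \<pi>" "frob f (v, 0) = frob f' (v, 0)"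
      note r = restrict_Hom[OF frob_Hom(1)[OF f(1)]] and r' = restrict_Hom[OF frob_Hom(1)[OF f(2)]]
      have "(\<lambda>x. frob f (x, 0)) = (\<lambda>x. frob f' (x, 0))"
        using f(3) by (intro inj_onD[OF bij_betw_imp_inj_on[OF bV]] r r')
      moreover have "(\<lambda>y. frob f (0, y)) = (\<lambda>y. frob f' (0, y))"
        using f(3) by (intro inj_onD[OF bij_betw_imp_inj_on[OF bW]] r r') (simp add: Pi f)
      ultimately have "frob f (x, y) = frob f' (x, y)" if "x \<in> vecs V" "y \<in> vecs W" for x y
        using that by (simp add: r(3) r'(3) fun_eq_iff)
      then show "f = f'" using f by (intro frob_inj) auto
    qed
    show "(\<lambda>f. frob f (v, 0)) ` Hom GL2 homology \<pi> = hecke_eigen chi V.sign W.sign"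
    proof
      show "(\<lambda>f. frob f (v, 0)) ` Hom GL2 homology \<pi> \<subseteq> hecke_eigen chi V.sign W.sign" using ev by blast
      show "hecke_eigen chi V.sign W.sign \<subseteq> (\<lambda>f. frob f (v, 0)) ` Hom GL2 homology \<pi>"
      proof
        fix z assume z: "z \<in> hecke_eigen chi V.sign W.sign"
        let ?P = "matrix_inv Pi_mat :: 'f mat22"
        have zV: "z \<in> (\<lambda>\<phi>. \<phi> v) ` Hom GL2 V descend" and zW: "opr \<pi> ?P z \<in> (\<lambda>\<theta>. \<theta> w) ` Hom GL2 W descend"
          unfolding bij_betw_imp_surj_on[OF bV] bij_betw_imp_surj_on[OF bW]
          using z unfolding hecke_eigen_iff by (rule conjunct1, rule conjunct2)
        obtain \<phi> where "z = \<phi> v" and \<phi>: "\<phi> \<in> Hom GL2 V descend" using zV by (rule imageE)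
        obtain \<theta> where "opr \<pi> ?P z = \<theta> w" and \<theta>: "\<theta> \<in> Hom GL2 W descend" using zW by (rule imageE)
        note \<phi> = \<phi> \<open>z = \<phi> v\<close>[symmetric] and \<theta> = \<theta> \<open>opr \<pi> ?P z = \<theta> w\<close>[symmetric]
        define F where "F = (\<lambda>d. if d \<in> vecs (D0_rep V W) then \<phi> (fst d) + \<theta> (snd d) else 0)"
        have F: "F \<in> Hom (stabiliser sigma0) (D0_rep V W) \<pi>" unfolding F_def by (rule extend_Hom[OF \<phi>(1) \<theta>(1)])
        have zero: "\<phi> 0 = 0" "\<theta> 0 = 0"
          using Hom_linear(1)[OF \<phi>(1) V.vs is_rep_subspace[OF V.is_rep]] Hom_linear(1)[OF \<theta>(1) W.vs is_rep_subspace[OF W.is_rep]] .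
        have Fvw: "F (v, 0) = z" "F (0, w) = opr \<pi> ?P z"
          using V.v_in W.v_in \<phi>(2) \<theta>(2) by (simp_all add: F_def zero V.vecs_closed W.vecs_closed)
        have PP: "opr \<pi> ?P (opr \<pi> ?P z) = z" "z \<in> vecs \<pi>" using z by (auto simp: hecke_eigen_def invariants_def)
        have Pst: "?P \<in> stabiliser sigma1" using Pi_stabiliser by (rule stabiliser_inv)
        \<comment> \<open>Both \<open>U\<close>-invariant spaces are lines, so compatibility reduces
          to the two spanning vectors, where it is the choice of values together with
          \<open>PP\<close>.\<close>
        have "F (opr D1 ?P d) = opr \<pi> ?P (F d)" if d: "d \<in> vecs D1" for d
        proof -
          obtain a b where ab: "d = (scl V a v, scl W b w)"
            using d V.one_dim W.one_dim unfolding vecs_D1 by blast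
          have sc: "scl D1 c (x, y) = (scl V c x, scl W c y)" for c x y by (simp add: scl_eq)
          have "d = scl D1 a (v, 0) + scl D1 b (0, w)" by (simp add: ab sc V.scl_simps W.scl_simps)
          then have "opr D1 ?P d = opr D1 ?P (scl D1 a (v, 0)) + opr D1 ?P (scl D1 b (0, w))"
            using D1.opr_add[OF Pst] v1 by (simp only: D1.vecs_closed)
          also have "\<dots> = (scl V b v, scl W a w)"
            using D1.opr_scl[OF Pst v1(1)] D1.opr_scl[OF Pst v1(2)] by (simp add: Pi_D1 sc V.scl_simps W.scl_simps)
          finally have "F (opr D1 ?P d) = scl \<pi> b z + scl \<pi> a (opr \<pi> ?P z)"
            using V.v_in W.v_in \<phi> \<theta> HomD(3)[OF \<phi>(1)] HomD(3)[OF \<theta>(1)] by (simp add: F_def V.vecs_closed W.vecs_closed)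
          moreover have "F d = scl \<pi> a z + scl \<pi> b (opr \<pi> ?P z)"
            using V.v_in W.v_in \<phi> \<theta> HomD(3)[OF \<phi>(1)] HomD(3)[OF \<theta>(1)] by (simp add: ab F_def V.vecs_closed W.vecs_closed)
          ultimately show ?thesis using PP by (simp add: opr_add opr_scl vecs_closed opr_closed)
        qed
        then obtain f where f: "f \<in> Hom GL2 homology \<pi>" "\<And>d. d \<in> vecs (D0_rep V W) \<Longrightarrow> frob f d = F d"
          using frob_surj[OF F] by blast
        then have "frob f (v, 0) = z" using Fvw(1) V.v_in by (simp add: V.vecs_closed W.vecs_closed)
        then show "z \<in> (\<lambda>f. frob f (v, 0)) ` Hom GL2 homology \<pi>" using f(1) by blast
      qed
    qed
  qed
qed

end

locale gamma_rho = gamma_data \<pi> V chi J v W "J0 chi - J" w D1 for \<pi> V chi J v W w D1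
begin

text \<open>For \<open>J = {weyl_s}\<close> the summand \<open>V\<close> is one-dimensional with
  sign 0 and the Steinberg sign sits on \<open>W\<close>; evaluating at \<open>(0, w)\<close>
  restores the order of signs found for the module.\<close>

lemma eval_iso:
  assumes J: "J \<subseteq> J0 chi"
  defines "S \<equiv> hecke_eigen chi (if char_eq chi (conj_s chi) then - 1 else 0) 0"
  obtains d where "bij_betw (\<lambda>f. frob f d) (Hom GL2 homology \<pi>) S"
proof (cases "char_eq chi (conj_s chi) \<and> J = {weyl_s}")
  case True
  then have ce: "char_eq chi (conj_s chi)" and J: "J = {weyl_s}" by auto
  have ce': "char_eq (conj_s chi) (conj_s (conj_s chi))" using ce by (auto simp: char_eq_def conj_s_conj_s)
  have sign: "V.sign = 0" "W.sign = - 1"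
    unfolding V.sign_def W.sign_def using ce ce' J by (simp_all add: J0_def)
  have eq: "hecke_eigen (conj_s chi) e e' = hecke_eigen chi e e'" for e e'
    using ce by (auto simp: hecke_eigen_def char_eq_def)
  let ?P = "opr \<pi> (matrix_inv Pi_mat)"
  have swap: "?P z \<in> hecke_eigen chi e e'" if "z \<in> hecke_eigen chi e' e" for z e e'
    using hecke_eigen_swap[OF that] unfolding eq .
  \<comment> \<open>The operator is its own inverse here, since vectors of these sets are fixed by
    its square.\<close>
  have "bij_betw ?P (hecke_eigen chi 0 (- 1)) (hecke_eigen chi (- 1) 0)"
    by (rule bij_betw_byWitness[where f' = ?P]) (auto intro: swap, auto simp: hecke_eigen_def)
  then have "bij_betw (?P \<circ> (\<lambda>f. frob f (v, 0))) (Hom GL2 homology \<pi>) (hecke_eigen chi (- 1) 0)"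
    using eval_bij(1) unfolding sign by (rule bij_betw_trans[rotated])
  then have "bij_betw (\<lambda>f. frob f (0, w)) (Hom GL2 homology \<pi>) S" unfolding S_def if_P[OF ce]
    by (rule bij_betw_cong[THEN iffD1, rotated]) (simp add: eval_bij(2))
  then show ?thesis by (rule that)
next
  case False
  have sign: "V.sign = (if char_eq chi (conj_s chi) then - 1 else 0)" "W.sign = 0"
  proof -
    show "V.sign = (if char_eq chi (conj_s chi) then - 1 else 0)" unfolding V.sign_def using False by auto
    have "J0 chi - J = {weyl_s}" if "char_eq chi (conj_s chi)" using J False that by (auto simp: J0_def)
    moreover have "char_eq chi (conj_s chi)" if "char_eq (conj_s chi) (conj_s (conj_s chi))"
      using that by (auto simp: char_eq_def conj_s_conj_s)
    ultimately show "W.sign = 0" unfolding W.sign_def by auto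
  qed
  show ?thesis by (rule that[of "(v, 0)"]) (use eval_bij(1) in \<open>simp only: S_def sign\<close>)
qed

end

theorem corollary6p8:
  fixes chi :: "'f::nonarch_local_field residue_field mat22 \<Rightarrow> 'p::prime_card mod_ring alg_closure"
    and J :: "'f residue_field mat22 set"
    and \<rho> :: "('f residue_field mat22, 'p mod_ring alg_closure, 'a::ab_group_add) repr"
    and \<rho>' :: "('f residue_field mat22, 'p mod_ring alg_closure, 'b::ab_group_add) repr"
    and v :: 'a and v' :: 'b
    and D1 :: "('f mat22, 'p mod_ring alg_closure, 'a \<times> 'b) repr"
    and M :: "(('f, 'p mod_ring alg_closure) hecke_elt, 'p mod_ring alg_closure, 'm::ab_group_add) repr"
    and \<pi> :: "('f mat22, 'p mod_ring alg_closure, 'v::ab_group_add) repr"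
  assumes "CHAR('f residue_field) = CARD('p)"
    and "diag_char chi"
    and "J \<subseteq> J0 chi"
    and "is_rho chi J \<rho>"
    and "is_rho (conj_s chi) (J0 chi - J) \<rho>'"
    and "v \<in> invariants pro_p_iwahori (inflate \<rho>)" and "v \<noteq> 0"
    and "v' \<in> invariants pro_p_iwahori (inflate \<rho>')" and "v' \<noteq> 0"
    and "is_D1 \<rho> \<rho>' v v' D1"
    and "is_M_gamma chi M"
    and "smooth_rep \<pi>"
    and "char_eq chi (conj_s chi) \<or> CARD('p) = CARD('f residue_field)"
  shows "vs_isomorphic
    (Hom_space GL2 (homology0 (induced_system (D0_rep \<rho> \<rho>') D1)) \<pi>)
    (Hom_space hecke M (hecke_invariants \<pi>))"
proof -
  have CHAR: "CHAR('p mod_ring alg_closure) = CARD('p)"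
    by (simp add: CHAR_alg_closure)
  have card: "of_nat CARD('f residue_field) = (0 :: 'p mod_ring alg_closure)"
    using CHAR_dvd_CARD[where ?'a = "'f residue_field"] assms(1) by (simp add: of_nat_eq_0_iff_char_dvd CHAR)
  \<comment> \<open>If \<open>chi\<close> is not its own conjugate, the last assumption gives
    \<open>q = p\<close>, and both characteristics equal the cardinality of the residue
    field.\<close>
  have prime: "Factorial_Ring.prime CARD('f residue_field) \<and> CHAR('f residue_field) = CARD('f residue_field)
      \<and> CHAR('p mod_ring alg_closure) = CARD('f residue_field)" if "\<not> char_eq chi (conj_s chi)"
    using that assms(1,13) CHAR prime_card[where ?'a = 'p] by simp
  have ce: "char_eq chi (conj_s chi)" if "char_eq (conj_s chi) (conj_s (conj_s chi))"
    using that by (auto simp: char_eq_def conj_s_conj_s)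
  have "char_eq (conj_s chi) (conj_s (conj_s chi))" if "char_eq chi (conj_s chi)"
    using that by (auto simp: char_eq_def conj_s_conj_s)
  then interpret gamma_rho \<pi> \<rho> chi J v \<rho>' v' D1
    by unfold_locales
      (use assms card prime in \<open>auto simp: smooth_rep_def is_rho_def[of chi] is_rho_def[of "conj_s chi"] diag_char_conj_s invariants_inflate\<close>)
  let ?S = "hecke_eigen chi (if char_eq chi (conj_s chi) then - 1 else 0) 0"
  obtain d where d: "bij_betw (\<lambda>f. frob f d) (Hom GL2 homology \<pi>) ?S" by (rule eval_iso[OF assms(3)])
  obtain m where m: "m \<in> vecs M" "bij_betw (\<lambda>F. F m) (Hom hecke M (hecke_invariants \<pi>)) ?S"
    by (rule Hom_M_gamma[OF assms(2,11)])
  have H: "lin_operators hecke (hecke_invariants \<pi>)"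
    using right_hecke_module_invariants by (simp add: right_hecke_module_def)
  have P: "lin_operators GL2 \<pi>" using is_rep by (simp add: is_rep_def)
  show ?thesis
    by (rule vs_isomorphic_via[where p = "\<lambda>f. frob f d" and q = "\<lambda>F. F m" and S = ?S and s = "scl \<pi>"])
      (use d m(2) Hom_closed[OF H, of _ M] Hom_closed[OF P, of _ homology] in
        \<open>auto simp: Hom_space_def frob_def pointwise_def[of _ _ _] hecke_invariants_simps scl_simps\<close>)
qed

end
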